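(* Let $T\in(0,\infty)$, $p,\mathfrak{P},q\in[0,\infty)$, $\alpha,\beta\in\mathbb{R}$, $\Theta=\bigcup_{n=1}^\infty\mathbb{Z}^n$, let $f\colon\mathbb{R}\to\mathbb{R}$ be Lipschitz continuous, and let $\xi_d\in\mathbb{R}^d$, $d\in\mathbb{N}$, and $g_d\in C^2(\mathbb{R}^d,\mathbb{R})$, $d\in\mathbb{N}$, satisfy $$\sup_{d\in\mathbb{N},\,x\in\mathbb{R}^d}\Big(\frac{|g_d(x)|}{d^{\mathfrak{P}}(1+\|x\|_{\mathbb{R}^d}^p)}+\frac{\|\xi_d\|_{\mathbb{R}^d}}{d^q}\Big)<\infty .$$ Let $u_d\in C^{1,2}([0,T]\times\mathbb{R}^d,\mathbb{R})$, $d\in\mathbb{N}$, be polynomially growing functions which satisfy for all $d\in\mathbb{N}$, $t\in(0,T)$, $x=(x_1,\dots,x_d)\in\mathbb{R}^d$ that $u_d(T,x)=g_d(x)$ and $$\Big(\frac{\partial u_d}{\partial t}\Big)(t,x)+\Big[\sum_{i=1}^d\frac{|\beta|^2|x_i|^2}{2}\Big(\frac{\partial^2u_d}{\partial(x_i)^2}\Big)(t,x)\Big]+\Big[\sum_{i=1}^d\alpha x_i\Big(\frac{\partial u_d}{\partial x_i}\Big)(t,x)\Big]+f(u_d(t,x))=0 .$$ Let $(\Omega,\mathcal{F},\mathbb{P})$ be a probability space, let $\mathcal{R}^\theta\colon\Omega\to[0,1]$, $\theta\in\Theta$, be independent random variables uniformly distributed on $[0,1]$, let $R^\theta_t=t+(T-t)\mathcal{R}^\theta$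 for $t\in[0,T]$, $\theta\in\Theta$, let $W^{d,\theta}=(W^{d,\theta,i})_{i\in\{1,\dots,d\}}\colon[0,T]\times\Omega\to\mathbb{R}^d$, $\theta\in\Theta$, $d\in\mathbb{N}$, be independent standard Brownian motions, and assume that $(W^{d,\theta})_{d\in\mathbb{N},\theta\in\Theta}$ and $(\mathcal{R}^\theta)_{\theta\in\Theta}$ are independent. For every $d\in\mathbb{N}$, $\theta\in\Theta$, $t\in[0,T]$, $s\in[t,T]$, $x=(x_1,\dots,x_d)\in\mathbb{R}^d$ let $X^{d,\theta,x}_{t,s}=(X^{d,\theta,x,i}_{t,s})_{i\in\{1,\dots,d\}}\colon\Omega\to\mathbb{R}^d$ satisfy for all $i\in\{1,\dots,d\}$ that $$X^{d,\theta,x,i}_{t,s}=x_i\exp\!\Big(\big(\alpha-\tfrac{\beta^2}{2}\big)(s-t)+\beta\big(W^{d,\theta,i}_s-W^{d,\theta,i}_t\big)\Big).$$ Let $V^{d,\theta}_{M,n}\colon[0,T]\times\mathbb{R}^d\times\Omega\to\mathbb{R}$, $M,n\in\mathbb{Z}$, $\theta\in\Theta$, $d\in\mathbb{N}$, be functions which satisfy for all $d,M,n\in\mathbb{N}$, $\theta\in\Theta$, $t\in[0,T]$, $x\in\mathbb{R}^d$ that $V^{d,\theta}_{M,-1}(t,x)=V^{d,\theta}_{M,0}(t,x)=0$ and $$V^{d,\theta}_{M,n}(t,x)=\sum_{k=0}^{n-1}\frac{(T-t)}{M^{n-k}}\Bigg[\sum_{m=1}^{M^{n-k}}f\Big(V^{d,(\theta,k,m)}_{M,k}\big(R^{(\theta,k,m)}_t,X^{d,(\theta,k,m),x}_{t,R^{(\theta,k,m)}_t}\big)\Big)-\mathbf{1}_{\mathbb{N}}(k)f\Big(V^{d,(\theta,k,-m)}_{M,k-1}\big(R^{(\theta,k,m)}_t,X^{d,(\theta,k,m),x}_{t,R^{(\theta,k,m)}_t}\big)\Big)\Bigg]+\Bigg[\sum_{m=1}^{M^n}\frac{g_d(X^{d,(\theta,n,-m),x}_{t,T})}{M^n}\Bigg].$$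 Let $(\mathcal{C}_{d,M,n})_{M,n\in\mathbb{Z},d\in\mathbb{N}}\subseteq\mathbb{N}_0$ satisfy for all $d,n,M\in\mathbb{N}$ that $\mathcal{C}_{d,M,0}=0$ and $$\mathcal{C}_{d,M,n}\le dM^n+\sum_{k=0}^{n-1}\big[M^{n-k}\big(d+1+\mathcal{C}_{d,M,k}+\mathbf{1}_{\mathbb{N}}(k)\,\mathcal{C}_{d,M,k-1}\big)\big].$$ Then there exist functions $N=(N_{d,\varepsilon})_{d\in\mathbb{N},\varepsilon\in(0,1]}\colon\mathbb{N}\times(0,1]\to\mathbb{N}$ and $C=(C_\delta)_{\delta\in(0,\infty)}\colon(0,\infty)\to(0,\infty)$ such that for all $d\in\mathbb{N}$, $\varepsilon\in(0,1]$, $\delta\in(0,\infty)$ it holds that $$\mathcal{C}_{d,N_{d,\varepsilon},N_{d,\varepsilon}}\le C_\delta\,d^{1+(\mathfrak{P}+qp)(2+\delta)}\,\varepsilon^{-(2+\delta)}\quad\text{and}\quad\big(\mathbb{E}\big[|u_d(0,\xi_d)-V^{d,0}_{N_{d,\varepsilon},N_{d,\varepsilon}}(0,\xi_d)|^2\big]\big)^{1/2}\le\varepsilon .$$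
   Context: $\mathbb{N}=\{1,2,3,\dots\}$, $\mathbb{N}_0=\mathbb{N}\cup\{0\}$. $\|\cdot\|_{\mathbb{R}^d}$ is the Euclidean norm. For $\theta\in\mathbb{Z}^n\subseteq\Theta$ and $k,m\in\mathbb{Z}$, $(\theta,k,m)$ denotes the element of $\mathbb{Z}^{n+2}\subseteq\Theta$ obtained by appending $k,m$ to $\theta$; the superscript $0$ in $V^{d,0}_{M,n}$ is the element $0\in\mathbb{Z}^1\subseteq\Theta$. $\mathbf{1}_{\mathbb{N}}(k)=1$ if $k\in\mathbb{N}$ and $\mathbf{1}_{\mathbb{N}}(0)=0$ (terms multiplied by $0$ are $0$). A function $u\colon[0,T]\times\mathbb{R}^d\to\mathbb{R}$ is (at most) polynomially growing if there are $c,r\in[0,\infty)$ with $|u(t,x)|\le c(1+\|x\|^r)$ for all $(t,x)$. The number $\mathcal{C}_{d,M,n}$ models the number of realizations of scalar standard normal random variables used to compute one realization of $V^{d,0}_{M,n}(t,x)$; its only property used is the stated recursive inequality. *)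

theory Defs
  imports "HOL-Probability.Probability"
begin

(* R^d for varying d: functions on the index set {1..d}, extended by the fixed value
   "undefined" outside of it, so that they agree with the points of PiM {1..d} (\<lambda>_. borel).
   On this set the topology of the type nat \<Rightarrow> real (the product topology) is the Euclidean
   topology of R^d, hence continuous_on is the usual continuity. *)
definition Rd :: "nat \<Rightarrow> (nat \<Rightarrow> real) set" where
  "Rd d = {1..d} \<rightarrow>\<^sub>E UNIV"

abbreviation borel_Rd :: "nat \<Rightarrow> (nat \<Rightarrow> real) measure" where
  "borel_Rd d \<equiv> PiM {1..d} (\<lambda>_. borel)"

definition norm_Rd :: "nat \<Rightarrow> (nat \<Rightarrow> real) \<Rightarrow> real" where
  "norm_Rd d x = L2_set x {1..d}"

(* a^r for a, r \<ge> 0 with the convention 0^0 = 1 (the library has 0 powr 0 = 0). *)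
definition rpow :: "real \<Rightarrow> real \<Rightarrow> real" where
  "rpow a r = (if r = 0 then 1 else a powr r)"

definition partial_differentiable :: "nat \<Rightarrow> ((nat \<Rightarrow> real) \<Rightarrow> real) \<Rightarrow> (nat \<Rightarrow> real) \<Rightarrow> bool" where
  "partial_differentiable i g x \<longleftrightarrow> (\<lambda>y. g (x(i := y))) field_differentiable (at (x i))"

definition partial_deriv :: "nat \<Rightarrow> ((nat \<Rightarrow> real) \<Rightarrow> real) \<Rightarrow> (nat \<Rightarrow> real) \<Rightarrow> real" where
  "partial_deriv i g x = deriv (\<lambda>y. g (x(i := y))) (x i)"

definition C2_Rd :: "nat \<Rightarrow> ((nat \<Rightarrow> real) \<Rightarrow> real) \<Rightarrow> bool" where
  "C2_Rd d g \<longleftrightarrow>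
     continuous_on (Rd d) g \<and>
     (\<forall>i\<in>{1..d}.
        (\<forall>x\<in>Rd d. partial_differentiable i g x) \<and>
        continuous_on (Rd d) (partial_deriv i g) \<and>
        (\<forall>j\<in>{1..d}.
           (\<forall>x\<in>Rd d. partial_differentiable j (partial_deriv i g) x) \<and>
           continuous_on (Rd d) (partial_deriv j (partial_deriv i g))))"

(* C^{1,2}([0,T] x R^d, R); the time derivative is one-sided at t = 0 and t = T, and all
   derivatives are jointly continuous up to the boundary. *)
definition C12 :: "real \<Rightarrow> nat \<Rightarrow> (real \<Rightarrow> (nat \<Rightarrow> real) \<Rightarrow> real) \<Rightarrow> bool" where
  "C12 T d u \<longleftrightarrow>
     continuous_on ({0..T} \<times> Rd d) (\<lambda>(t, x). u t x) \<and>
     (\<exists>u'. continuous_on ({0..T} \<times> Rd d) (\<lambda>(t, x). u' t x) \<and>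
        (\<forall>t\<in>{0..T}. \<forall>x\<in>Rd d.
           ((\<lambda>s. u s x) has_real_derivative u' t x) (at t within {0..T}))) \<and>
     (\<forall>i\<in>{1..d}.
        (\<forall>t\<in>{0..T}. \<forall>x\<in>Rd d. partial_differentiable i (u t) x) \<and>
        continuous_on ({0..T} \<times> Rd d) (\<lambda>(t, x). partial_deriv i (u t) x) \<and>
        (\<forall>j\<in>{1..d}.
           (\<forall>t\<in>{0..T}. \<forall>x\<in>Rd d. partial_differentiable j (partial_deriv i (u t)) x) \<and>
           continuous_on ({0..T} \<times> Rd d) (\<lambda>(t, x). partial_deriv j (partial_deriv i (u t)) x)))"

definition polynomially_growing :: "real \<Rightarrow> nat \<Rightarrow> (real \<Rightarrow> (nat \<Rightarrow> real) \<Rightarrow> real) \<Rightarrow> bool" where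
  "polynomially_growing T d u \<longleftrightarrow>
     (\<exists>c\<ge>0. \<exists>r\<ge>0. \<forall>t\<in>{0..T}. \<forall>x\<in>Rd d. \<bar>u t x\<bar> \<le> c * (1 + rpow (norm_Rd d x) r))"

(* The union of the Z^n, n \<ge> 1, with Z^n represented by the integer lists of length n;
   appending k, m to \<theta> is then \<theta> @ [k, m]. *)
definition index_set :: "int list set" where
  "index_set = {\<theta>. \<theta> \<noteq> []}"

(* Standard d-dimensional Brownian motion on [0,T]; W t \<omega> i is the i-th coordinate of W_t(\<omega>).
   Every sample path is continuous; with almost sure continuity only, W evaluated at a random
   time need not be measurable. *)
definition std_brownian_motion ::
    "'w measure \<Rightarrow> real \<Rightarrow> nat \<Rightarrow> (real \<Rightarrow> 'w \<Rightarrow> nat \<Rightarrow> real) \<Rightarrow> bool" where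
  "std_brownian_motion P T d W \<longleftrightarrow>
     (\<forall>t\<in>{0..T}. W t \<in> measurable P (borel_Rd d)) \<and>
     (AE \<omega> in P. \<forall>i\<in>{1..d}. W 0 \<omega> i = 0) \<and>
     (\<forall>\<omega>\<in>space P. \<forall>i\<in>{1..d}. continuous_on {0..T} (\<lambda>t. W t \<omega> i)) \<and>
     (\<forall>s t. 0 \<le> s \<and> s < t \<and> t \<le> T \<longrightarrow>
        distr P (borel_Rd d) (\<lambda>\<omega>. \<lambda>i\<in>{1..d}. W t \<omega> i - W s \<omega> i) =
        PiM {1..d} (\<lambda>_. density lborel (\<lambda>y. ennreal (normal_density 0 (sqrt (t - s)) y)))) \<and>
     (\<forall>(n::nat) (\<tau>::nat \<Rightarrow> real).
        0 \<le> \<tau> 0 \<and> (\<forall>k<n. \<tau> k < \<tau> (Suc k)) \<and> \<tau> n \<le> T \<longrightarrow>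
        prob_space.indep_vars P (\<lambda>_. borel_Rd d)
          (\<lambda>k \<omega>. \<lambda>i\<in>{1..d}. W (\<tau> (Suc k)) \<omega> i - W (\<tau> k) \<omega> i) {..<n})"

(* Processes as random variables with values in path space (product sigma-algebra over the
   time points), and a family of processes as a single random variable. *)
abbreviation path_space :: "real \<Rightarrow> nat \<Rightarrow> (real \<Rightarrow> nat \<Rightarrow> real) measure" where
  "path_space T d \<equiv> PiM {0..T} (\<lambda>_. borel_Rd d)"

definition sample_path :: "real \<Rightarrow> (real \<Rightarrow> 'w \<Rightarrow> nat \<Rightarrow> real) \<Rightarrow> 'w \<Rightarrow> (real \<Rightarrow> nat \<Rightarrow> real)" where
  "sample_path T W \<omega> = (\<lambda>t\<in>{0..T}. W t \<omega>)"

(* Independence of two random variables with values in different types (the library's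
   indep_var requires a common type): independence of the generated sigma-algebras. *)
definition indep_random_variables ::
    "'w measure \<Rightarrow> 'a measure \<Rightarrow> ('w \<Rightarrow> 'a) \<Rightarrow> 'b measure \<Rightarrow> ('w \<Rightarrow> 'b) \<Rightarrow> bool" where
  "indep_random_variables P A Y B Z \<longleftrightarrow>
     Y \<in> measurable P A \<and> Z \<in> measurable P B \<and>
     prob_space.indep_set P (sets (vimage_algebra (space P) Y A)) (sets (vimage_algebra (space P) Z B))"

end

theory Submission imports Defs begin

text \<open>
  Along a geometric Brownian motion written as a function of a single Gaussian vector, \<open>u\<close> satisfies the
  Feynman--Kac fixed point equation. It is obtained from the differential equation by Gaussian
  integration by parts against cutoffs that are then removed, so that only the growth of \<open>u\<close> itself
  and no stochastic integral is needed.

  The summands of one approximation level are independent, and their expectations telescope to the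
  fixed point equation with \<open>u\<close> replaced by the previous level. The second moments of the errors
  therefore obey a linear recursion in the number of levels. In the weight
  \<open>exp (M * (T - t)) * (1 + \<parallel>x\<parallel>\<^sup>2\<^sup>p)\<close> every time integral gains a factor \<open>1 / M\<close>, uniformly in the dimension,
  and with \<open>M = n\<close> levels the mean square error is at most \<open>A * d powr (2 * Q) * B ^ n / n ^ n\<close>, where
  \<open>Q = \<PP> + q * p\<close>, while the cost is at most \<open>d * (6 * n) ^ n\<close>. The least \<open>n\<close> that meets the tolerance
  gives the claim.
\<close>

section \<open>Cutoffs and Gaussian integration by parts\<close>

text \<open>Each u_d is polynomially growing with a degree and a constant that may depend on d,
  whereas the final bound allows only an explicit power of d. So u_d is first estimated anew from
  its fixed point equation, through the growth of g_d alone. The exponents come from one balance.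
  With M = n levels the mean square error is about n^(-n) and the cost about n^n, up to geometric
  factors, so a root mean square error \<epsilon> costs about \<epsilon>^(-2). The passage from the
  preceding level to the chosen one and all geometric factors are paid by the power n^(-n \<delta> /
  2); hence \<delta> > 0 and the constant \<open>C \<delta>\<close>. The cost is linear in d, and A
  d^(2 Q) enters to the power 1 + \<delta> / 2, which together gives the exponent 1 + Q (2 +
  \<delta>). Expectations at the random time are controlled only after multiplication by T - t,
  because they are bounded through a time integral over [t, T]. This factor is therefore carried
  along instead of being divided out, and t = T is treated apart wherever finite expectations are
  needed.\<close>

lemma has_real_derivative_along_curve:
  fixes U :: "real \<Rightarrow> (nat \<Rightarrow> real) \<Rightarrow> real" and \<gamma> :: "real \<Rightarrow> nat \<Rightarrow> real"
  assumes s: "s \<in> {a<..<b}"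
    and dt: "((\<lambda>r. U r (\<gamma> s)) has_real_derivative U') (at s)"
    and pd: "\<And>i r x. i \<in> {1..d} \<Longrightarrow> r \<in> {a..b} \<Longrightarrow> x \<in> Rd d \<Longrightarrow> partial_differentiable i (U r) x"
    and pc: "\<And>i. i \<in> {1..d} \<Longrightarrow>
      continuous_on ({a..b} \<times> Rd d) (\<lambda>(r, x). partial_deriv i (U r) x)"
    and \<gamma>: "\<And>r. \<gamma> r \<in> Rd d" "continuous_on {a<..<b} \<gamma>"
    and d\<gamma>: "\<And>i. i \<in> {1..d} \<Longrightarrow> ((\<lambda>r. \<gamma> r i) has_real_derivative \<gamma>' i) (at s)"
  shows "((\<lambda>r. U r (\<gamma> r)) has_real_derivative
    U' + (\<Sum>i=1..d. partial_deriv i (U s) (\<gamma> s) * \<gamma>' i)) (at s)"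
proof -
  \<comment> \<open>The curve is followed one coordinate at a time: \<open>mix k\<close> moves only
    the coordinates 1, ..., k. Each induction step is then the chain rule for a function of two real
    variables, the time and the coordinate \<open>Suc k\<close>.\<close>
  define mix where "mix k r = (\<lambda>i. if i \<in> {1..k} then \<gamma> r i else \<gamma> s i)" for k r
  have mixRd: "mix k r \<in> Rd d" for k r
    using \<gamma>(1) by (auto simp: mix_def Rd_def PiE_iff extensional_def)
  have "k \<le> d \<Longrightarrow> ((\<lambda>r. U r (mix k r)) has_real_derivative
    U' + (\<Sum>i=1..k. partial_deriv i (U s) (\<gamma> s) * \<gamma>' i)) (at s)" for k
  proof (induction k)
    case 0
    have "mix 0 r = \<gamma> s" for r by (auto simp: mix_def)
    then show ?case using dt by simp
  next
    case (Suc k)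
    define j where "j = Suc k"
    have j: "j \<in> {1..d}" using Suc.prems by (auto simp: j_def)
    define F where "F r y = U r ((mix k r)(j := y))" for r y
    have upd: "(mix k r)(j := y) \<in> Rd d" for r y
      using mixRd[of k r] j by (auto simp: Rd_def PiE_iff extensional_def)
    have mixs: "(mix k s)(j := \<gamma> s j) = \<gamma> s" "mix k s = \<gamma> s"
      by (auto simp: mix_def)
    have mixk: "mix k r j = \<gamma> s j" for r by (auto simp: mix_def j_def)
    have Fk: "F r (\<gamma> s j) = U r (mix k r)" for r
      unfolding F_def by (metis mixk fun_upd_triv)
    have FSuc: "F r (\<gamma> r j) = U r (mix (Suc k) r)" for r
    proof -
      have "(mix k r)(j := \<gamma> r j) = mix (Suc k) r" by (auto simp: mix_def j_def fun_eq_iff)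
      then show ?thesis by (simp add: F_def)
    qed
    have cont: "continuous_on ({a<..<b} \<times> UNIV) (\<lambda>(r, y). partial_deriv j (U r) ((mix k r)(j := y)))"
    proof -
      have 1: "continuous_on ({a<..<b} \<times> (UNIV::real set)) (\<lambda>p. (fst p, (mix k (fst p))(j := snd p)))"
      proof (intro continuous_on_Pair continuous_intros continuous_on_coordinatewise_then_product)
        fix i
        have "continuous_on ({a<..<b} \<times> (UNIV::real set)) (\<lambda>p. \<gamma> (fst p) i)"
          by (rule continuous_on_compose2[OF continuous_on_product_then_coordinatewise[OF \<gamma>(2)]])
            (auto intro: continuous_intros)
        then show "continuous_on ({a<..<b} \<times> UNIV) (\<lambda>p. ((mix k (fst p))(j := snd p)) i)"
          by (cases "i = j"; cases "i \<in> {1..k}") (auto simp: mix_def intro!: continuous_intros)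
      qed
      have "continuous_on ({a<..<b} \<times> (UNIV::real set))
          (\<lambda>p. (\<lambda>(r, x). partial_deriv j (U r) x) (fst p, (mix k (fst p))(j := snd p)))"
        by (rule continuous_on_compose2[OF pc[OF j] 1]) (use upd in auto)
      then show ?thesis by (simp add: case_prod_unfold)
    qed
    have "((\<lambda>(r, y). F r y) has_derivative
        (\<lambda>(tr, ty). (U' + (\<Sum>i=1..k. partial_deriv i (U s) (\<gamma> s) * \<gamma>' i)) * tr +
          blinfun_apply (blinfun_mult_right (partial_deriv j (U s) (\<gamma> s))) ty))
        (at (s, \<gamma> s j) within {a<..<b} \<times> UNIV)"
    \<comment> \<open>The rule is asymmetric: the first partial derivative is asked for at one
      point, where the induction hypothesis supplies it, and the second one in a neighbourhood and
      continuous, which \<open>pd\<close> and \<open>pc\<close> supply.\<close>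
    proof (rule has_derivative_partialsI[where f = F and X = "{a<..<b}" and Y = UNIV and x = s and y = "\<gamma> s j"
          and fx = "times (U' + (\<Sum>i=1..k. partial_deriv i (U s) (\<gamma> s) * \<gamma>' i))"
          and fy = "\<lambda>r y. blinfun_mult_right (partial_deriv j (U r) ((mix k r)(j := y)))",
          unfolded mixs fun_upd_triv])
      show "((\<lambda>r. F r (\<gamma> s j)) has_derivative times (U' + (\<Sum>i=1..k. partial_deriv i (U s) (\<gamma> s) * \<gamma>' i)))
          (at s within {a<..<b})"
        using Suc.IH Suc.prems unfolding Fk has_field_derivative_def
        by (auto intro: has_derivative_at_withinI)
      show "((\<lambda>y. F r y) has_derivative blinfun_apply (blinfun_mult_right (partial_deriv j (U r) ((mix k r)(j := y)))))
          (at y within UNIV)" if "r \<in> {a<..<b}" for r y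
      proof -
        have "partial_differentiable j (U r) ((mix k r)(j := y))"
          using that upd by (intro pd j) auto
        then have "((\<lambda>y'. U r (((mix k r)(j := y))(j := y'))) has_real_derivative
            partial_deriv j (U r) ((mix k r)(j := y))) (at y)"
          unfolding partial_differentiable_def partial_deriv_def
          by (auto dest: field_differentiable_derivI)
        then show ?thesis by (simp add: F_def has_field_derivative_def)
      qed
      have "((\<lambda>(r, y). partial_deriv j (U r) ((mix k r)(j := y))) \<longlongrightarrow>
          (\<lambda>(r, y). partial_deriv j (U r) ((mix k r)(j := y))) (s, \<gamma> s j)) (at (s, \<gamma> s j) within {a<..<b} \<times> UNIV)"
        using cont s unfolding continuous_on_def by blast
      then have "((\<lambda>p. blinfun_mult_right ((\<lambda>(r, y). partial_deriv j (U r) ((mix k r)(j := y))) p)) \<longlongrightarrow>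
          blinfun_mult_right ((\<lambda>(r, y). partial_deriv j (U r) ((mix k r)(j := y))) (s, \<gamma> s j)))
          (at (s, \<gamma> s j) within {a<..<b} \<times> UNIV)"
        by (rule bounded_linear.tendsto[OF bounded_linear_blinfun_mult_right])
      then show "continuous (at (s, \<gamma> s j) within {a<..<b} \<times> UNIV)
          (\<lambda>(r, y). blinfun_mult_right (partial_deriv j (U r) ((mix k r)(j := y))))"
        by (simp add: continuous_within case_prod_unfold)
    qed (use s in auto)
    then have D: "((\<lambda>(r, y). F r y) has_derivative
        (\<lambda>(tr, ty). (U' + (\<Sum>i=1..k. partial_deriv i (U s) (\<gamma> s) * \<gamma>' i)) * tr +
          partial_deriv j (U s) (\<gamma> s) * ty)) (at (s, \<gamma> s j))"
      using s by (subst (asm) at_within_open) (auto intro: open_Times)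
    have "((\<lambda>r. (r, \<gamma> r j)) has_derivative (\<lambda>h. (h, \<gamma>' j * h))) (at s)"
      using d\<gamma>[OF j] by (intro has_derivative_Pair) (auto simp: has_field_derivative_def)
    then have "((\<lambda>r. (\<lambda>(r, y). F r y) (r, \<gamma> r j)) has_derivative
       (\<lambda>h. (\<lambda>(tr, ty). (U' + (\<Sum>i=1..k. partial_deriv i (U s) (\<gamma> s) * \<gamma>' i)) * tr +
          partial_deriv j (U s) (\<gamma> s) * ty) (h, \<gamma>' j * h))) (at s)"
      by (rule has_derivative_compose) (use D in auto)
    then have "((\<lambda>r. U r (mix (Suc k) r)) has_derivative
       (\<lambda>h. (U' + (\<Sum>i=1..k. partial_deriv i (U s) (\<gamma> s) * \<gamma>' i)) * h +
          partial_deriv j (U s) (\<gamma> s) * (\<gamma>' j * h))) (at s)"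
      by (simp only: FSuc prod.case)
    then show ?case unfolding has_field_derivative_def
      by (rule has_derivative_eq_rhs) (simp add: fun_eq_iff j_def algebra_simps)
  qed
  from this[of d] show ?thesis
  proof -
    have "mix d r = \<gamma> r" for r
    proof
      fix i show "mix d r i = \<gamma> r i"
        using \<gamma>(1)[of r] \<gamma>(1)[of s] by (auto simp: mix_def Rd_def PiE_iff extensional_def)
    qed
    with \<open>d \<le> d \<Longrightarrow> _\<close> show ?thesis by simp
  qed
qed

text \<open>The third power makes the function and its first two derivatives vanish at y = r and y =
  -r. So the truncated polynomial is C^2 on the line, and two integrations by parts leave no
  boundary terms.\<close>

definition cutoff :: "real \<Rightarrow> real \<Rightarrow> real" where
  "cutoff r y = (if \<bar>y\<bar> \<le> r then (1 - (y / r)^2)^3 else 0)"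

text \<open>
  \<open>cutoff1\<close> and \<open>cutoff2\<close> are the first two derivatives of the compactly supported function \<open>cutoff\<close>.
\<close>

definition cutoff1 :: "real \<Rightarrow> real \<Rightarrow> real" where
  "cutoff1 r y = (if \<bar>y\<bar> \<le> r then - 6 * (y / r) / r * (1 - (y / r)^2)^2 else 0)"

definition cutoff2 :: "real \<Rightarrow> real \<Rightarrow> real" where
  "cutoff2 r y = (if \<bar>y\<bar> \<le> r then (24 * (y / r)^2 * (1 - (y / r)^2) - 6 * (1 - (y / r)^2)^2) / r^2 else 0)"

lemma cutoff_boundary: "\<bar>y\<bar> = (r::real) \<Longrightarrow> r > 0 \<Longrightarrow> (y / r)^2 = 1"
  using power2_abs[of y] by (auto simp: power_divide)

lemma continuous_on_abs_le_else_zero: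
  fixes h :: "real \<Rightarrow> real"
  assumes "continuous_on UNIV h" "\<And>y. \<bar>y\<bar> = r \<Longrightarrow> h y = 0"
  shows "continuous_on UNIV (\<lambda>y. if \<bar>y\<bar> \<le> r then h y else 0)"
proof -
  have "continuous_on ({y. \<bar>y\<bar> \<le> r} \<union> {y. \<bar>y\<bar> \<ge> r}) (\<lambda>y. if \<bar>y\<bar> \<le> r then h y else 0)"
    by (rule continuous_on_If)
      (use assms in \<open>auto intro!: closed_Collect_le continuous_intros intro: continuous_on_subset\<close>)
  also have "{y. \<bar>y\<bar> \<le> r} \<union> {y. \<bar>y\<bar> \<ge> r} = UNIV" by auto
  finally show ?thesis .
qed

lemma continuous_cutoff:
  assumes r: "r > 0"
  shows "continuous_on UNIV (cutoff r)" "continuous_on UNIV (cutoff1 r)" "continuous_on UNIV (cutoff2 r)"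
proof -
  show "continuous_on UNIV (cutoff r)" unfolding cutoff_def
    by (rule continuous_on_abs_le_else_zero) (use r in \<open>auto intro!: continuous_intros simp: cutoff_boundary\<close>)
  show "continuous_on UNIV (cutoff1 r)" unfolding cutoff1_def
    by (rule continuous_on_abs_le_else_zero) (use r in \<open>auto intro!: continuous_intros simp: cutoff_boundary\<close>)
  show "continuous_on UNIV (cutoff2 r)" unfolding cutoff2_def
    by (rule continuous_on_abs_le_else_zero) (use r in \<open>auto intro!: continuous_intros simp: cutoff_boundary\<close>)
qed

text \<open>The third bound is what later removes the cutoff. Up to sign its left side is the
  Ornstein-Uhlenbeck operator h'' - y h' applied to the cutoff, and it decays like 1 / r^2. The
  constant collects 6 y^2 + 6 + 24.\<close>

lemma cutoff_bounds:
  assumes r: "r \<ge> 1"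
  shows "0 \<le> cutoff r y" "cutoff r y \<le> 1" "\<bar>y * cutoff1 r y - cutoff2 r y\<bar> \<le> 30 * (1 + y^2) / r^2"
proof -
  have *: "0 \<le> 1 - (y / r)^2" "1 - (y/r)^2 \<le> 1" if "\<bar>y\<bar> \<le> r"
  proof -
    have "\<bar>y / r\<bar> \<le> 1" using that r by simp
    then show "0 \<le> 1 - (y / r)^2" by (simp add: abs_square_le_1)
  qed simp
  show "0 \<le> cutoff r y" using * by (simp add: cutoff_def)
  show "cutoff r y \<le> 1" using * by (simp add: cutoff_def power_le_one)
  show "\<bar>y * cutoff1 r y - cutoff2 r y\<bar> \<le> 30 * (1 + y^2) / r^2"
  proof (cases "\<bar>y\<bar> \<le> r")
    case True
    define w where "w = 1 - (y/r)^2"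
    have w: "0 \<le> w" "w \<le> 1" "w^2 \<le> 1" using *[OF True] by (auto simp: w_def power_le_one)
    have "y * cutoff1 r y - cutoff2 r y = (- 6 * y^2 * w^2 + 6 * w^2 - 24 * (y / r)^2 * w) / r^2"
      using True r by (simp add: cutoff1_def cutoff2_def w_def[symmetric]) (simp add: field_simps power2_eq_square)
    moreover have "\<bar>- 6 * y^2 * w^2 + 6 * w^2 - 24 * (y / r)^2 * w\<bar> \<le> 30 * (1 + y^2)"
    proof -
      have yr: "(y/r)^2 \<le> 1" using *[OF True] by simp
      have "\<bar>- 6 * y^2 * w^2 + 6 * w^2 - 24 * (y / r)^2 * w\<bar> \<le> 6 * (y^2 * w^2) + 6 * w^2 + 24 * ((y / r)^2 * w)"
        using w by (intro order_trans[OF abs_triangle_ineq4] order_trans[OF add_mono[OF abs_triangle_ineq order_refl]])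
           (auto simp: abs_mult)
      also have "\<dots> \<le> 6 * (y^2 * 1) + 6 * 1 + 24 * (1 * 1)"
        using w yr by (intro add_mono mult_mono) auto
      finally show ?thesis by (auto simp: algebra_simps intro: order_trans)
    qed
    ultimately show ?thesis using r by (simp add: divide_right_mono)
  next
    case False
    then show ?thesis by (simp add: cutoff1_def cutoff2_def)
  qed
qed

lemma cutoff_tendsto: "(\<lambda>n. cutoff (real (Suc n)) y) \<longlonglongrightarrow> 1"
proof -
  have 1: "(\<lambda>n. (1 - (y / real (Suc n))^2)^3) \<longlonglongrightarrow> (1 - 0^2)^3"
    using tendsto_mult[OF tendsto_const[of y] LIMSEQ_inverse_real_of_nat]
    by (intro tendsto_intros) (simp add: divide_inverse)
  have "eventually (\<lambda>n. \<bar>y\<bar> \<le> real (Suc n)) sequentially"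
    using eventually_ge_at_top[of "nat \<lceil>\<bar>y\<bar>\<rceil>"] by eventually_elim linarith
  then have "eventually (\<lambda>n. cutoff (real (Suc n)) y = (1 - (y / real (Suc n))^2)^3) sequentially"
    by eventually_elim (simp add: cutoff_def)
  then show ?thesis using 1 by (subst tendsto_cong) auto
qed

abbreviation std_normal :: "real measure" where
  "std_normal \<equiv> density lborel (\<lambda>y. ennreal (std_normal_density y))"

lemma prob_space_std_normal: "prob_space std_normal"
  by (rule prob_space_normal_density) simp

lemma integrable_std_normal_exp: "integrable std_normal (\<lambda>y. exp (c * y))"
proof -
  \<comment> \<open>Completing the square: \<open>exp (c * y)\<close> times the standard density is
    \<open>exp (c^2 / 2)\<close> times the normal density with mean c.\<close>
  have "integrable lborel (\<lambda>y. exp (c^2 / 2) * normal_density c 1 y)"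
    by (intro integrable_mult_right integrable_normal_density) simp
  also have "(\<lambda>y. exp (c^2 / 2) * normal_density c 1 y) = (\<lambda>y. std_normal_density y *\<^sub>R exp (c * y))"
  proof
    fix y
    have "c^2 / 2 + (- ((y - c)^2) / 2) = - (y^2) / 2 + c * y" by (simp add: power2_eq_square field_simps)
    then show "exp (c^2 / 2) * normal_density c 1 y = std_normal_density y *\<^sub>R exp (c * y)"
      by (simp add: normal_density_def exp_add[symmetric] mult.commute mult.left_commute)
  qed
  finally show ?thesis
    by (subst integrable_density) auto
qed

lemma integrable_std_normal_exp_abs: "integrable std_normal (\<lambda>y. exp (c * \<bar>y\<bar>))"
proof (rule Bochner_Integration.integrable_bound)
  show "integrable std_normal (\<lambda>y. exp (c * y) + exp ((- c) * y))"
    by (intro integrable_std_normal_exp Bochner_Integration.integrable_add)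
  show "AE y in std_normal. norm (exp (c * \<bar>y\<bar>)) \<le> norm (exp (c * y) + exp ((- c) * y))"
  proof (rule AE_I2)
    fix y :: real
    have "0 < exp (c * y)" "0 < exp (- (c * y))" by auto
    then have "\<bar>exp (c * y) + exp (- (c * y))\<bar> = exp (c * y) + exp (- (c * y))" by simp
    with \<open>0 < exp (c * y)\<close> \<open>0 < exp (- (c * y))\<close> show "norm (exp (c * \<bar>y\<bar>)) \<le> norm (exp (c * y) + exp ((- c) * y))"
      by (simp add: abs_if)
  qed
qed simp

text \<open>
  In the application only \<open>v\<close>, not its derivatives \<open>c * D\<close> and \<open>c\<^sup>2 * E\<close>, has a known growth. Integrating
  by parts twice moves both derivatives to the cutoff.
\<close>

lemma stein_cutoff:
  fixes v D E :: "real \<Rightarrow> real"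
  assumes r: "r > 0"
    and v: "\<And>y. (v has_real_derivative c * D y) (at y)"
    and D: "\<And>y. (D has_real_derivative c * E y) (at y)"
    and E: "continuous_on UNIV E"
  shows "(\<integral>y. c * (cutoff r y * (y * D y - c * E y)) - v y * (y * cutoff1 r y - cutoff2 r y) \<partial>std_normal) = 0"
proof -
  define \<psi> \<psi>1 \<psi>2 where "\<psi> y = (1 - (y / r)^2)^3" and "\<psi>1 y = - 6 * (y / r) / r * (1 - (y / r)^2)^2"
    and "\<psi>2 y = (24 * (y / r)^2 * (1 - (y / r)^2) - 6 * (1 - (y / r)^2)^2) / r^2" for y
  have d1: "(\<psi> has_real_derivative \<psi>1 y) (at y)" for y
    unfolding \<psi>_def \<psi>1_def using r
    by (auto intro!: derivative_eq_intros simp: divide_inverse power2_eq_square algebra_simps)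
  have d2: "(\<psi>1 has_real_derivative \<psi>2 y) (at y)" for y
    unfolding \<psi>1_def \<psi>2_def using r
    by (auto intro!: derivative_eq_intros simp: divide_inverse)
      (simp add: power2_eq_square algebra_simps)
  have d0: "(std_normal_density has_real_derivative - y * std_normal_density y) (at y)" for y
    unfolding std_normal_density_def
    by (auto intro!: derivative_eq_intros simp: field_simps)
  have cont: "continuous_on S v" "continuous_on S D" "continuous_on S E" "continuous_on S \<psi>"
     "continuous_on S \<psi>1" "continuous_on S \<psi>2" "continuous_on S std_normal_density" for S
    using r continuous_on_subset[OF E subset_UNIV]
    by (auto simp: \<psi>2_def intro!: continuous_intros
          DERIV_continuous_on[OF has_field_derivative_at_within[OF v]]
          DERIV_continuous_on[OF has_field_derivative_at_within[OF D]]
          DERIV_continuous_on[OF has_field_derivative_at_within[OF d0]]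
          DERIV_continuous_on[OF has_field_derivative_at_within[OF d1]]
          DERIV_continuous_on[OF has_field_derivative_at_within[OF d2]])
  let ?h = "\<lambda>y. std_normal_density y * (c * (\<psi> y * (y * D y - c * E y)) - v y * (y * \<psi>1 y - \<psi>2 y))"
  \<comment> \<open>\<open>?H\<close> is an antiderivative of \<open>?h\<close>: the density \<rho>
    satisfies \<rho>' = - y \<rho>, and the two terms with \<open>\<psi>1 y * D y\<close> cancel.
    Its boundary values vanish because \<psi> and \<open>\<psi>1\<close> do.\<close>
  let ?H = "\<lambda>y. std_normal_density y * \<psi>1 y * v y - c * std_normal_density y * \<psi> y * D y"
  have meas: "v \<in> borel_measurable borel" "D \<in> borel_measurable borel" "E \<in> borel_measurable borel"
    "cutoff r \<in> borel_measurable borel" "cutoff1 r \<in> borel_measurable borel" "cutoff2 r \<in> borel_measurable borel"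
    using cont continuous_cutoff[OF r] by (auto intro!: borel_measurable_continuous_onI)
  note [measurable] = meas
  have "(\<integral>y. c * (cutoff r y * (y * D y - c * E y)) - v y * (y * cutoff1 r y - cutoff2 r y) \<partial>std_normal)
     = (\<integral>y. indicator {-r..r} y *\<^sub>R ?h y \<partial>lborel)"
    by (subst integral_density)
      (auto intro!: Bochner_Integration.integral_cong simp: cutoff_def cutoff1_def cutoff2_def \<psi>_def \<psi>1_def \<psi>2_def split: split_indicator)
  also have "\<dots> = ?H r - ?H (- r)"
  proof (rule integral_FTC_atLeastAtMost)
    show "continuous_on {-r..r} ?h" by (intro continuous_intros cont)
    show "(?H has_vector_derivative ?h y) (at y within {-r..r})" for y
      unfolding has_real_derivative_iff_has_vector_derivative[symmetric]
      by (rule has_field_derivative_at_within)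
        (auto intro!: derivative_eq_intros d0 d1 d2 v D simp: algebra_simps)
  qed (use r in auto)
  also have "\<dots> = 0" using r by (simp add: \<psi>_def \<psi>1_def)
  finally show ?thesis .
qed

section \<open>Geometric Brownian motion\<close>

definition std_gauss :: "nat \<Rightarrow> (nat \<Rightarrow> real) measure" where
  "std_gauss d = PiM {1..d} (\<lambda>_. std_normal)"

definition gbm :: "real \<Rightarrow> real \<Rightarrow> nat \<Rightarrow> (nat \<Rightarrow> real) \<Rightarrow> real \<Rightarrow> (nat \<Rightarrow> real) \<Rightarrow> nat \<Rightarrow> real" where
  "gbm \<alpha> \<beta> d x \<tau> z = (\<lambda>i\<in>{1..d}. x i * exp ((\<alpha> - \<beta>^2 / 2) * \<tau> + \<beta> * sqrt \<tau> * z i))"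

lemma gbm_Rd [simp]: "gbm \<alpha> \<beta> d x \<tau> z \<in> Rd d"
  by (simp add: gbm_def Rd_def)

lemma space_borel_Rd: "space (borel_Rd d) = Rd d"
  by (simp add: space_PiM Rd_def)

lemma sets_std_gauss [measurable_cong]: "sets (std_gauss d) = sets (borel_Rd d)"
  unfolding std_gauss_def by (rule sets_PiM_cong) auto

lemma space_std_gauss: "space (std_gauss d) = Rd d"
  by (simp add: sets_eq_imp_space_eq[OF sets_std_gauss] space_PiM Rd_def)

lemma prob_space_std_gauss: "prob_space (std_gauss d)"
  unfolding std_gauss_def by (intro prob_space_PiM prob_space_std_normal)

text \<open>Off \<open>{1..d}\<close> every coordinate is constant on \<open>Rd d\<close>, so only
  the coordinates in \<open>{1..d}\<close> have to be checked. This makes functions that are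
  continuous in the product topology of \<open>nat \<Rightarrow> real\<close> measurable for
  \<open>borel_Rd d\<close>.\<close>

lemma measurable_ident_borel_Rd [measurable]: "(\<lambda>z. z) \<in> measurable (borel_Rd d) borel"
proof (rule measurable_coordinatewise_then_product)
  fix i show "(\<lambda>z. z i) \<in> borel_measurable (borel_Rd d)"
  proof (cases "i \<in> {1..d}")
    case True then show ?thesis by measurable
  next
    case False
    then have "(\<lambda>z. z i) \<in> borel_measurable (borel_Rd d) \<longleftrightarrow> (\<lambda>z. undefined::real) \<in> borel_measurable (borel_Rd d)"
      by (intro measurable_cong) (auto simp: space_PiM PiE_iff extensional_def)
    then show ?thesis by simp
  qed
qed

lemma borel_measurable_borel_Rd_continuous:
  fixes h :: "(nat \<Rightarrow> real) \<Rightarrow> real"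
  assumes "continuous_on UNIV h"
  shows "h \<in> borel_measurable (borel_Rd d)"
  using measurable_compose[OF measurable_ident_borel_Rd borel_measurable_continuous_onI[OF assms]] .

lemma borel_measurable_pair_borel_Rd_continuous:
  fixes h :: "real \<times> (nat \<Rightarrow> real) \<Rightarrow> real"
  assumes "continuous_on UNIV h"
  shows "h \<in> borel_measurable (borel \<Otimes>\<^sub>M borel_Rd d)"
proof -
  have "(\<lambda>p. (fst p, snd p)) \<in> measurable (borel \<Otimes>\<^sub>M borel_Rd d) ((borel :: real measure) \<Otimes>\<^sub>M (borel :: (nat \<Rightarrow> real) measure))"
    by (intro measurable_Pair measurable_fst measurable_compose[OF measurable_snd measurable_ident_borel_Rd])
  then have "(\<lambda>p. (fst p, snd p)) \<in> measurable (borel \<Otimes>\<^sub>M borel_Rd d) (borel :: (real \<times> (nat \<Rightarrow> real)) measure)"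
    by (simp only: borel_prod)
  from measurable_compose[OF this borel_measurable_continuous_onI[OF assms]] show ?thesis by simp
qed

text \<open>The common dominating function: along a geometric Brownian motion, polynomial growth in
  the state becomes exponential growth in the sum of the |z_i|.\<close>

lemma integrable_std_gauss_exp: "integrable (std_gauss d) (\<lambda>z. exp (\<kappa> * (\<Sum>i=1..d. \<bar>z i\<bar>)))"
proof -
  interpret product_sigma_finite "\<lambda>_::nat. std_normal"
    by (intro product_sigma_finite.intro prob_space_imp_sigma_finite prob_space_std_normal)
  have "integrable (std_gauss d) (\<lambda>z. \<Prod>i\<in>{1..d}. exp (\<kappa> * \<bar>z i\<bar>))"
    unfolding std_gauss_def by (intro product_integrable_prod integrable_std_normal_exp_abs) simp
  then show ?thesis by (simp add: exp_sum sum_distrib_left)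
qed

definition cube :: "nat \<Rightarrow> real \<Rightarrow> (nat \<Rightarrow> real) set" where
  "cube d r = {z \<in> Rd d. \<forall>i\<in>{1..d}. \<bar>z i\<bar> \<le> r}"

text \<open>Tychonoff over all of \<open>nat\<close>, with the singleton \<open>{undefined}\<close>
  as the factor of every index outside \<open>{1..d}\<close>.\<close>

lemma compact_cube: "compact (cube d r)"
proof -
  have "compact (Pi\<^sub>E (UNIV::nat set) (\<lambda>i. if i \<in> {1..d} then {-r..r} else {undefined}))"
    using compactin_PiE[of "\<lambda>_. euclidean :: real topology" "UNIV::nat set" "\<lambda>i. if i \<in> {1..d} then {-r..r} else {undefined}"]
    by (simp add: euclidean_product_topology compactin_euclidean_iff)
  also have "Pi\<^sub>E (UNIV::nat set) (\<lambda>i. if i \<in> {1..d} then {-r..r} else {undefined}) = cube d r"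
  proof (intro set_eqI iffI)
    fix z :: "nat \<Rightarrow> real"
    assume z: "z \<in> Pi\<^sub>E (UNIV::nat set) (\<lambda>i. if i \<in> {1..d} then {-r..r} else {undefined})"
    have "\<bar>z i\<bar> \<le> r" if "i \<in> {1..d}" for i
      using PiE_mem[OF z, of i] that by auto
    moreover have "z i = undefined" if "i \<notin> {1..d}" for i
      using PiE_mem[OF z, of i] that by auto
    ultimately show "z \<in> cube d r" by (auto simp: cube_def Rd_def PiE_iff extensional_def)
  next
    fix z :: "nat \<Rightarrow> real"
    assume "z \<in> cube d r"
    then have "\<And>i. i \<in> {1..d} \<Longrightarrow> \<bar>z i\<bar> \<le> r" "\<And>i. i \<notin> {1..d} \<Longrightarrow> z i = undefined"
      by (auto simp: cube_def Rd_def PiE_iff extensional_def)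
    then show "z \<in> Pi\<^sub>E (UNIV::nat set) (\<lambda>i. if i \<in> {1..d} then {-r..r} else {undefined})"
      by (auto simp: PiE_iff abs_le_iff minus_le_iff)
  qed
  finally show ?thesis .
qed

lemma L2_set_abs: "L2_set (\<lambda>i. \<bar>h i\<bar>) A = L2_set h A"
  by (simp add: L2_set_def)

text \<open>This serves integrability for one fixed d, so the exponent may grow with the dimension;
  the bound that is uniform in d is \<open>gbm_weight_moment\<close>.\<close>

lemma norm_gbm_le:
  assumes "0 \<le> \<tau>" "\<tau> \<le> T"
  shows "norm_Rd d (gbm \<alpha> \<beta> d x \<tau> z)
    \<le> norm_Rd d x * exp (\<bar>\<alpha> - \<beta>^2/2\<bar> * T + \<bar>\<beta>\<bar> * sqrt T * (\<Sum>i=1..d. \<bar>z i\<bar>))"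
proof -
  let ?K = "exp (\<bar>\<alpha> - \<beta>^2/2\<bar> * T + \<bar>\<beta>\<bar> * sqrt T * (\<Sum>i=1..d. \<bar>z i\<bar>))"
  have "\<bar>gbm \<alpha> \<beta> d x \<tau> z i\<bar> \<le> ?K * \<bar>x i\<bar>" if i: "i \<in> {1..d}" for i
  proof -
    have "(\<alpha> - \<beta>^2 / 2) * \<tau> \<le> \<bar>\<alpha> - \<beta>^2/2\<bar> * T"
      using assms by (meson abs_ge_self abs_ge_zero mult_mono order_trans mult_right_mono)
    moreover have "\<beta> * sqrt \<tau> * z i \<le> \<bar>\<beta>\<bar> * sqrt T * (\<Sum>i=1..d. \<bar>z i\<bar>)"
    proof -
      have "\<beta> * sqrt \<tau> * z i \<le> \<bar>\<beta>\<bar> * sqrt \<tau> * \<bar>z i\<bar>"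
        using assms by (metis abs_ge_self abs_mult abs_of_nonneg real_sqrt_ge_zero)
      also have "\<dots> \<le> \<bar>\<beta>\<bar> * sqrt T * (\<Sum>i=1..d. \<bar>z i\<bar>)"
        using assms i by (intro mult_mono member_le_sum) auto
      finally show ?thesis .
    qed
    ultimately show ?thesis using i by (simp add: gbm_def abs_mult mult_left_mono add_mono mult.commute)
  qed
  then have "norm_Rd d (gbm \<alpha> \<beta> d x \<tau> z) \<le> L2_set (\<lambda>i. ?K * \<bar>x i\<bar>) {1..d}"
    unfolding norm_Rd_def unfolding L2_set_abs[symmetric, of "gbm \<alpha> \<beta> d x \<tau> z"] by (intro L2_set_mono) auto
  also have "\<dots> = ?K * norm_Rd d x"
    unfolding norm_Rd_def by (subst L2_set_right_distrib[symmetric]) (auto simp: L2_set_abs)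
  finally show ?thesis by (simp add: mult.commute)
qed

lemma rpow_nonneg: "0 \<le> rpow a r"
  by (simp add: rpow_def)

lemma rpow_mono: "0 \<le> a \<Longrightarrow> a \<le> b \<Longrightarrow> 0 \<le> r \<Longrightarrow> rpow a r \<le> rpow b r"
  by (simp add: rpow_def powr_mono2)

lemma rpow_mult: "0 \<le> a \<Longrightarrow> 0 \<le> b \<Longrightarrow> rpow (a * b) r = rpow a r * rpow b r"
  by (simp add: rpow_def powr_mult)

lemma rpow_exp: "rpow (exp a) r = exp (r * a)"
  by (simp add: rpow_def powr_def)

lemma norm_Rd_nonneg: "0 \<le> norm_Rd d x"
  by (simp add: norm_Rd_def)

lemma continuous_gbm:
  "continuous_on UNIV (\<lambda>p. gbm \<alpha> \<beta> d x (fst p) (snd p))"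
proof (rule continuous_on_coordinatewise_then_product)
  fix i
  have *: "continuous_on UNIV (\<lambda>p::real \<times> (nat \<Rightarrow> real). snd p i)"
    by (rule continuous_on_product_then_coordinatewise) (auto intro: continuous_intros)
  show "continuous_on UNIV (\<lambda>p. gbm \<alpha> \<beta> d x (fst p) (snd p) i)"
    by (cases "i \<in> {1..d}") (auto simp: gbm_def intro!: continuous_intros *)
qed

section \<open>The solution evaluated along a geometric Brownian motion, and its derivatives\<close>

locale semilinear_pde =
  fixes T \<alpha> \<beta> L :: real and f :: "real \<Rightarrow> real" and d :: nat
    and u :: "real \<Rightarrow> (nat \<Rightarrow> real) \<Rightarrow> real"
  assumes T: "T > 0" and f_lipschitz: "L-lipschitz_on UNIV f"
    and C12: "C12 T d u" and growing: "polynomially_growing T d u"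
    and pde: "\<And>t x. t \<in> {0<..<T} \<Longrightarrow> x \<in> Rd d \<Longrightarrow>
        deriv (\<lambda>s. u s x) t
        + (\<Sum>i=1..d. \<bar>\<beta>\<bar>^2 * \<bar>x i\<bar>^2 / 2 * partial_deriv i (partial_deriv i (u t)) x)
        + (\<Sum>i=1..d. \<alpha> * x i * partial_deriv i (u t) x)
        + f (u t x) = 0"
begin

text \<open>
  Freezing the time outside of \<open>{t..T}\<close> makes the functions below continuous on the whole line.
\<close>

definition clampT :: "real \<Rightarrow> real \<Rightarrow> real" where
  "clampT t s = max t (min T s)"

text \<open>For a standard Gaussian vector Z, \<open>v t x s Z\<close> has the law of u at time s
  and at the state reached from x at time t. The Feynman-Kac formula amounts to saying that the
  s-derivative of its expectation is minus the expectation of f of it.\<close>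

definition v :: "real \<Rightarrow> (nat \<Rightarrow> real) \<Rightarrow> real \<Rightarrow> (nat \<Rightarrow> real) \<Rightarrow> real" where
  "v t x s z = u (clampT t s) (gbm \<alpha> \<beta> d x (clampT t s - t) z)"

text \<open>
  With \<open>y = ln x\<^sub>i\<close> the functions \<open>D\<close> and \<open>E\<close> are the first two \<open>y\<close>-derivatives of \<open>u\<close> along the
  geometric Brownian motion. By the differential equation \<open>dsv\<close> is the time derivative of \<open>v\<close>.
\<close>

definition D where
  "D t x i s z = gbm \<alpha> \<beta> d x (clampT t s - t) z i *
     partial_deriv i (u (clampT t s)) (gbm \<alpha> \<beta> d x (clampT t s - t) z)"

definition E where
  "E t x i s z = D t x i s z + (gbm \<alpha> \<beta> d x (clampT t s - t) z i)^2 *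
     partial_deriv i (partial_deriv i (u (clampT t s))) (gbm \<alpha> \<beta> d x (clampT t s - t) z)"

definition dsv where
  "dsv t x s z = - f (v t x s z) + (\<Sum>i=1..d. \<beta> / (2 * sqrt (s - t)) *
     (z i * D t x i s z - \<beta> * sqrt (s - t) * E t x i s z))"

lemma clampT: "0 \<le> t \<Longrightarrow> t \<le> T \<Longrightarrow> clampT t s \<in> {0..T}" "t \<le> T \<Longrightarrow> s \<in> {t..T} \<Longrightarrow> clampT t s = s"
    "t \<le> T \<Longrightarrow> clampT t s \<in> {t..T}"
  by (auto simp: clampT_def)

lemma continuous_comp:
  assumes "continuous_on ({0..T} \<times> Rd d) (\<lambda>(t, x). h t x :: real)" "0 \<le> t" "t \<le> T"
  shows "continuous_on UNIV (\<lambda>p. h (clampT t (fst p)) (gbm \<alpha> \<beta> d x (clampT t (fst p) - t) (snd p)))"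
proof -
  have 1: "continuous_on UNIV (\<lambda>p::real \<times> (nat \<Rightarrow> real). clampT t (fst p))"
    unfolding clampT_def by (intro continuous_intros)
  have 2: "continuous_on UNIV (\<lambda>p. gbm \<alpha> \<beta> d x (clampT t (fst p) - t) (snd p))"
    using continuous_on_compose2[OF continuous_gbm[of \<alpha> \<beta> d x] continuous_on_Pair[OF continuous_on_diff[OF 1 continuous_on_const[of _ t]] continuous_on_snd[OF continuous_on_id]]]
    by simp
  have "continuous_on UNIV (\<lambda>p. (\<lambda>(t, x). h t x) (clampT t (fst p), gbm \<alpha> \<beta> d x (clampT t (fst p) - t) (snd p)))"
    by (rule continuous_on_compose2[OF assms(1) continuous_on_Pair[OF 1 2]]) (use clampT(1) assms in auto)
  then show ?thesis by simp
qed

lemma continuous_gbm_clamp: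
  "continuous_on UNIV (\<lambda>p. gbm \<alpha> \<beta> d x (clampT t (fst p) - t) (snd p) i)"
proof -
  have 1: "continuous_on UNIV (\<lambda>p::real \<times> (nat \<Rightarrow> real). clampT t (fst p))"
    unfolding clampT_def by (intro continuous_intros)
  have "continuous_on UNIV (\<lambda>p. gbm \<alpha> \<beta> d x (clampT t (fst p) - t) (snd p))"
    using continuous_on_compose2[OF continuous_gbm[of \<alpha> \<beta> d x] continuous_on_Pair[OF continuous_on_diff[OF 1 continuous_on_const[of _ t]] continuous_on_snd[OF continuous_on_id]]]
    by simp
  then show ?thesis by (rule continuous_on_product_then_coordinatewise)
qed

lemma continuous_f: "continuous_on UNIV f"
  using f_lipschitz by (rule lipschitz_on_continuous_on)

lemma continuous_vDE:
  assumes t: "0 \<le> t" "t \<le> T"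
  shows "continuous_on UNIV (\<lambda>p. v t x (fst p) (snd p))"
    "i \<in> {1..d} \<Longrightarrow> continuous_on UNIV (\<lambda>p. D t x i (fst p) (snd p))"
    "i \<in> {1..d} \<Longrightarrow> continuous_on UNIV (\<lambda>p. E t x i (fst p) (snd p))"
    "continuous_on UNIV (\<lambda>p. f (v t x (fst p) (snd p)))"
proof -
  show 1: "continuous_on UNIV (\<lambda>p. v t x (fst p) (snd p))"
    unfolding v_def using C12 by (intro continuous_comp t) (auto simp: C12_def)
  show 2: "continuous_on UNIV (\<lambda>p. D t x i (fst p) (snd p))" if "i \<in> {1..d}" for i
    unfolding D_def using C12 that
    by (intro continuous_on_mult continuous_gbm_clamp continuous_comp t) (auto simp: C12_def)
  show "continuous_on UNIV (\<lambda>p. E t x i (fst p) (snd p))" if "i \<in> {1..d}"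
    unfolding E_def using C12 that
    by (intro continuous_on_add 2 continuous_on_mult continuous_on_power continuous_gbm_clamp
         continuous_comp[where h = "\<lambda>s. partial_deriv i (partial_deriv i (u s))"] t) (auto simp: C12_def)
  show "continuous_on UNIV (\<lambda>p. f (v t x (fst p) (snd p)))"
    by (rule continuous_on_compose2[OF continuous_f 1]) auto
qed

lemma v_has_derivative_time:
  assumes t: "0 \<le> t" and s: "s \<in> {t<..<T}" and x: "x \<in> Rd d"
  shows "((\<lambda>s. v t x s z) has_real_derivative dsv t x s z) (at s)"
proof -
  define \<gamma> where "\<gamma> r = gbm \<alpha> \<beta> d x (r - t) z" for r
  define \<gamma>' where "\<gamma>' i = \<gamma> s i * ((\<alpha> - \<beta>^2/2) + \<beta> * z i / (2 * sqrt (s - t)))" for i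
  have st: "s - t > 0" using s by simp
  have s0: "s \<in> {0<..<T}" using s t by auto
  obtain u' where u': "\<And>t x. t\<in>{0..T} \<Longrightarrow> x\<in>Rd d \<Longrightarrow>
      ((\<lambda>s. u s x) has_real_derivative u' t x) (at t within {0..T})"
    using C12 unfolding C12_def by blast
  have \<gamma>: "\<gamma> r \<in> Rd d" for r by (simp add: \<gamma>_def)
  have ut: "((\<lambda>r. u r (\<gamma> s)) has_real_derivative u' s (\<gamma> s)) (at s)"
    using u'[of s "\<gamma> s"] s0 \<gamma> by (auto simp: at_within_Icc_at)
  have "continuous_on UNIV \<gamma>"
  proof -
    have "continuous_on UNIV (\<lambda>r. gbm \<alpha> \<beta> d x (fst (r - t, z)) (snd (r - t, z)))"
      by (rule continuous_on_compose2[OF continuous_gbm]) (auto intro!: continuous_intros)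
    then show ?thesis by (simp add: \<gamma>_def[abs_def])
  qed
  then have \<gamma>c: "continuous_on {0<..<T} \<gamma>" by (rule continuous_on_subset) simp
  have "((\<lambda>r. u r (\<gamma> r)) has_real_derivative
      u' s (\<gamma> s) + (\<Sum>i=1..d. partial_deriv i (u s) (\<gamma> s) * \<gamma>' i)) (at s)"
  proof (rule has_real_derivative_along_curve[where a = 0 and b = T and U = u and \<gamma> = \<gamma> and \<gamma>' = \<gamma>', OF s0 ut])
    show "((\<lambda>r. \<gamma> r i) has_real_derivative \<gamma>' i) (at s)" if "i \<in> {1..d}" for i
      unfolding \<gamma>'_def \<gamma>_def gbm_def using that st
      by (auto intro!: derivative_eq_intros simp: field_simps)
  qed (use C12 \<gamma> \<gamma>c in \<open>auto simp: C12_def\<close>)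
  \<comment> \<open>The drift \<alpha> cancels against the first order term of the equation, and the
    remaining - \<beta>^2 / 2 completes the second x_i-derivative to \<open>E\<close>. Apart from -
    f, what is left is exactly the expression whose Gaussian expectation vanishes after integration
    by parts.\<close>
  also have "u' s (\<gamma> s) + (\<Sum>i=1..d. partial_deriv i (u s) (\<gamma> s) * \<gamma>' i) = dsv t x s z"
  proof -
    have cl: "clampT t s = s" using s by (auto simp: clampT_def)
    have "deriv (\<lambda>r. u r (\<gamma> s)) s = u' s (\<gamma> s)" using ut by (rule DERIV_imp_deriv)
    then have "u' s (\<gamma> s) = - (\<Sum>i=1..d. \<bar>\<beta>\<bar>^2 * \<bar>\<gamma> s i\<bar>^2 / 2 * partial_deriv i (partial_deriv i (u s)) (\<gamma> s))
        - (\<Sum>i=1..d. \<alpha> * \<gamma> s i * partial_deriv i (u s) (\<gamma> s)) - f (u s (\<gamma> s))"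
      using pde[OF s0 \<gamma>[of s]] by linarith
    then show ?thesis
      unfolding dsv_def v_def D_def E_def cl \<gamma>_def[symmetric] \<gamma>'_def
      using st by (simp add: sum_negf[symmetric] sum_subtractf[symmetric] sum.distrib[symmetric])
        (intro sum.cong refl, simp add: field_simps power2_eq_square)
  qed
  finally show ?thesis
    by (rule has_field_derivative_transform_within_open[where S = "{t<..<T}"])
      (use s in \<open>auto simp: v_def clampT_def \<gamma>_def\<close>)
qed

lemma gbm_upd: "i \<in> {1..d} \<Longrightarrow> gbm \<alpha> \<beta> d x \<tau> (z(i := y)) =
   (gbm \<alpha> \<beta> d x \<tau> z)(i := x i * exp ((\<alpha> - \<beta>^2 / 2) * \<tau> + \<beta> * sqrt \<tau> * y))"
  by (auto simp: gbm_def fun_eq_iff)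

text \<open>The i-th state coordinate depends on z_i through the factor
  \<open>exp (\<beta> * sqrt (s - t) * z i)\<close>, so differentiation in z_i is \<beta> sqrt (s -
  t) times the operator x_i d/dx_i. These are the hypotheses of \<open>stein_cutoff\<close> with c =
  \<beta> sqrt (s - t).\<close>

lemma vD_has_derivative_space:
  assumes t: "0 \<le> t" "s \<in> {t..T}" and i: "i \<in> {1..d}"
  shows "((\<lambda>y. v t x s (z(i := y))) has_real_derivative (\<beta> * sqrt (s - t)) * D t x i s (z(i := y))) (at y)"
    and "((\<lambda>y. D t x i s (z(i := y))) has_real_derivative (\<beta> * sqrt (s - t)) * E t x i s (z(i := y))) (at y)"
proof -
  define X where "X = gbm \<alpha> \<beta> d x (s - t) z"
  define e where "e y = x i * exp ((\<alpha> - \<beta>^2 / 2) * (s - t) + \<beta> * sqrt (s - t) * y)" for y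
  have cl: "clampT t s = s" using t by (auto simp: clampT_def)
  have s: "s \<in> {0..T}" using t by auto
  have XR: "X(i := w) \<in> Rd d" for w
    using i by (auto simp: X_def gbm_def Rd_def PiE_iff extensional_def)
  have e': "(e has_real_derivative (\<beta> * sqrt (s - t)) * e y) (at y)" for y
    unfolding e_def by (auto intro!: derivative_eq_intros)
  have d1: "((\<lambda>w. u s (X(i := w))) has_real_derivative partial_deriv i (u s) (X(i := w))) (at w)" for w
  proof -
    have "partial_differentiable i (u s) (X(i := w))" using C12 s i XR by (auto simp: C12_def)
    then show ?thesis unfolding partial_differentiable_def partial_deriv_def
      by (auto dest: field_differentiable_derivI)
  qed
  have d2: "((\<lambda>w. partial_deriv i (u s) (X(i := w))) has_real_derivative
      partial_deriv i (partial_deriv i (u s)) (X(i := w))) (at w)" for w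
  proof -
    have "partial_differentiable i (partial_deriv i (u s)) (X(i := w))" using C12 s i XR by (auto simp: C12_def)
    then have "((\<lambda>w'. partial_deriv i (u s) ((X(i := w))(i := w'))) has_real_derivative
       deriv (\<lambda>w'. partial_deriv i (u s) ((X(i := w))(i := w'))) ((X(i := w)) i)) (at w)"
      unfolding partial_differentiable_def by (auto dest: field_differentiable_derivI)
    then show ?thesis by (simp add: partial_deriv_def)
  qed
  have v: "v t x s (z(i := y)) = u s (X(i := e y))" for y
    by (simp add: v_def cl gbm_upd[OF i] X_def e_def)
  have D: "D t x i s (z(i := y)) = e y * partial_deriv i (u s) (X(i := e y))" for y
    by (simp add: D_def cl gbm_upd[OF i] X_def e_def)
  have E: "E t x i s (z(i := y)) = e y * partial_deriv i (u s) (X(i := e y)) +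
      (e y)^2 * partial_deriv i (partial_deriv i (u s)) (X(i := e y))" for y
    by (simp add: E_def D_def cl gbm_upd[OF i] X_def e_def)
  show "((\<lambda>y. v t x s (z(i := y))) has_real_derivative (\<beta> * sqrt (s - t)) * D t x i s (z(i := y))) (at y)"
    unfolding v D by (rule DERIV_cong[OF DERIV_chain2[OF d1 e']]) simp
  show "((\<lambda>y. D t x i s (z(i := y))) has_real_derivative (\<beta> * sqrt (s - t)) * E t x i s (z(i := y))) (at y)"
    unfolding D E
    by (rule DERIV_cong[OF DERIV_mult[OF e' DERIV_chain2[OF d2 e']]]) (simp add: algebra_simps power2_eq_square)
qed

end

section \<open>The Feynman--Kac formula\<close>

declare One_nat_def [simp del]

context semilinear_pde begin

text \<open>The constants are independent of s and z, so one dominating function serves all times at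
  once.\<close>

lemma growth_exp:
  obtains K \<kappa> where "K \<ge> 0" "\<kappa> \<ge> 0"
    "\<And>s z. 0 \<le> t \<Longrightarrow> t \<le> T \<Longrightarrow> \<bar>v t x s z\<bar> \<le> K * exp (\<kappa> * (\<Sum>i=1..d. \<bar>z i\<bar>))"
    "\<And>s z. 0 \<le> t \<Longrightarrow> t \<le> T \<Longrightarrow> \<bar>f (v t x s z)\<bar> \<le> K * exp (\<kappa> * (\<Sum>i=1..d. \<bar>z i\<bar>))"
proof -
  obtain c r where cr: "c \<ge> 0" "r \<ge> 0" "\<And>t x. t\<in>{0..T} \<Longrightarrow> x\<in>Rd d \<Longrightarrow> \<bar>u t x\<bar> \<le> c * (1 + rpow (norm_Rd d x) r)"
    using growing unfolding polynomially_growing_def by blast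
  define A where "A = rpow (norm_Rd d x) r * exp (r * (\<bar>\<alpha> - \<beta>^2/2\<bar> * T))"
  define \<kappa> where "\<kappa> = r * (\<bar>\<beta>\<bar> * sqrt T)"
  have A: "A \<ge> 0" by (simp add: A_def rpow_nonneg)
  have \<kappa>: "\<kappa> \<ge> 0" using cr T by (simp add: \<kappa>_def)
  have L: "L \<ge> 0" using f_lipschitz by (rule lipschitz_on_nonneg)
  have v: "\<bar>v t x s z\<bar> \<le> c * (1 + A) * exp (\<kappa> * (\<Sum>i=1..d. \<bar>z i\<bar>))" if t: "0 \<le> t" "t \<le> T" for s z
  proof -
    let ?S = "\<Sum>i=1..d. \<bar>z i\<bar>"
    have \<tau>: "0 \<le> clampT t s - t" "clampT t s - t \<le> T" using clampT(3)[OF t(2), of s] t by auto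
    have "rpow (norm_Rd d (gbm \<alpha> \<beta> d x (clampT t s - t) z)) r
      \<le> rpow (norm_Rd d x * exp (\<bar>\<alpha> - \<beta>^2/2\<bar> * T + \<bar>\<beta>\<bar> * sqrt T * ?S)) r"
      by (intro rpow_mono norm_Rd_nonneg norm_gbm_le \<tau> cr)
    also have "\<dots> = A * exp (\<kappa> * ?S)"
      by (simp add: rpow_mult norm_Rd_nonneg rpow_exp A_def \<kappa>_def exp_add[symmetric] algebra_simps)
    finally have *: "rpow (norm_Rd d (gbm \<alpha> \<beta> d x (clampT t s - t) z)) r \<le> A * exp (\<kappa> * ?S)" .
    have "\<bar>v t x s z\<bar> \<le> c * (1 + rpow (norm_Rd d (gbm \<alpha> \<beta> d x (clampT t s - t) z)) r)"
      unfolding v_def using clampT(1)[OF t, of s] by (intro cr(3)) auto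
    also have "\<dots> \<le> c * (1 + A * exp (\<kappa> * ?S))"
      using cr(1) * by (intro mult_left_mono add_left_mono)
    also have "\<dots> \<le> c * (1 * exp (\<kappa> * ?S) + A * exp (\<kappa> * ?S))"
      using \<kappa> cr(1) A by (intro mult_left_mono add_mono) (auto intro: sum_nonneg)
    finally show ?thesis by (simp add: algebra_simps)
  qed
  have fv: "\<bar>f (v t x s z)\<bar> \<le> (\<bar>f 0\<bar> + L * (c * (1 + A))) * exp (\<kappa> * (\<Sum>i=1..d. \<bar>z i\<bar>))" if t: "0 \<le> t" "t \<le> T" for s z
  proof -
    have "\<bar>f (v t x s z) - f 0\<bar> \<le> L * \<bar>v t x s z\<bar>"
      using lipschitz_onD[OF f_lipschitz, of "v t x s z" 0] by (simp add: dist_real_def)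
    also have "\<dots> \<le> L * (c * (1 + A) * exp (\<kappa> * (\<Sum>i=1..d. \<bar>z i\<bar>)))"
      using v[OF t, of s z] L by (rule mult_left_mono)
    finally have "\<bar>f (v t x s z)\<bar> \<le> \<bar>f 0\<bar> * 1 + L * (c * (1 + A) * exp (\<kappa> * (\<Sum>i=1..d. \<bar>z i\<bar>)))" by linarith
    also have "\<dots> \<le> \<bar>f 0\<bar> * exp (\<kappa> * (\<Sum>i=1..d. \<bar>z i\<bar>)) + L * (c * (1 + A) * exp (\<kappa> * (\<Sum>i=1..d. \<bar>z i\<bar>)))"
      using \<kappa> cr(1) A L by (intro add_mono mult_left_mono mult_right_mono mult_nonneg_nonneg) (auto intro: sum_nonneg)
    finally show ?thesis by (simp add: algebra_simps)
  qed
  show ?thesis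
  proof (rule that[of "max (c * (1 + A)) (\<bar>f 0\<bar> + L * (c * (1 + A)))" \<kappa>])
    show "\<bar>v t x s z\<bar> \<le> max (c * (1 + A)) (\<bar>f 0\<bar> + L * (c * (1 + A))) * exp (\<kappa> * (\<Sum>i=1..d. \<bar>z i\<bar>))" if t: "0 \<le> t" "t \<le> T" for s z
      by (rule order_trans[OF v[OF t] mult_right_mono]) auto
    show "\<bar>f (v t x s z)\<bar> \<le> max (c * (1 + A)) (\<bar>f 0\<bar> + L * (c * (1 + A))) * exp (\<kappa> * (\<Sum>i=1..d. \<bar>z i\<bar>))" if t: "0 \<le> t" "t \<le> T" for s z
      by (rule order_trans[OF fv[OF t] mult_right_mono]) auto
  qed (use cr A \<kappa> L in \<open>auto simp: max_def\<close>)
qed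

definition cutprod where "cutprod J r z = (\<Prod>j\<in>J. cutoff r (z j))" for z :: "nat \<Rightarrow> real"

text \<open>What remains of the second order terms once both z_i-derivatives have moved from
  \<open>v\<close> to \<open>cutoff r (z i)\<close>; the other coordinates keep their cutoffs as
  factors.\<close>

definition cuterr where
  "cuterr t x r s z = (\<Sum>i=1..d. cutprod ({1..d} - {i}) r z * (v t x s z * (z i * cutoff1 r (z i) - cutoff2 r (z i))))"

lemma continuous_snd_coord: "continuous_on UNIV (\<lambda>p::real \<times> (nat \<Rightarrow> real). snd p i)"
  by (rule continuous_on_product_then_coordinatewise) (auto intro: continuous_intros)

lemma continuous_cut_coord:
  assumes "r > 0"
  shows "continuous_on UNIV (\<lambda>p::real \<times> (nat \<Rightarrow> real). cutoff r (snd p i))"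
    "continuous_on UNIV (\<lambda>p::real \<times> (nat \<Rightarrow> real). cutoff1 r (snd p i))"
    "continuous_on UNIV (\<lambda>p::real \<times> (nat \<Rightarrow> real). cutoff2 r (snd p i))"
    "continuous_on UNIV (\<lambda>p::real \<times> (nat \<Rightarrow> real). cutprod J r (snd p))"
proof -
  show 1: "continuous_on UNIV (\<lambda>p::real \<times> (nat \<Rightarrow> real). cutoff r (snd p i))" for i
    by (rule continuous_on_compose2[OF continuous_cutoff(1)[OF assms] continuous_snd_coord]) auto
  show "continuous_on UNIV (\<lambda>p::real \<times> (nat \<Rightarrow> real). cutoff1 r (snd p i))"
    by (rule continuous_on_compose2[OF continuous_cutoff(2)[OF assms] continuous_snd_coord]) auto
  show "continuous_on UNIV (\<lambda>p::real \<times> (nat \<Rightarrow> real). cutoff2 r (snd p i))"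
    by (rule continuous_on_compose2[OF continuous_cutoff(3)[OF assms] continuous_snd_coord]) auto
  show "continuous_on UNIV (\<lambda>p::real \<times> (nat \<Rightarrow> real). cutprod J r (snd p))"
    unfolding cutprod_def by (intro continuous_on_prod 1)
qed

lemma cutprod_bounds: "r \<ge> 1 \<Longrightarrow> 0 \<le> cutprod J r z" "r \<ge> 1 \<Longrightarrow> cutprod J r z \<le> 1"
  unfolding cutprod_def by (auto intro!: prod_nonneg prod_le_1 cutoff_bounds)

lemma cutprod_eq_0: "finite J \<Longrightarrow> j \<in> J \<Longrightarrow> \<bar>z j\<bar> > r \<Longrightarrow> cutprod J r z = 0"
  unfolding cutprod_def by (rule prod_zero) (auto simp: cutoff_def intro!: bexI[of _ j])

lemma cutprod_split: "i \<in> {1..d} \<Longrightarrow> cutprod {1..d} r z = cutprod ({1..d} - {i}) r z * cutoff r (z i)"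
  unfolding cutprod_def by (subst prod.remove[of _ i]) auto

lemma cuterr_le:
  assumes r: "r \<ge> 1" and v: "\<bar>v t x s z\<bar> \<le> K * exp (\<kappa> * (\<Sum>i=1..d. \<bar>z i\<bar>))" and K: "K \<ge> 0"
  shows "\<bar>cuterr t x r s z\<bar> \<le> real d * (60 * K) * exp ((\<kappa> + 1) * (\<Sum>i=1..d. \<bar>z i\<bar>)) / r^2"
proof -
  let ?S = "\<Sum>i=1..d. \<bar>z i\<bar>"
  have "\<bar>cutprod ({1..d} - {i}) r z * (v t x s z * (z i * cutoff1 r (z i) - cutoff2 r (z i)))\<bar>
     \<le> (60 * K) * exp ((\<kappa> + 1) * ?S) / r^2" if i: "i \<in> {1..d}" for i
  proof -
    \<comment> \<open>From exp y >= 1 + y + y^2 / 2 for y >= 0. The factor 2 turns the 30 of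
      \<open>cutoff_bounds\<close> into 60.\<close>
    have "1 + (z i)^2 \<le> 2 * exp \<bar>z i\<bar>"
      using exp_lower_Taylor_quadratic[of "\<bar>z i\<bar>"] by simp
    also have "\<dots> \<le> 2 * exp ?S" using i by (auto intro: member_le_sum)
    finally have 1: "30 * (1 + (z i)^2) / r^2 \<le> 60 * exp ?S / r^2"
      using r by (intro divide_right_mono) auto
    have "\<bar>cutprod ({1..d} - {i}) r z * (v t x s z * (z i * cutoff1 r (z i) - cutoff2 r (z i)))\<bar>
      \<le> 1 * ((K * exp (\<kappa> * ?S)) * (60 * exp ?S / r^2))"
      unfolding abs_mult using cutprod_bounds[OF r, of "{1..d} - {i}" z] r K
      by (intro mult_mono v order_trans[OF cutoff_bounds(3)[OF r] 1]) auto
    then show ?thesis by (simp add: algebra_simps exp_add)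
  qed
  then have "\<bar>cuterr t x r s z\<bar> \<le> (\<Sum>i=1..d. (60 * K) * exp ((\<kappa> + 1) * ?S) / r^2)"
    unfolding cuterr_def by (intro order_trans[OF sum_abs] sum_mono) auto
  then show ?thesis by simp
qed

text \<open>The derivatives of u have no known growth. Multiplied by a cutoff they are continuous
  and supported in a compact cube, hence bounded; this supplies integrability as long as the cutoff
  is present.\<close>

lemma bounded_on_cube:
  fixes a b :: real
  assumes h: "continuous_on ({a..b} \<times> UNIV) (\<lambda>p. h (fst p) (snd p) :: real)"
    and 0: "\<And>s z. z \<in> Rd d \<Longrightarrow> s \<in> {a..b} \<Longrightarrow> z \<notin> cube d r \<Longrightarrow> h s z = 0"
  obtains B where "B \<ge> 0" "\<And>s z. z \<in> Rd d \<Longrightarrow> s \<in> {a..b} \<Longrightarrow> \<bar>h s z\<bar> \<le> B"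
proof -
  have "compact ((\<lambda>p. h (fst p) (snd p)) ` ({a..b} \<times> cube d r))"
    by (intro compact_continuous_image compact_Times compact_cube compact_Icc) (auto intro: continuous_on_subset[OF h])
  then have "bounded ((\<lambda>p. h (fst p) (snd p)) ` ({a..b} \<times> cube d r))"
    by (rule compact_imp_bounded)
  then obtain B where B: "B > 0" "\<forall>y \<in> (\<lambda>p. h (fst p) (snd p)) ` ({a..b} \<times> cube d r). norm y \<le> B"
    unfolding bounded_pos by blast
  have "\<bar>h s z\<bar> \<le> B" if z: "z \<in> Rd d" "s \<in> {a..b}" for s z
  proof (cases "z \<in> cube d r")
    case True
    then have "(\<lambda>p. h (fst p) (snd p)) (s, z) \<in> (\<lambda>p. h (fst p) (snd p)) ` ({a..b} \<times> cube d r)"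
      using z by (intro imageI) auto
    then show ?thesis using B(2) by fastforce
  next
    case False
    then show ?thesis using 0[OF z] B(1) by simp
  qed
  with B(1) show ?thesis by (intro that[of B]) auto
qed

text \<open>Integrating over z_i first, the cutoffs of the other coordinates are constants, and the
  inner integral is the one in \<open>stein_cutoff\<close>.\<close>

lemma stein_cutprod:
  fixes x :: "nat \<Rightarrow> real"
  assumes t: "0 \<le> t" "t < s" "s \<le> T" and i: "i \<in> {1..d}" and r: "r \<ge> 1"
  defines "c \<equiv> \<beta> * sqrt (s - t)"
  defines "F \<equiv> \<lambda>z. cutprod ({1..d} - {i}) r z *
    (c * (cutoff r (z i) * (z i * D t x i s z - c * E t x i s z)) -
     v t x s z * (z i * cutoff1 r (z i) - cutoff2 r (z i)))"
  shows "integrable (std_gauss d) F" "(\<integral>z. F z \<partial>std_gauss d) = 0"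
proof -
  have cont: "continuous_on UNIV (\<lambda>p. h (fst p) (snd p)) \<Longrightarrow> continuous_on UNIV (\<lambda>p. h s (snd p))"
    for h :: "real \<Rightarrow> (nat \<Rightarrow> real) \<Rightarrow> real"
    by (rule continuous_on_compose2[where g = "\<lambda>p. h (fst p) (snd p)" and f = "\<lambda>p. (s, snd p)" and t = UNIV, simplified])
      (auto intro!: continuous_on_Pair continuous_on_const continuous_on_snd[OF continuous_on_id])
  have Fc: "continuous_on UNIV (\<lambda>p::real \<times> (nat \<Rightarrow> real). F (snd p))"
    unfolding F_def using r t i
    by (intro continuous_intros continuous_cut_coord continuous_snd_coord
       cont[OF continuous_vDE(1)] cont[OF continuous_vDE(2)] cont[OF continuous_vDE(3)]) auto
  have Fc2: "continuous_on UNIV F"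
    using continuous_on_compose2[OF Fc continuous_on_Pair[OF continuous_on_const[of UNIV 0] continuous_on_id]] by simp
  have F0: "F z = 0" if "z \<in> Rd d" "z \<notin> cube d r" for z
  proof -
    from that have "\<not> (\<forall>j\<in>{1..d}. \<bar>z j\<bar> \<le> r)" by (auto simp: cube_def)
    then obtain j where j: "j \<in> {1..d}" "\<bar>z j\<bar> > r" by (auto simp: not_le)
    show ?thesis
    proof (cases "j = i")
      case True then show ?thesis using j by (simp add: F_def cutoff_def cutoff1_def cutoff2_def)
    next
      case False
      then have "cutprod ({1..d} - {i}) r z = 0" using j by (intro cutprod_eq_0[of _ j]) auto
      then show ?thesis by (simp add: F_def)
    qed
  qed
  obtain B where B: "\<And>z. z \<in> Rd d \<Longrightarrow> \<bar>F z\<bar> \<le> B"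
  proof (rule bounded_on_cube[of 0 0 "\<lambda>_. F" r])
    show "continuous_on ({0..0} \<times> UNIV) (\<lambda>p::real \<times> (nat \<Rightarrow> real). F (snd p))"
      using Fc by (rule continuous_on_subset) simp
  qed (auto simp: F0)
  interpret G: prob_space "std_gauss d" by (rule prob_space_std_gauss)
  have Fm: "F \<in> borel_measurable (std_gauss d)"
    using borel_measurable_borel_Rd_continuous[OF Fc2, of d] by (simp cong: measurable_cong_sets add: sets_std_gauss)
  show Fi: "integrable (std_gauss d) F"
    by (rule G.integrable_const_bound[of _ B]) (use B Fm in \<open>auto simp: space_std_gauss\<close>)
  interpret product_sigma_finite "\<lambda>_::nat. std_normal"
    by (intro product_sigma_finite.intro prob_space_imp_sigma_finite prob_space_std_normal)
  have ins: "insert i ({1..d} - {i}) = {1..d}" using i by auto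
  have "(\<integral>z. F z \<partial>std_gauss d) =
      (\<integral>z. (\<integral>y. F (z(i := y)) \<partial>std_normal) \<partial>PiM ({1..d} - {i}) (\<lambda>_. std_normal))"
    using Fi unfolding std_gauss_def
    by (subst product_integral_insert[of "{1..d} - {i}" i F, unfolded ins]) auto
  also have "\<dots> = (\<integral>z. 0 \<partial>PiM ({1..d} - {i}) (\<lambda>_. std_normal))"
  proof (rule Bochner_Integration.integral_cong[OF refl])
    fix z :: "nat \<Rightarrow> real"
    have [simp]: "cutprod ({1..d} - {i}) r (z(i := y)) = cutprod ({1..d} - {i}) r z" for y
      unfolding cutprod_def by (intro prod.cong) auto
    have "(\<integral>y. F (z(i := y)) \<partial>std_normal) =
      cutprod ({1..d} - {i}) r z * (\<integral>y. c * (cutoff r y * (y * D t x i s (z(i := y)) - c * E t x i s (z(i := y)))) -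
     v t x s (z(i := y)) * (y * cutoff1 r y - cutoff2 r y) \<partial>std_normal)"
      unfolding F_def by simp
    also have "\<dots> = 0"
    proof (subst stein_cutoff)
      show "continuous_on UNIV (\<lambda>y. E t x i s (z(i := y)))"
      proof -
        have "continuous_on UNIV (\<lambda>y. (s, z(i := y)))"
        proof (intro continuous_on_Pair continuous_on_const continuous_on_coordinatewise_then_product)
          fix j show "continuous_on UNIV (\<lambda>y. (z(i := y)) j)"
            by (cases "j = i") (auto intro: continuous_intros)
        qed
        from continuous_on_compose2[OF continuous_vDE(3)[OF t(1) _ i] this, of x] t show ?thesis by auto
      qed
    qed (use vD_has_derivative_space[OF t(1) _ i, of s x z] t r in \<open>auto simp: c_def\<close>)
    finally show "(\<integral>y. F (z(i := y)) \<partial>std_normal) = 0" .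
  qed
  finally show "(\<integral>z. F z \<partial>std_gauss d) = 0" by simp
qed

end

context semilinear_pde begin

lemma measurable_vDE:
  assumes t: "0 \<le> t" "t \<le> T"
  shows "(\<lambda>p. v t x (fst p) (snd p)) \<in> borel_measurable (borel \<Otimes>\<^sub>M borel_Rd d)"
    "i \<in> {1..d} \<Longrightarrow> (\<lambda>p. D t x i (fst p) (snd p)) \<in> borel_measurable (borel \<Otimes>\<^sub>M borel_Rd d)"
    "i \<in> {1..d} \<Longrightarrow> (\<lambda>p. E t x i (fst p) (snd p)) \<in> borel_measurable (borel \<Otimes>\<^sub>M borel_Rd d)"
    "(\<lambda>p. f (v t x (fst p) (snd p))) \<in> borel_measurable (borel \<Otimes>\<^sub>M borel_Rd d)"
  by (intro borel_measurable_pair_borel_Rd_continuous continuous_vDE t; assumption)+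

lemma measurable_cut:
  assumes r: "r > 0"
  shows "(\<lambda>p::real \<times> (nat \<Rightarrow> real). cutprod J r (snd p)) \<in> borel_measurable (borel \<Otimes>\<^sub>M borel_Rd d)"
    "(\<lambda>p::real \<times> (nat \<Rightarrow> real). cutoff1 r (snd p i)) \<in> borel_measurable (borel \<Otimes>\<^sub>M borel_Rd d)"
    "(\<lambda>p::real \<times> (nat \<Rightarrow> real). cutoff2 r (snd p i)) \<in> borel_measurable (borel \<Otimes>\<^sub>M borel_Rd d)"
  using r by (auto intro!: borel_measurable_pair_borel_Rd_continuous continuous_cut_coord continuous_snd_coord)

lemma measurable_snd_coord:
  "(\<lambda>p::real \<times> (nat \<Rightarrow> real). snd p i) \<in> borel_measurable (borel \<Otimes>\<^sub>M borel_Rd d)"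
  by (intro borel_measurable_pair_borel_Rd_continuous continuous_snd_coord)

lemma measurable_dsv:
  assumes t: "0 \<le> t" "t \<le> T"
  shows "(\<lambda>p. dsv t x (fst p) (snd p)) \<in> borel_measurable (borel \<Otimes>\<^sub>M borel_Rd d)"
  unfolding dsv_def
  by (intro borel_measurable_add borel_measurable_uminus borel_measurable_sum borel_measurable_times
      borel_measurable_diff measurable_vDE t measurable_snd_coord) measurable

lemma measurable_cuterr:
  assumes t: "0 \<le> t" "t \<le> T" and r: "r > 0"
  shows "(\<lambda>p. cuterr t x r (fst p) (snd p)) \<in> borel_measurable (borel \<Otimes>\<^sub>M borel_Rd d)"
  unfolding cuterr_def
  by (intro borel_measurable_sum borel_measurable_times borel_measurable_diff measurable_vDE t measurable_cut r
     measurable_snd_coord)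

lemma measurable_section:
  fixes h :: "real \<Rightarrow> (nat \<Rightarrow> real) \<Rightarrow> real"
  assumes "(\<lambda>p. h (fst p) (snd p) :: real) \<in> borel_measurable (borel \<Otimes>\<^sub>M borel_Rd d)"
  shows "h s \<in> borel_measurable (std_gauss d)"
proof -
  have "(\<lambda>z. (s::real, z)) \<in> measurable (borel_Rd d) (borel \<Otimes>\<^sub>M borel_Rd d)" by simp
  from measurable_compose[OF this assms] show ?thesis
    by (simp cong: measurable_cong_sets add: sets_std_gauss)
qed

lemma measurable_pair_gauss:
  fixes h :: "real \<Rightarrow> (nat \<Rightarrow> real) \<Rightarrow> real"
  assumes "(\<lambda>p. h (fst p) (snd p) :: real) \<in> borel_measurable (borel \<Otimes>\<^sub>M borel_Rd d)"
  shows "(\<lambda>(s, z). h s z) \<in> borel_measurable (lborel \<Otimes>\<^sub>M std_gauss d)"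
proof -
  have "sets (lborel \<Otimes>\<^sub>M std_gauss d) = sets (borel \<Otimes>\<^sub>M borel_Rd d)"
    by (intro sets_pair_measure_cong sets_std_gauss) simp
  from measurable_cong_sets[OF this refl] show ?thesis using assms by (simp add: case_prod_unfold)
qed

lemma measurable_inner_integral:
  fixes h :: "real \<Rightarrow> (nat \<Rightarrow> real) \<Rightarrow> real"
  assumes "(\<lambda>p. h (fst p) (snd p) :: real) \<in> borel_measurable (borel \<Otimes>\<^sub>M borel_Rd d)"
  shows "(\<lambda>s. \<integral>z. h s z \<partial>std_gauss d) \<in> borel_measurable borel"
proof -
  interpret G: prob_space "std_gauss d" by (rule prob_space_std_gauss)
  have "(\<lambda>s. \<integral>z. h s z \<partial>std_gauss d) \<in> borel_measurable lborel"
    using measurable_pair_gauss[OF assms] by (rule G.borel_measurable_lebesgue_integral)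
  then show ?thesis by simp
qed

text \<open>\<open>dsv\<close> contains the factor 1 / sqrt (s - t), which is singular at s = t.
  Hence the time intervals start at some a > t, and a tends to t only in
  \<open>feynman_kac\<close>.\<close>

lemma continuous_dsv:
  assumes t: "0 \<le> t" "t < a"  "b \<le> T"
  shows "continuous_on ({a..b} \<times> UNIV) (\<lambda>p. dsv t x (fst p) (snd p))"
proof (cases "a \<le> b")
  case True
  then have tT: "t \<le> T" using t by auto
  show ?thesis unfolding dsv_def
    using t by (intro continuous_intros continuous_on_subset[OF continuous_vDE(2)[OF t(1) tT] subset_UNIV]
      continuous_on_subset[OF continuous_vDE(3)[OF t(1) tT] subset_UNIV]
      continuous_on_subset[OF continuous_vDE(4)[OF t(1) tT] subset_UNIV]
      continuous_on_subset[OF continuous_snd_coord subset_UNIV]) auto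
next
  case False
  then show ?thesis by simp
qed

lemma cutprod_outside_cube: "z \<in> Rd d \<Longrightarrow> z \<notin> cube d r \<Longrightarrow> cutprod {1..d} r z = 0"
  by (auto simp: cube_def not_le intro: cutprod_eq_0)

text \<open>Subtracting the vanishing integrals of \<open>stein_cutprod\<close>, each with the
  weight 1 / (2 (s - t)), cancels \<open>D\<close> and \<open>E\<close> pointwise and leaves terms
  in \<open>v\<close> alone.\<close>

lemma integral_cutprod_dsv:
  assumes t: "0 \<le> t" "t < s" "s \<le> T" and r: "r \<ge> 1"
  shows "(\<integral>z. cutprod {1..d} r z * dsv t x s z \<partial>std_gauss d) =
    (\<integral>z. - cutprod {1..d} r z * f (v t x s z) + cuterr t x r s z / (2 * (s - t)) \<partial>std_gauss d)"
proof -
  interpret G: prob_space "std_gauss d" by (rule prob_space_std_gauss)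
  have tT: "t \<le> T" using t by auto
  define c where "c = \<beta> * sqrt (s - t)"
  define F where "F i z = cutprod ({1..d} - {i}) r z *
    (c * (cutoff r (z i) * (z i * D t x i s z - c * E t x i s z)) -
     v t x s z * (z i * cutoff1 r (z i) - cutoff2 r (z i)))" for i z
  have F: "integrable (std_gauss d) (F i)" "(\<integral>z. F i z \<partial>std_gauss d) = 0" if "i \<in> {1..d}" for i
    using stein_cutprod[OF t that r, of x] by (auto simp: F_def[abs_def] c_def)
  obtain B where B: "\<And>z. z \<in> Rd d \<Longrightarrow> \<bar>cutprod {1..d} r z * dsv t x s z\<bar> \<le> B"
  proof (rule bounded_on_cube[of s s "\<lambda>s z. cutprod {1..d} r z * dsv t x s z" r])
    show "continuous_on ({s..s} \<times> UNIV) (\<lambda>p. cutprod {1..d} r (snd p) * dsv t x (fst p) (snd p))"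
      using t r by (intro continuous_on_mult continuous_dsv continuous_on_subset[OF continuous_cut_coord(4)]) auto
  qed (auto simp: cutprod_outside_cube simp del: One_nat_def)
  have int: "integrable (std_gauss d) (\<lambda>z. cutprod {1..d} r z * dsv t x s z)"
    using B r t by (intro G.integrable_const_bound[of _ B] measurable_section[of "\<lambda>s z. cutprod {1..d} r z * dsv t x s z"]
       borel_measurable_times measurable_cut measurable_dsv) (auto simp: space_std_gauss)
  have "(\<integral>z. cutprod {1..d} r z * dsv t x s z \<partial>std_gauss d) =
      (\<integral>z. cutprod {1..d} r z * dsv t x s z - (\<Sum>i=1..d. 1 / (2 * (s - t)) * F i z) \<partial>std_gauss d)"
    using F int by (subst Bochner_Integration.integral_diff) (auto simp: Bochner_Integration.integral_sum)
  also have "\<dots> = (\<integral>z. - cutprod {1..d} r z * f (v t x s z) + cuterr t x r s z / (2 * (s - t)) \<partial>std_gauss d)"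
  proof (rule Bochner_Integration.integral_cong[OF refl])
    fix z
    have sq: "sqrt (s - t) * sqrt (s - t) = s - t" "sqrt (s - t) > 0" using t by auto
    have cancel: "\<beta> * q / (2 * (q * q)) = \<beta> / (2 * q)" if "q > 0" for q using that by (simp add: field_simps)
    \<comment> \<open>Brings the prefactor in \<open>dsv\<close> to the form in which it matches the
      weight 1 / (2 (s - t)) of \<open>F i\<close>.\<close>
    have \<beta>: "\<beta> / (2 * sqrt (s - t)) = c / (2 * (s - t))"
    proof -
      have "c / (2 * (s - t)) = \<beta> * sqrt (s - t) / (2 * (sqrt (s - t) * sqrt (s - t)))"
        unfolding c_def by (simp only: sq(1))
      also have "\<dots> = \<beta> / (2 * sqrt (s - t))" using sq(2) by (rule cancel)
      finally show ?thesis ..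
    qed
    have "cutprod {1..d} r z * (\<Sum>i=1..d. \<beta> / (2 * sqrt (s - t)) * (z i * D t x i s z - \<beta> * sqrt (s - t) * E t x i s z))
       - (\<Sum>i=1..d. 1 / (2 * (s - t)) * F i z) = cuterr t x r s z / (2 * (s - t))"
      unfolding sum_distrib_left sum_subtractf[symmetric] cuterr_def sum_divide_distrib
    proof (rule sum.cong[OF refl])
      fix i assume i: "i \<in> {1..d}"
      show "cutprod {1..d} r z * (\<beta> / (2 * sqrt (s - t)) * (z i * D t x i s z - \<beta> * sqrt (s - t) * E t x i s z)) -
          1 / (2 * (s - t)) * F i z =
          cutprod ({1..d} - {i}) r z * (v t x s z * (z i * cutoff1 r (z i) - cutoff2 r (z i))) / (2 * (s - t))"
      proof -
        define q where "q = 2 * (s - t)"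
        have "q > 0" using t by (simp add: q_def)
        then show ?thesis
          unfolding cutprod_split[OF i] \<beta> F_def c_def[symmetric] q_def[symmetric] by (simp add: field_simps)
      qed
    qed
    then show "cutprod {1..d} r z * dsv t x s z - (\<Sum>i=1..d. 1 / (2 * (s - t)) * F i z) =
      - cutprod {1..d} r z * f (v t x s z) + cuterr t x r s z / (2 * (s - t))"
      unfolding dsv_def by (simp add: algebra_simps)
  qed
  finally show ?thesis .
qed

text \<open>The fundamental theorem of calculus for each z, followed by Fubini: thanks to the cutoff
  the integrand is bounded and lives on [a, b] x R^d, which has finite measure. Both ends stay
  inside the open interval in which \<open>v_has_derivative_time\<close> applies.\<close>

lemma integral_cutprod_increment:
  assumes t: "0 \<le> t" "t < a" "a \<le> b" "b < T" and r: "r \<ge> 1" and x: "x \<in> Rd d"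
  shows "(\<integral>z. cutprod {1..d} r z * (v t x b z - v t x a z) \<partial>std_gauss d) =
    (\<integral>s. indicator {a..b} s * (\<integral>z. - cutprod {1..d} r z * f (v t x s z)
       + cuterr t x r s z / (2 * (s - t)) \<partial>std_gauss d) \<partial>lborel)"
proof -
  interpret G: prob_space "std_gauss d" by (rule prob_space_std_gauss)
  interpret P: pair_sigma_finite lborel "std_gauss d"
    by (intro pair_sigma_finite.intro lborel.sigma_finite_measure_axioms G.sigma_finite_measure_axioms)
  have tT: "t \<le> T" using t by auto
  obtain B where B: "B \<ge> 0" "\<And>s z. z \<in> Rd d \<Longrightarrow> s \<in> {a..b} \<Longrightarrow> \<bar>cutprod {1..d} r z * dsv t x s z\<bar> \<le> B"
  proof (rule bounded_on_cube[of a b "\<lambda>s z. cutprod {1..d} r z * dsv t x s z" r])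
    show "continuous_on ({a..b} \<times> UNIV) (\<lambda>p. cutprod {1..d} r (snd p) * dsv t x (fst p) (snd p))"
      using t r by (intro continuous_on_mult continuous_dsv continuous_on_subset[OF continuous_cut_coord(4)]) auto
  qed (auto simp: cutprod_outside_cube simp del: One_nat_def)
  let ?h = "\<lambda>s z. indicator {a..b} s * (cutprod {1..d} r z * dsv t x s z)"
  have m: "(\<lambda>p. ?h (fst p) (snd p)) \<in> borel_measurable (borel \<Otimes>\<^sub>M borel_Rd d)"
    using r by (intro borel_measurable_times measurable_cut measurable_dsv t tT) measurable
  have int: "integrable (lborel \<Otimes>\<^sub>M std_gauss d) (\<lambda>(s, z). ?h s z)"
  proof (rule integrableI_bounded_set[where A = "{a..b} \<times> space (std_gauss d)" and B = B])
    show "{a..b} \<times> space (std_gauss d) \<in> sets (lborel \<Otimes>\<^sub>M std_gauss d)" by simp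
    show "(\<lambda>(s, z). ?h s z) \<in> borel_measurable (lborel \<Otimes>\<^sub>M std_gauss d)"
      using m by (rule measurable_pair_gauss)
    show "emeasure (lborel \<Otimes>\<^sub>M std_gauss d) ({a..b} \<times> space (std_gauss d)) < \<infinity>"
      by (subst G.emeasure_pair_measure_Times) (use t in \<open>auto simp: G.emeasure_space_1\<close>)
    show "AE p in lborel \<Otimes>\<^sub>M std_gauss d. p \<in> {a..b} \<times> space (std_gauss d) \<longrightarrow> norm ((\<lambda>(s, z). ?h s z) p) \<le> B"
      using B by (intro AE_I2) (auto simp: space_std_gauss)
    show "AE p in lborel \<Otimes>\<^sub>M std_gauss d. p \<notin> {a..b} \<times> space (std_gauss d) \<longrightarrow> (\<lambda>(s, z). ?h s z) p = 0"
      by (intro AE_I2) (auto simp: space_pair_measure indicator_def)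
  qed
  have "(\<integral>z. cutprod {1..d} r z * (v t x b z - v t x a z) \<partial>std_gauss d) =
      (\<integral>z. (\<integral>s. ?h s z \<partial>lborel) \<partial>std_gauss d)"
  proof (rule Bochner_Integration.integral_cong[OF refl])
    fix z
    have c: "continuous_on {a..b} (\<lambda>s. dsv t x s z)"
    proof -
      have "continuous_on {a..b} (\<lambda>s. (s, z))" by (intro continuous_on_Pair continuous_on_id continuous_on_const)
      from continuous_on_compose2[OF continuous_dsv[of t a b x] this] t show ?thesis by (simp add: image_subset_iff)
    qed
    have "integral\<^sup>L lborel (\<lambda>s. indicator {a..b} s *\<^sub>R dsv t x s z) = v t x b z - v t x a z"
    proof (rule integral_FTC_atLeastAtMost[OF t(3) _ c])
      show "((\<lambda>s. v t x s z) has_vector_derivative dsv t x s z) (at s within {a..b})" if "a \<le> s" "s \<le> b" for s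
        unfolding has_real_derivative_iff_has_vector_derivative[symmetric]
        by (rule has_field_derivative_at_within, rule v_has_derivative_time) (use that t x in auto)
    qed
    then show "cutprod {1..d} r z * (v t x b z - v t x a z) = (\<integral>s. ?h s z \<partial>lborel)"
    proof -
      assume *: "(LBINT s. indicator {a..b} s *\<^sub>R dsv t x s z) = v t x b z - v t x a z"
      have "(\<integral>s. ?h s z \<partial>lborel) = (\<integral>s. cutprod {1..d} r z * (indicator {a..b} s *\<^sub>R dsv t x s z) \<partial>lborel)"
        by (intro Bochner_Integration.integral_cong) auto
      then show ?thesis using * by simp
    qed
  qed
  also have "\<dots> = (\<integral>s. (\<integral>z. ?h s z \<partial>std_gauss d) \<partial>lborel)"
    using int by (rule P.Fubini_integral)
  also have "\<dots> = (\<integral>s. indicator {a..b} s * (\<integral>z. - cutprod {1..d} r z * f (v t x s z)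
       + cuterr t x r s z / (2 * (s - t)) \<partial>std_gauss d) \<partial>lborel)"
  proof (rule Bochner_Integration.integral_cong[OF refl])
    fix s
    show "(\<integral>z. ?h s z \<partial>std_gauss d) = indicator {a..b} s * (\<integral>z. - cutprod {1..d} r z * f (v t x s z)
       + cuterr t x r s z / (2 * (s - t)) \<partial>std_gauss d)"
    proof (cases "s \<in> {a..b}")
      case True
      then show ?thesis using integral_cutprod_dsv[OF t(1) _ _ r, of s x] t by auto
    qed simp
  qed
  finally show ?thesis .
qed

lemma cutprod_tendsto: "(\<lambda>n. cutprod {1..d} (real (Suc n)) z) \<longlonglongrightarrow> 1"
proof -
  have "(\<lambda>n. \<Prod>j\<in>{1..d}. cutoff (real (Suc n)) (z j)) \<longlonglongrightarrow> (\<Prod>j\<in>{1..d}. 1)"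
    by (intro tendsto_prod cutoff_tendsto)
  then show ?thesis by (simp add: cutprod_def)
qed

text \<open>The cutoff is removed by dominated convergence, first in z at each time and then in the
  time. Since a > t, the factor 1 / (2 (s - t)) is bounded, so \<open>cuterr\<close> remains
  dominated and vanishes like 1 / r^2.\<close>

lemma integral_increment:
  assumes t: "0 \<le> t" "t < a" "a \<le> b" "b < T" and x: "x \<in> Rd d"
  shows "(\<integral>z. v t x b z - v t x a z \<partial>std_gauss d) =
    - (\<integral>s. indicator {a..b} s * (\<integral>z. f (v t x s z) \<partial>std_gauss d) \<partial>lborel)"
proof -
  interpret G: prob_space "std_gauss d" by (rule prob_space_std_gauss)
  have tT: "t \<le> T" using t by auto
  obtain K \<kappa> where K: "K \<ge> 0" "\<kappa> \<ge> 0"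
    "\<And>s z. \<bar>v t x s z\<bar> \<le> K * exp (\<kappa> * (\<Sum>i=1..d. \<bar>z i\<bar>))"
    "\<And>s z. \<bar>f (v t x s z)\<bar> \<le> K * exp (\<kappa> * (\<Sum>i=1..d. \<bar>z i\<bar>))"
    using growth_exp[of t x] t(1) tT by metis
  let ?e = "\<lambda>k z. exp (k * (\<Sum>i=1..d. \<bar>z i\<bar>))"
  let ?r = "\<lambda>n. real (Suc n)"
  \<comment> \<open>The constant of \<open>cuterr_le\<close> for r >= 1, together with s - t >= a -
    t.\<close>
  let ?K2 = "real d * (60 * K) / (2 * (a - t))"
  note me = measurable_vDE[OF t(1) tT, where x = x]
  have mv: "v t x s \<in> borel_measurable (std_gauss d)" "(\<lambda>z. f (v t x s z)) \<in> borel_measurable (std_gauss d)" for s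
    using measurable_section[of "v t x" s] measurable_section[of "\<lambda>s z. f (v t x s z)" s] me(1,4) by auto
  have mc: "cutprod J r \<in> borel_measurable (std_gauss d)" if "r > 0" for J r
    using measurable_section[of "\<lambda>s. cutprod J r" 0] measurable_cut(1)[OF that] by auto
  have L: "(\<lambda>n. \<integral>z. cutprod {1..d} (?r n) z * (v t x b z - v t x a z) \<partial>std_gauss d) \<longlonglongrightarrow>
      (\<integral>z. v t x b z - v t x a z \<partial>std_gauss d)"
  proof (rule integral_dominated_convergence[where w = "\<lambda>z. 2 * K * ?e \<kappa> z"])
    show "integrable (std_gauss d) (\<lambda>z. 2 * K * ?e \<kappa> z)"
      by (intro integrable_mult_right integrable_std_gauss_exp)
    show "AE z in std_gauss d. (\<lambda>n. cutprod {1..d} (?r n) z * (v t x b z - v t x a z)) \<longlonglongrightarrow> v t x b z - v t x a z"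
      using tendsto_mult[OF cutprod_tendsto tendsto_const] by (intro AE_I2) force
    show "AE z in std_gauss d. norm (cutprod {1..d} (?r n) z * (v t x b z - v t x a z)) \<le> 2 * K * ?e \<kappa> z" for n
    proof (rule AE_I2)
      fix z
      have "\<bar>v t x b z - v t x a z\<bar> \<le> 2 * K * ?e \<kappa> z" using K(3)[of b z] K(3)[of a z] by linarith
      moreover have "0 \<le> cutprod {1..d} (?r n) z" "cutprod {1..d} (?r n) z \<le> 1"
        by (auto intro: cutprod_bounds)
      ultimately have "\<bar>cutprod {1..d} (?r n) z\<bar> * \<bar>v t x b z - v t x a z\<bar> \<le> 1 * (2 * K * ?e \<kappa> z)"
        by (intro mult_mono) auto
      then show "norm (cutprod {1..d} (?r n) z * (v t x b z - v t x a z)) \<le> 2 * K * ?e \<kappa> z" by (simp add: abs_mult)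
    qed
  qed (use mv mc in auto)
  define J where "J n s = (\<integral>z. - cutprod {1..d} (?r n) z * f (v t x s z) + cuterr t x (?r n) s z / (2 * (s - t)) \<partial>std_gauss d)" for n s
  have bnd: "\<bar>- cutprod {1..d} (?r n) z * f (v t x s z) + cuterr t x (?r n) s z / (2 * (s - t))\<bar> \<le>
      (K + ?K2) * ?e (\<kappa> + 1) z" if s: "s \<in> {a..b}" for n s z
  proof -
    have "0 \<le> cutprod {1..d} (?r n) z" "cutprod {1..d} (?r n) z \<le> 1"
      by (auto intro: cutprod_bounds)
    then have "\<bar>cutprod {1..d} (?r n) z\<bar> * \<bar>f (v t x s z)\<bar> \<le> 1 * (K * ?e \<kappa> z)"
      by (intro mult_mono K(4)) auto
    also have "\<dots> \<le> K * ?e (\<kappa> + 1) z" using K by (auto intro!: mult_left_mono mult_right_mono sum_nonneg)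
    finally have 1: "\<bar>- cutprod {1..d} (?r n) z * f (v t x s z)\<bar> \<le> K * ?e (\<kappa> + 1) z" by (simp add: abs_mult)
    have "\<bar>cuterr t x (?r n) s z\<bar> \<le> real d * (60 * K) * ?e (\<kappa> + 1) z / (?r n)^2"
      by (rule cuterr_le[OF _ K(3) K(1)]) simp
    also have "\<dots> \<le> real d * (60 * K) * ?e (\<kappa> + 1) z / 1"
      using K by (intro divide_left_mono) (auto simp: one_le_power)
    finally have "\<bar>cuterr t x (?r n) s z\<bar> / (2 * (s - t)) \<le> real d * (60 * K) * ?e (\<kappa> + 1) z / (2 * (a - t))"
      using s t K by (intro frac_le) auto
    then have 2: "\<bar>cuterr t x (?r n) s z / (2 * (s - t))\<bar> \<le> ?K2 * ?e (\<kappa> + 1) z"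
      using s t by (simp add: abs_divide)
    show ?thesis using abs_triangle_ineq 1 2 by (smt (verit) distrib_right)
  qed
  have lim_in: "(\<lambda>n. J n s) \<longlonglongrightarrow> - (\<integral>z. f (v t x s z) \<partial>std_gauss d)" if s: "s \<in> {a..b}" for s
    unfolding J_def Bochner_Integration.integral_minus[symmetric]
  proof (rule integral_dominated_convergence[where w = "\<lambda>z. (K + ?K2) * ?e (\<kappa> + 1) z"])
    show "integrable (std_gauss d) (\<lambda>z. (K + ?K2) * ?e (\<kappa> + 1) z)"
      by (intro integrable_mult_right integrable_std_gauss_exp)
    show "AE z in std_gauss d. norm (- cutprod {1..d} (?r n) z * f (v t x s z) + cuterr t x (?r n) s z / (2 * (s - t))) \<le>
       (K + ?K2) * ?e (\<kappa> + 1) z" for n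
      using bnd[OF s] by simp
    show "AE z in std_gauss d. (\<lambda>n. - cutprod {1..d} (?r n) z * f (v t x s z) + cuterr t x (?r n) s z / (2 * (s - t)))
       \<longlonglongrightarrow> - f (v t x s z)"
    proof (rule AE_I2)
      fix z
      have "(\<lambda>n. cuterr t x (?r n) s z) \<longlonglongrightarrow> 0"
      proof (rule tendsto_rabs_zero_cancel, rule tendsto_sandwich[OF _ _ tendsto_const])
        show "\<forall>\<^sub>F n in sequentially. \<bar>cuterr t x (?r n) s z\<bar> \<le> real d * (60 * K) * ?e (\<kappa> + 1) z * (inverse (?r n))^2"
          using cuterr_le[OF _ K(3) K(1), of "?r _" s z] by (intro always_eventually allI) (simp add: field_simps)
        show "(\<lambda>n. real d * (60 * K) * ?e (\<kappa> + 1) z * (inverse (?r n))^2) \<longlonglongrightarrow> 0"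
          using tendsto_mult[OF tendsto_const tendsto_power[OF LIMSEQ_inverse_real_of_nat, of 2]] by (simp del: of_nat_Suc)
      qed auto
      then have "(\<lambda>n. - cutprod {1..d} (?r n) z * f (v t x s z) + cuterr t x (?r n) s z / (2 * (s - t)))
       \<longlonglongrightarrow> - 1 * f (v t x s z) + 0 / (2 * (s - t))"
        using s t by (intro tendsto_intros cutprod_tendsto) auto
      then show "(\<lambda>n. - cutprod {1..d} (?r n) z * f (v t x s z) + cuterr t x (?r n) s z / (2 * (s - t)))
       \<longlonglongrightarrow> - f (v t x s z)" by simp
    qed
    show "(\<lambda>z. - cutprod {1..d} (?r n) z * f (v t x s z) + cuterr t x (?r n) s z / (2 * (s - t))) \<in> borel_measurable (std_gauss d)" for n
      using measurable_section[of "cuterr t x (?r n)" s] measurable_cuterr[OF t(1) tT, of "?r n" x] mv mc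
      by (intro borel_measurable_add borel_measurable_times borel_measurable_uminus borel_measurable_divide) auto
  qed (use mv in auto)
  have R: "(\<lambda>n. \<integral>s. indicator {a..b} s * J n s \<partial>lborel) \<longlonglongrightarrow>
     (\<integral>s. indicator {a..b} s * (- (\<integral>z. f (v t x s z) \<partial>std_gauss d)) \<partial>lborel)"
  proof (rule integral_dominated_convergence[where w = "\<lambda>s. indicator {a..b} s * ((K + ?K2) * (\<integral>z. ?e (\<kappa> + 1) z \<partial>std_gauss d))"])
    show "integrable lborel (\<lambda>s. indicator {a..b} s * ((K + ?K2) * (\<integral>z. ?e (\<kappa> + 1) z \<partial>std_gauss d)))"
      by (intro integrable_mult_left integrable_real_indicator) (use t in auto)
    show "AE s in lborel. (\<lambda>n. indicator {a..b} s * J n s) \<longlonglongrightarrow> indicator {a..b} s * (- (\<integral>z. f (v t x s z) \<partial>std_gauss d))"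
      by (intro AE_I2) (auto split: split_indicator intro: lim_in)
    show "AE s in lborel. norm (indicator {a..b} s * J n s) \<le> indicator {a..b} s * ((K + ?K2) * (\<integral>z. ?e (\<kappa> + 1) z \<partial>std_gauss d))" for n
    proof (rule AE_I2)
      fix s
      have "norm (J n s) \<le> (\<integral>z. (K + ?K2) * ?e (\<kappa> + 1) z \<partial>std_gauss d)" if "s \<in> {a..b}"
        unfolding J_def
      proof (rule order_trans[OF integral_norm_bound integral_mono'])
        show "integrable (std_gauss d) (\<lambda>z. (K + ?K2) * ?e (\<kappa> + 1) z)"
          by (intro integrable_mult_right integrable_std_gauss_exp)
        show "norm (- cutprod {1..d} (?r n) z * f (v t x s z) + cuterr t x (?r n) s z / (2 * (s - t)))
            \<le> (K + ?K2) * ?e (\<kappa> + 1) z" for z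
          unfolding real_norm_def using that by (rule bnd)
        show "0 \<le> (K + ?K2) * ?e (\<kappa> + 1) z" for z
          by (rule order_trans[OF abs_ge_zero bnd[OF that]])
      qed
      then show "norm (indicator {a..b} s * J n s) \<le> indicator {a..b} s * ((K + ?K2) * (\<integral>z. ?e (\<kappa> + 1) z \<partial>std_gauss d))"
        by (auto split: split_indicator)
    qed
    have Jm: "(\<lambda>p. - cutprod {1..d} (?r n) (snd p) * f (v t x (fst p) (snd p)) + cuterr t x (?r n) (fst p) (snd p) / (2 * (fst p - t)))
        \<in> borel_measurable (borel \<Otimes>\<^sub>M borel_Rd d)" for n
    proof (intro borel_measurable_add borel_measurable_times borel_measurable_divide borel_measurable_uminus)
      show "(\<lambda>p::real \<times> (nat \<Rightarrow> real). cutprod {1..d} (?r n) (snd p)) \<in> borel_measurable (borel \<Otimes>\<^sub>M borel_Rd d)"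
        by (rule measurable_cut) simp
      show "(\<lambda>p. cuterr t x (?r n) (fst p) (snd p)) \<in> borel_measurable (borel \<Otimes>\<^sub>M borel_Rd d)"
        by (rule measurable_cuterr[OF t(1) tT]) simp
    qed (use me in measurable)
    have "(\<lambda>s. J n s) \<in> borel_measurable borel" for n
      unfolding J_def using Jm[of n] by (rule measurable_inner_integral)
    then show "(\<lambda>s. indicator {a..b} s * J n s) \<in> borel_measurable lborel" for n by simp
    have "(\<lambda>s. \<integral>z. f (v t x s z) \<partial>std_gauss d) \<in> borel_measurable borel"
      using me(4) by (rule measurable_inner_integral)
    then show "(\<lambda>s. indicator {a..b} s * (- (\<integral>z. f (v t x s z) \<partial>std_gauss d))) \<in> borel_measurable lborel" by simp
  qed
  have "(\<integral>z. v t x b z - v t x a z \<partial>std_gauss d) = (\<integral>s. indicator {a..b} s * (- (\<integral>z. f (v t x s z) \<partial>std_gauss d)) \<partial>lborel)"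
    using LIMSEQ_unique[OF L] R unfolding J_def using integral_cutprod_increment[OF t _ x] by simp
  then show ?thesis by simp
qed

theorem feynman_kac:
  assumes t: "0 \<le> t" "t \<le> T" and x: "x \<in> Rd d"
  shows "u t x = (\<integral>z. u T (gbm \<alpha> \<beta> d x (T - t) z) \<partial>std_gauss d) +
    (\<integral>s. indicator {t..T} s * (\<integral>z. f (u s (gbm \<alpha> \<beta> d x (s - t) z)) \<partial>std_gauss d) \<partial>lborel)"
proof (cases "t = T")
  interpret G: prob_space "std_gauss d" by (rule prob_space_std_gauss)
  have gbm0: "gbm \<alpha> \<beta> d x 0 z = x" for z
    using x by (auto simp: gbm_def Rd_def PiE_iff extensional_def fun_eq_iff)
  {
    case True
    have "AE s in lborel. indicator {t..T} s * (\<integral>z. f (u s (gbm \<alpha> \<beta> d x (s - t) z)) \<partial>std_gauss d) = 0"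
      using AE_lborel_singleton[of T] by eventually_elim (use True in \<open>auto split: split_indicator\<close>)
    then have "(\<integral>s. indicator {t..T} s * (\<integral>z. f (u s (gbm \<alpha> \<beta> d x (s - t) z)) \<partial>std_gauss d) \<partial>lborel) = 0"
      by (rule integral_eq_zero_AE)
    then show ?thesis using True by (simp add: gbm0 G.prob_space)
  next
    case False
    then have tT: "t < T" using t by simp
    obtain K \<kappa> where K: "K \<ge> 0" "\<kappa> \<ge> 0"
      "\<And>s z. \<bar>v t x s z\<bar> \<le> K * exp (\<kappa> * (\<Sum>i=1..d. \<bar>z i\<bar>))"
      "\<And>s z. \<bar>f (v t x s z)\<bar> \<le> K * exp (\<kappa> * (\<Sum>i=1..d. \<bar>z i\<bar>))"
      using growth_exp[of t x] t by metis
    let ?e = "\<lambda>k z. exp (k * (\<Sum>i=1..d. \<bar>z i\<bar>))"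
    note me = measurable_vDE[OF t, where x = x]
    have mv: "v t x s \<in> borel_measurable (std_gauss d)" "(\<lambda>z. f (v t x s z)) \<in> borel_measurable (std_gauss d)" for s
      using measurable_section[of "v t x" s] measurable_section[of "\<lambda>s z. f (v t x s z)" s] me(1,4) by auto
    define H where "H s = (\<integral>z. f (v t x s z) \<partial>std_gauss d)" for s
    have Hm: "H \<in> borel_measurable borel"
      using measurable_inner_integral[of "\<lambda>s z. f (v t x s z)"] me(4) by (simp add: H_def[abs_def])
    have Hb: "norm (H s) \<le> (\<integral>z. K * ?e \<kappa> z \<partial>std_gauss d)" for s
      unfolding H_def
      by (rule order_trans[OF integral_norm_bound integral_mono'])
        (use K(1,4) in \<open>auto intro!: integrable_mult_right integrable_std_gauss_exp\<close>)
    \<comment> \<open>Both ends are moved inwards, away from the singularity of \<open>dsv\<close>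
      at t and from T. The factor 1 / 2 keeps t + \<delta> n at most T - \<delta> n.\<close>
    define \<delta> where "\<delta> n = (T - t) / 2 * inverse (real (Suc n))" for n
    have \<delta>: "0 < \<delta> n" "\<delta> n \<le> (T - t) / 2" for n
    proof -
      show "0 < \<delta> n" using tT by (simp add: \<delta>_def)
      have "inverse (real (Suc n)) \<le> 1" by (simp add: field_simps)
      then show "\<delta> n \<le> (T - t) / 2" using tT unfolding \<delta>_def by (intro mult_left_le) auto
    qed
    have \<delta>lim: "\<delta> \<longlonglongrightarrow> 0"
      unfolding \<delta>_def using tendsto_mult_right_zero[OF LIMSEQ_inverse_real_of_nat] by simp
    have vlim: "(\<lambda>n. \<integral>z. v t x (s n) z \<partial>std_gauss d) \<longlonglongrightarrow> (\<integral>z. v t x s0 z \<partial>std_gauss d)" if s: "s \<longlonglongrightarrow> s0" for s s0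
    proof (rule integral_dominated_convergence[where w = "\<lambda>z. K * ?e \<kappa> z"])
      show "AE z in std_gauss d. (\<lambda>n. v t x (s n) z) \<longlonglongrightarrow> v t x s0 z"
      proof (rule AE_I2)
        fix z
        have "continuous_on UNIV (\<lambda>s. v t x s z)"
        proof -
          have "continuous_on UNIV (\<lambda>s. (s, z))" by (intro continuous_on_Pair continuous_on_id continuous_on_const)
          from continuous_on_compose2[OF continuous_vDE(1)[OF t, of x] this] show ?thesis by simp
        qed
        then show "(\<lambda>n. v t x (s n) z) \<longlonglongrightarrow> v t x s0 z"
          using s by (auto simp: continuous_on_eq_continuous_within intro: continuous_within_tendsto_compose' isCont_tendsto_compose)
      qed
    qed (use K mv in \<open>auto intro!: integrable_mult_right integrable_std_gauss_exp\<close>)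
    have vint: "integrable (std_gauss d) (v t x s)" for s
      by (rule Bochner_Integration.integrable_bound[of _ "\<lambda>z. K * ?e \<kappa> z"])
        (use K mv in \<open>auto intro!: integrable_mult_right integrable_std_gauss_exp AE_I2 intro: order_trans[OF _ abs_ge_self]\<close>)
    \<comment> \<open>The limit carries the open interval, because t and T belong to none of the
      shrunken intervals; the closed interval differs from it by a null set.\<close>
    have Rlim: "(\<lambda>n. \<integral>s. indicator {t + \<delta> n..T - \<delta> n} s * H s \<partial>lborel) \<longlonglongrightarrow> (\<integral>s. indicator {t<..<T} s * H s \<partial>lborel)"
    proof (rule integral_dominated_convergence[where w = "\<lambda>s. indicator {t..T} s * (\<integral>z. K * ?e \<kappa> z \<partial>std_gauss d)"])
      show "integrable lborel (\<lambda>s. indicator {t..T} s * (\<integral>z. K * ?e \<kappa> z \<partial>std_gauss d))"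
        by (intro integrable_mult_left integrable_real_indicator) (use tT in auto)
      show "AE s in lborel. norm (indicator {t + \<delta> n..T - \<delta> n} s * H s) \<le> indicator {t..T} s * (\<integral>z. K * ?e \<kappa> z \<partial>std_gauss d)" for n
        using Hb \<delta>[of n] by (intro AE_I2) (auto split: split_indicator intro: order_trans[OF abs_ge_zero])
      show "AE s in lborel. (\<lambda>n. indicator {t + \<delta> n..T - \<delta> n} s * H s) \<longlonglongrightarrow> indicator {t<..<T} s * H s"
      proof (rule AE_I2)
        fix s
        show "(\<lambda>n. indicator {t + \<delta> n..T - \<delta> n} s * H s) \<longlonglongrightarrow> indicator {t<..<T} s * H s"
        proof (cases "s \<in> {t<..<T}")
          case True
          then have "min (s - t) (T - s) > 0" by auto
          then have "\<forall>\<^sub>F n in sequentially. \<delta> n < min (s - t) (T - s)"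
            using \<delta>lim by (rule order_tendstoD(2)[rotated])
          then have "\<forall>\<^sub>F n in sequentially. indicator {t + \<delta> n..T - \<delta> n} s * H s = H s"
            by eventually_elim auto
          then show ?thesis using True by (simp add: tendsto_eventually)
        next
          case False
          then have "indicator {t + \<delta> n..T - \<delta> n} s = (0::real)" for n using \<delta>[of n] by (auto split: split_indicator)
          then show ?thesis using False by simp
        qed
      qed
    qed (use Hm in auto)
    have eq: "(\<integral>z. v t x (T - \<delta> n) z \<partial>std_gauss d) - (\<integral>z. v t x (t + \<delta> n) z \<partial>std_gauss d) =
        - (\<integral>s. indicator {t + \<delta> n..T - \<delta> n} s * H s \<partial>lborel)" for n
    proof -
      have "t < t + \<delta> n" "t + \<delta> n \<le> T - \<delta> n" "T - \<delta> n < T" using \<delta>[of n] by (auto simp: field_simps)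
      from integral_increment[OF t(1) this x] show ?thesis
        by (simp add: Bochner_Integration.integral_diff[OF vint vint] H_def)
    qed
    have "(\<lambda>n. T - \<delta> n) \<longlonglongrightarrow> T" "(\<lambda>n. t + \<delta> n) \<longlonglongrightarrow> t"
      using tendsto_diff[OF tendsto_const[of T] \<delta>lim] tendsto_add[OF tendsto_const[of t] \<delta>lim] by auto
    then have "(\<lambda>n. (\<integral>z. v t x (T - \<delta> n) z \<partial>std_gauss d) - (\<integral>z. v t x (t + \<delta> n) z \<partial>std_gauss d)) \<longlonglongrightarrow>
        (\<integral>z. v t x T z \<partial>std_gauss d) - (\<integral>z. v t x t z \<partial>std_gauss d)"
      by (intro tendsto_diff vlim)
    then have "(\<integral>z. v t x T z \<partial>std_gauss d) - (\<integral>z. v t x t z \<partial>std_gauss d) = - (\<integral>s. indicator {t<..<T} s * H s \<partial>lborel)"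
      unfolding eq using LIMSEQ_unique tendsto_minus[OF Rlim] by blast
    moreover have "(\<integral>z. v t x t z \<partial>std_gauss d) = u t x"
      using clampT(2)[OF t(2), of t] t by (simp add: v_def gbm0 G.prob_space)
    moreover have "(\<integral>z. v t x T z \<partial>std_gauss d) = (\<integral>z. u T (gbm \<alpha> \<beta> d x (T - t) z) \<partial>std_gauss d)"
      using clampT(2)[OF t(2), of T] t by (simp add: v_def)
    moreover have "(\<integral>s. indicator {t<..<T} s * H s \<partial>lborel) = (\<integral>s. indicator {t..T} s * (\<integral>z. f (u s (gbm \<alpha> \<beta> d x (s - t) z)) \<partial>std_gauss d) \<partial>lborel)"
    proof (rule integral_cong_AE)
      have i: "indicator {t..T} s * (\<integral>z. f (u s (gbm \<alpha> \<beta> d x (s - t) z)) \<partial>std_gauss d) = indicator {t..T} s * H s" for s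
        using clampT(2)[OF t(2), of s] by (auto simp: H_def v_def split: split_indicator)
      show "(\<lambda>s. indicator {t..T} s * (\<integral>z. f (u s (gbm \<alpha> \<beta> d x (s - t) z)) \<partial>std_gauss d)) \<in> borel_measurable lborel"
        unfolding i using Hm by simp
      show "AE s in lborel. indicator {t<..<T} s * H s = indicator {t..T} s * (\<integral>z. f (u s (gbm \<alpha> \<beta> d x (s - t) z)) \<partial>std_gauss d)"
        unfolding i using AE_lborel_singleton[of T] AE_lborel_singleton[of t]
        by eventually_elim (auto split: split_indicator)
    qed (use Hm in simp)
    ultimately show ?thesis by linarith
  }
qed

end

section \<open>Moments of geometric Brownian motion\<close>

lemma nn_integral_std_gauss_coord:
  assumes "i \<in> {1..d}" "h \<in> borel_measurable borel"
  shows "(\<integral>\<^sup>+z. h (z i) \<partial>std_gauss d) = (\<integral>\<^sup>+y. h y \<partial>std_normal)"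
proof -
  have "std_normal = distr (std_gauss d) std_normal (\<lambda>z. z i)"
    unfolding std_gauss_def using distr_PiM_component[of "{1..d}" "\<lambda>_. std_normal" i] assms(1) prob_space_std_normal
    by simp
  then have "(\<integral>\<^sup>+y. h y \<partial>std_normal) = (\<integral>\<^sup>+y. h y \<partial>distr (std_gauss d) std_normal (\<lambda>z. z i))"
    by simp
  also have "\<dots> = (\<integral>\<^sup>+z. h (z i) \<partial>std_gauss d)"
    using assms by (intro nn_integral_distr)
      (auto simp: std_gauss_def intro!: measurable_component_singleton)
  finally show ?thesis ..
qed

lemma convex_power_nonneg: "convex_on {0..} (\<lambda>x::real. x ^ n)"
  by (cases "even n") (auto intro: convex_power_odd convex_on_subset[OF convex_power_even])

text \<open>Trades the real exponent r for an integer power of y^2, to which Jensen's inequality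
  applies.\<close>

lemma rpow_le_one_plus_power:
  assumes "0 \<le> y" "0 \<le> r" "r \<le> 2 * real m"
  shows "rpow y r \<le> 1 + (y^2)^m"
proof (cases "y \<le> 1")
  case True
  then have "rpow y r \<le> rpow 1 r" using assms by (intro rpow_mono) auto
  also have "\<dots> = 1" by (simp add: rpow_def)
  finally show ?thesis by (simp add: add_increasing2)
next
  case False
  have "rpow y r \<le> y powr (2 * real m)"
    using False assms by (cases "r = 0") (auto simp: rpow_def ge_one_powr_ge_zero intro!: powr_mono)
  also have "\<dots> = y ^ (2 * m)"
    using False by (subst powr_realpow[symmetric]) auto
  finally show ?thesis by (simp add: power_mult)
qed

text \<open>
  The bound is uniform in the dimension: with the weights \<open>x\<^sub>i\<^sup>2 / \<parallel>x\<parallel>\<^sup>2\<close>, convexity reduces the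
  moments of the norm to those of a single lognormal coordinate.
\<close>

lemma gbm_weight_moment:
  assumes T: "T > 0" and r: "r \<ge> 0"
  obtains K where "K \<ge> 1" "\<And>d \<tau> x. 0 \<le> \<tau> \<Longrightarrow> \<tau> \<le> T \<Longrightarrow>
     (\<integral>\<^sup>+z. ennreal (1 + rpow (norm_Rd d (gbm \<alpha> \<beta> d x \<tau> z)) r) \<partial>std_gauss d)
      \<le> ennreal (K * (1 + rpow (norm_Rd d x) r))"
proof -
  obtain k where "r \<le> real k" using real_arch_simple by blast
  define m where "m = Suc k"
  have m: "r \<le> 2 * real m" unfolding m_def using r \<open>r \<le> real k\<close> by simp
  define \<kappa> where "\<kappa> = 2 * real m * (\<bar>\<beta>\<bar> * sqrt T)"
  define K1 where "K1 = exp (2 * real m * (\<bar>\<alpha> - \<beta>^2/2\<bar> * T))"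
  define K0 where "K0 = K1 * (\<integral>y. exp (\<kappa> * \<bar>y\<bar>) \<partial>std_normal)"
  have K0: "K0 \<ge> 0" unfolding K0_def K1_def by (intro mult_nonneg_nonneg integral_nonneg_AE) auto
  have main: "(\<integral>\<^sup>+z. ennreal (1 + rpow (norm_Rd d (gbm \<alpha> \<beta> d x \<tau> z)) r) \<partial>std_gauss d)
      \<le> ennreal ((2 + K0) * (1 + rpow (norm_Rd d x) r))" if \<tau>: "0 \<le> \<tau>" "\<tau> \<le> T" for d \<tau> x
  proof -
    interpret G: prob_space "std_gauss d" by (rule prob_space_std_gauss)
    define N where "N = norm_Rd d x"
    define e where "e y = exp ((\<alpha> - \<beta>^2 / 2) * \<tau> + \<beta> * sqrt \<tau> * y)" for y
    define w where "w i = (x i)^2 / N^2" for i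
    have N0: "N \<ge> 0" by (simp add: N_def norm_Rd_nonneg)
    have N2: "N^2 = (\<Sum>i=1..d. (x i)^2)" by (simp add: N_def norm_Rd_def L2_set_def sum_nonneg)
    have eb: "e y ^ (2 * m) \<le> K1 * exp (\<kappa> * \<bar>y\<bar>)" for y
    proof -
      have "(\<alpha> - \<beta>^2 / 2) * \<tau> \<le> \<bar>\<alpha> - \<beta>^2/2\<bar> * T"
        using \<tau> by (meson abs_ge_self abs_ge_zero mult_mono order_trans mult_right_mono)
      moreover have "\<beta> * sqrt \<tau> * y \<le> \<bar>\<beta>\<bar> * sqrt T * \<bar>y\<bar>"
      proof -
        have "\<beta> * sqrt \<tau> * y \<le> \<bar>\<beta>\<bar> * sqrt \<tau> * \<bar>y\<bar>"
          using \<tau> by (metis abs_ge_self abs_mult abs_of_nonneg real_sqrt_ge_zero)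
        also have "\<dots> \<le> \<bar>\<beta>\<bar> * sqrt T * \<bar>y\<bar>" using \<tau> by (intro mult_right_mono mult_left_mono) auto
        finally show ?thesis .
      qed
      ultimately have "(\<alpha> - \<beta>^2 / 2) * \<tau> + \<beta> * sqrt \<tau> * y \<le> \<bar>\<alpha> - \<beta>^2/2\<bar> * T + \<bar>\<beta>\<bar> * sqrt T * \<bar>y\<bar>"
        by linarith
      then have "real (2 * m) * ((\<alpha> - \<beta>^2 / 2) * \<tau> + \<beta> * sqrt \<tau> * y) \<le> real (2 * m) * (\<bar>\<alpha> - \<beta>^2/2\<bar> * T + \<bar>\<beta>\<bar> * sqrt T * \<bar>y\<bar>)"
        by (rule mult_left_mono) simp
      then have "exp (real (2 * m) * ((\<alpha> - \<beta>^2 / 2) * \<tau> + \<beta> * sqrt \<tau> * y)) \<le> K1 * exp (\<kappa> * \<bar>y\<bar>)"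
        unfolding K1_def \<kappa>_def exp_add[symmetric] by (subst exp_le_cancel_iff) (simp add: algebra_simps)
      then show ?thesis unfolding e_def by (simp only: exp_of_nat_mult)
    qed
    have int_e: "(\<integral>\<^sup>+z. ennreal (e (z i) ^ (2 * m)) \<partial>std_gauss d) \<le> ennreal K0" if "i \<in> {1..d}" for i
    proof -
      have "(\<integral>\<^sup>+z. ennreal (e (z i) ^ (2 * m)) \<partial>std_gauss d) = (\<integral>\<^sup>+y. ennreal (e y ^ (2 * m)) \<partial>std_normal)"
        using that by (intro nn_integral_std_gauss_coord) (auto simp: e_def)
      also have "\<dots> \<le> (\<integral>\<^sup>+y. ennreal (K1 * exp (\<kappa> * \<bar>y\<bar>)) \<partial>std_normal)"
        by (intro nn_integral_mono ennreal_leI eb)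
      also have "\<dots> = ennreal (\<integral>y. K1 * exp (\<kappa> * \<bar>y\<bar>) \<partial>std_normal)"
        by (intro nn_integral_eq_integral integrable_mult_right integrable_std_normal_exp_abs) (auto simp: K1_def)
      finally show ?thesis by (simp add: K0_def)
    qed
    have ptw: "1 + rpow (norm_Rd d (gbm \<alpha> \<beta> d x \<tau> z)) r \<le>
        1 + rpow N r + (\<Sum>i=1..d. rpow N r * w i * e (z i) ^ (2 * m))" for z
    \<comment> \<open>For N = 0 the weights are 0 by the convention for division by zero, and both
      norms vanish.\<close>
    proof (cases "N = 0")
      case True
      then have x0: "x i = 0" if "i \<in> {1..d}" for i
        using N2 that by (simp add: sum_nonneg_eq_0_iff)
      have "norm_Rd d (gbm \<alpha> \<beta> d x \<tau> z) = N"
        unfolding N_def norm_Rd_def by (intro L2_set_cong refl) (use x0 in \<open>auto simp: gbm_def\<close>)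
      then show ?thesis using True by (auto simp: w_def)
    next
      case False
      then have N: "N > 0" using N0 by simp
      define y where "y = norm_Rd d (gbm \<alpha> \<beta> d x \<tau> z) / N"
      have y0: "y \<ge> 0" using N by (simp add: y_def norm_Rd_nonneg)
      have y2: "y^2 = (\<Sum>i=1..d. w i *\<^sub>R (e (z i))^2)"
        by (simp add: y_def norm_Rd_def L2_set_def power_divide sum_nonneg w_def sum_divide_distrib gbm_def e_def power_mult_distrib)
      have w1: "(\<Sum>i=1..d. w i) = 1" unfolding w_def sum_divide_distrib[symmetric] N2[symmetric] using N by simp
      then have ne: "{1..d} \<noteq> {}" by (metis sum.empty zero_neq_one)
      have "(y^2)^m \<le> (\<Sum>i=1..d. w i * ((e (z i))^2)^m)"
        unfolding y2 by (rule convex_on_sum[OF _ ne convex_power_nonneg w1]) (auto simp: w_def)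
      then have "rpow y r \<le> 1 + (\<Sum>i=1..d. w i * e (z i) ^ (2 * m))"
        using rpow_le_one_plus_power[OF y0 r m] by (simp add: power_mult)
      then have "rpow N r * rpow y r \<le> rpow N r * (1 + (\<Sum>i=1..d. w i * e (z i) ^ (2 * m)))"
        by (rule mult_left_mono) (rule rpow_nonneg)
      moreover have "rpow N r * rpow y r = rpow (norm_Rd d (gbm \<alpha> \<beta> d x \<tau> z)) r"
        using N y0 by (subst rpow_mult[symmetric]) (auto simp: y_def)
      ultimately show ?thesis by (simp add: algebra_simps sum_distrib_left)
    qed
    have w0: "0 \<le> w i" for i by (simp add: w_def)
    have e0: "0 \<le> e y" for y by (simp add: e_def)
    have coord: "(\<lambda>z. z i) \<in> borel_measurable (std_gauss d)" if "i \<in> {1..d}" for i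
      using that by (simp cong: measurable_cong_sets add: sets_std_gauss)
    have em: "(\<lambda>z. e (z i)) \<in> borel_measurable (std_gauss d)" if "i \<in> {1..d}" for i
      unfolding e_def by (intro borel_measurable_exp[THEN measurable_compose[rotated]] borel_measurable_add
          borel_measurable_times coord that borel_measurable_const) 
    have "(\<integral>\<^sup>+z. ennreal (1 + rpow (norm_Rd d (gbm \<alpha> \<beta> d x \<tau> z)) r) \<partial>std_gauss d)
      \<le> (\<integral>\<^sup>+z. ennreal (1 + rpow N r) + (\<Sum>i=1..d. ennreal (rpow N r * w i) * ennreal (e (z i) ^ (2 * m))) \<partial>std_gauss d)"
    proof (rule nn_integral_mono)
      fix z
      have "ennreal (1 + rpow (norm_Rd d (gbm \<alpha> \<beta> d x \<tau> z)) r) \<le> ennreal (1 + rpow N r + (\<Sum>i=1..d. rpow N r * w i * e (z i) ^ (2 * m)))"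
        by (intro ennreal_leI ptw)
      also have "\<dots> = ennreal (1 + rpow N r) + (\<Sum>i=1..d. ennreal (rpow N r * w i) * ennreal (e (z i) ^ (2 * m)))"
        using w0 e0 rpow_nonneg[of N r]
        by (subst ennreal_plus) (auto intro!: sum_nonneg mult_nonneg_nonneg add_nonneg_nonneg simp: sum_ennreal[symmetric] ennreal_mult simp del: sum_ennreal)
      finally show "ennreal (1 + rpow (norm_Rd d (gbm \<alpha> \<beta> d x \<tau> z)) r) \<le> ennreal (1 + rpow N r) + (\<Sum>i=1..d. ennreal (rpow N r * w i) * ennreal (e (z i) ^ (2 * m)))" .
    qed
    also have "\<dots> = ennreal (1 + rpow N r) + (\<Sum>i=1..d. ennreal (rpow N r * w i) * (\<integral>\<^sup>+z. ennreal (e (z i) ^ (2 * m)) \<partial>std_gauss d))"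
    proof -
      have em': "(\<lambda>z. ennreal (e (z i) ^ (2 * m))) \<in> borel_measurable (std_gauss d)" if "i \<in> {1..d}" for i
        by (intro measurable_compose[OF _ measurable_ennreal] borel_measurable_power em that)
      have "(\<integral>\<^sup>+z. ennreal (1 + rpow N r) + (\<Sum>i=1..d. ennreal (rpow N r * w i) * ennreal (e (z i) ^ (2 * m))) \<partial>std_gauss d)
        = (\<integral>\<^sup>+z. ennreal (1 + rpow N r) \<partial>std_gauss d) + (\<integral>\<^sup>+z. (\<Sum>i=1..d. ennreal (rpow N r * w i) * ennreal (e (z i) ^ (2 * m))) \<partial>std_gauss d)"
        by (intro nn_integral_add borel_measurable_sum borel_measurable_times_ennreal em' borel_measurable_const) auto
      also have "(\<integral>\<^sup>+z. (\<Sum>i=1..d. ennreal (rpow N r * w i) * ennreal (e (z i) ^ (2 * m))) \<partial>std_gauss d)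
        = (\<Sum>i=1..d. (\<integral>\<^sup>+z. ennreal (rpow N r * w i) * ennreal (e (z i) ^ (2 * m)) \<partial>std_gauss d))"
        by (rule nn_integral_sum) (rule borel_measurable_times_ennreal[OF borel_measurable_const em'])
      also have "\<dots> = (\<Sum>i=1..d. ennreal (rpow N r * w i) * (\<integral>\<^sup>+z. ennreal (e (z i) ^ (2 * m)) \<partial>std_gauss d))"
        by (intro sum.cong refl nn_integral_cmult em')
      finally show ?thesis by (simp add: G.emeasure_space_1)
    qed
    also have "\<dots> \<le> ennreal (1 + rpow N r) + (\<Sum>i=1..d. ennreal (rpow N r * w i) * ennreal K0)"
      by (intro add_left_mono sum_mono mult_left_mono int_e) auto
    also have "\<dots> = ennreal (1 + rpow N r + (\<Sum>i=1..d. rpow N r * w i * K0))"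
      using w0 K0 rpow_nonneg[of N r]
      by (subst ennreal_plus) (auto intro!: sum_nonneg mult_nonneg_nonneg add_nonneg_nonneg simp: sum_ennreal[symmetric] ennreal_mult simp del: sum_ennreal)
    \<comment> \<open>The weights sum to 1, or to 0 if N = 0, and with them the dimension disappears
      from the bound.\<close>
    also have "\<dots> \<le> ennreal ((2 + K0) * (1 + rpow N r))"
    proof (rule ennreal_leI)
      have "(\<Sum>i=1..d. w i) \<le> 1"
        unfolding w_def sum_divide_distrib[symmetric] N2[symmetric] by (cases "N = 0") auto
      then have "rpow N r * K0 * (\<Sum>i=1..d. w i) \<le> rpow N r * K0 * 1"
        using K0 rpow_nonneg[of N r] by (intro mult_left_mono) auto
      then have "(\<Sum>i=1..d. rpow N r * w i * K0) \<le> rpow N r * K0"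
        by (simp add: sum_distrib_left ac_simps)
      then show "1 + rpow N r + (\<Sum>i=1..d. rpow N r * w i * K0) \<le> (2 + K0) * (1 + rpow N r)"
        using K0 rpow_nonneg[of N r] by (simp add: algebra_simps)
    qed
    finally show ?thesis by (simp add: N_def)
  qed
  show ?thesis by (rule that[of "2 + K0"]) (use K0 main in auto)
qed

section \<open>Brownian paths as random elements\<close>

text \<open>The largest multiple of T / (n + 1) that does not exceed s. For fixed n it takes
  countably many values, which is what makes evaluation at a random time measurable, and on [0, T]
  it does not leave the interval on which paths are given.\<close>

definition grid :: "real \<Rightarrow> nat \<Rightarrow> real \<Rightarrow> real" where
  "grid T n s = T * real_of_int \<lfloor>real (Suc n) * s / T\<rfloor> / real (Suc n)"

text \<open>
  Evaluation of a path at a time that may itself be random. The product \<open>\<sigma>\<close>-algebra on path space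
  does not make \<open>(s, w) \<mapsto> w s\<close> measurable; the limit along grids is measurable, and it agrees with
  evaluation on continuous paths.
\<close>

definition path_at :: "real \<Rightarrow> nat \<Rightarrow> real \<Rightarrow> (real \<Rightarrow> nat \<Rightarrow> real) \<Rightarrow> nat \<Rightarrow> real" where
  "path_at T d s w = (\<lambda>i\<in>{1..d}. lim (\<lambda>n. w (grid T n s) i))"

lemma grid_bounds: "0 < T \<Longrightarrow> s \<in> {0..T} \<Longrightarrow> grid T n s \<in> {0..T}"
proof -
  assume T: "0 < T" and s: "s \<in> {0..T}"
  have "real_of_int \<lfloor>real (Suc n) * s / T\<rfloor> \<le> real (Suc n) * s / T" by linarith
  also have "\<dots> = real (Suc n) * (s / T)" by simp
  also have "\<dots> \<le> real (Suc n) * 1" using T s by (intro mult_left_mono) auto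
  finally have "T * real_of_int \<lfloor>real (Suc n) * s / T\<rfloor> \<le> T * real (Suc n)" using T by simp
  moreover have "0 \<le> \<lfloor>real (Suc n) * s / T\<rfloor>" using T s by simp
  ultimately show "grid T n s \<in> {0..T}" using T by (simp add: grid_def field_simps del: of_nat_Suc)
qed

lemma grid_tendsto:
  assumes T: "0 < T"
  shows "(\<lambda>n. grid T n s) \<longlonglongrightarrow> s"
proof (rule LIMSEQ_I)
  have *: "\<bar>grid T n s - s\<bar> \<le> T * inverse (real (Suc n))" for n
  proof -
    define k where "k = real (Suc n)"
    have k: "k > 0" by (simp add: k_def)
    define q where "q = k * s / T"
    have q: "q - 1 \<le> real_of_int \<lfloor>q\<rfloor>" "real_of_int \<lfloor>q\<rfloor> \<le> q" by linarith+
    have "grid T n s - s = T * (real_of_int \<lfloor>q\<rfloor> - q) / k"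
      using T k by (simp add: grid_def k_def[symmetric] q_def field_simps del: of_nat_Suc)
    moreover have "\<bar>T * (real_of_int \<lfloor>q\<rfloor> - q) / k\<bar> \<le> T * 1 / k"
    proof -
      have "\<bar>real_of_int \<lfloor>q\<rfloor> - q\<bar> \<le> 1" using q by linarith
      then have "T * \<bar>real_of_int \<lfloor>q\<rfloor> - q\<bar> / k \<le> T * 1 / k"
        using T k by (intro divide_right_mono mult_left_mono) auto
      then show ?thesis using T k by (simp add: abs_mult abs_divide)
    qed
    ultimately show ?thesis by (simp add: k_def divide_inverse)
  qed
  have "(\<lambda>n. T * inverse (real (Suc n))) \<longlonglongrightarrow> T * 0"
    by (intro tendsto_mult tendsto_const LIMSEQ_inverse_real_of_nat)
  then show "\<exists>no. \<forall>n\<ge>no. norm (grid T n s - s) < r" if "r > 0" for r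
  proof -
    have "\<forall>\<^sub>F n in sequentially. T * inverse (real (Suc n)) < r"
      using \<open>(\<lambda>n. T * inverse (real (Suc n))) \<longlonglongrightarrow> T * 0\<close> that by (intro order_tendstoD(2)) auto
    then show ?thesis using * unfolding eventually_sequentially real_norm_def by (meson order_le_less_trans)
  qed
qed

lemma measurable_path_coord:
  assumes "i \<in> {1..d}"
  shows "(\<lambda>w. w \<tau> i) \<in> borel_measurable (path_space T d)"
proof (cases "\<tau> \<in> {0..T}")
  case True
  then have "(\<lambda>w. w \<tau>) \<in> measurable (path_space T d) (borel_Rd d)"
    by (rule measurable_component_singleton)
  from measurable_compose[OF this measurable_component_singleton[OF assms]] show ?thesis .
next
  case False
  then have "(\<lambda>w. w \<tau> i) \<in> borel_measurable (path_space T d) \<longleftrightarrow>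
      (\<lambda>w. (undefined :: nat \<Rightarrow> real) i) \<in> borel_measurable (path_space T d)"
    by (intro measurable_cong) (auto simp: space_PiM PiE_iff extensional_def)
  then show ?thesis by simp
qed

lemma measurable_path_at:
  "(\<lambda>p. path_at T d (fst p) (snd p)) \<in> measurable (borel \<Otimes>\<^sub>M path_space T d) (borel_Rd d)"
  unfolding path_at_def
proof (rule measurable_restrict)
  fix i assume i: "i \<in> {1..d}"
  show "(\<lambda>p. lim (\<lambda>n. snd p (grid T n (fst p)) i)) \<in> borel_measurable (borel \<Otimes>\<^sub>M path_space T d)"
  proof (rule borel_measurable_lim_metric)
    fix n
    \<comment> \<open>For each of the countably many values k of the floor, the evaluation is a
      fixed coordinate of the path; these pieces are glued along the measurable index.\<close>
    have "(\<lambda>p. (\<lambda>k p. snd p (T * real_of_int k / real (Suc n)) i) \<lfloor>real (Suc n) * fst p / T\<rfloor> p)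
        \<in> borel_measurable (borel \<Otimes>\<^sub>M path_space T d)"
    proof (rule measurable_compose_countable[where f = "\<lambda>k p. snd p (T * real_of_int k / real (Suc n)) i"
          and g = "\<lambda>p. \<lfloor>real (Suc n) * fst p / T\<rfloor>"])
      show "(\<lambda>p::real \<times> _. snd p (T * real_of_int k / real (Suc n)) i) \<in> borel_measurable (borel \<Otimes>\<^sub>M path_space T d)" for k
        by (rule measurable_compose[OF measurable_snd measurable_path_coord[OF i]])
      have "(\<lambda>s. \<lfloor>real (Suc n) * s / T\<rfloor>) \<in> measurable borel (count_space UNIV)"
        by measurable
      from measurable_compose[OF measurable_fst this]
      show "(\<lambda>p. \<lfloor>real (Suc n) * fst p / T\<rfloor>) \<in> measurable (borel \<Otimes>\<^sub>M path_space T d) (count_space UNIV)" .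
    qed
    then show "(\<lambda>p. snd p (grid T n (fst p)) i) \<in> borel_measurable (borel \<Otimes>\<^sub>M path_space T d)"
      by (simp add: grid_def)
  qed
qed

lemma path_at_continuous:
  assumes T: "T > 0" and s: "s \<in> {0..T}" and w: "w s \<in> Rd d"
    and c: "\<And>i. i \<in> {1..d} \<Longrightarrow> continuous_on {0..T} (\<lambda>t. w t i)"
  shows "path_at T d s (\<lambda>t\<in>{0..T}. w t) = w s"
proof
  fix i
  show "path_at T d s (\<lambda>t\<in>{0..T}. w t) i = w s i"
  proof (cases "i \<in> {1..d}")
    case True
    have "(\<lambda>n. w (grid T n s) i) \<longlonglongrightarrow> w s i"
      using continuous_on_tendsto_compose[OF c[OF True] grid_tendsto[OF T] s] grid_bounds[OF T s] by simp
    then show ?thesis using True grid_bounds[OF T s] by (simp add: path_at_def limI)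
  next
    case False
    then show ?thesis using w by (auto simp: path_at_def Rd_def PiE_iff extensional_def)
  qed
qed

definition brownian_gbm where
  "brownian_gbm \<alpha> \<beta> T d t s x w = (\<lambda>i\<in>{1..d}.
     x i * exp ((\<alpha> - \<beta>^2 / 2) * (s - t) + \<beta> * (path_at T d s w i - path_at T d t w i)))"

lemma measurable_brownian_gbm:
  assumes [measurable]: "h1 \<in> borel_measurable M" "h2 \<in> borel_measurable M"
    "h3 \<in> measurable M (borel_Rd d)" "h4 \<in> measurable M (path_space T d)"
  shows "(\<lambda>y. brownian_gbm \<alpha> \<beta> T d (h1 y) (h2 y) (h3 y) (h4 y)) \<in> measurable M (borel_Rd d)"
  unfolding brownian_gbm_def
proof (rule measurable_restrict)
  fix i assume i: "i \<in> {1..d}"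
  note pa = measurable_compose[OF _ measurable_component_singleton[OF i]]
  have [measurable]: "(\<lambda>y. path_at T d (h1 y) (h4 y) i) \<in> borel_measurable M"
    using pa[OF measurable_compose[OF measurable_Pair[OF assms(1,4)] measurable_path_at]] by simp
  have [measurable]: "(\<lambda>y. path_at T d (h2 y) (h4 y) i) \<in> borel_measurable M"
    using pa[OF measurable_compose[OF measurable_Pair[OF assms(2,4)] measurable_path_at]] by simp
  have [measurable]: "(\<lambda>y. h3 y i) \<in> borel_measurable M" using pa[OF assms(3)] .
  show "(\<lambda>y. h3 y i * exp ((\<alpha> - \<beta>^2 / 2) * (h2 y - h1 y) + \<beta> * (path_at T d (h2 y) (h4 y) i - path_at T d (h1 y) (h4 y) i)))
    \<in> borel_measurable M" by measurable
qed

lemma normal_density_eq_distr: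
  assumes "\<sigma> > 0"
  shows "density lborel (\<lambda>y. ennreal (normal_density 0 \<sigma> y)) = distr std_normal borel (\<lambda>y. \<sigma> * y)"
proof -
  interpret prob_space std_normal by (rule prob_space_std_normal)
  have "distributed std_normal lborel (\<lambda>x. x) (normal_density 0 1)"
    unfolding distributed_def by (auto intro!: measure_eqI simp: emeasure_distr)
  from normal_density_affine[OF this, of \<sigma> 0] assms
  have "distributed std_normal lborel (\<lambda>x. \<sigma> * x) (normal_density 0 \<sigma>)" by simp
  then have "density lborel (\<lambda>y. ennreal (normal_density 0 \<sigma> y)) = distr std_normal lborel (\<lambda>y. \<sigma> * y)"
    by (simp add: distributed_def)
  also have "\<dots> = distr std_normal borel (\<lambda>y. \<sigma> * y)" by (rule distr_cong) auto
  finally show ?thesis .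
qed

lemma PiM_normal_eq_distr:
  assumes "\<sigma> > 0"
  shows "PiM {1..d} (\<lambda>_. density lborel (\<lambda>y. ennreal (normal_density 0 \<sigma> y)))
    = distr (std_gauss d) (borel_Rd d) (\<lambda>z. \<lambda>i\<in>{1..d}. \<sigma> * z i)"
proof -
  have "distr (PiM {1..d} (\<lambda>_. std_normal)) (PiM {1..d} (\<lambda>_. distr std_normal borel (\<lambda>y. \<sigma> * y))) (compose {1..d} (\<lambda>y. \<sigma> * y))
    = PiM {1..d} (\<lambda>_. distr std_normal (distr std_normal borel (\<lambda>y. \<sigma> * y)) (\<lambda>y. \<sigma> * y))"
    by (rule distr_PiM_finite_prob_space') (auto intro: prob_space_std_normal prob_space.prob_space_distr)
  moreover have "distr std_normal (distr std_normal borel (\<lambda>y. \<sigma> * y)) (\<lambda>y. \<sigma> * y) = distr std_normal borel (\<lambda>y. \<sigma> * y)"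
    by (rule distr_cong) auto
  moreover have "distr (PiM {1..d} (\<lambda>_. std_normal)) (PiM {1..d} (\<lambda>_. distr std_normal borel (\<lambda>y. \<sigma> * y))) (compose {1..d} (\<lambda>y. \<sigma> * y))
    = distr (std_gauss d) (borel_Rd d) (\<lambda>z. \<lambda>i\<in>{1..d}. \<sigma> * z i)"
    unfolding std_gauss_def by (rule distr_cong) (auto intro!: sets_PiM_cong simp: compose_def)
  ultimately show ?thesis using normal_density_eq_distr[OF assms] by simp
qed

lemma nn_integral_brownian_gbm:
  assumes P: "prob_space P" and W: "std_brownian_motion P T d W" and T: "T > 0"
    and t: "0 \<le> t" "t \<le> s" "s \<le> T" and x: "x \<in> Rd d"
    and h: "h \<in> borel_measurable (borel_Rd d)"
    and sp: "sample_path T W \<in> measurable P (path_space T d)"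
  shows "(\<integral>\<^sup>+w. h (brownian_gbm \<alpha> \<beta> T d t s x w) \<partial>distr P (path_space T d) (sample_path T W))
    = (\<integral>\<^sup>+z. h (gbm \<alpha> \<beta> d x (s - t) z) \<partial>std_gauss d)"
proof -
  interpret prob_space P by fact
  interpret G: prob_space "std_gauss d" by (rule prob_space_std_gauss)
  define G where "G y = (\<lambda>i\<in>{1..d}. x i * exp ((\<alpha> - \<beta>^2 / 2) * (s - t) + \<beta> * y i))" for y :: "nat \<Rightarrow> real"
  have Gm: "G \<in> measurable (borel_Rd d) (borel_Rd d)"
    unfolding G_def by (rule measurable_restrict) measurable
  have bm: "(\<lambda>w. brownian_gbm \<alpha> \<beta> T d t s x w) \<in> measurable (path_space T d) (borel_Rd d)"
    by (rule measurable_brownian_gbm) (use x in \<open>auto simp: space_borel_Rd simp del: One_nat_def\<close>)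
  have Wsp: "W \<tau> \<omega> \<in> Rd d" if "\<omega> \<in> space P" "\<tau> \<in> {0..T}" for \<tau> \<omega>
    using W that measurable_space[of "W \<tau>" P "borel_Rd d" \<omega>] unfolding std_brownian_motion_def space_borel_Rd by blast
  have pa: "path_at T d \<tau> (sample_path T W \<omega>) = W \<tau> \<omega>" if "\<omega> \<in> space P" "\<tau> \<in> {0..T}" for \<tau> \<omega>
    unfolding sample_path_def
    using W that by (intro path_at_continuous[OF T]) (auto simp: std_brownian_motion_def Wsp)
  have eq: "brownian_gbm \<alpha> \<beta> T d t s x (sample_path T W \<omega>) = G (\<lambda>i\<in>{1..d}. W s \<omega> i - W t \<omega> i)" if "\<omega> \<in> space P" for \<omega>
    using that t by (auto simp: brownian_gbm_def G_def pa fun_eq_iff)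
  have "(\<integral>\<^sup>+w. h (brownian_gbm \<alpha> \<beta> T d t s x w) \<partial>distr P (path_space T d) (sample_path T W))
     = (\<integral>\<^sup>+\<omega>. h (brownian_gbm \<alpha> \<beta> T d t s x (sample_path T W \<omega>)) \<partial>P)"
    using sp measurable_compose[OF bm h] by (simp add: nn_integral_distr)
  also have "\<dots> = (\<integral>\<^sup>+\<omega>. h (G (\<lambda>i\<in>{1..d}. W s \<omega> i - W t \<omega> i)) \<partial>P)"
    by (intro nn_integral_cong) (simp add: eq)
  also have "\<dots> = (\<integral>\<^sup>+z. h (gbm \<alpha> \<beta> d x (s - t) z) \<partial>std_gauss d)"
  \<comment> \<open>The law of increments is given for distinct times, with a density; for t = s
    both processes are at x.\<close>
  proof (cases "t = s")
    case True
    have "G (\<lambda>i\<in>{1..d}. W s \<omega> i - W t \<omega> i) = x" for \<omega>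
      using True x by (auto simp: G_def Rd_def PiE_iff extensional_def fun_eq_iff)
    moreover have "gbm \<alpha> \<beta> d x (s - t) z = x" for z
      using True x by (auto simp: gbm_def Rd_def PiE_iff extensional_def fun_eq_iff)
    ultimately show ?thesis by (simp add: emeasure_space_1 G.emeasure_space_1)
  next
    case False
    then have ts: "t < s" using t by simp
    have inc: "(\<lambda>\<omega>. \<lambda>i\<in>{1..d}. W s \<omega> i - W t \<omega> i) \<in> measurable P (borel_Rd d)"
    proof (rule measurable_restrict)
      fix i assume i: "i \<in> {1..d}"
      have "W s \<in> measurable P (borel_Rd d)" "W t \<in> measurable P (borel_Rd d)"
        using W t unfolding std_brownian_motion_def by auto
      from this[THEN measurable_compose, OF measurable_component_singleton[OF i]]
      show "(\<lambda>\<omega>. W s \<omega> i - W t \<omega> i) \<in> borel_measurable P" by measurable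
    qed
    have hG: "(\<lambda>y. h (G y)) \<in> borel_measurable (borel_Rd d)" by (rule measurable_compose[OF Gm h])
    have sc: "(\<lambda>z. \<lambda>i\<in>{1..d}. sqrt (s - t) * z i) \<in> measurable (std_gauss d) (borel_Rd d)"
      unfolding measurable_cong_sets[OF sets_std_gauss refl] by (rule measurable_restrict) measurable
    have D: "distr P (borel_Rd d) (\<lambda>\<omega>. \<lambda>i\<in>{1..d}. W s \<omega> i - W t \<omega> i) =
        distr (std_gauss d) (borel_Rd d) (\<lambda>z. \<lambda>i\<in>{1..d}. sqrt (s - t) * z i)"
      using W t ts PiM_normal_eq_distr[of "sqrt (s - t)" d] unfolding std_brownian_motion_def by auto
    have "(\<integral>\<^sup>+\<omega>. h (G (\<lambda>i\<in>{1..d}. W s \<omega> i - W t \<omega> i)) \<partial>P) =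
       (\<integral>\<^sup>+y. h (G y) \<partial>distr P (borel_Rd d) (\<lambda>\<omega>. \<lambda>i\<in>{1..d}. W s \<omega> i - W t \<omega> i))"
      using inc hG by (simp add: nn_integral_distr)
    also have "\<dots> = (\<integral>\<^sup>+z. h (G (\<lambda>i\<in>{1..d}. sqrt (s - t) * z i)) \<partial>std_gauss d)"
      unfolding D using sc hG by (simp add: nn_integral_distr)
    also have "\<dots> = (\<integral>\<^sup>+z. h (gbm \<alpha> \<beta> d x (s - t) z) \<partial>std_gauss d)"
    proof (rule nn_integral_cong)
      fix z
      have "G (\<lambda>i\<in>{1..d}. sqrt (s - t) * z i) = gbm \<alpha> \<beta> d x (s - t) z"
        by (auto simp: G_def gbm_def fun_eq_iff mult.assoc)
      then show "h (G (\<lambda>i\<in>{1..d}. sqrt (s - t) * z i)) = h (gbm \<alpha> \<beta> d x (s - t) z)" by simp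
    qed
    finally show ?thesis .
  qed
  finally show ?thesis .
qed

lemma measurable_sample_path:
  assumes "std_brownian_motion P T d W"
  shows "sample_path T W \<in> measurable P (path_space T d)"
  unfolding sample_path_def using assms by (intro measurable_restrict) (auto simp: std_brownian_motion_def)

text \<open>
  A Brownian motion is determined in law by its increments: every finite set of times is completed
  by \<open>0\<close> and \<open>T\<close> to a partition, along which the path is the partial sum of independent increments.
\<close>

lemma brownian_cylinder_probability:
  assumes T: "T > 0" and J: "finite J" "J \<subseteq> {0..T}"
    and A: "\<And>j. j \<in> J \<Longrightarrow> A j \<in> sets (borel_Rd d)"
  shows "\<exists>c. \<forall>(P :: 'w measure) W. prob_space P \<longrightarrow> std_brownian_motion P T d W \<longrightarrow>
    emeasure P {\<omega> \<in> space P. \<forall>j\<in>J. W j \<omega> \<in> A j} = c"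
proof -
  \<comment> \<open>0 is added because W is rebuilt from its increments starting at time 0, and T so
    that there is at least one increment even if J is empty or contains only 0.\<close>
  define J' where "J' = insert 0 (insert T J)"
  define l where "l = sorted_list_of_set J'"
  define n where "n = length l - 1"
  define \<tau> where "\<tau> k = l ! k" for k
  have J': "finite J'" "J' \<subseteq> {0..T}" "0 \<in> J'" "T \<in> J'" using J T by (auto simp: J'_def)
  have l: "set l = J'" "sorted_wrt (<) l" "distinct l"
    using J' by (auto simp: l_def strict_sorted_list_of_set)
  have "card J' \<ge> card {0, T}" using J' by (intro card_mono) auto
  then have len: "length l = Suc n" "n \<ge> 1"
    using T J' by (auto simp: n_def l_def)
  have mono: "\<tau> k < \<tau> (Suc k)" if "k < n" for k
    using sorted_wrt_nth_less[OF l(2), of k "Suc k"] that len by (auto simp: \<tau>_def)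
  have in0T: "\<tau> k \<in> {0..T}" if "k \<le> n" for k
    using nth_mem[of k l] that len J' l(1) by (auto simp: \<tau>_def)
  have ex: "\<exists>k\<le>n. \<tau> k = j" if "j \<in> J'" for j
    using that l(1) len by (metis \<tau>_def in_set_conv_nth less_Suc_eq_le)
  have \<tau>0: "\<tau> 0 = 0"
  proof -
    obtain k where k: "k \<le> n" "\<tau> k = 0" using ex J' by blast
    show ?thesis
    proof (cases "k = 0")
      case False
      then have "\<tau> 0 < \<tau> k" using sorted_wrt_nth_less[OF l(2), of 0 k] k len by (auto simp: \<tau>_def)
      then show ?thesis using in0T[of 0] k by auto
    qed (use k in simp)
  qed
  define idx where "idx j = (SOME k. k \<le> n \<and> \<tau> k = j)" for j
  have idx: "idx j \<le> n" "\<tau> (idx j) = j" if "j \<in> J" for j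
    using someI_ex[of "\<lambda>k. k \<le> n \<and> \<tau> k = j"] ex[of j] that by (auto simp: idx_def J'_def)
  define Q where "Q = PiM {..<n} (\<lambda>k. PiM {1..d} (\<lambda>_::nat. density lborel (\<lambda>y. ennreal (normal_density 0 (sqrt (\<tau> (Suc k) - \<tau> k)) y))))"
  define psum where "psum y j = (\<lambda>i\<in>{1..d}. \<Sum>k<idx j. y k i)" for y :: "nat \<Rightarrow> nat \<Rightarrow> real" and j
  define Q' where "Q' = PiM {..<n} (\<lambda>_. borel_Rd d)"
  have setsQ: "sets Q = sets Q'" unfolding Q_def Q'_def by (intro sets_PiM_cong) auto
  have psum: "(\<lambda>y. psum y j) \<in> measurable Q' (borel_Rd d)" if "j \<in> J" for j
    unfolding psum_def
  proof (rule measurable_restrict, rule borel_measurable_sum)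
    fix i k assume i: "i \<in> {1..d}" and k: "k \<in> {..<idx j}"
    then have "k \<in> {..<n}" using idx[OF that] by auto
    then have "(\<lambda>y. y k) \<in> measurable Q' (borel_Rd d)"
      unfolding Q'_def by (rule measurable_component_singleton)
    from measurable_compose[OF this measurable_component_singleton[OF i]]
    show "(\<lambda>y. y k i) \<in> borel_measurable Q'" .
  qed
  define C where "C = {y \<in> space Q'. \<forall>j\<in>J. psum y j \<in> A j}"
  have C: "C \<in> sets Q'"
    unfolding C_def
  proof (rule sets.sets_Collect_finite_All[OF _ J(1)])
    fix j assume j: "j \<in> J"
    show "{y \<in> space Q'. psum y j \<in> A j} \<in> sets Q'"
      using measurable_sets[OF psum[OF j] A[OF j]] by (simp add: vimage_def Int_def conj_commute)
  qed
  show ?thesis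
  \<comment> \<open>The common value is the probability of \<open>C\<close> under the product
    \<open>Q\<close> of the normal increment laws, in which neither P nor W occurs.\<close>
  proof (intro exI[of _ "emeasure Q C"] allI impI)
    fix P :: "'w measure" and W
    assume P: "prob_space P" and W: "std_brownian_motion P T d W"
    interpret prob_space P by fact
    define \<Delta> where "\<Delta> k \<omega> = (\<lambda>i\<in>{1..d}. W (\<tau> (Suc k)) \<omega> i - W (\<tau> k) \<omega> i)" for k \<omega>
    have Wm: "W t \<in> measurable P (borel_Rd d)" if "t \<in> {0..T}" for t
      using W that by (auto simp: std_brownian_motion_def)
    have iv: "indep_vars (\<lambda>_. borel_Rd d) \<Delta> {..<n}"
      using W \<tau>0 mono in0T[of n] unfolding std_brownian_motion_def \<Delta>_def[abs_def] by (auto simp del: One_nat_def)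
    have \<Delta>m: "\<Delta> k \<in> measurable P (borel_Rd d)" if "k \<in> {..<n}" for k
      using iv that by (auto simp: indep_vars_def)
    have D: "distr P Q' (\<lambda>\<omega>. \<lambda>k\<in>{..<n}. \<Delta> k \<omega>) = Q"
    proof -
      have "distr P Q' (\<lambda>\<omega>. \<lambda>k\<in>{..<n}. \<Delta> k \<omega>) = PiM {..<n} (\<lambda>k. distr P (borel_Rd d) (\<Delta> k))"
        unfolding Q'_def using len iv \<Delta>m
        by (subst indep_vars_iff_distr_eq_PiM'[symmetric]) (auto simp: lessThan_empty_iff simp del: One_nat_def)
      also have "\<dots> = Q"
        unfolding Q_def
      proof (rule PiM_cong[OF refl])
        fix k assume "k \<in> {..<n}"
        then have "0 \<le> \<tau> k" "\<tau> k < \<tau> (Suc k)" "\<tau> (Suc k) \<le> T"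
          using mono in0T[of k] in0T[of "Suc k"] by auto
        then show "distr P (borel_Rd d) (\<Delta> k) = PiM {1..d} (\<lambda>_::nat. density lborel (\<lambda>y. ennreal (normal_density 0 (sqrt (\<tau> (Suc k) - \<tau> k)) y)))"
          using W unfolding std_brownian_motion_def \<Delta>_def[abs_def] by (auto simp del: One_nat_def)
      qed
      finally show ?thesis .
    qed
    have \<Delta>m': "(\<lambda>\<omega>. \<lambda>k\<in>{..<n}. \<Delta> k \<omega>) \<in> measurable P Q'"
      unfolding Q'_def by (intro measurable_restrict \<Delta>m)
    \<comment> \<open>The reconstruction from increments starts from \<open>W 0 = 0\<close>, which
      holds almost surely.\<close>
    have AE: "AE \<omega> in P. (\<forall>j\<in>J. W j \<omega> \<in> A j) \<longleftrightarrow> (\<lambda>k\<in>{..<n}. \<Delta> k \<omega>) \<in> C"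
    proof -
      have "AE \<omega> in P. \<forall>i\<in>{1..d}. W 0 \<omega> i = 0"
        using W by (simp add: std_brownian_motion_def del: One_nat_def)
      then show ?thesis using AE_space
      proof eventually_elim
        case (elim \<omega>)
        have tel: "W (\<tau> m) \<omega> i = (\<Sum>k<m. \<Delta> k \<omega> i)" if "m \<le> n" "i \<in> {1..d}" for m i
          using that(1)
        proof (induction m)
          case 0 then show ?case using elim that \<tau>0 by simp
        next
          case (Suc m)
          then show ?case using that by (simp add: \<Delta>_def del: One_nat_def)
        qed
        have "psum (\<lambda>k\<in>{..<n}. \<Delta> k \<omega>) j = W j \<omega>" if j: "j \<in> J" for j
        proof
          fix i
          show "psum (\<lambda>k\<in>{..<n}. \<Delta> k \<omega>) j i = W j \<omega> i"
          proof (cases "i \<in> {1..d}")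
            case True
            have "(\<Sum>k<idx j. (\<lambda>k\<in>{..<n}. \<Delta> k \<omega>) k i) = (\<Sum>k<idx j. \<Delta> k \<omega> i)"
              using idx[OF j] by (intro sum.cong) auto
            then show ?thesis using True tel[of "idx j" i] idx[OF j] by (simp add: psum_def del: One_nat_def)
          next
            case False
            have "W j \<omega> \<in> Rd d"
              using measurable_space[OF Wm, of j \<omega>] J j elim(2) by (auto simp: space_borel_Rd simp del: One_nat_def)
            then show ?thesis using False by (auto simp: psum_def Rd_def PiE_iff extensional_def simp del: One_nat_def)
          qed
        qed
        then show ?case using measurable_space[OF \<Delta>m' elim(2)] by (auto simp: C_def)
      qed
    qed
    have "emeasure P {\<omega> \<in> space P. \<forall>j\<in>J. W j \<omega> \<in> A j} = emeasure P ((\<lambda>\<omega>. \<lambda>k\<in>{..<n}. \<Delta> k \<omega>) -` C \<inter> space P)"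
    proof (rule emeasure_eq_AE)
      show "AE \<omega> in P. (\<omega> \<in> {\<omega> \<in> space P. \<forall>j\<in>J. W j \<omega> \<in> A j}) = (\<omega> \<in> (\<lambda>\<omega>. \<lambda>k\<in>{..<n}. \<Delta> k \<omega>) -` C \<inter> space P)"
        using AE AE_space by eventually_elim auto
      show "{\<omega> \<in> space P. \<forall>j\<in>J. W j \<omega> \<in> A j} \<in> sets P"
      proof (rule sets.sets_Collect_finite_All[OF _ J(1)])
        fix j assume j: "j \<in> J"
        then have "j \<in> {0..T}" using J(2) by auto
        from measurable_sets[OF Wm[OF this] A[OF j]]
        show "{\<omega> \<in> space P. W j \<omega> \<in> A j} \<in> sets P" by (simp add: vimage_def Int_def conj_commute)
      qed
      show "(\<lambda>\<omega>. \<lambda>k\<in>{..<n}. \<Delta> k \<omega>) -` C \<inter> space P \<in> sets P" by (rule measurable_sets[OF \<Delta>m' C])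
    qed
    also have "\<dots> = emeasure Q C"
      unfolding D[symmetric] by (rule emeasure_distr[OF \<Delta>m' C, symmetric])
    finally show "emeasure P {\<omega> \<in> space P. \<forall>j\<in>J. W j \<omega> \<in> A j} = emeasure Q C" .
  qed
qed

text \<open>Cylinder sets determine a law on path space. This lets one path measure, that of the
  index [0], stand for the paths of all indices.\<close>

lemma brownian_path_law_unique:
  assumes T: "T > 0" and P: "prob_space P"
    and W: "std_brownian_motion P T d W" "std_brownian_motion P T d W'"
  shows "distr P (path_space T d) (sample_path T W) = distr P (path_space T d) (sample_path T W')"
proof (rule measure_eqI_PiM_infinite)
  interpret prob_space P by fact
  show "finite_measure (distr P (path_space T d) (sample_path T W))"
    using measurable_sample_path[OF W(1)] by (intro finite_measure_distr)
  fix A J assume J: "finite J" "J \<subseteq> {0..T}" and A: "\<And>i. i \<in> J \<Longrightarrow> A i \<in> sets (borel_Rd d)"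
  have "\<exists>c. \<forall>(P :: 'a measure) W. prob_space P \<longrightarrow> std_brownian_motion P T d W \<longrightarrow>
    emeasure P {\<omega> \<in> space P. \<forall>j\<in>J. W j \<omega> \<in> A j} = c"
    by (rule brownian_cylinder_probability[OF T J A])
  then obtain c where c: "\<forall>(P :: 'a measure) W. prob_space P \<longrightarrow> std_brownian_motion P T d W \<longrightarrow>
    emeasure P {\<omega> \<in> space P. \<forall>j\<in>J. W j \<omega> \<in> A j} = c" ..
  let ?E = "prod_emb {0..T} (\<lambda>_. borel_Rd d) J (Pi\<^sub>E J A)"
  have "emeasure (distr P (path_space T d) (sample_path T W)) ?E = c" if W: "std_brownian_motion P T d W" for W
  proof -
    have "emeasure (distr P (path_space T d) (sample_path T W)) ?E = emeasure P (sample_path T W -` ?E \<inter> space P)"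
      using J A by (intro emeasure_distr measurable_sample_path W sets_PiM_I) auto
    also have "sample_path T W -` ?E \<inter> space P = {\<omega> \<in> space P. \<forall>j\<in>J. W j \<omega> \<in> A j}"
    proof (intro set_eqI)
      fix \<omega>
      have "sample_path T W \<omega> \<in> ?E \<longleftrightarrow> (\<forall>j\<in>J. W j \<omega> \<in> A j)" if "\<omega> \<in> space P"
      proof -
        have "sample_path T W \<omega> \<in> space (path_space T d)"
          using measurable_space[OF measurable_sample_path[OF W] that] .
        then have "sample_path T W \<omega> \<in> ?E \<longleftrightarrow> restrict (sample_path T W \<omega>) J \<in> Pi\<^sub>E J A"
          by (simp add: prod_emb_def space_PiM)
        also have "\<dots> \<longleftrightarrow> (\<forall>j\<in>J. sample_path T W \<omega> j \<in> A j)"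
          by (simp add: PiE_iff)
        also have "\<dots> \<longleftrightarrow> (\<forall>j\<in>J. W j \<omega> \<in> A j)"
          by (rule ball_cong[OF refl]) (metis J(2) restrict_apply' sample_path_def subsetD)
        finally show ?thesis .
      qed
      then show "\<omega> \<in> sample_path T W -` ?E \<inter> space P \<longleftrightarrow> \<omega> \<in> {\<omega> \<in> space P. \<forall>j\<in>J. W j \<omega> \<in> A j}"
        by blast
    qed
    finally show ?thesis using c P W by simp
  qed
  from this[OF W(1)] this[OF W(2)]
  show "emeasure (distr P (path_space T d) (sample_path T W)) ?E = emeasure (distr P (path_space T d) (sample_path T W')) ?E" by simp
qed auto

section \<open>Independence of the noise\<close>

text \<open>Forces the random time into [t, T] for every noise value and not merely for almost every
  one under the uniform law.\<close>

definition clamp01 :: "real \<Rightarrow> real" where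
  "clamp01 r = max 0 (min 1 r)"

abbreviation uniform01 :: "real measure" where
  "uniform01 \<equiv> uniform_measure lborel {0..1}"

abbreviation noise_space :: "real \<Rightarrow> nat \<Rightarrow> (real \<times> (real \<Rightarrow> nat \<Rightarrow> real)) measure" where
  "noise_space T d \<equiv> borel \<Otimes>\<^sub>M path_space T d"

lemma prob_space_uniform01: "prob_space uniform01"
  by (rule prob_space_uniform_measure) auto

lemma measurable_pair_noise:
  assumes "\<R> \<in> borel_measurable P" "w \<in> measurable P (path_space T d)"
  shows "(\<lambda>\<omega>. (\<R> \<omega>, w \<omega>)) \<in> measurable P (noise_space T d)"
  using assms by (rule measurable_Pair)

text \<open>Applied to the map that pairs an index with a fixed dimension, and to the map that
  prepends a fixed list to an index.\<close>

lemma (in prob_space) indep_vars_reindex: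
  assumes f: "inj_on f I" and X: "indep_vars M' X (f ` I)"
  shows "indep_vars (\<lambda>i. M' (f i)) (\<lambda>i. X (f i)) I"
  unfolding indep_vars_def2
proof (intro conjI ballI)
  show "X (f i) \<in> measurable M (M' (f i))" if "i \<in> I" for i
    using X that by (auto simp: indep_vars_def)
  have ind: "indep_sets (\<lambda>i. {X i -` A \<inter> space M |A. A \<in> sets (M' i)}) (f ` I)"
    using X by (auto simp: indep_vars_def2)
  show "indep_sets (\<lambda>i. {X (f i) -` A \<inter> space M |A. A \<in> sets (M' (f i))}) I"
  proof (rule indep_setsI)
    show "{X (f i) -` A \<inter> space M |A. A \<in> sets (M' (f i))} \<subseteq> events" if "i \<in> I" for i
      using ind that by (auto simp: indep_sets_def)
    fix A J assume J: "J \<noteq> {}" "J \<subseteq> I" "finite J" and A: "\<forall>j\<in>J. A j \<in> {X (f j) -` A \<inter> space M |A. A \<in> sets (M' (f j))}"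
    define g where "g = inv_into J f"
    have fJ: "inj_on f J" using f J by (auto intro: inj_on_subset)
    have g: "g (f j) = j" if "j \<in> J" for j using that fJ by (simp add: g_def)
    have "prob (\<Inter>k\<in>f ` J. A (g k)) = (\<Prod>k\<in>f ` J. prob (A (g k)))"
      using A J g by (intro indep_setsD[OF ind]) auto
    then show "prob (\<Inter>j\<in>J. A j) = (\<Prod>j\<in>J. prob (A j))"
      using g by (simp add: prod.reindex[OF fJ] cong: prod.cong)
  qed
qed

text \<open>
  Independence of the pairs: the rectangles \<open>{\<R>\<^sub>i \<in> A} \<inter> {Y\<^sub>i \<in> B}\<close> form an intersection-stable
  generator, on which the joint probabilities factorize.
\<close>

lemma (in prob_space) indep_vars_pair:
  assumes I: "I \<noteq> {}"
    and iR: "indep_vars (\<lambda>_. NR) RR I" and iW: "indep_vars (\<lambda>_. NW) WW I"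
    and RW: "\<And>a b. a \<in> sigma_sets (space M) (\<Union>i\<in>I. {RR i -` A \<inter> space M |A. A \<in> sets NR}) \<Longrightarrow>
        b \<in> sigma_sets (space M) (\<Union>i\<in>I. {WW i -` B \<inter> space M |B. B \<in> sets NW}) \<Longrightarrow>
        prob (a \<inter> b) = prob a * prob b"
  shows "indep_vars (\<lambda>_. NR \<Otimes>\<^sub>M NW) (\<lambda>i \<omega>. (RR i \<omega>, WW i \<omega>)) I"
proof -
  have Rm: "RR i \<in> measurable M NR" and Wm: "WW i \<in> measurable M NW" if "i \<in> I" for i
    using iR iW that by (auto simp: indep_vars_def)
  define G where "G i = {(RR i -` A \<inter> space M) \<inter> (WW i -` B \<inter> space M) |A B. A \<in> sets NR \<and> B \<in> sets NW}" for i
  have ind: "indep_sets G I"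
  proof (rule indep_setsI)
    show "G i \<subseteq> events" if "i \<in> I" for i
      using Rm[OF that] Wm[OF that] by (auto simp: G_def intro!: sets.Int measurable_sets)
  next
    fix C J assume J: "J \<noteq> {}" "J \<subseteq> I" "finite J" and C: "\<forall>j\<in>J. C j \<in> G j"
    have "\<exists>A B. A \<in> sets NR \<and> B \<in> sets NW \<and> C j = (RR j -` A \<inter> space M) \<inter> (WW j -` B \<inter> space M)" if "j \<in> J" for j
    proof -
      from C that have "C j \<in> G j" by blast
      then show ?thesis unfolding G_def by (elim CollectE exE conjE) (intro exI conjI)
    qed
    then obtain A B where AB: "\<And>j. j \<in> J \<Longrightarrow> A j \<in> sets NR" "\<And>j. j \<in> J \<Longrightarrow> B j \<in> sets NW"
      "\<And>j. j \<in> J \<Longrightarrow> C j = (RR j -` A j \<inter> space M) \<inter> (WW j -` B j \<inter> space M)"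
      by metis
    let ?a = "\<lambda>j. RR j -` A j \<inter> space M" and ?b = "\<lambda>j. WW j -` B j \<inter> space M"
    let ?\<R> = "sigma_sets (space M) (\<Union>i\<in>I. {RR i -` A \<inter> space M |A. A \<in> sets NR})"
    let ?\<W> = "sigma_sets (space M) (\<Union>i\<in>I. {WW i -` B \<inter> space M |B. B \<in> sets NW})"
    have a: "?a j \<in> ?\<R>" and b: "?b j \<in> ?\<W>" if "j \<in> J" for j
      using AB(1,2)[OF that] J that by (auto intro!: sigma_sets.Basic UN_I[of j])
    have setsR: "sets (sigma (space M) (\<Union>i\<in>I. {RR i -` A \<inter> space M |A. A \<in> sets NR})) = ?\<R>"
      by (rule sets_measure_of) blast
    have setsW: "sets (sigma (space M) (\<Union>i\<in>I. {WW i -` B \<inter> space M |B. B \<in> sets NW})) = ?\<W>"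
      by (rule sets_measure_of) blast
    have "(\<Inter>j\<in>J. C j) = (\<Inter>j\<in>J. ?a j \<inter> ?b j)" by (rule INF_cong[OF refl AB(3)])
    also have "\<dots> = (\<Inter>j\<in>J. ?a j) \<inter> (\<Inter>j\<in>J. ?b j)" by (rule INT_Int_distrib)
    also have "prob \<dots> = prob (\<Inter>j\<in>J. ?a j) * prob (\<Inter>j\<in>J. ?b j)"
    proof (rule RW)
      show "(\<Inter>j\<in>J. ?a j) \<in> ?\<R>" unfolding setsR[symmetric]
        by (rule sets.finite_INT[OF J(3,1)]) (simp only: setsR a)
      show "(\<Inter>j\<in>J. ?b j) \<in> ?\<W>" unfolding setsW[symmetric]
        by (rule sets.finite_INT[OF J(3,1)]) (simp only: setsW b)
    qed
    also have "prob (\<Inter>j\<in>J. ?a j) = (\<Prod>j\<in>J. prob (?a j))"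
      using AB J by (intro indep_varsD[OF iR]) auto
    also have "prob (\<Inter>j\<in>J. ?b j) = (\<Prod>j\<in>J. prob (?b j))"
      using AB J by (intro indep_varsD[OF iW]) auto
    also have "(\<Prod>j\<in>J. prob (?a j)) * (\<Prod>j\<in>J. prob (?b j)) = (\<Prod>j\<in>J. prob (?a j \<inter> ?b j))"
      unfolding prod.distrib[symmetric] by (rule prod.cong[OF refl RW[OF a b, symmetric]])
    also have "\<dots> = (\<Prod>j\<in>J. prob (C j))" by (rule prod.cong[OF refl arg_cong[OF AB(3)[symmetric], of _ prob]])
    finally show "prob (\<Inter>j\<in>J. C j) = (\<Prod>j\<in>J. prob (C j))" .
  qed
  have stable: "Int_stable (G i)" for i
  proof (rule Int_stableI)
    fix a b assume "a \<in> G i" "b \<in> G i"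
    then obtain A B A' B' where *: "A \<in> sets NR" "B \<in> sets NW" "A' \<in> sets NR" "B' \<in> sets NW"
      "a = (RR i -` A \<inter> space M) \<inter> (WW i -` B \<inter> space M)" "b = (RR i -` A' \<inter> space M) \<inter> (WW i -` B' \<inter> space M)"
      unfolding G_def by auto
    then have "a \<inter> b = (RR i -` (A \<inter> A') \<inter> space M) \<inter> (WW i -` (B \<inter> B') \<inter> space M)" by auto
    with * show "a \<inter> b \<in> G i" unfolding G_def by blast
  qed
  have ind': "indep_sets (\<lambda>i. sigma_sets (space M) (G i)) I"
    by (rule indep_sets_sigma[OF ind stable])
  show ?thesis
    unfolding indep_vars_def2
  proof (intro conjI ballI)
    show "(\<lambda>\<omega>. (RR i \<omega>, WW i \<omega>)) \<in> measurable M (NR \<Otimes>\<^sub>M NW)" if "i \<in> I" for i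
      using Rm[OF that] Wm[OF that] by (rule measurable_Pair)
    show "indep_sets (\<lambda>i. {(\<lambda>\<omega>. (RR i \<omega>, WW i \<omega>)) -` A \<inter> space M |A. A \<in> sets (NR \<Otimes>\<^sub>M NW)}) I"
    proof (rule indep_sets_mono_sets[OF ind'])
      fix i assume i: "i \<in> I"
      let ?Y = "\<lambda>\<omega>. (RR i \<omega>, WW i \<omega>)"
      have Y: "?Y \<in> space M \<rightarrow> space NR \<times> space NW"
        using measurable_space[OF Rm[OF i]] measurable_space[OF Wm[OF i]] by auto
      have "{?Y -` A \<inter> space M |A. A \<in> sets (NR \<Otimes>\<^sub>M NW)} =
          sigma_sets (space M) {?Y -` A \<inter> space M |A. A \<in> {a \<times> b |a b. a \<in> sets NR \<and> b \<in> sets NW}}"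
        unfolding sets_pair_measure by (rule sigma_sets_vimage_commute[OF Y])
      also have "{?Y -` A \<inter> space M |A. A \<in> {a \<times> b |a b. a \<in> sets NR \<and> b \<in> sets NW}} \<subseteq> G i"
        unfolding G_def by blast
      then have "sigma_sets (space M) {?Y -` A \<inter> space M |A. A \<in> {a \<times> b |a b. a \<in> sets NR \<and> b \<in> sets NW}} \<subseteq> sigma_sets (space M) (G i)"
        by (rule sigma_sets_mono')
      finally show "{?Y -` A \<inter> space M |A. A \<in> sets (NR \<Otimes>\<^sub>M NW)} \<subseteq> sigma_sets (space M) (G i)" .
    qed
  qed
qed

text \<open>Independence of the whole family of paths from the whole family of uniform variables
  yields the product rule across the two generated \<sigma>-algebras. With it
  \<open>indep_vars_pair\<close> applies, and the law of a single pair is identified on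
  rectangles.\<close>

lemma (in prob_space) iid_noise:
  fixes \<R> :: "int list \<Rightarrow> 'a \<Rightarrow> real" and W :: "nat \<Rightarrow> int list \<Rightarrow> real \<Rightarrow> 'a \<Rightarrow> nat \<Rightarrow> real"
  assumes T: "T > 0" and d: "d \<ge> 1"
    and R_indep: "indep_vars (\<lambda>_. borel) \<R> index_set"
    and R_uniform: "\<And>\<theta>. \<theta> \<in> index_set \<Longrightarrow> distr M borel (\<R> \<theta>) = uniform01"
    and W_brownian: "\<And>d \<theta>. d \<ge> 1 \<Longrightarrow> \<theta> \<in> index_set \<Longrightarrow> std_brownian_motion M T d (W d \<theta>)"
    and W_indep: "indep_vars (\<lambda>(d, \<theta>). path_space T d)
        (\<lambda>(d, \<theta>). sample_path T (W d \<theta>)) ({1..} \<times> index_set)"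
    and W_R_indep: "indep_random_variables M
        (PiM ({1..} \<times> index_set) (\<lambda>(d, \<theta>). path_space T d))
        (\<lambda>\<omega>. \<lambda>(d, \<theta>)\<in>{1..} \<times> index_set. sample_path T (W d \<theta>) \<omega>)
        (PiM index_set (\<lambda>_. borel))
        (\<lambda>\<omega>. \<lambda>\<theta>\<in>index_set. \<R> \<theta> \<omega>)"
  defines "\<mu> \<equiv> distr M (path_space T d) (sample_path T (W d [0]))"
  shows "indep_vars (\<lambda>_. noise_space T d) (\<lambda>\<theta> \<omega>. (\<R> \<theta> \<omega>, sample_path T (W d \<theta>) \<omega>)) index_set"
    and "\<theta> \<in> index_set \<Longrightarrow> distr M (noise_space T d) (\<lambda>\<omega>. (\<R> \<theta> \<omega>, sample_path T (W d \<theta>) \<omega>)) = uniform01 \<Otimes>\<^sub>M \<mu>"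
proof -
  let ?RF = "\<lambda>\<omega>. \<lambda>\<theta>\<in>index_set. \<R> \<theta> \<omega>"
  let ?WF = "\<lambda>\<omega>. \<lambda>(d, \<theta>)\<in>{1..} \<times> index_set. sample_path T (W d \<theta>) \<omega>"
  let ?PR = "PiM index_set (\<lambda>_. borel :: real measure)"
  let ?PW = "PiM ({1..} \<times> index_set) (\<lambda>(d, \<theta>::int list). path_space T d)"
  let ?SR = "sigma_sets (space M) (\<Union>i\<in>index_set. {\<R> i -` A \<inter> space M |A. A \<in> sets borel})"
  let ?SW = "sigma_sets (space M) (\<Union>i\<in>index_set. {sample_path T (W d i) -` B \<inter> space M |B. B \<in> sets (path_space T d)})"
  have ne: "[0] \<in> index_set" by (simp add: index_set_def)
  have Rm: "\<R> \<theta> \<in> borel_measurable M" if "\<theta> \<in> index_set" for \<theta>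
    using R_indep that by (auto simp: indep_vars_def)
  have Wm: "sample_path T (W d \<theta>) \<in> measurable M (path_space T d)" if "\<theta> \<in> index_set" for \<theta>
    using W_brownian[OF d that] by (rule measurable_sample_path)
  have iW: "indep_vars (\<lambda>_. path_space T d) (\<lambda>\<theta>. sample_path T (W d \<theta>)) index_set"
  proof -
    have "inj_on (\<lambda>\<theta>::int list. (d, \<theta>)) index_set" by (auto intro: inj_onI)
    from indep_vars_reindex[OF this, of "\<lambda>(d, \<theta>). path_space T d" "\<lambda>(d, \<theta>). sample_path T (W d \<theta>)"]
      indep_vars_subset[OF W_indep, of "(\<lambda>\<theta>. (d, \<theta>)) ` index_set"] d
    show ?thesis by (auto simp: comp_def)
  qed
  have mRF: "?RF \<in> measurable M ?PR" and mWF: "?WF \<in> measurable M ?PW"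
    and indep: "indep_set (sets (vimage_algebra (space M) ?WF ?PW)) (sets (vimage_algebra (space M) ?RF ?PR))"
    using W_R_indep by (auto simp: indep_random_variables_def)
  \<comment> \<open>The \<sigma>-algebra generated by the single variables is contained in that of
    the whole family, to which the assumed independence refers.\<close>
  have SR: "?SR \<subseteq> sets (vimage_algebra (space M) ?RF ?PR)"
  proof -
    have "\<R> i -` A \<inter> space M \<in> sets (vimage_algebra (space M) ?RF ?PR)" if i: "i \<in> index_set" and A: "A \<in> sets borel" for i A
    proof -
      have "(\<lambda>z. z i) -` A \<inter> space ?PR \<in> sets ?PR"
        using i A by (intro measurable_sets[OF measurable_component_singleton]) auto
      then have "?RF -` ((\<lambda>z. z i) -` A \<inter> space ?PR) \<inter> space M \<in> sets (vimage_algebra (space M) ?RF ?PR)"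
        by (rule in_vimage_algebra)
      also have "?RF -` ((\<lambda>z. z i) -` A \<inter> space ?PR) \<inter> space M = \<R> i -` A \<inter> space M"
        using i measurable_space[OF mRF] by auto
      finally show ?thesis .
    qed
    then show ?thesis
      by (intro sets.sigma_sets_subset[of _ "vimage_algebra (space M) ?RF ?PR", simplified]) auto
  qed
  have SW: "?SW \<subseteq> sets (vimage_algebra (space M) ?WF ?PW)"
  proof -
    have "sample_path T (W d i) -` A \<inter> space M \<in> sets (vimage_algebra (space M) ?WF ?PW)" if i: "i \<in> index_set" and A: "A \<in> sets (path_space T d)" for i A
    proof -
      have di: "(d, i) \<in> {1..} \<times> index_set" using d i by simp
      have "(\<lambda>z. z (d, i)) \<in> measurable ?PW (path_space T d)"
        using measurable_component_singleton[OF di, of "\<lambda>(d, \<theta>). path_space T d"] by simp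
      then have "(\<lambda>z. z (d, i)) -` A \<inter> space ?PW \<in> sets ?PW"
        using A by (rule measurable_sets)
      then have "?WF -` ((\<lambda>z. z (d, i)) -` A \<inter> space ?PW) \<inter> space M \<in> sets (vimage_algebra (space M) ?WF ?PW)"
        by (rule in_vimage_algebra)
      also have "?WF -` ((\<lambda>z. z (d, i)) -` A \<inter> space ?PW) \<inter> space M = sample_path T (W d i) -` A \<inter> space M"
        using di measurable_space[OF mWF] by auto
      finally show ?thesis .
    qed
    then show ?thesis
      by (intro sets.sigma_sets_subset[of _ "vimage_algebra (space M) ?WF ?PW", simplified]) auto
  qed
  have RW: "prob (a \<inter> b) = prob a * prob b" if "a \<in> ?SR" "b \<in> ?SW" for a b
    using indep_setD[OF indep, of b a] that SR SW by (auto simp: Int_commute mult.commute)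
  show "indep_vars (\<lambda>_. noise_space T d) (\<lambda>\<theta> \<omega>. (\<R> \<theta> \<omega>, sample_path T (W d \<theta>) \<omega>)) index_set"
    using ne RW by (intro indep_vars_pair R_indep iW) auto
  show "distr M (noise_space T d) (\<lambda>\<omega>. (\<R> \<theta> \<omega>, sample_path T (W d \<theta>) \<omega>)) = uniform01 \<Otimes>\<^sub>M \<mu>" if \<theta>: "\<theta> \<in> index_set"
  proof (rule pair_measure_eqI[symmetric])
    interpret mu: prob_space \<mu> unfolding \<mu>_def by (rule prob_space_distr[OF Wm[OF ne]])
    interpret U: prob_space uniform01 by (rule prob_space_uniform01)
    show "sigma_finite_measure uniform01" "sigma_finite_measure \<mu>" by unfold_locales
    show "sets (uniform01 \<Otimes>\<^sub>M \<mu>) = sets (distr M (noise_space T d) (\<lambda>\<omega>. (\<R> \<theta> \<omega>, sample_path T (W d \<theta>) \<omega>)))"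
      by (simp add: \<mu>_def cong: sets_pair_measure_cong)
    fix A B assume "A \<in> sets uniform01" "B \<in> sets \<mu>"
    then have A: "A \<in> sets borel" and B: "B \<in> sets (path_space T d)" by (auto simp: \<mu>_def)
    have \<mu>: "\<mu> = distr M (path_space T d) (sample_path T (W d \<theta>))"
      unfolding \<mu>_def using prob_space_axioms W_brownian[OF d ne] W_brownian[OF d \<theta>] by (intro brownian_path_law_unique T)
    have "emeasure uniform01 A * emeasure \<mu> B = emeasure M (\<R> \<theta> -` A \<inter> space M) * emeasure M (sample_path T (W d \<theta>) -` B \<inter> space M)"
      unfolding R_uniform[OF \<theta>, symmetric] \<mu> using A B Rm[OF \<theta>] Wm[OF \<theta>] by (simp add: emeasure_distr)
    also have "\<dots> = ennreal (prob (\<R> \<theta> -` A \<inter> space M) * prob (sample_path T (W d \<theta>) -` B \<inter> space M))"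
      by (simp add: emeasure_eq_measure ennreal_mult)
    also have "\<dots> = ennreal (prob ((\<R> \<theta> -` A \<inter> space M) \<inter> (sample_path T (W d \<theta>) -` B \<inter> space M)))"
      using A B \<theta> by (subst RW) (auto intro!: sigma_sets.Basic)
    also have "\<dots> = emeasure M ((\<lambda>\<omega>. (\<R> \<theta> \<omega>, sample_path T (W d \<theta>) \<omega>)) -` (A \<times> B) \<inter> space M)"
      unfolding emeasure_eq_measure by (intro arg_cong[where f = ennreal] arg_cong[where f = prob]) auto
    also have "\<dots> = emeasure (distr M (noise_space T d) (\<lambda>\<omega>. (\<R> \<theta> \<omega>, sample_path T (W d \<theta>) \<omega>))) (A \<times> B)"
      using A B Rm[OF \<theta>] Wm[OF \<theta>] by (intro emeasure_distr[symmetric] measurable_pair_noise) auto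
    finally show "emeasure uniform01 A * emeasure \<mu> B = emeasure (distr M (noise_space T d) (\<lambda>\<omega>. (\<R> \<theta> \<omega>, sample_path T (W d \<theta>) \<omega>))) (A \<times> B)" .
  qed
qed

text \<open>Prepending \<theta> is injective, so the noise variables of the extensions of \<theta>
  are again independent with law \<nu>. This moves an approximation with index \<theta> to the
  canonical product space.\<close>

lemma (in prob_space) distr_shifted_iid:
  assumes iv: "indep_vars (\<lambda>_. N) Y index_set"
    and law: "\<And>\<eta>. \<eta> \<in> index_set \<Longrightarrow> distr M N (Y \<eta>) = \<nu>" and setsN: "sets \<nu> = sets N"
    and \<theta>: "\<theta> \<in> index_set"
  shows "distr M (PiM index_set (\<lambda>_. \<nu>)) (\<lambda>\<omega>. \<lambda>\<zeta>\<in>index_set. Y (\<theta> @ \<zeta>) \<omega>) = PiM index_set (\<lambda>_. \<nu>)"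
proof -
  have sub: "(@) \<theta> ` index_set \<subseteq> index_set" by (auto simp: index_set_def)
  have "indep_vars (\<lambda>_. N) (\<lambda>\<zeta>. Y (\<theta> @ \<zeta>)) index_set"
    using indep_vars_reindex[of "(@) \<theta>" index_set "\<lambda>_. N" Y] indep_vars_subset[OF iv sub]
    by (auto simp: comp_def inj_on_def)
  then have "distr M (PiM index_set (\<lambda>_. N)) (\<lambda>\<omega>. \<lambda>\<zeta>\<in>index_set. Y (\<theta> @ \<zeta>) \<omega>)
      = PiM index_set (\<lambda>\<zeta>. distr M N (Y (\<theta> @ \<zeta>)))"
    using iv sub \<theta> by (subst (asm) indep_vars_iff_distr_eq_PiM') (auto simp: indep_vars_def image_subset_iff)
  also have "\<dots> = PiM index_set (\<lambda>_. \<nu>)"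
    using law sub by (intro PiM_cong refl) (auto simp: image_subset_iff)
  also have "distr M (PiM index_set (\<lambda>_. N)) (\<lambda>\<omega>. \<lambda>\<zeta>\<in>index_set. Y (\<theta> @ \<zeta>) \<omega>) =
     distr M (PiM index_set (\<lambda>_. \<nu>)) (\<lambda>\<omega>. \<lambda>\<zeta>\<in>index_set. Y (\<theta> @ \<zeta>) \<omega>)"
    using setsN by (intro distr_cong refl sets_PiM_cong) auto
  finally show ?thesis .
qed

section \<open>Expectations over the noise\<close>

definition noise_time :: "real \<Rightarrow> real \<Rightarrow> real \<times> 'b \<Rightarrow> real" where
  "noise_time T t y = t + (T - t) * clamp01 (fst y)"

definition noise_state where
  "noise_state \<alpha> \<beta> T d t x y = brownian_gbm \<alpha> \<beta> T d t (noise_time T t y) x (snd y)"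

definition noise_final where
  "noise_final \<alpha> \<beta> T d t x y = brownian_gbm \<alpha> \<beta> T d t T x (snd y)"

lemma clamp01: "clamp01 r \<in> {0..1}" "r \<in> {0..1} \<Longrightarrow> clamp01 r = r"
  by (auto simp: clamp01_def)

lemma clamp01_measurable [measurable]: "clamp01 \<in> borel_measurable borel"
  unfolding clamp01_def[abs_def] by measurable

lemma affine_time: "0 \<le> r \<Longrightarrow> r \<le> 1 \<Longrightarrow> t \<le> T \<Longrightarrow> t + (T - t) * r \<in> {t..T::real}"
  using mult_left_le[of r "T - t"] by auto

lemma noise_time_range: "t \<le> T \<Longrightarrow> noise_time T t y \<in> {t..T}"
  unfolding noise_time_def using clamp01(1)[of "fst y"] by (intro affine_time) auto

lemma uniform01_density: "uniform01 = density lborel (\<lambda>x. ennreal (indicator {0..1} x))"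
  unfolding uniform_measure_def
  by (rule density_cong) (auto split: split_indicator simp: divide_ennreal_def)

text \<open>All that is retained of the Brownian path measure: started from x at time t, the state
  at a fixed time s has the law of the Gaussian representation \<open>gbm\<close>.\<close>

locale brownian_noise =
  fixes T \<alpha> \<beta> :: real and d :: nat and \<mu> :: "(real \<Rightarrow> nat \<Rightarrow> real) measure"
  assumes T: "T > 0" and prob_path: "prob_space \<mu>" and sets_path: "sets \<mu> = sets (path_space T d)"
    and law: "\<And>t s x h. 0 \<le> t \<Longrightarrow> t \<le> s \<Longrightarrow> s \<le> T \<Longrightarrow> x \<in> Rd d \<Longrightarrow> h \<in> borel_measurable (borel_Rd d) \<Longrightarrow>
      (\<integral>\<^sup>+w. h (brownian_gbm \<alpha> \<beta> T d t s x w) \<partial>\<mu>) = (\<integral>\<^sup>+z. h (gbm \<alpha> \<beta> d x (s - t) z) \<partial>std_gauss d)"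
begin

abbreviation \<nu> where "\<nu> \<equiv> uniform01 \<Otimes>\<^sub>M \<mu>"

lemma prob_noise: "prob_space \<nu>"
  using prob_space_uniform01 prob_path by (rule prob_space_pair)

lemma sets_noise: "sets \<nu> = sets (noise_space T d)"
  by (intro sets_pair_measure_cong sets_path) simp

lemma measurable_snd_noise: "snd \<in> measurable \<nu> (path_space T d)"
  using measurable_snd[of uniform01 \<mu>] by (simp cong: measurable_cong_sets add: sets_path)

lemma measurable_fst_noise: "fst \<in> borel_measurable \<nu>"
  using measurable_fst[of uniform01 \<mu>] by (simp cong: measurable_cong_sets)

lemma measurable_noise_time:
  assumes "h1 \<in> borel_measurable M" "h2 \<in> measurable M \<nu>"
  shows "(\<lambda>y. noise_time T (h1 y) (h2 y)) \<in> borel_measurable M"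
proof -
  note [measurable] = assms(1) measurable_compose[OF assms(2) measurable_fst_noise]
  show ?thesis unfolding noise_time_def by measurable
qed

lemma measurable_noise_state:
  assumes "h1 \<in> borel_measurable M" "h2 \<in> measurable M (borel_Rd d)" "h3 \<in> measurable M \<nu>"
  shows "(\<lambda>y. noise_state \<alpha> \<beta> T d (h1 y) (h2 y) (h3 y)) \<in> measurable M (borel_Rd d)"
  unfolding noise_state_def
  by (intro measurable_brownian_gbm measurable_noise_time assms measurable_compose[OF assms(3) measurable_snd_noise])

lemma measurable_noise_final:
  assumes "h1 \<in> borel_measurable M" "h2 \<in> measurable M (borel_Rd d)" "h3 \<in> measurable M \<nu>"
  shows "(\<lambda>y. noise_final \<alpha> \<beta> T d (h1 y) (h2 y) (h3 y)) \<in> measurable M (borel_Rd d)"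
  unfolding noise_final_def
  by (intro measurable_brownian_gbm assms measurable_compose[OF assms(3) measurable_snd_noise]) simp

lemma measurable_gbm:
  assumes "h1 \<in> borel_measurable M" "h2 \<in> measurable M (std_gauss d)"
  shows "(\<lambda>y. gbm \<alpha> \<beta> d x (h1 y) (h2 y)) \<in> measurable M (borel_Rd d)"
  unfolding gbm_def
proof (rule measurable_restrict)
  fix i assume i: "i \<in> {1..d}"
  have "h2 \<in> measurable M (borel_Rd d)"
    using assms(2) by (simp cong: measurable_cong_sets add: sets_std_gauss)
  from measurable_compose[OF this measurable_component_singleton[OF i]]
  have [measurable]: "(\<lambda>y. h2 y i) \<in> borel_measurable M" .
  note [measurable] = assms(1)
  show "(\<lambda>y. x i * exp ((\<alpha> - \<beta>\<^sup>2 / 2) * h1 y + \<beta> * sqrt (h1 y) * h2 y i)) \<in> borel_measurable M"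
    by measurable
qed

text \<open>The integrands depend on the random time as well as on the state, so the joint law of
  the two is what has to be computed.\<close>

definition pair_state where
  "pair_state t x y = (noise_time T t y, noise_state \<alpha> \<beta> T d t x y)"

definition pair_gauss where
  "pair_gauss t x p = (t + (T - t) * clamp01 (fst p), gbm \<alpha> \<beta> d x ((T - t) * clamp01 (fst p)) (snd p))"

lemma measurable_pair_state:
  assumes "x \<in> Rd d"
  shows "pair_state t x \<in> measurable \<nu> (borel \<Otimes>\<^sub>M borel_Rd d)"
  unfolding pair_state_def[abs_def]
  by (intro measurable_Pair measurable_noise_time measurable_noise_state)
    (use assms in \<open>auto simp: space_borel_Rd\<close>)

lemma measurable_pair_gauss': "pair_gauss t x \<in> measurable (uniform01 \<Otimes>\<^sub>M std_gauss d) (borel \<Otimes>\<^sub>M borel_Rd d)"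
proof -
  have [measurable]: "fst \<in> borel_measurable (uniform01 \<Otimes>\<^sub>M std_gauss d)"
    using measurable_fst[of uniform01 "std_gauss d"] by (simp cong: measurable_cong_sets)
  show ?thesis
    unfolding pair_gauss_def[abs_def]
    by (intro measurable_Pair measurable_gbm measurable_snd) measurable
qed

text \<open>Time and path are independent under \<nu>; with the time frozen, the inner integral is
  given by \<open>law\<close>.\<close>

lemma nn_integral_pair_state:
  assumes t: "0 \<le> t" "t \<le> T" and x: "x \<in> Rd d" and h: "h \<in> borel_measurable (borel \<Otimes>\<^sub>M borel_Rd d)"
  shows "(\<integral>\<^sup>+y. h (pair_state t x y) \<partial>\<nu>) = (\<integral>\<^sup>+r. (\<integral>\<^sup>+z. h (pair_gauss t x (r, z)) \<partial>std_gauss d) \<partial>uniform01)"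
proof -
  interpret mu: prob_space \<mu> by (rule prob_path)
  have "(\<integral>\<^sup>+y. h (pair_state t x y) \<partial>\<nu>) = (\<integral>\<^sup>+r. (\<integral>\<^sup>+w. h (pair_state t x (r, w)) \<partial>\<mu>) \<partial>uniform01)"
    using measurable_compose[OF measurable_pair_state[OF x] h] by (subst mu.nn_integral_fst[symmetric]) auto
  also have "\<dots> = (\<integral>\<^sup>+r. (\<integral>\<^sup>+z. h (pair_gauss t x (r, z)) \<partial>std_gauss d) \<partial>uniform01)"
  proof (rule nn_integral_cong)
    fix r
    let ?s = "t + (T - t) * clamp01 r"
    have s: "t \<le> ?s" "?s \<le> T" using noise_time_range[OF t(2), of "(r, undefined)"] by (auto simp: noise_time_def)
    have "(\<lambda>y. h (?s, y)) \<in> borel_measurable (borel_Rd d)"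
      by (rule measurable_compose[OF _ h]) simp
    from law[OF t(1) s x this]
    show "(\<integral>\<^sup>+w. h (pair_state t x (r, w)) \<partial>\<mu>) = (\<integral>\<^sup>+z. h (pair_gauss t x (r, z)) \<partial>std_gauss d)"
      by (simp add: pair_state_def pair_gauss_def noise_state_def noise_time_def)
  qed
  finally show ?thesis .
qed

text \<open>The equality of laws transfers the computation to integrals of signed functions.\<close>

lemma distr_pair_state:
  assumes t: "0 \<le> t" "t \<le> T" and x: "x \<in> Rd d"
  shows "distr \<nu> (borel \<Otimes>\<^sub>M borel_Rd d) (pair_state t x) =
    distr (uniform01 \<Otimes>\<^sub>M std_gauss d) (borel \<Otimes>\<^sub>M borel_Rd d) (pair_gauss t x)"
proof (rule measure_eqI)
  interpret G: prob_space "std_gauss d" by (rule prob_space_std_gauss)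
  fix A assume "A \<in> sets (distr \<nu> (borel \<Otimes>\<^sub>M borel_Rd d) (pair_state t x))"
  then have A: "A \<in> sets (borel \<Otimes>\<^sub>M borel_Rd d)" by simp
  then have ind: "(indicator A :: _ \<Rightarrow> ennreal) \<in> borel_measurable (borel \<Otimes>\<^sub>M borel_Rd d)" by simp
  have "emeasure (distr \<nu> (borel \<Otimes>\<^sub>M borel_Rd d) (pair_state t x)) A
     = (\<integral>\<^sup>+p. indicator A p \<partial>distr \<nu> (borel \<Otimes>\<^sub>M borel_Rd d) (pair_state t x))"
    using A by simp
  also have "\<dots> = (\<integral>\<^sup>+y. indicator A (pair_state t x y) \<partial>\<nu>)"
    using measurable_pair_state[OF x] ind by (simp add: nn_integral_distr del: nn_integral_indicator)
  also have "\<dots> = (\<integral>\<^sup>+r. (\<integral>\<^sup>+z. indicator A (pair_gauss t x (r, z)) \<partial>std_gauss d) \<partial>uniform01)"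
    by (rule nn_integral_pair_state[OF t x ind])
  also have "\<dots> = (\<integral>\<^sup>+p. indicator A (pair_gauss t x p) \<partial>(uniform01 \<Otimes>\<^sub>M std_gauss d))"
    using measurable_compose[OF measurable_pair_gauss' ind] by (subst G.nn_integral_fst[symmetric]) auto
  also have "\<dots> = (\<integral>\<^sup>+p. indicator A p \<partial>distr (uniform01 \<Otimes>\<^sub>M std_gauss d) (borel \<Otimes>\<^sub>M borel_Rd d) (pair_gauss t x))"
    using measurable_pair_gauss' ind by (simp add: nn_integral_distr del: nn_integral_indicator)
  also have "\<dots> = emeasure (distr (uniform01 \<Otimes>\<^sub>M std_gauss d) (borel \<Otimes>\<^sub>M borel_Rd d) (pair_gauss t x)) A"
    using A by simp
  finally show "emeasure (distr \<nu> (borel \<Otimes>\<^sub>M borel_Rd d) (pair_state t x)) A =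
    emeasure (distr (uniform01 \<Otimes>\<^sub>M std_gauss d) (borel \<Otimes>\<^sub>M borel_Rd d) (pair_gauss t x)) A" .
qed simp

text \<open>The substitution s = t + (T - t) r. The factor T - t on the left keeps the identity true
  at t = T, where both sides are 0 even if the integral over the noise is infinite.\<close>

lemma nn_integral_noise_state:
  assumes t: "0 \<le> t" "t \<le> T" and x: "x \<in> Rd d" and h: "h \<in> borel_measurable (borel \<Otimes>\<^sub>M borel_Rd d)"
  shows "ennreal (T - t) * (\<integral>\<^sup>+y. h (noise_time T t y, noise_state \<alpha> \<beta> T d t x y) \<partial>\<nu>) =
    (\<integral>\<^sup>+s. indicator {t..T} s * (\<integral>\<^sup>+z. h (s, gbm \<alpha> \<beta> d x (s - t) z) \<partial>std_gauss d) \<partial>lborel)"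
proof -
  interpret G: prob_space "std_gauss d" by (rule prob_space_std_gauss)
  define H where "H s = (\<integral>\<^sup>+z. h (s, gbm \<alpha> \<beta> d x (s - t) z) \<partial>std_gauss d)" for s
  have Hm: "H \<in> borel_measurable borel"
  proof -
    have "(\<lambda>p. h (fst p, gbm \<alpha> \<beta> d x (fst p - t) (snd p))) \<in> borel_measurable (borel \<Otimes>\<^sub>M std_gauss d)"
      by (intro measurable_compose[OF _ h] measurable_Pair measurable_gbm borel_measurable_diff measurable_fst measurable_snd borel_measurable_const)
    from G.borel_measurable_nn_integral_fst[OF this] show ?thesis by (simp add: H_def[abs_def])
  qed
  show ?thesis
  proof (cases "t = T")
    case True
    have "AE s in lborel. indicator {t..T} s * H s = 0"
      using AE_lborel_singleton[of T] by eventually_elim (use True in \<open>auto split: split_indicator\<close>)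
    then have "(\<integral>\<^sup>+s. indicator {t..T} s * H s \<partial>lborel) = (\<integral>\<^sup>+s. 0 \<partial>(lborel::real measure))"
      by (rule nn_integral_cong_AE)
    then show ?thesis using True by (simp add: H_def)
  next
    case False
    then have tT: "T - t > 0" using t by simp
    have "(\<integral>\<^sup>+y. h (noise_time T t y, noise_state \<alpha> \<beta> T d t x y) \<partial>\<nu>) = (\<integral>\<^sup>+r. H (t + (T - t) * clamp01 r) \<partial>uniform01)"
      using nn_integral_pair_state[OF t x h] by (simp add: pair_state_def pair_gauss_def H_def)
    also have "\<dots> = (\<integral>\<^sup>+r. indicator {0..1} r * H (t + (T - t) * clamp01 r) \<partial>lborel)"
      using Hm unfolding uniform01_density by (subst nn_integral_density) (auto simp: ennreal_indicator)
    also have "\<dots> = (\<integral>\<^sup>+r. indicator {t..T} (t + (T - t) * r) * H (t + (T - t) * r) \<partial>lborel)"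
    proof (rule nn_integral_cong)
      fix r
      have "t \<le> t + (T - t) * r \<longleftrightarrow> 0 \<le> r" using tT by (simp add: zero_le_mult_iff)
      moreover have "t + (T - t) * r \<le> T \<longleftrightarrow> r \<le> 1"
      proof -
        have "t + (T - t) * r \<le> T \<longleftrightarrow> (T - t) * r \<le> (T - t) * 1" by auto
        also have "\<dots> \<longleftrightarrow> r \<le> 1" by (rule mult_le_cancel_left_pos[OF tT])
        finally show ?thesis .
      qed
      ultimately show "indicator {0..1} r * H (t + (T - t) * clamp01 r) = indicator {t..T} (t + (T - t) * r) * H (t + (T - t) * r)"
        by (auto simp: clamp01(2) split: split_indicator)
    qed
    finally have "(\<integral>\<^sup>+y. h (noise_time T t y, noise_state \<alpha> \<beta> T d t x y) \<partial>\<nu>) =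
       (\<integral>\<^sup>+r. indicator {t..T} (t + (T - t) * r) * H (t + (T - t) * r) \<partial>lborel)" .
    moreover have "(\<integral>\<^sup>+s. indicator {t..T} s * H s \<partial>lborel) = \<bar>T - t\<bar> * (\<integral>\<^sup>+r. indicator {t..T} (t + (T - t) * r) * H (t + (T - t) * r) \<partial>lborel)"
      using Hm tT by (intro nn_integral_real_affine) auto
    ultimately show ?thesis using tT by (simp add: H_def)
  qed
qed

text \<open>Integrability is asked for t < T; at t = T the prefactor is 0 and the time interval is a
  null set.\<close>

lemma integral_noise_state:
  fixes h :: "real \<times> (nat \<Rightarrow> real) \<Rightarrow> real"
  assumes t: "0 \<le> t" "t \<le> T" and x: "x \<in> Rd d" and h: "h \<in> borel_measurable (borel \<Otimes>\<^sub>M borel_Rd d)"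
    and int: "t < T \<Longrightarrow> integrable \<nu> (\<lambda>y. h (noise_time T t y, noise_state \<alpha> \<beta> T d t x y))"
  shows "(T - t) * (\<integral>y. h (noise_time T t y, noise_state \<alpha> \<beta> T d t x y) \<partial>\<nu>) =
    (\<integral>s. indicator {t..T} s * (\<integral>z. h (s, gbm \<alpha> \<beta> d x (s - t) z) \<partial>std_gauss d) \<partial>lborel)"
proof -
  interpret G: prob_space "std_gauss d" by (rule prob_space_std_gauss)
  interpret U: prob_space uniform01 by (rule prob_space_uniform01)
  interpret P: pair_sigma_finite uniform01 "std_gauss d" ..
  define H where "H s = (\<integral>z. h (s, gbm \<alpha> \<beta> d x (s - t) z) \<partial>std_gauss d)" for s
  have Hm: "H \<in> borel_measurable borel"
  proof -
    have "(\<lambda>p. h (fst p, gbm \<alpha> \<beta> d x (fst p - t) (snd p))) \<in> borel_measurable (borel \<Otimes>\<^sub>M std_gauss d)"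
      by (intro measurable_compose[OF _ h] measurable_Pair measurable_gbm borel_measurable_diff measurable_fst measurable_snd borel_measurable_const)
    then have "(\<lambda>(s, z). h (s, gbm \<alpha> \<beta> d x (s - t) z)) \<in> borel_measurable (borel \<Otimes>\<^sub>M std_gauss d)"
      by (simp add: case_prod_unfold)
    from G.borel_measurable_lebesgue_integral[OF this] show ?thesis by (simp add: H_def[abs_def])
  qed
  show ?thesis
  proof (cases "t = T")
    case True
    have "AE s in lborel. indicator {t..T} s * H s = 0"
      using AE_lborel_singleton[of T] by eventually_elim (use True in \<open>auto split: split_indicator\<close>)
    then have "(\<integral>s. indicator {t..T} s * H s \<partial>lborel) = 0" by (rule integral_eq_zero_AE)
    then show ?thesis using True by (simp add: H_def)
  next
    case False
    then have tT: "T - t > 0" using t by simp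
    have int1: "integrable \<nu> (\<lambda>y. h (pair_state t x y))" using int tT by (simp add: pair_state_def)
    then have "integrable (distr \<nu> (borel \<Otimes>\<^sub>M borel_Rd d) (pair_state t x)) h"
      using measurable_pair_state[OF x] h by (subst integrable_distr_eq)
    then have int2: "integrable (uniform01 \<Otimes>\<^sub>M std_gauss d) (\<lambda>p. h (pair_gauss t x p))"
      unfolding distr_pair_state[OF t x] using measurable_pair_gauss' h by (subst (asm) integrable_distr_eq)
    have "(\<integral>y. h (pair_state t x y) \<partial>\<nu>) = (\<integral>p. h p \<partial>distr \<nu> (borel \<Otimes>\<^sub>M borel_Rd d) (pair_state t x))"
      using measurable_pair_state[OF x] h by (rule integral_distr[symmetric])
    also have "\<dots> = (\<integral>p. h (pair_gauss t x p) \<partial>(uniform01 \<Otimes>\<^sub>M std_gauss d))"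
      unfolding distr_pair_state[OF t x] using measurable_pair_gauss' h by (rule integral_distr)
    also have "\<dots> = (\<integral>r. (\<integral>z. h (pair_gauss t x (r, z)) \<partial>std_gauss d) \<partial>uniform01)"
      using P.integral_fst'[OF int2] by simp
    also have "\<dots> = (\<integral>r. H (t + (T - t) * clamp01 r) \<partial>uniform01)"
      by (simp add: pair_gauss_def H_def)
    also have "\<dots> = (\<integral>r. indicator {0..1} r * H (t + (T - t) * clamp01 r) \<partial>lborel)"
      using Hm unfolding uniform01_density by (subst integral_density) auto
    also have "\<dots> = (\<integral>r. indicator {t..T} (t + (T - t) * r) * H (t + (T - t) * r) \<partial>lborel)"
    proof (rule Bochner_Integration.integral_cong[OF refl])
      fix r
      have "t \<le> t + (T - t) * r \<longleftrightarrow> 0 \<le> r" using tT by (simp add: zero_le_mult_iff)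
      moreover have "t + (T - t) * r \<le> T \<longleftrightarrow> r \<le> 1"
      proof -
        have "t + (T - t) * r \<le> T \<longleftrightarrow> (T - t) * r \<le> (T - t) * 1" by auto
        also have "\<dots> \<longleftrightarrow> r \<le> 1" by (rule mult_le_cancel_left_pos[OF tT])
        finally show ?thesis .
      qed
      ultimately show "indicator {0..1} r * H (t + (T - t) * clamp01 r) = indicator {t..T} (t + (T - t) * r) * H (t + (T - t) * r)"
        by (auto simp: clamp01(2) split: split_indicator)
    qed
    finally have "(\<integral>y. h (pair_state t x y) \<partial>\<nu>) =
       (\<integral>r. indicator {t..T} (t + (T - t) * r) * H (t + (T - t) * r) \<partial>lborel)" .
    moreover have "(\<integral>s. indicator {t..T} s * H s \<partial>lborel) = \<bar>T - t\<bar> *\<^sub>R (\<integral>r. indicator {t..T} (t + (T - t) * r) * H (t + (T - t) * r) \<partial>lborel)"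
      using tT by (intro lborel_integral_real_affine) auto
    ultimately show ?thesis using tT by (simp add: H_def pair_state_def)
  qed
qed

lemma nn_integral_noise_final:
  assumes t: "0 \<le> t" "t \<le> T" and x: "x \<in> Rd d" and h: "h \<in> borel_measurable (borel_Rd d)"
  shows "(\<integral>\<^sup>+y. h (noise_final \<alpha> \<beta> T d t x y) \<partial>\<nu>) = (\<integral>\<^sup>+z. h (gbm \<alpha> \<beta> d x (T - t) z) \<partial>std_gauss d)"
proof -
  interpret mu: prob_space \<mu> by (rule prob_path)
  interpret U: prob_space uniform01 by (rule prob_space_uniform01)
  have m: "noise_final \<alpha> \<beta> T d t x \<in> measurable \<nu> (borel_Rd d)"
    using x by (intro measurable_noise_final) (auto simp: space_borel_Rd)
  have "(\<integral>\<^sup>+y. h (noise_final \<alpha> \<beta> T d t x y) \<partial>\<nu>) = (\<integral>\<^sup>+r. (\<integral>\<^sup>+w. h (noise_final \<alpha> \<beta> T d t x (r, w)) \<partial>\<mu>) \<partial>uniform01)"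
    using measurable_compose[OF m h] by (subst mu.nn_integral_fst[symmetric]) auto
  also have "\<dots> = (\<integral>\<^sup>+r. (\<integral>\<^sup>+z. h (gbm \<alpha> \<beta> d x (T - t) z) \<partial>std_gauss d) \<partial>uniform01)"
    using law[OF t order_refl x h] by (simp add: noise_final_def)
  finally show ?thesis by (simp add: U.emeasure_space_1 del: nn_integral_const add: nn_integral_const)
qed

lemma distr_noise_final:
  assumes t: "0 \<le> t" "t \<le> T" and x: "x \<in> Rd d"
  shows "distr \<nu> (borel_Rd d) (noise_final \<alpha> \<beta> T d t x) = distr (std_gauss d) (borel_Rd d) (gbm \<alpha> \<beta> d x (T - t))"
proof (rule measure_eqI)
  have m: "noise_final \<alpha> \<beta> T d t x \<in> measurable \<nu> (borel_Rd d)"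
    using x by (intro measurable_noise_final) (auto simp: space_borel_Rd)
  have m': "gbm \<alpha> \<beta> d x (T - t) \<in> measurable (std_gauss d) (borel_Rd d)"
    by (intro measurable_gbm) auto
  fix A assume "A \<in> sets (distr \<nu> (borel_Rd d) (noise_final \<alpha> \<beta> T d t x))"
  then have A: "A \<in> sets (borel_Rd d)" by simp
  then have ind: "(indicator A :: _ \<Rightarrow> ennreal) \<in> borel_measurable (borel_Rd d)" by simp
  have "emeasure (distr \<nu> (borel_Rd d) (noise_final \<alpha> \<beta> T d t x)) A = (\<integral>\<^sup>+p. indicator A p \<partial>distr \<nu> (borel_Rd d) (noise_final \<alpha> \<beta> T d t x))"
    using A by simp
  also have "\<dots> = (\<integral>\<^sup>+y. indicator A (noise_final \<alpha> \<beta> T d t x y) \<partial>\<nu>)"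
    using m ind by (simp add: nn_integral_distr del: nn_integral_indicator)
  also have "\<dots> = (\<integral>\<^sup>+z. indicator A (gbm \<alpha> \<beta> d x (T - t) z) \<partial>std_gauss d)"
    by (rule nn_integral_noise_final[OF t x ind])
  also have "\<dots> = (\<integral>\<^sup>+p. indicator A p \<partial>distr (std_gauss d) (borel_Rd d) (gbm \<alpha> \<beta> d x (T - t)))"
    using m' ind by (simp add: nn_integral_distr del: nn_integral_indicator)
  also have "\<dots> = emeasure (distr (std_gauss d) (borel_Rd d) (gbm \<alpha> \<beta> d x (T - t))) A" using A by simp
  finally show "emeasure (distr \<nu> (borel_Rd d) (noise_final \<alpha> \<beta> T d t x)) A = emeasure (distr (std_gauss d) (borel_Rd d) (gbm \<alpha> \<beta> d x (T - t))) A" .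
qed simp

lemma integral_noise_final:
  fixes h :: "(nat \<Rightarrow> real) \<Rightarrow> real"
  assumes t: "0 \<le> t" "t \<le> T" and x: "x \<in> Rd d" and h: "h \<in> borel_measurable (borel_Rd d)"
  shows "(\<integral>y. h (noise_final \<alpha> \<beta> T d t x y) \<partial>\<nu>) = (\<integral>z. h (gbm \<alpha> \<beta> d x (T - t) z) \<partial>std_gauss d)"
proof -
  have m: "noise_final \<alpha> \<beta> T d t x \<in> measurable \<nu> (borel_Rd d)"
    using x by (intro measurable_noise_final) (auto simp: space_borel_Rd)
  have m': "gbm \<alpha> \<beta> d x (T - t) \<in> measurable (std_gauss d) (borel_Rd d)"
    by (intro measurable_gbm) auto
  have "(\<integral>y. h (noise_final \<alpha> \<beta> T d t x y) \<partial>\<nu>) = (\<integral>p. h p \<partial>distr \<nu> (borel_Rd d) (noise_final \<alpha> \<beta> T d t x))"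
    by (rule integral_distr[OF m h, symmetric])
  also have "\<dots> = (\<integral>z. h (gbm \<alpha> \<beta> d x (T - t) z) \<partial>std_gauss d)"
    unfolding distr_noise_final[OF t x] by (rule integral_distr[OF m' h])
  finally show ?thesis .
qed

end

section \<open>Multilevel Picard approximations driven by an abstract noise\<close>

lemma (in prob_space) square_expectation_le:
  fixes X :: "'a \<Rightarrow> real"
  assumes [measurable]: "X \<in> borel_measurable M"
  shows "ennreal ((expectation X)^2) \<le> (\<integral>\<^sup>+\<omega>. ennreal ((X \<omega>)^2) \<partial>M)"
proof (cases "(\<integral>\<^sup>+\<omega>. ennreal ((X \<omega>)^2) \<partial>M) < \<infinity>")
  case True
  then have i2: "integrable M (\<lambda>\<omega>. (X \<omega>)^2)"
    by (intro integrableI_nonneg) auto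
  then have i1: "integrable M X" by (rule square_integrable_imp_integrable[rotated]) simp
  have "(expectation X)^2 \<le> expectation (\<lambda>\<omega>. (X \<omega>)^2)"
    using variance_eq[OF i1 i2] variance_positive[of X] by simp
  then show ?thesis using i2 by (simp add: nn_integral_eq_integral)
qed (simp add: not_less top.extremum_unique)

text \<open>Squared bias plus variance: the variance of a sum of independent terms is the sum of the
  variances, and each of these is at most the second moment.\<close>

lemma (in prob_space) second_moment_sum_indep:
  fixes Z :: "'i \<Rightarrow> 'a \<Rightarrow> real"
  assumes J: "finite J" and ind: "indep_vars (\<lambda>_. borel) Z J"
    and int: "\<And>j. j \<in> J \<Longrightarrow> integrable M (\<lambda>\<omega>. (Z j \<omega>)^2)"
  shows "integrable M (\<lambda>\<omega>. ((\<Sum>j\<in>J. Z j \<omega>) - c)^2)"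
    and "expectation (\<lambda>\<omega>. ((\<Sum>j\<in>J. Z j \<omega>) - c)^2)
      \<le> ((\<Sum>j\<in>J. expectation (Z j)) - c)^2 + (\<Sum>j\<in>J. expectation (\<lambda>\<omega>. (Z j \<omega>)^2))"
proof -
  have Zm: "Z j \<in> borel_measurable M" if "j \<in> J" for j using ind that by (auto simp: indep_vars_def)
  have i1: "integrable M (Z j)" if "j \<in> J" for j
    using square_integrable_imp_integrable[OF Zm int] that by auto
  define m where "m j = expectation (Z j)" for j
  define Y where "Y j \<omega> = Z j \<omega> - m j" for j \<omega>
  define b where "b = (\<Sum>j\<in>J. m j) - c"
  have Yi: "integrable M (Y j)" if "j \<in> J" for j using i1[OF that] by (simp add: Y_def[abs_def])
  have EY: "expectation (Y j) = 0" if "j \<in> J" for j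
    using i1[OF that] by (simp add: Y_def[abs_def] m_def prob_space)
  have Y2: "integrable M (\<lambda>\<omega>. (Y j \<omega>)^2)" if "j \<in> J" for j
    using i1[OF that] int[OF that] by (simp add: Y_def[abs_def] power2_diff)
  have EY2: "expectation (\<lambda>\<omega>. (Y j \<omega>)^2) \<le> expectation (\<lambda>\<omega>. (Z j \<omega>)^2)" if "j \<in> J" for j
    using variance_eq[OF i1[OF that] int[OF that]] by (simp add: Y_def[abs_def] m_def)
  have YYi: "integrable M (\<lambda>\<omega>. Y i \<omega> * Y j \<omega>)" if "i \<in> J" "j \<in> J" for i j
  proof (rule Bochner_Integration.integrable_bound)
    show "integrable M (\<lambda>\<omega>. (Y i \<omega>)^2 + (Y j \<omega>)^2)" using Y2 that by simp
    show "(\<lambda>\<omega>. Y i \<omega> * Y j \<omega>) \<in> borel_measurable M" using Yi that by auto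
    show "AE \<omega> in M. norm (Y i \<omega> * Y j \<omega>) \<le> norm ((Y i \<omega>)^2 + (Y j \<omega>)^2)"
    proof (rule AE_I2)
      fix \<omega>
      have "2 * \<bar>Y i \<omega> * Y j \<omega>\<bar> \<le> (Y i \<omega>)^2 + (Y j \<omega>)^2"
        using sum_squares_bound[of "\<bar>Y i \<omega>\<bar>" "\<bar>Y j \<omega>\<bar>"] by (simp add: abs_mult)
      then show "norm (Y i \<omega> * Y j \<omega>) \<le> norm ((Y i \<omega>)^2 + (Y j \<omega>)^2)" by simp
    qed
  qed
  have EYY: "expectation (\<lambda>\<omega>. Y i \<omega> * Y j \<omega>) = (if i = j then expectation (\<lambda>\<omega>. (Y i \<omega>)^2) else 0)" if "i \<in> J" "j \<in> J" for i j
  proof (cases "i = j")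
    case False
    have "indep_vars (\<lambda>_. borel) Z {i, j}" by (rule indep_vars_subset[OF ind]) (use that in auto)
    then have iv: "indep_vars (\<lambda>_. borel) Y {i, j}"
      unfolding Y_def[abs_def] by (rule indep_vars_compose2[where Y = "\<lambda>j z. z - m j"]) simp
    have "expectation (\<lambda>\<omega>. \<Prod>k\<in>{i, j}. Y k \<omega>) = (\<Prod>k\<in>{i, j}. expectation (Y k))"
    proof (rule indep_vars_lebesgue_integral[OF _ iv])
      show "integrable M (Y k)" if "k \<in> {i, j}" for k using Yi \<open>i \<in> J\<close> \<open>j \<in> J\<close> that by blast
    qed simp
    then show ?thesis using False EY[OF that(1)] by simp
  qed (simp add: power2_eq_square)
  have eq: "((\<Sum>j\<in>J. Z j \<omega>) - c)^2 = b^2 + 2 * b * (\<Sum>j\<in>J. Y j \<omega>) + (\<Sum>i\<in>J. \<Sum>j\<in>J. Y i \<omega> * Y j \<omega>)" for \<omega>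
  proof -
    define A where "A = (\<Sum>j\<in>J. Y j \<omega>)"
    have AA: "A * A = (\<Sum>i\<in>J. \<Sum>j\<in>J. Y i \<omega> * Y j \<omega>)" unfolding A_def by (rule sum_product)
    have "(\<Sum>j\<in>J. Z j \<omega>) - c = b + A" by (simp add: A_def Y_def b_def sum_subtractf)
    then have "((\<Sum>j\<in>J. Z j \<omega>) - c)^2 = b^2 + 2 * b * A + A * A" by (simp add: power2_eq_square algebra_simps)
    then show ?thesis unfolding AA by (simp add: A_def)
  qed
  show "integrable M (\<lambda>\<omega>. ((\<Sum>j\<in>J. Z j \<omega>) - c)^2)"
    unfolding eq using Yi YYi by auto
  have "expectation (\<lambda>\<omega>. ((\<Sum>j\<in>J. Z j \<omega>) - c)^2) =
     b^2 + 2 * b * (\<Sum>j\<in>J. expectation (Y j)) + (\<Sum>i\<in>J. \<Sum>j\<in>J. expectation (\<lambda>\<omega>. Y i \<omega> * Y j \<omega>))"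
    unfolding eq using Yi YYi by (simp add: Bochner_Integration.integral_sum prob_space)
  also have "\<dots> = b^2 + (\<Sum>j\<in>J. expectation (\<lambda>\<omega>. (Y j \<omega>)^2))"
    using J EY EYY by (simp cong: sum.cong)
  also have "\<dots> \<le> b^2 + (\<Sum>j\<in>J. expectation (\<lambda>\<omega>. (Z j \<omega>)^2))"
    by (intro add_left_mono sum_mono EY2)
  finally show "expectation (\<lambda>\<omega>. ((\<Sum>j\<in>J. Z j \<omega>) - c)^2)
      \<le> ((\<Sum>j\<in>J. expectation (Z j)) - c)^2 + (\<Sum>j\<in>J. expectation (\<lambda>\<omega>. (Z j \<omega>)^2))"
    by (simp add: b_def m_def)
qed

text \<open>
  Here \<open>\<nu>\<close> is the law of one noise variable \<open>y\<close>, and \<open>Rf t y\<close>, \<open>Xf t x y\<close>, \<open>XT t x y\<close> are the random time in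
  \<open>{t..T}\<close>, the state at this time and the terminal state of the process started at \<open>(t, x)\<close>.
\<close>

locale mlp =
  fixes T L :: real and f :: "real \<Rightarrow> real" and \<nu> :: "'n measure" and S :: "'s measure"
    and Rf :: "real \<Rightarrow> 'n \<Rightarrow> real" and Xf XT :: "real \<Rightarrow> 's \<Rightarrow> 'n \<Rightarrow> 's"
    and g :: "'s \<Rightarrow> real" and u :: "real \<Rightarrow> 's \<Rightarrow> real" and w :: "'s \<Rightarrow> real" and K G :: real
  assumes T: "T > 0" and f_lipschitz: "L-lipschitz_on UNIV f" and prob_noise: "prob_space \<nu>"
    and Rf_measurable: "(\<lambda>p. Rf (fst p) (snd p)) \<in> borel_measurable (borel \<Otimes>\<^sub>M \<nu>)"
    and Xf_measurable: "(\<lambda>p. Xf (fst p) (fst (snd p)) (snd (snd p))) \<in> measurable (borel \<Otimes>\<^sub>M (S \<Otimes>\<^sub>M \<nu>)) S"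
    and XT_measurable: "(\<lambda>p. XT (fst p) (fst (snd p)) (snd (snd p))) \<in> measurable (borel \<Otimes>\<^sub>M (S \<Otimes>\<^sub>M \<nu>)) S"
    and Rf_range: "\<And>t y. t \<in> {0..T} \<Longrightarrow> y \<in> space \<nu> \<Longrightarrow> Rf t y \<in> {t..T}"
    and g_measurable: "g \<in> borel_measurable S"
    and u_measurable: "(\<lambda>p. u (fst p) (snd p)) \<in> borel_measurable (borel \<Otimes>\<^sub>M S)"
    and w_measurable: "w \<in> borel_measurable S" and w_ge_1: "\<And>x. x \<in> space S \<Longrightarrow> w x \<ge> 1"
    and K: "K \<ge> 0" and G: "G \<ge> 0"
    and w_moment: "\<And>t x \<phi>. t \<in> {0..T} \<Longrightarrow> x \<in> space S \<Longrightarrow> \<phi> \<in> borel_measurable borel \<Longrightarrow>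
      ennreal (T - t) * (\<integral>\<^sup>+y. \<phi> (Rf t y) * ennreal (w (Xf t x y)) \<partial>\<nu>)
        \<le> ennreal (K * w x) * (\<integral>\<^sup>+s. indicator {t..T} s * \<phi> s \<partial>lborel)"
    and g_moment: "\<And>t x. t \<in> {0..T} \<Longrightarrow> x \<in> space S \<Longrightarrow>
      (\<integral>\<^sup>+y. ennreal ((g (XT t x y))^2) \<partial>\<nu>) \<le> ennreal (G * w x)"
    and u_fixpoint: "\<And>t x. t \<in> {0..T} \<Longrightarrow> x \<in> space S \<Longrightarrow>
      u t x = (\<integral>y. g (XT t x y) \<partial>\<nu>) + (T - t) * (\<integral>y. f (u (Rf t y) (Xf t x y)) \<partial>\<nu>)"
begin

sublocale \<nu>: prob_space \<nu> by (rule prob_noise)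

lemma L: "L \<ge> 0" using f_lipschitz by (rule lipschitz_on_nonneg)

lemma f_bound: "\<bar>f a - f b\<bar> \<le> L * \<bar>a - b\<bar>"
  using lipschitz_onD[OF f_lipschitz, of a b] by (simp add: dist_real_def)

lemma f_bound_square: "(f a - f b)^2 \<le> L^2 * (a - b)^2"
proof -
  have "\<bar>f a - f b\<bar>^2 \<le> (L * \<bar>a - b\<bar>)^2" by (intro power_mono f_bound) auto
  then show ?thesis by (simp add: power_mult_distrib)
qed

lemma f_measurable [measurable]: "f \<in> borel_measurable borel"
  using lipschitz_on_continuous_on[OF f_lipschitz] by (rule borel_measurable_continuous_onI)

lemma measurable_Rf:
  "h1 \<in> borel_measurable M \<Longrightarrow> h2 \<in> measurable M \<nu> \<Longrightarrow> (\<lambda>y. Rf (h1 y) (h2 y)) \<in> borel_measurable M"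
  using measurable_compose[OF measurable_Pair Rf_measurable] by simp

lemma measurable_Xf:
  "h1 \<in> borel_measurable M \<Longrightarrow> h2 \<in> measurable M S \<Longrightarrow> h3 \<in> measurable M \<nu> \<Longrightarrow> (\<lambda>y. Xf (h1 y) (h2 y) (h3 y)) \<in> measurable M S"
  using measurable_compose[OF measurable_Pair[OF _ measurable_Pair] Xf_measurable] by simp

lemma measurable_XT:
  "h1 \<in> borel_measurable M \<Longrightarrow> h2 \<in> measurable M S \<Longrightarrow> h3 \<in> measurable M \<nu> \<Longrightarrow> (\<lambda>y. XT (h1 y) (h2 y) (h3 y)) \<in> measurable M S"
  using measurable_compose[OF measurable_Pair[OF _ measurable_Pair] XT_measurable] by simp

lemma measurable_u:
  "h1 \<in> borel_measurable M \<Longrightarrow> h2 \<in> measurable M S \<Longrightarrow> (\<lambda>y. u (h1 y) (h2 y)) \<in> borel_measurable M"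
  using measurable_compose[OF measurable_Pair u_measurable] by simp

lemma measurable_at:
  assumes "x \<in> space S"
  shows "Rf t \<in> borel_measurable \<nu>" "Xf t x \<in> measurable \<nu> S" "XT t x \<in> measurable \<nu> S"
    "(\<lambda>y. u (Rf t y) (Xf t x y)) \<in> borel_measurable \<nu>" "(\<lambda>y. g (XT t x y)) \<in> borel_measurable \<nu>"
proof -
  show 1: "Rf t \<in> borel_measurable \<nu>" by (intro measurable_Rf) auto
  show 2: "Xf t x \<in> measurable \<nu> S" by (intro measurable_Xf) (use assms in auto)
  show 3: "XT t x \<in> measurable \<nu> S" by (intro measurable_XT) (use assms in auto)
  show "(\<lambda>y. u (Rf t y) (Xf t x y)) \<in> borel_measurable \<nu>" by (rule measurable_u[OF 1 2])
  show "(\<lambda>y. g (XT t x y)) \<in> borel_measurable \<nu>" by (rule measurable_compose[OF 3 g_measurable])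
qed

text \<open>\<open>w_moment\<close> for the function exp (\<rho> (T - s)), whose integral over
  [t, T] is at most exp (\<rho> (T - t)) / \<rho>. The exponential weight thus reproduces itself
  with the gain 1 / \<rho>.\<close>

lemma exp_moment:
  assumes t: "t \<in> {0..T}" and x: "x \<in> space S" and \<rho>: "\<rho> > 0"
  shows "ennreal (T - t) * (\<integral>\<^sup>+y. ennreal (exp (\<rho> * (T - Rf t y)) * w (Xf t x y)) \<partial>\<nu>)
    \<le> ennreal (K * w x * exp (\<rho> * (T - t)) / \<rho>)"
proof -
  have "ennreal (T - t) * (\<integral>\<^sup>+y. ennreal (exp (\<rho> * (T - Rf t y)) * w (Xf t x y)) \<partial>\<nu>) =
      ennreal (T - t) * (\<integral>\<^sup>+y. ennreal (exp (\<rho> * (T - Rf t y))) * ennreal (w (Xf t x y)) \<partial>\<nu>)"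
    by (simp add: ennreal_mult')
  also have "\<dots> \<le> ennreal (K * w x) * (\<integral>\<^sup>+s. indicator {t..T} s * ennreal (exp (\<rho> * (T - s))) \<partial>lborel)"
    by (rule w_moment[OF t x]) measurable
  also have "(\<integral>\<^sup>+s. indicator {t..T} s * ennreal (exp (\<rho> * (T - s))) \<partial>lborel) =
      ennreal (- (exp (\<rho> * (T - T)) / \<rho>) - - (exp (\<rho> * (T - t)) / \<rho>))"
    unfolding mult.commute[of "indicator _ _"] using t \<rho>
    by (intro nn_integral_FTC_Icc) (auto intro!: derivative_eq_intros)
  also have "\<dots> \<le> ennreal (exp (\<rho> * (T - t)) / \<rho>)"
    using \<rho> by (intro ennreal_leI) (auto simp: field_simps)
  finally show ?thesis
    using K w_ge_1[OF x] \<rho> by (simp add: ennreal_mult[symmetric] mult_left_mono)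
qed

end

section \<open>A priori bound for the solution of the fixed point equation\<close>

lemma square_add_le: "(a + b)^2 \<le> 2 * a^2 + 2 * (b::real)^2"
  using sum_squares_bound[of a b] by (simp add: power2_sum)

context mlp begin

text \<open>Jensen, the Lipschitz bound and \<open>square_add_le\<close> in the fixed point
  equation. Only one factor of (T - t)^2 in front of the integral is estimated by T; the other one
  is what \<open>w_moment\<close> needs.\<close>

lemma u_square_le_step:
  assumes t: "t \<in> {0..T}" and x: "x \<in> space S"
  shows "ennreal ((u t x)^2) \<le> ennreal ((2 * G + 4 * T^2 * (f 0)^2) * w x)
    + ennreal (4 * T * L^2) * (ennreal (T - t) * (\<integral>\<^sup>+y. ennreal ((u (Rf t y) (Xf t x y))^2) \<partial>\<nu>))"
proof -
  note [measurable] = measurable_at[OF x, of t]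
  let ?I = "\<integral>\<^sup>+y. ennreal ((u (Rf t y) (Xf t x y))^2) \<partial>\<nu>"
  define A where "A = (\<integral>y. g (XT t x y) \<partial>\<nu>)"
  define B where "B = (\<integral>y. f (u (Rf t y) (Xf t x y)) \<partial>\<nu>)"
  have A: "ennreal (A^2) \<le> ennreal (G * w x)"
    unfolding A_def by (rule order_trans[OF \<nu>.square_expectation_le g_moment[OF t x]]) measurable
  have B: "ennreal (B^2) \<le> ennreal (2 * (f 0)^2) + ennreal (2 * L^2) * ?I"
  proof -
    have "ennreal (B^2) \<le> (\<integral>\<^sup>+y. ennreal ((f (u (Rf t y) (Xf t x y)))^2) \<partial>\<nu>)"
      unfolding B_def by (rule \<nu>.square_expectation_le) measurable
    also have "\<dots> \<le> (\<integral>\<^sup>+y. ennreal (2 * (f 0)^2) + ennreal (2 * L^2) * ennreal ((u (Rf t y) (Xf t x y))^2) \<partial>\<nu>)"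
    proof (rule nn_integral_mono)
      fix y
      let ?v = "u (Rf t y) (Xf t x y)"
      have "(f ?v)^2 = (f 0 + (f ?v - f 0))^2" by simp
      also have "\<dots> \<le> 2 * (f 0)^2 + 2 * (f ?v - f 0)^2"
        by (rule square_add_le)
      also have "\<dots> \<le> 2 * (f 0)^2 + 2 * L^2 * ?v^2" using f_bound_square[of ?v 0] by simp
      finally show "ennreal ((f ?v)^2) \<le> ennreal (2 * (f 0)^2) + ennreal (2 * L^2) * ennreal (?v^2)"
        by (simp add: ennreal_mult[symmetric] ennreal_plus[symmetric] ennreal_leI del: ennreal_plus)
    qed
    also have "\<dots> = ennreal (2 * (f 0)^2) + ennreal (2 * L^2) * ?I"
      by (subst nn_integral_add) (auto simp: nn_integral_cmult \<nu>.emeasure_space_1)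
    finally show ?thesis .
  qed
  have tt: "0 \<le> T - t" "T - t \<le> T" "0 < T" using t T by auto
  then have tt2: "(T - t)^2 \<le> T * (T - t)" "(T - t)^2 \<le> T^2"
    by (auto simp: power2_eq_square intro!: mult_mono)
  have "(u t x)^2 = (A + (T - t) * B)^2" unfolding u_fixpoint[OF t x] A_def B_def ..
  also have "\<dots> \<le> 2 * A^2 + 2 * ((T - t) * B)^2"
    by (rule square_add_le)
  also have "\<dots> = 2 * A^2 + 2 * (T - t)^2 * B^2" by (simp add: power_mult_distrib)
  finally have "ennreal ((u t x)^2) \<le> ennreal 2 * ennreal (A^2) + ennreal (2 * (T - t)^2) * ennreal (B^2)"
  proof -
    assume "(u t x)^2 \<le> 2 * A^2 + 2 * (T - t)^2 * B^2"
    then have "ennreal ((u t x)^2) \<le> ennreal (2 * A^2 + 2 * (T - t)^2 * B^2)" by (rule ennreal_leI)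
    also have "\<dots> = ennreal 2 * ennreal (A^2) + ennreal (2 * (T - t)^2) * ennreal (B^2)"
      by (simp add: ennreal_mult mult.assoc)
    finally show ?thesis .
  qed
  also have "\<dots> \<le> ennreal 2 * ennreal (G * w x) + ennreal (2 * (T - t)^2) * (ennreal (2 * (f 0)^2) + ennreal (2 * L^2) * ?I)"
    by (intro add_mono mult_left_mono A B) auto
  also have "\<dots> = ennreal (2 * G * w x + 4 * (T - t)^2 * (f 0)^2) + ennreal (4 * (T - t)^2 * L^2) * ?I"
    using G w_ge_1[OF x] by (simp add: distrib_left ennreal_mult[symmetric] mult.assoc[symmetric] add.assoc[symmetric] ennreal_plus[symmetric] del: ennreal_plus)
      (simp add: ennreal_mult mult_ac)?
  also have "\<dots> \<le> ennreal ((2 * G + 4 * T^2 * (f 0)^2) * w x) + ennreal (4 * T * L^2 * (T - t)) * ?I"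
  proof (intro add_mono mult_right_mono ennreal_leI)
    have "(T - t)^2 * (f 0)^2 \<le> T^2 * (f 0)^2 * 1" using tt2 by (simp add: mult_right_mono)
    also have "T^2 * (f 0)^2 * 1 \<le> T^2 * (f 0)^2 * w x" using w_ge_1[OF x] by (intro mult_left_mono) auto
    finally show "2 * G * w x + 4 * (T - t)^2 * (f 0)^2 \<le> (2 * G + 4 * T^2 * (f 0)^2) * w x"
      by (simp add: algebra_simps)
    have "4 * L^2 * (T - t)^2 \<le> 4 * L^2 * (T * (T - t))" using tt2 by (intro mult_left_mono) auto
    then show "4 * (T - t)^2 * L^2 \<le> 4 * T * L^2 * (T - t)" by (simp add: mult_ac)
  qed auto
  also have "ennreal (4 * T * L^2 * (T - t)) * ?I = ennreal (4 * T * L^2) * (ennreal (T - t) * ?I)"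
    using tt by (simp add: ennreal_mult mult.assoc)
  finally show ?thesis .
qed

text \<open>Each application raises the power of T - t by one and divides by the new exponent;
  iteration produces the factorial.\<close>

lemma power_moment:
  assumes w': "w' \<in> borel_measurable S" "\<And>x. x \<in> space S \<Longrightarrow> w' x \<ge> 0" and K': "K' \<ge> 0"
    and mom: "\<And>t x \<phi>. t \<in> {0..T} \<Longrightarrow> x \<in> space S \<Longrightarrow> \<phi> \<in> borel_measurable borel \<Longrightarrow>
      ennreal (T - t) * (\<integral>\<^sup>+y. \<phi> (Rf t y) * ennreal (w' (Xf t x y)) \<partial>\<nu>)
        \<le> ennreal (K' * w' x) * (\<integral>\<^sup>+s. indicator {t..T} s * \<phi> s \<partial>lborel)"
    and t: "t \<in> {0..T}" and x: "x \<in> space S"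
  shows "ennreal (T - t) * (\<integral>\<^sup>+y. ennreal ((T - Rf t y)^j * w' (Xf t x y)) \<partial>\<nu>)
    \<le> ennreal (K' * w' x * (T - t)^Suc j / real (Suc j))"
proof -
  have "ennreal (T - t) * (\<integral>\<^sup>+y. ennreal ((T - Rf t y)^j * w' (Xf t x y)) \<partial>\<nu>) =
      ennreal (T - t) * (\<integral>\<^sup>+y. ennreal ((T - Rf t y)^j) * ennreal (w' (Xf t x y)) \<partial>\<nu>)"
    using Rf_range[OF t] by (intro arg_cong2[where f = "times"] refl nn_integral_cong ennreal_mult')
      (simp add: zero_le_power)
  also have "\<dots> \<le> ennreal (K' * w' x) * (\<integral>\<^sup>+s. indicator {t..T} s * ennreal ((T - s)^j) \<partial>lborel)"
    by (rule mom[OF t x]) measurable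
  also have "(\<integral>\<^sup>+s. indicator {t..T} s * ennreal ((T - s)^j) \<partial>lborel) =
      ennreal (- ((T - T)^Suc j / real (Suc j)) - - ((T - t)^Suc j / real (Suc j)))"
    unfolding mult.commute[of "indicator _ _"] using t
    by (intro nn_integral_FTC_Icc) (auto intro!: derivative_eq_intros simp del: power_Suc)
  finally show ?thesis
    using K' w'(2)[OF x] t by (simp add: ennreal_mult[symmetric])
qed

text \<open>
  A first bound through a weight \<open>w'\<close> of unspecified growth, whose contribution the iterated time
  integral divides by \<open>j!\<close>, makes it possible to absorb the fixed point term into the weight \<open>w\<close> with
  constants that depend on \<open>w\<close> only.
\<close>

lemma u_square_le:
  assumes w': "w' \<in> borel_measurable S" "\<And>x. x \<in> space S \<Longrightarrow> w' x \<ge> 0" and K': "K' \<ge> 0"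
    and mom: "\<And>t x \<phi>. t \<in> {0..T} \<Longrightarrow> x \<in> space S \<Longrightarrow> \<phi> \<in> borel_measurable borel \<Longrightarrow>
      ennreal (T - t) * (\<integral>\<^sup>+y. \<phi> (Rf t y) * ennreal (w' (Xf t x y)) \<partial>\<nu>)
        \<le> ennreal (K' * w' x) * (\<integral>\<^sup>+s. indicator {t..T} s * \<phi> s \<partial>lborel)"
    and U: "U \<ge> 0" "\<And>t x. t \<in> {0..T} \<Longrightarrow> x \<in> space S \<Longrightarrow> (u t x)^2 \<le> U * w' x"
    and t: "t \<in> {0..T}" and x: "x \<in> space S"
  shows "(u t x)^2 \<le> 2 * (2 * G + 4 * T^2 * (f 0)^2) * exp ((8 * T * L^2 * K + 1) * (T - t)) * w x"
proof -
  \<comment> \<open>With the coefficient \<open>q\<close> of the fixed point term, \<rho> = 2 q K +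
    1, hence q K / \<rho> <= 1 / 2. One half of \<open>A\<close> covers the inhomogeneous term, and
    the other half absorbs the fixed point term.\<close>
  define \<rho> where "\<rho> = 8 * T * L^2 * K + 1"
  define A where "A = 2 * (2 * G + 4 * T^2 * (f 0)^2)"
  define q where "q = 4 * T * L^2"
  define U' where "U' j = U * (q * K')^j / fact j" for j
  have \<rho>: "\<rho> > 0" using T K by (simp add: \<rho>_def add_nonneg_pos)
  have A: "A \<ge> 0" using G by (simp add: A_def)
  have q: "q \<ge> 0" using T by (simp add: q_def)
  have U': "U' j \<ge> 0" for j using U(1) q K' by (simp add: U'_def)
  have main: "(u t x)^2 \<le> A * exp (\<rho> * (T - t)) * w x + U' j * (T - t)^j * w' x" if "t \<in> {0..T}" "x \<in> space S" for j t x
    using that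
  proof (induction j arbitrary: t x)
    case 0
    have "0 \<le> A * exp (\<rho> * (T - t)) * w x" using A w_ge_1[of x] 0 by (intro mult_nonneg_nonneg) auto
    then show ?case using U(2)[of t x] 0 by (simp add: U'_def)
  next
    case (Suc j)
    note t = Suc.prems(1) and x = Suc.prems(2)
    have wx: "w x \<ge> 1" "w' x \<ge> 0" using w_ge_1[OF x] w'(2)[OF x] by auto
    have tt: "0 \<le> T - t" using t by simp
    note [measurable] = measurable_at[OF x, of t]
    have [measurable]: "(\<lambda>y. w (Xf t x y)) \<in> borel_measurable \<nu>" "(\<lambda>y. w' (Xf t x y)) \<in> borel_measurable \<nu>"
      using measurable_compose[OF measurable_at(2)[OF x, of t]] w_measurable w'(1) by auto
    have Xs: "Xf t x y \<in> space S" if "y \<in> space \<nu>" for y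
      using measurable_space[OF measurable_at(2)[OF x] that] .
    have Rs: "Rf t y \<in> {0..T}" if "y \<in> space \<nu>" for y using Rf_range[OF t that] t by auto
    have "(\<integral>\<^sup>+y. ennreal ((u (Rf t y) (Xf t x y))^2) \<partial>\<nu>) \<le>
        (\<integral>\<^sup>+y. ennreal A * ennreal (exp (\<rho> * (T - Rf t y)) * w (Xf t x y)) + ennreal (U' j) * ennreal ((T - Rf t y)^j * w' (Xf t x y)) \<partial>\<nu>)"
    proof (rule nn_integral_mono)
      fix y assume y: "y \<in> space \<nu>"
      have "(u (Rf t y) (Xf t x y))^2 \<le> A * (exp (\<rho> * (T - Rf t y)) * w (Xf t x y)) + U' j * ((T - Rf t y)^j * w' (Xf t x y))"
        using Suc.IH[OF Rs[OF y] Xs[OF y]] by (simp add: mult.assoc)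
      then show "ennreal ((u (Rf t y) (Xf t x y))^2) \<le> ennreal A * ennreal (exp (\<rho> * (T - Rf t y)) * w (Xf t x y)) + ennreal (U' j) * ennreal ((T - Rf t y)^j * w' (Xf t x y))"
        using A U'[of j] w_ge_1[OF Xs[OF y]] w'(2)[OF Xs[OF y]] Rs[OF y]
        by (simp add: ennreal_mult[symmetric] ennreal_plus[symmetric] ennreal_leI del: ennreal_plus)
    qed
    also have "\<dots> = ennreal A * (\<integral>\<^sup>+y. ennreal (exp (\<rho> * (T - Rf t y)) * w (Xf t x y)) \<partial>\<nu>)
        + ennreal (U' j) * (\<integral>\<^sup>+y. ennreal ((T - Rf t y)^j * w' (Xf t x y)) \<partial>\<nu>)"
      by (subst nn_integral_add) (auto simp: nn_integral_cmult)
    finally have "ennreal (T - t) * (\<integral>\<^sup>+y. ennreal ((u (Rf t y) (Xf t x y))^2) \<partial>\<nu>) \<le>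
        ennreal (T - t) * (ennreal A * (\<integral>\<^sup>+y. ennreal (exp (\<rho> * (T - Rf t y)) * w (Xf t x y)) \<partial>\<nu>)
        + ennreal (U' j) * (\<integral>\<^sup>+y. ennreal ((T - Rf t y)^j * w' (Xf t x y)) \<partial>\<nu>))"
      by (rule mult_left_mono) simp
    also have "\<dots> = ennreal A * (ennreal (T - t) * (\<integral>\<^sup>+y. ennreal (exp (\<rho> * (T - Rf t y)) * w (Xf t x y)) \<partial>\<nu>))
        + ennreal (U' j) * (ennreal (T - t) * (\<integral>\<^sup>+y. ennreal ((T - Rf t y)^j * w' (Xf t x y)) \<partial>\<nu>))"
      by (simp add: distrib_left mult_ac)
    also have "\<dots> \<le> ennreal A * ennreal (K * w x * exp (\<rho> * (T - t)) / \<rho>)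
        + ennreal (U' j) * ennreal (K' * w' x * (T - t)^Suc j / real (Suc j))"
      by (intro add_mono mult_left_mono exp_moment[OF t x \<rho>] power_moment[OF w' K' mom t x]) auto
    also have "\<dots> = ennreal (A * (K * w x * exp (\<rho> * (T - t)) / \<rho>) + U' j * (K' * w' x * (T - t)^Suc j / real (Suc j)))"
      using A U'[of j] K K' wx \<rho> tt by (simp add: ennreal_mult[symmetric] ennreal_plus[symmetric] del: ennreal_plus power_Suc of_nat_Suc)
    finally have I: "ennreal (T - t) * (\<integral>\<^sup>+y. ennreal ((u (Rf t y) (Xf t x y))^2) \<partial>\<nu>) \<le>
        ennreal (A * (K * w x * exp (\<rho> * (T - t)) / \<rho>) + U' j * (K' * w' x * (T - t)^Suc j / real (Suc j)))" .
    have A2: "2 * G + 4 * T^2 * (f 0)^2 = A / 2" by (simp add: A_def)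
    have "ennreal ((u t x)^2) \<le> ennreal (A / 2 * w x) + ennreal q *
        (ennreal (T - t) * (\<integral>\<^sup>+y. ennreal ((u (Rf t y) (Xf t x y))^2) \<partial>\<nu>))"
      using u_square_le_step[OF t x] by (simp only: A2 q_def)
    also have "\<dots> \<le> ennreal (A / 2 * w x) + ennreal q *
        ennreal (A * (K * w x * exp (\<rho> * (T - t)) / \<rho>) + U' j * (K' * w' x * (T - t)^Suc j / real (Suc j)))"
      by (intro add_left_mono mult_left_mono I) simp
    also have "\<dots> = ennreal (A / 2 * w x + q * (A * (K * w x * exp (\<rho> * (T - t)) / \<rho>) + U' j * (K' * w' x * (T - t)^Suc j / real (Suc j))))"
      using A U'[of j] K K' wx \<rho> tt q by (simp add: ennreal_mult[symmetric] ennreal_plus[symmetric] del: ennreal_plus power_Suc of_nat_Suc)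
    finally have "(u t x)^2 \<le> A / 2 * w x + q * (A * (K * w x * exp (\<rho> * (T - t)) / \<rho>) + U' j * (K' * w' x * (T - t)^Suc j / real (Suc j)))"
      using A U'[of j] K K' wx \<rho> tt q by (subst (asm) ennreal_le_iff) (auto intro!: add_nonneg_nonneg mult_nonneg_nonneg divide_nonneg_nonneg)
    also have "\<dots> \<le> A * exp (\<rho> * (T - t)) * w x + U' (Suc j) * (T - t)^Suc j * w' x"
    proof -
      have e: "exp (\<rho> * (T - t)) \<ge> 1" using \<rho> tt by simp
      have "A / 2 * w x * 1 \<le> A / 2 * w x * exp (\<rho> * (T - t))" using A wx e by (intro mult_left_mono) auto
      moreover have "q * (A * (K * w x * exp (\<rho> * (T - t)) / \<rho>)) \<le> A / 2 * w x * exp (\<rho> * (T - t))"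
      proof -
        have "q * K / \<rho> \<le> 1 / 2" using \<rho> by (simp add: field_simps) (simp add: q_def \<rho>_def)
        then have "(q * K / \<rho>) * (A * w x * exp (\<rho> * (T - t))) \<le> 1 / 2 * (A * w x * exp (\<rho> * (T - t)))"
          using A wx by (intro mult_right_mono) auto
        then show ?thesis by (simp add: mult_ac)
      qed
      moreover have "q * (U' j * (K' * w' x * (T - t)^Suc j / real (Suc j))) = U' (Suc j) * (T - t)^Suc j * w' x"
        by (simp add: U'_def field_simps)
      moreover have "A * exp (\<rho> * (T - t)) * w x = A / 2 * w x * exp (\<rho> * (T - t)) + A / 2 * w x * exp (\<rho> * (T - t))"
        by (simp add: mult_ac)
      ultimately show ?thesis unfolding distrib_left by linarith
    qed
    finally show ?case .
  qed
  \<comment> \<open>As j grows, the term with \<open>w'\<close> vanishes, and with it every constant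
    that depends on \<open>w'\<close>.\<close>
  have "(\<lambda>j. A * exp (\<rho> * (T - t)) * w x + U * w' x * ((q * K' * (T - t))^j / fact j)) \<longlonglongrightarrow> A * exp (\<rho> * (T - t)) * w x + U * w' x * 0"
    using summable_LIMSEQ_zero[OF summable_exp[of "q * K' * (T - t)"]] by (intro tendsto_intros) (simp add: field_simps)
  moreover have "(u t x)^2 \<le> A * exp (\<rho> * (T - t)) * w x + U * w' x * ((q * K' * (T - t))^j / fact j)" for j
    using main[OF t x, of j] by (simp add: U'_def power_mult_distrib mult_ac)
  ultimately have "(u t x)^2 \<le> A * exp (\<rho> * (T - t)) * w x + U * w' x * 0"
    by (intro LIMSEQ_le_const) auto
  then show ?thesis by (simp add: A_def \<rho>_def)
qed

text \<open>
  The approximations on the canonical space of the noise: the one with index \<open>\<theta>\<close> is \<open>Phi\<close> evaluated at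
  the noise variables indexed by the extensions of \<open>\<theta>\<close>.
\<close>

definition shift :: "int list \<Rightarrow> (int list \<Rightarrow> 'n) \<Rightarrow> int list \<Rightarrow> 'n" where
  "shift \<eta> z = (\<lambda>\<zeta>\<in>index_set. z (\<eta> @ \<zeta>))"

function Phi :: "nat \<Rightarrow> nat \<Rightarrow> real \<Rightarrow> 's \<Rightarrow> (int list \<Rightarrow> 'n) \<Rightarrow> real" where
  "Phi M n t x z = (if n = 0 then 0 else
     (\<Sum>k<n. (T - t) / real M ^ (n - k) * (\<Sum>m=1..M ^ (n - k).
        f (Phi M k (Rf t (z [int k, int m])) (Xf t x (z [int k, int m])) (shift [int k, int m] z))
        - (if k = 0 then 0 else
           f (Phi M (k - 1) (Rf t (z [int k, int m])) (Xf t x (z [int k, int m])) (shift [int k, - int m] z)))))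
     + (\<Sum>m=1..M ^ n. g (XT t x (z [int n, - int m])) / real M ^ n))"
  by pat_completeness auto
termination by (relation "Wellfounded.measure (\<lambda>(M, n, _). n)") auto

declare Phi.simps [simp del]

abbreviation \<N> :: "(int list \<Rightarrow> 'n) measure" where
  "\<N> \<equiv> PiM index_set (\<lambda>_. \<nu>)"

sublocale Pi: prob_space \<N> by (intro prob_space_PiM prob_noise)

lemma pair_index [simp]: "[a, b] \<in> index_set" "\<eta> @ [a, b] \<in> index_set"
  by (auto simp: index_set_def)

lemma append_index [simp]: "\<zeta> \<in> index_set \<Longrightarrow> \<eta> @ \<zeta> \<in> index_set"
  by (auto simp: index_set_def)

lemma measurable_shift:
  assumes "\<And>\<zeta>. \<zeta> \<in> index_set \<Longrightarrow> \<eta> @ \<zeta> \<in> B"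
  shows "shift \<eta> \<in> measurable (PiM B (\<lambda>_. \<nu>)) \<N>"
  unfolding shift_def[abs_def] using assms by (intro measurable_restrict measurable_component_singleton)

lemma measurable_Phi_pair:
  "(\<lambda>p. Phi M n (fst p) (fst (snd p)) (snd (snd p))) \<in> borel_measurable (borel \<Otimes>\<^sub>M (S \<Otimes>\<^sub>M \<N>))"
proof (induction n rule: less_induct)
  case (less n)
  let ?N = "borel \<Otimes>\<^sub>M (S \<Otimes>\<^sub>M \<N>)"
  have t: "fst \<in> borel_measurable ?N" by simp
  have x: "(\<lambda>p. fst (snd p)) \<in> measurable ?N S" by simp
  have zz: "(\<lambda>p. snd (snd p)) \<in> measurable ?N \<N>" by simp
  have z: "(\<lambda>p. snd (snd p) [a, b]) \<in> measurable ?N \<nu>" for a b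
    by (rule measurable_compose[OF zz measurable_component_singleton]) simp
  have sh: "(\<lambda>p. shift [a, b] (snd (snd p))) \<in> measurable ?N \<N>" for a b
    by (rule measurable_compose[OF zz measurable_shift]) (simp add: index_set_def)
  have step: "(\<lambda>p. f (Phi M k (Rf (fst p) (snd (snd p) [a, b])) (Xf (fst p) (fst (snd p)) (snd (snd p) [a, b])) (shift [c, e] (snd (snd p)))))
      \<in> borel_measurable ?N" if "k < n" for k a b c e
  proof -
    have "(\<lambda>p. (Rf (fst p) (snd (snd p) [a, b]), (Xf (fst p) (fst (snd p)) (snd (snd p) [a, b]), shift [c, e] (snd (snd p))))) \<in> measurable ?N ?N"
      by (intro measurable_Pair measurable_Rf measurable_Xf t x z sh)
    from measurable_compose[OF this measurable_compose[OF less[OF that] f_measurable]] show ?thesis by simp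
  qed
  show ?case
  proof (cases "n = 0")
    case False
    have "(\<lambda>p. g (XT (fst p) (fst (snd p)) (snd (snd p) [a, b]))) \<in> borel_measurable ?N" for a b
      by (intro measurable_compose[OF measurable_XT g_measurable] t x z)
    moreover have "(\<lambda>p. if k = 0 then 0 else
        f (Phi M (k - 1) (Rf (fst p) (snd (snd p) [a, b])) (Xf (fst p) (fst (snd p)) (snd (snd p) [a, b])) (shift [c, e] (snd (snd p)))))
      \<in> borel_measurable ?N" if "k < n" for k a b c e
      using that by (cases "k = 0") (auto intro: step)
    ultimately show ?thesis
      using False t by (subst Phi.simps)
        (auto intro!: borel_measurable_add borel_measurable_sum borel_measurable_times borel_measurable_diff
          borel_measurable_divide step)
  qed (simp add: Phi.simps)
qed

lemma measurable_Phi: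
  assumes "h1 \<in> borel_measurable N" "h2 \<in> measurable N S" "h3 \<in> measurable N \<N>"
  shows "(\<lambda>y. Phi M n (h1 y) (h2 y) (h3 y)) \<in> borel_measurable N"
  using measurable_compose[OF measurable_Pair[OF assms(1) measurable_Pair[OF assms(2,3)]] measurable_Phi_pair] by simp

lemma distr_coordinate: "i \<in> index_set \<Longrightarrow> distr \<N> \<nu> (\<lambda>z. z i) = \<nu>"
  using distr_PiM_component[of index_set "\<lambda>_. \<nu>" i] prob_noise by simp

lemma indep_coordinates: "Pi.indep_vars (\<lambda>_. \<nu>) (\<lambda>i z. z i) index_set"
proof -
  have ne: "index_set \<noteq> {}" by (auto simp: index_set_def)
  have "distr \<N> \<N> (\<lambda>z. \<lambda>i\<in>index_set. z i) = distr \<N> \<N> (\<lambda>z. z)"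
    by (rule distr_cong) (auto simp: space_PiM PiE_iff extensional_restrict)
  also have "\<dots> = \<N>" by simp
  also have "\<N> = PiM index_set (\<lambda>i. distr \<N> \<nu> (\<lambda>z. z i))"
    by (intro PiM_cong refl) (simp add: distr_coordinate)
  finally show ?thesis
    by (subst Pi.indep_vars_iff_distr_eq_PiM'[OF ne]) auto
qed

lemma distr_shift: "distr \<N> \<N> (shift \<eta>) = \<N>"
  unfolding shift_def[abs_def] using prob_noise
  by (intro distr_PiM_reindex[where M = "\<lambda>_. \<nu>", simplified]) (auto simp: inj_on_def)

text \<open>If \<eta> is not an extension of \<open>\<eta>'\<close>, then the coordinate and the
  shift read disjoint sets of independent coordinates. Hence the random time and state are
  independent of the approximation evaluated there.\<close>

lemma distr_coordinate_shift:
  assumes \<eta>: "\<eta> \<in> index_set" "\<And>\<zeta>. \<zeta> \<in> index_set \<Longrightarrow> \<eta> \<noteq> \<eta>' @ \<zeta>"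
  shows "distr \<N> (\<nu> \<Otimes>\<^sub>M \<N>) (\<lambda>z. (z \<eta>, shift \<eta>' z)) = \<nu> \<Otimes>\<^sub>M \<N>"
proof -
  let ?B = "(@) \<eta>' ` index_set"
  let ?P1 = "PiM {\<eta>} (\<lambda>_. \<nu>)"
  have sub: "{\<eta>} \<subseteq> index_set" "?B \<subseteq> index_set" "{\<eta>} \<inter> ?B = {}" using \<eta> by auto
  have m1: "(\<lambda>z. restrict (\<lambda>i. z i) {\<eta>}) \<in> measurable \<N> ?P1"
    using \<eta>(1) by (intro measurable_restrict measurable_component_singleton) auto
  have m2: "shift \<eta>' \<in> measurable \<N> \<N>" by (rule measurable_shift) simp
  have "Pi.indep_var ?P1 ((\<lambda>a. a) \<circ> (\<lambda>z. restrict (\<lambda>i. z i) {\<eta>})) \<N> (shift \<eta>' \<circ> (\<lambda>z. restrict (\<lambda>i. z i) ?B))"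
    by (rule Pi.indep_var_compose[OF Pi.indep_var_restrict[OF indep_coordinates sub(3,1,2)]])
      (auto intro!: measurable_shift)
  moreover have "shift \<eta>' \<circ> (\<lambda>z. restrict (\<lambda>i. z i) ?B) = shift \<eta>'"
    by (auto simp: shift_def fun_eq_iff)
  ultimately have "Pi.indep_var ?P1 (\<lambda>z. restrict (\<lambda>i. z i) {\<eta>}) \<N> (shift \<eta>')"
    by (simp add: comp_def)
  then have D: "distr \<N> ?P1 (\<lambda>z. restrict (\<lambda>i. z i) {\<eta>}) \<Otimes>\<^sub>M \<N> =
      distr \<N> (?P1 \<Otimes>\<^sub>M \<N>) (\<lambda>z. (restrict (\<lambda>i. z i) {\<eta>}, shift \<eta>' z))"
    unfolding Pi.indep_var_distribution_eq distr_shift by simp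
  let ?D1 = "distr \<N> ?P1 (\<lambda>z. restrict (\<lambda>i. z i) {\<eta>})"
  have c1: "(\<lambda>a. a \<eta>) \<in> measurable ?P1 \<nu>" by (rule measurable_component_singleton) simp
  have "distr \<N> (\<nu> \<Otimes>\<^sub>M \<N>) (\<lambda>z. (z \<eta>, shift \<eta>' z)) =
     distr (distr \<N> (?P1 \<Otimes>\<^sub>M \<N>) (\<lambda>z. (restrict (\<lambda>i. z i) {\<eta>}, shift \<eta>' z))) (\<nu> \<Otimes>\<^sub>M \<N>) (\<lambda>(a, b). (a \<eta>, b))"
  proof (subst distr_distr)
    show "(\<lambda>(a, b). (a \<eta>, b)) \<in> measurable (?P1 \<Otimes>\<^sub>M \<N>) (\<nu> \<Otimes>\<^sub>M \<N>)"
      using measurable_compose[OF measurable_fst c1] by (auto simp: case_prod_unfold intro!: measurable_Pair)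
    show "(\<lambda>z. (restrict (\<lambda>i. z i) {\<eta>}, shift \<eta>' z)) \<in> measurable \<N> (?P1 \<Otimes>\<^sub>M \<N>)"
      by (intro measurable_Pair m1 m2)
  qed (simp add: comp_def)
  also have "\<dots> = distr (?D1 \<Otimes>\<^sub>M \<N>) (\<nu> \<Otimes>\<^sub>M \<N>) (\<lambda>(a, b). (a \<eta>, b))" unfolding D ..
  also have "\<dots> = distr ?D1 \<nu> (\<lambda>a. a \<eta>) \<Otimes>\<^sub>M distr \<N> \<N> (\<lambda>b. b)"
    using c1 Pi.sigma_finite_measure_axioms by (intro pair_measure_distr[symmetric]) (auto simp: measurable_distr_eq1)
  also have "distr ?D1 \<nu> (\<lambda>a. a \<eta>) = \<nu>"
    using m1 c1 \<eta>(1) by (subst distr_distr) (auto simp: comp_def distr_coordinate)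
  finally show ?thesis by simp
qed

end

section \<open>Bias and variance of a level\<close>

context mlp begin

text \<open>The pair \<open>p\<close> separates two independent sources of randomness: the noise
  variable behind the time and the state, and the noise that drives the lower approximation.\<close>

definition FP where
  "FP M k t x p = Phi M k (Rf t (fst p)) (Xf t x (fst p)) (snd p)"

text \<open>An integral in \<open>ennreal\<close>, so that it is meaningful before finiteness is
  known; finiteness comes out of the induction in \<open>mlp_error\<close>.\<close>

definition e2 where
  "e2 M n t x = (\<integral>\<^sup>+z. ennreal ((Phi M n t x z - u t x)^2) \<partial>\<N>)"

lemma measurable_FP:
  assumes x: "x \<in> space S" and h: "h1 \<in> measurable N \<nu>" "h2 \<in> measurable N \<N>"
  shows "(\<lambda>z. FP M k t x (h1 z, h2 z)) \<in> borel_measurable N"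
  unfolding FP_def fst_conv snd_conv
  by (intro measurable_Phi measurable_compose[OF h(1) measurable_at(1)[OF x]] measurable_compose[OF h(1) measurable_at(2)[OF x]] h(2))

lemma measurable_FP_pair: "x \<in> space S \<Longrightarrow> FP M k t x \<in> borel_measurable (\<nu> \<Otimes>\<^sub>M \<N>)"
  using measurable_FP[of x fst "\<nu> \<Otimes>\<^sub>M \<N>" snd] by simp

text \<open>Shifts read extensions by nonempty lists, so an index of length two is never among them,
  even if the two pairs coincide.\<close>

lemma pair_neq_append: "\<zeta> \<in> index_set \<Longrightarrow> [a, b] \<noteq> [c, e] @ \<zeta>"
  by (auto simp: index_set_def)

lemma measurable_coordinate_shift: "(\<lambda>z. (z [a, b], shift [c, e] z)) \<in> measurable \<N> (\<nu> \<Otimes>\<^sub>M \<N>)"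
  by (intro measurable_Pair measurable_component_singleton measurable_shift) (auto simp: index_set_def)

lemma nn_integral_coordinate_shift:
  assumes "h \<in> borel_measurable (\<nu> \<Otimes>\<^sub>M \<N>)"
  shows "(\<integral>\<^sup>+z. h (z [a, b], shift [c, e] z) \<partial>\<N>) = (\<integral>\<^sup>+y. (\<integral>\<^sup>+z. h (y, z) \<partial>\<N>) \<partial>\<nu>)"
proof -
  have "(\<integral>\<^sup>+z. h (z [a, b], shift [c, e] z) \<partial>\<N>) = (\<integral>\<^sup>+p. h p \<partial>distr \<N> (\<nu> \<Otimes>\<^sub>M \<N>) (\<lambda>z. (z [a, b], shift [c, e] z)))"
    using measurable_coordinate_shift[of a b c e] assms by (simp add: nn_integral_distr)
  also have "\<dots> = (\<integral>\<^sup>+p. h p \<partial>(\<nu> \<Otimes>\<^sub>M \<N>))"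
    by (subst distr_coordinate_shift) (use pair_neq_append in auto)
  also have "\<dots> = (\<integral>\<^sup>+y. (\<integral>\<^sup>+z. h (y, z) \<partial>\<N>) \<partial>\<nu>)"
    using assms by (rule Pi.nn_integral_fst[symmetric])
  finally show ?thesis .
qed

text \<open>Once the time and the state are frozen, the remaining error is the mean square error of
  the lower level at that point. The pairs in the index are arbitrary, which covers both
  approximations in a level difference.\<close>

lemma e2_frozen:
  assumes x: "x \<in> space S"
  shows "(\<integral>\<^sup>+p. ennreal ((FP M k t x p - u (Rf t (fst p)) (Xf t x (fst p)))^2) \<partial>(\<nu> \<Otimes>\<^sub>M \<N>))
      = (\<integral>\<^sup>+y. e2 M k (Rf t y) (Xf t x y) \<partial>\<nu>)"
    and "(\<integral>\<^sup>+z. ennreal ((FP M k t x (z [a, b], shift [c, e] z) - u (Rf t (z [a, b])) (Xf t x (z [a, b])))^2) \<partial>\<N>)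
      = (\<integral>\<^sup>+y. e2 M k (Rf t y) (Xf t x y) \<partial>\<nu>)"
proof -
  let ?h = "\<lambda>p. ennreal ((FP M k t x p - u (Rf t (fst p)) (Xf t x (fst p)))^2)"
  have h: "?h \<in> borel_measurable (\<nu> \<Otimes>\<^sub>M \<N>)"
    by (intro measurable_compose[OF _ measurable_ennreal] borel_measurable_power borel_measurable_diff
        measurable_FP_pair[OF x] measurable_compose[OF measurable_fst measurable_at(4)[OF x]])
  show "(\<integral>\<^sup>+p. ?h p \<partial>(\<nu> \<Otimes>\<^sub>M \<N>)) = (\<integral>\<^sup>+y. e2 M k (Rf t y) (Xf t x y) \<partial>\<nu>)"
    using Pi.nn_integral_fst[OF h] by (simp add: e2_def FP_def)
  show "(\<integral>\<^sup>+z. ennreal ((FP M k t x (z [a, b], shift [c, e] z) - u (Rf t (z [a, b])) (Xf t x (z [a, b])))^2) \<partial>\<N>)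
      = (\<integral>\<^sup>+y. e2 M k (Rf t y) (Xf t x y) \<partial>\<nu>)"
    using nn_integral_coordinate_shift[OF h] by (simp add: e2_def FP_def)
qed

definition Dt where
  "Dt M t x k m z = f (FP M k t x (z [int k, int m], shift [int k, int m] z))
     - (if k = 0 then 0 else f (FP M (k - 1) t x (z [int k, int m], shift [int k, - int m] z)))"

definition Zt where
  "Zt M n t x j z = (if fst j < n then (T - t) / real M ^ (n - fst j) * Dt M t x (fst j) (snd j) z
     else g (XT t x (z [int n, - int (snd j)])) / real M ^ n)"

text \<open>A pair (k, m) with k < n stands for the m-th sample of the difference between the levels
  k and k - 1, and (n, m) for the m-th sample of the terminal value.\<close>

definition terms :: "nat \<Rightarrow> nat \<Rightarrow> (nat \<times> nat) set" where
  "terms M n = Sigma {..<Suc n} (\<lambda>k. {1..M ^ (if k < n then n - k else n)})"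

lemma finite_terms: "finite (terms M n)"
  by (simp add: terms_def)

lemma sum_terms: "(\<Sum>j\<in>terms M n. h j) = (\<Sum>k<n. \<Sum>m=1..M ^ (n - k). h (k, m)) + (\<Sum>m=1..M ^ n. h (n, m))"
proof -
  have "(\<Sum>j\<in>terms M n. h j) = (\<Sum>k<Suc n. \<Sum>m=1..M ^ (if k < n then n - k else n). h (k, m))"
    unfolding terms_def by (subst sum.Sigma) auto
  then show ?thesis by simp
qed

lemma Phi_eq_sum:
  assumes "n > 0"
  shows "Phi M n t x z = (\<Sum>j\<in>terms M n. Zt M n t x j z)"
  using assms by (subst Phi.simps) (simp add: sum_terms Zt_def Dt_def FP_def sum_distrib_left cong: if_cong)

text \<open>
  The summand with index \<open>j\<close> depends only on the noise variables in \<open>block j\<close>, and these blocks are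
  disjoint.
\<close>

definition block :: "nat \<times> nat \<Rightarrow> int list set" where
  "block j = {\<eta>. \<exists>r. \<eta> = int (fst j) # int (snd j) # r \<or> \<eta> = int (fst j) # (- int (snd j)) # r}"

text \<open>Measurability with respect to the coordinates in \<open>B\<close> alone, as is needed to
  deduce independence from disjoint blocks.\<close>

lemma measurable_Zt:
  assumes x: "x \<in> space S" and n: "fst j \<le> n" and B: "block j \<subseteq> B"
  shows "Zt M n t x j \<in> borel_measurable (PiM B (\<lambda>_. \<nu>))"
proof -
  obtain k m where j: "j = (k, m)" by (cases j)
  have z: "(\<lambda>z. z [int k, int m]) \<in> measurable (PiM B (\<lambda>_. \<nu>)) \<nu>" "(\<lambda>z. z [int k, - int m]) \<in> measurable (PiM B (\<lambda>_. \<nu>)) \<nu>"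
    using B by (auto simp: block_def j intro!: measurable_component_singleton)
  have sh: "shift [int k, int m] \<in> measurable (PiM B (\<lambda>_. \<nu>)) \<N>" "shift [int k, - int m] \<in> measurable (PiM B (\<lambda>_. \<nu>)) \<N>"
    using B by (auto simp: block_def j intro!: measurable_shift)
  have D: "Dt M t x k m \<in> borel_measurable (PiM B (\<lambda>_. \<nu>))"
  proof -
    have "(\<lambda>z. f (FP M k t x (z [int k, int m], shift [int k, int m] z))) \<in> borel_measurable (PiM B (\<lambda>_. \<nu>))"
      "(\<lambda>z. f (FP M (k - 1) t x (z [int k, int m], shift [int k, - int m] z))) \<in> borel_measurable (PiM B (\<lambda>_. \<nu>))"
      by (intro measurable_compose[OF _ f_measurable] measurable_FP x z sh)+
    then show ?thesis by (cases "k = 0") (simp_all add: Dt_def[abs_def])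
  qed
  show ?thesis
  proof (cases "k < n")
    case True
    then show ?thesis using D by (simp add: Zt_def[abs_def] j)
  next
    case False
    then have "k = n" using n j by simp
    then show ?thesis
      using measurable_compose[OF z(2) measurable_at(5)[OF x]] by (simp add: Zt_def[abs_def] j)
  qed
qed

lemma Zt_restrict:
  assumes "fst j \<le> n"
  shows "Zt M n t x j (restrict z (block j)) = Zt M n t x j z"
proof -
  obtain k m where j: "j = (k, m)" by (cases j)
  have "[int k, int m] \<in> block j" "[int k, - int m] \<in> block j" by (auto simp: block_def j)
  moreover have "shift [int k, int m] (restrict z (block j)) = shift [int k, int m] z"
    "shift [int k, - int m] (restrict z (block j)) = shift [int k, - int m] z"
    by (auto simp: shift_def block_def j fun_eq_iff)
  ultimately show ?thesis using assms by (auto simp: Zt_def Dt_def j)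
qed

lemma indep_terms:
  assumes x: "x \<in> space S"
  shows "Pi.indep_vars (\<lambda>_. borel) (Zt M n t x) (terms M n)"
proof -
  have "Pi.indep_vars (\<lambda>j. PiM (block j) (\<lambda>_. \<nu>)) (\<lambda>j z. restrict (\<lambda>i. z i) (block j)) (terms M n)"
  proof (rule Pi.indep_vars_restrict[OF indep_coordinates])
    show "block j \<subseteq> index_set" for j by (auto simp: block_def index_set_def)
    \<comment> \<open>The lists in different blocks differ in the first entry or in the modulus of
      the second.\<close>
    show "disjoint_family_on block (terms M n)"
      by (auto simp: disjoint_family_on_def block_def terms_def)
  qed
  then have "Pi.indep_vars (\<lambda>_. borel) (\<lambda>j z. Zt M n t x j (restrict (\<lambda>i. z i) (block j))) (terms M n)"
    by (rule Pi.indep_vars_compose2) (auto simp: terms_def intro!: measurable_Zt[OF x])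
  then show ?thesis
    by (subst (asm) Pi.indep_vars_cong[OF refl _ refl]) (auto simp: terms_def Zt_restrict)
qed

text \<open>Both approximations are evaluated at the same random time and state, so u at this point
  can be inserted between them: consecutive levels are close to each other because each is close to
  u.\<close>

lemma Dt_second_moment:
  assumes x: "x \<in> space S" and k: "k > 0"
  shows "(\<integral>\<^sup>+z. ennreal ((Dt M t x k m z)^2) \<partial>\<N>) \<le>
    ennreal (2 * L^2) * ((\<integral>\<^sup>+y. e2 M k (Rf t y) (Xf t x y) \<partial>\<nu>) + (\<integral>\<^sup>+y. e2 M (k - 1) (Rf t y) (Xf t x y) \<partial>\<nu>))"
proof -
  let ?y = "\<lambda>z. z [int k, int m]"
  let ?a = "\<lambda>z. FP M k t x (?y z, shift [int k, int m] z)"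
  let ?b = "\<lambda>z. FP M (k - 1) t x (?y z, shift [int k, - int m] z)"
  let ?c = "\<lambda>z. u (Rf t (?y z)) (Xf t x (?y z))"
  have y: "?y \<in> measurable \<N> \<nu>" by (rule measurable_component_singleton) simp
  have sh: "shift [int k, q] \<in> measurable \<N> \<N>" for q by (rule measurable_shift) (simp add: index_set_def)
  have [measurable]: "?a \<in> borel_measurable \<N>" "?b \<in> borel_measurable \<N>" "?c \<in> borel_measurable \<N>"
    using measurable_FP[OF x y sh] measurable_compose[OF y measurable_at(4)[OF x]] by auto
  have "(\<integral>\<^sup>+z. ennreal ((Dt M t x k m z)^2) \<partial>\<N>) \<le>
      (\<integral>\<^sup>+z. ennreal (2 * L^2) * ennreal ((?a z - ?c z)^2) + ennreal (2 * L^2) * ennreal ((?b z - ?c z)^2) \<partial>\<N>)"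
  proof (rule nn_integral_mono)
    fix z
    have "Dt M t x k m z = (f (?a z) - f (?c z)) + - (f (?b z) - f (?c z))" using k by (simp add: Dt_def)
    then have "(Dt M t x k m z)^2 \<le> 2 * (f (?a z) - f (?c z))^2 + 2 * (- (f (?b z) - f (?c z)))^2"
      using square_add_le by metis
    also have "\<dots> = 2 * (f (?a z) - f (?c z))^2 + 2 * (f (?b z) - f (?c z))^2" by (simp only: power2_minus)
    also have "\<dots> \<le> 2 * (L^2 * (?a z - ?c z)^2) + 2 * (L^2 * (?b z - ?c z)^2)"
      by (intro add_mono mult_left_mono f_bound_square) auto
    finally have "ennreal ((Dt M t x k m z)^2) \<le> ennreal (2 * (L^2 * (?a z - ?c z)^2) + 2 * (L^2 * (?b z - ?c z)^2))"
      by (rule ennreal_leI)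
    also have "\<dots> = ennreal (2 * L^2) * ennreal ((?a z - ?c z)^2) + ennreal (2 * L^2) * ennreal ((?b z - ?c z)^2)"
      by (simp add: ennreal_mult mult.assoc)
    finally show "ennreal ((Dt M t x k m z)^2) \<le> ennreal (2 * L^2) * ennreal ((?a z - ?c z)^2) + ennreal (2 * L^2) * ennreal ((?b z - ?c z)^2)" .
  qed
  also have "\<dots> = ennreal (2 * L^2) * (\<integral>\<^sup>+z. ennreal ((?a z - ?c z)^2) \<partial>\<N>) + ennreal (2 * L^2) * (\<integral>\<^sup>+z. ennreal ((?b z - ?c z)^2) \<partial>\<N>)"
    by (subst nn_integral_add) (auto simp: nn_integral_cmult)
  finally show ?thesis unfolding e2_frozen(2)[OF x] by (simp add: distrib_left)
qed

text \<open>The bias is the expectation of a difference of f at the approximation and at u, so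
  Jensen bounds its square by the mean square error of level k. The finiteness assumptions give both
  expectations a meaning separately.\<close>

lemma bias_bound:
  assumes x: "x \<in> space S"
    and fin: "(\<integral>\<^sup>+y. e2 M k (Rf t y) (Xf t x y) \<partial>\<nu>) < \<infinity>"
    and finu: "(\<integral>\<^sup>+y. ennreal ((u (Rf t y) (Xf t x y))^2) \<partial>\<nu>) < \<infinity>"
  shows "integrable (\<nu> \<Otimes>\<^sub>M \<N>) (\<lambda>p. f (FP M k t x p))"
    and "ennreal (((\<integral>p. f (FP M k t x p) \<partial>(\<nu> \<Otimes>\<^sub>M \<N>)) - (\<integral>y. f (u (Rf t y) (Xf t x y)) \<partial>\<nu>))^2)
      \<le> ennreal (L^2) * (\<integral>\<^sup>+y. e2 M k (Rf t y) (Xf t x y) \<partial>\<nu>)"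
proof -
  interpret P: pair_prob_space \<nu> \<N> ..
  let ?Q = "\<nu> \<Otimes>\<^sub>M \<N>"
  let ?a = "\<lambda>p. f (FP M k t x p)"
  let ?c = "\<lambda>p. f (u (Rf t (fst p)) (Xf t x (fst p)))"
  have um: "(\<lambda>y. u (Rf t y) (Xf t x y)) \<in> borel_measurable \<nu>" by (rule measurable_at(4)[OF x])
  have [measurable]: "?a \<in> borel_measurable ?Q" "?c \<in> borel_measurable ?Q" "FP M k t x \<in> borel_measurable ?Q"
     "(\<lambda>p. u (Rf t (fst p)) (Xf t x (fst p))) \<in> borel_measurable ?Q"
    using measurable_compose[OF measurable_FP_pair[OF x] f_measurable] measurable_FP_pair[OF x]
      measurable_compose[OF measurable_fst measurable_compose[OF um f_measurable]] measurable_compose[OF measurable_fst um] by auto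
  have am: "?a \<in> borel_measurable ?Q"
    by (rule measurable_compose[OF measurable_FP_pair[OF x] f_measurable])
  have cm: "?c \<in> borel_measurable ?Q"
    by (rule measurable_compose[OF measurable_fst measurable_compose[OF um f_measurable]])
  have le: "(\<integral>\<^sup>+p. ennreal ((?a p - ?c p)^2) \<partial>?Q) \<le> ennreal (L^2) * (\<integral>\<^sup>+y. e2 M k (Rf t y) (Xf t x y) \<partial>\<nu>)"
  proof -
    have "(\<integral>\<^sup>+p. ennreal ((?a p - ?c p)^2) \<partial>?Q) \<le>
        (\<integral>\<^sup>+p. ennreal (L^2) * ennreal ((FP M k t x p - u (Rf t (fst p)) (Xf t x (fst p)))^2) \<partial>?Q)"
      by (intro nn_integral_mono) (simp add: ennreal_mult[symmetric] ennreal_leI f_bound_square)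
    also have "\<dots> = ennreal (L^2) * (\<integral>\<^sup>+y. e2 M k (Rf t y) (Xf t x y) \<partial>\<nu>)"
      by (subst nn_integral_cmult) (auto simp: e2_frozen(1)[OF x])
    finally show ?thesis .
  qed
  have i1: "integrable ?Q (\<lambda>p. ?a p - ?c p)"
  proof -
    have "(\<integral>\<^sup>+p. ennreal ((?a p - ?c p)^2) \<partial>?Q) < \<infinity>"
      by (rule order.strict_trans1[OF le]) (use fin in \<open>simp add: ennreal_mult_less_top\<close>)
    then have "integrable ?Q (\<lambda>p. (?a p - ?c p)^2)"
      by (rule integrableI_nonneg[rotated 2]) (intro borel_measurable_power borel_measurable_diff am cm, rule AE_I2, rule zero_le_power2)
    then show ?thesis by (rule P.square_integrable_imp_integrable[rotated]) (intro borel_measurable_diff am cm)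
  qed
  have i2: "integrable \<nu> (\<lambda>y. f (u (Rf t y) (Xf t x y)))"
  proof -
    have "integrable \<nu> (\<lambda>y. (u (Rf t y) (Xf t x y))^2)"
      by (rule integrableI_nonneg[OF borel_measurable_power[OF um] _ finu]) (rule AE_I2, rule zero_le_power2)
    then have ui: "integrable \<nu> (\<lambda>y. u (Rf t y) (Xf t x y))"
      by (rule \<nu>.square_integrable_imp_integrable[OF um])
    show ?thesis
    proof (rule Bochner_Integration.integrable_bound)
      show "integrable \<nu> (\<lambda>y. \<bar>f 0\<bar> + L * \<bar>u (Rf t y) (Xf t x y)\<bar>)"
        by (intro Bochner_Integration.integrable_add \<nu>.integrable_const integrable_mult_right integrable_abs ui)
      show "(\<lambda>y. f (u (Rf t y) (Xf t x y))) \<in> borel_measurable \<nu>" by (rule measurable_compose[OF um f_measurable])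
      show "AE y in \<nu>. norm (f (u (Rf t y) (Xf t x y))) \<le> norm (\<bar>f 0\<bar> + L * \<bar>u (Rf t y) (Xf t x y)\<bar>)"
      proof (rule AE_I2)
        fix y
        have "\<bar>f (u (Rf t y) (Xf t x y)) - f 0\<bar> \<le> L * \<bar>u (Rf t y) (Xf t x y)\<bar>" using f_bound[of _ 0] by simp
        moreover have "0 \<le> L * \<bar>u (Rf t y) (Xf t x y)\<bar>" using L by simp
        ultimately show "norm (f (u (Rf t y) (Xf t x y))) \<le> norm (\<bar>f 0\<bar> + L * \<bar>u (Rf t y) (Xf t x y)\<bar>)"
          unfolding real_norm_def by linarith
      qed
    qed
  qed
  have i3: "integrable ?Q ?c"
  proof -
    have "(\<integral>\<^sup>+p. ennreal (norm (?c p)) \<partial>?Q) = (\<integral>\<^sup>+y. (\<integral>\<^sup>+z. ennreal (norm (f (u (Rf t y) (Xf t x y)))) \<partial>\<N>) \<partial>\<nu>)"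
      using Pi.nn_integral_fst[of "\<lambda>p. ennreal (norm (?c p))" \<nu>]
        measurable_compose[OF measurable_compose[OF cm borel_measurable_norm] measurable_ennreal] by simp
    also have "\<dots> < \<infinity>" using i2 by (simp add: Pi.emeasure_space_1 integrable_iff_bounded)
    finally show ?thesis by (rule integrableI_bounded[OF cm])
  qed
  have c: "(\<integral>p. ?c p \<partial>?Q) = (\<integral>y. f (u (Rf t y) (Xf t x y)) \<partial>\<nu>)"
    using P.integral_fst'[OF i3] by (simp add: Pi.prob_space)
  show i4: "integrable ?Q ?a" using Bochner_Integration.integrable_add[OF i1 i3] by simp
  have "(\<integral>p. ?a p \<partial>?Q) - (\<integral>y. f (u (Rf t y) (Xf t x y)) \<partial>\<nu>) = (\<integral>p. ?a p - ?c p \<partial>?Q)"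
    using i4 i3 by (simp add: c)
  then show "ennreal (((\<integral>p. ?a p \<partial>?Q) - (\<integral>y. f (u (Rf t y) (Xf t x y)) \<partial>\<nu>))^2)
      \<le> ennreal (L^2) * (\<integral>\<^sup>+y. e2 M k (Rf t y) (Xf t x y) \<partial>\<nu>)"
    using order_trans[OF P.square_expectation_le[OF borel_measurable_diff[OF am cm]] le] by simp
qed

lemma expectation_FP:
  assumes x: "x \<in> space S"
  shows "(\<integral>z. f (FP M k t x (z [a, b], shift [c, e] z)) \<partial>\<N>) = (\<integral>p. f (FP M k t x p) \<partial>(\<nu> \<Otimes>\<^sub>M \<N>))"
    and "integrable (\<nu> \<Otimes>\<^sub>M \<N>) (\<lambda>p. f (FP M k t x p)) \<Longrightarrow>
      integrable \<N> (\<lambda>z. f (FP M k t x (z [a, b], shift [c, e] z)))"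
proof -
  have m: "(\<lambda>p. f (FP M k t x p)) \<in> borel_measurable (\<nu> \<Otimes>\<^sub>M \<N>)"
    by (rule measurable_compose[OF measurable_FP_pair[OF x] f_measurable])
  have D: "distr \<N> (\<nu> \<Otimes>\<^sub>M \<N>) (\<lambda>z. (z [a, b], shift [c, e] z)) = \<nu> \<Otimes>\<^sub>M \<N>"
    by (rule distr_coordinate_shift) (use pair_neq_append in auto)
  show "(\<integral>z. f (FP M k t x (z [a, b], shift [c, e] z)) \<partial>\<N>) = (\<integral>p. f (FP M k t x p) \<partial>(\<nu> \<Otimes>\<^sub>M \<N>))"
    using integral_distr[OF measurable_coordinate_shift[of a b c e] m] by (simp add: D)
  show "integrable (\<nu> \<Otimes>\<^sub>M \<N>) (\<lambda>p. f (FP M k t x p)) \<Longrightarrow>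
      integrable \<N> (\<lambda>z. f (FP M k t x (z [a, b], shift [c, e] z)))"
    using integrable_distr_eq[OF measurable_coordinate_shift[of a b c e] m] by (simp add: D)
qed

end

text \<open>A discrete Gronwall identity: the recursion e_n = a + (c - 1) (e_0 + ... + e_(n-1)) is
  solved by e_n = a c^n.\<close>

lemma geometric_recursion: "(1 + (c - 1) * (\<Sum>k<n. c ^ k)) = (c::real) ^ n"
  by (induction n) (auto simp: algebra_simps)

context mlp begin

section \<open>Induction on the number of levels\<close>

lemma u_second_moment_finite:
  assumes U: "U \<ge> 0" "\<And>t x. t \<in> {0..T} \<Longrightarrow> x \<in> space S \<Longrightarrow> (u t x)^2 \<le> U * w x"
    and t: "t \<in> {0..T}" "t < T" and x: "x \<in> space S"
  shows "(\<integral>\<^sup>+y. ennreal ((u (Rf t y) (Xf t x y))^2) \<partial>\<nu>) < \<infinity>"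
proof -
  have "(\<integral>\<^sup>+y. ennreal ((u (Rf t y) (Xf t x y))^2) \<partial>\<nu>) \<le> (\<integral>\<^sup>+y. ennreal U * ennreal (exp (1 * (T - Rf t y)) * w (Xf t x y)) \<partial>\<nu>)"
  proof (rule nn_integral_mono)
    fix y assume y: "y \<in> space \<nu>"
    have R: "Rf t y \<in> {0..T}" using Rf_range[OF t(1) y] t by auto
    have X: "Xf t x y \<in> space S" using measurable_space[OF measurable_at(2)[OF x] y] .
    have "(u (Rf t y) (Xf t x y))^2 \<le> U * (1 * w (Xf t x y))" using U(2)[OF R X] by simp
    also have "\<dots> \<le> U * (exp (1 * (T - Rf t y)) * w (Xf t x y))"
      using U(1) w_ge_1[OF X] R by (intro mult_left_mono mult_right_mono) auto
    finally show "ennreal ((u (Rf t y) (Xf t x y))^2) \<le> ennreal U * ennreal (exp (1 * (T - Rf t y)) * w (Xf t x y))"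
      using U(1) w_ge_1[OF X] by (simp add: ennreal_mult[symmetric] ennreal_leI)
  qed
  also have "\<dots> = ennreal U * (\<integral>\<^sup>+y. ennreal (exp (1 * (T - Rf t y)) * w (Xf t x y)) \<partial>\<nu>)"
    using measurable_at(1)[OF x, of t] measurable_compose[OF measurable_at(2)[OF x, of t] w_measurable]
    by (intro nn_integral_cmult) measurable
  also have "\<dots> < \<infinity>"
  proof -
    \<comment> \<open>Finiteness of the product gives finiteness of the integral because T - t is
      positive.\<close>
    have "ennreal (T - t) * (\<integral>\<^sup>+y. ennreal (exp (1 * (T - Rf t y)) * w (Xf t x y)) \<partial>\<nu>) < \<infinity>"
      using exp_moment[OF t(1) x, of 1] by (rule order.strict_trans1) (auto intro: ennreal_less_top)
    then show ?thesis using t(2) by (auto simp: ennreal_mult_less_top)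
  qed
  finally show ?thesis .
qed

text \<open>
  The exponential weight \<open>exp (M * (T - t))\<close> turns every time integral into a factor \<open>1 / M\<close>; this is
  what makes the error decay like \<open>M\<^sup>-\<^sup>n\<close> up to geometric factors.
\<close>

theorem mlp_error:
  fixes M n :: nat
  assumes M: "M \<ge> 1" and a: "a \<ge> U" "a \<ge> G + T^2 * (f 0)^2"
    and U: "U \<ge> 0" "\<And>t x. t \<in> {0..T} \<Longrightarrow> x \<in> space S \<Longrightarrow> (u t x)^2 \<le> U * w x"
    and c: "c = 1 + 5 * (L^2 * T * K)"
    and t: "t \<in> {0..T}" and x: "x \<in> space S"
  shows "e2 M n t x \<le> ennreal (a * c ^ n / real M ^ n * (exp (real M * (T - t)) * w x))"
  using t x
proof (induction n arbitrary: t x rule: less_induct)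
  case (less n t x)
  note t = less.prems(1) and x = less.prems(2)
  define Mr where "Mr = real M"
  have Mr: "Mr \<ge> 1" using M by (simp add: Mr_def)
  define b where "b = L^2 * T * K"
  have b: "b \<ge> 0" using T K by (simp add: b_def)
  \<comment> \<open>The 5 in \<open>c\<close> is 4 + 1: measured in W / M^n, the level difference k
    contributes at most 4 b a c^k, and the bias contributes b a c^(n - 1).\<close>
  have c1: "c \<ge> 1" "c - 1 = 5 * b" using b by (auto simp: c b_def)
  have a0: "a \<ge> 0" using a U by simp
  define W where "W = exp (Mr * (T - t)) * w x"
  have tt: "0 \<le> T - t" "T - t \<le> T" using t by auto
  have Ww: "w x \<le> W"
    using mult_right_mono[of 1 "exp (Mr * (T - t))" "w x"] w_ge_1[OF x] Mr tt by (simp add: W_def)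
  have W1: "1 \<le> W" using Ww w_ge_1[OF x] by simp
  show ?case
  proof (cases "n = 0")
    case True
    have "e2 M 0 t x = ennreal ((u t x)^2)" by (simp add: e2_def Phi.simps Pi.emeasure_space_1)
    also have "\<dots> \<le> ennreal (a * W)"
    proof (rule ennreal_leI)
      have "(u t x)^2 \<le> U * w x" by (rule U(2)[OF t x])
      also have "\<dots> \<le> a * W" using a U Ww w_ge_1[OF x] by (intro mult_mono) auto
      finally show "(u t x)^2 \<le> a * W" .
    qed
    finally show ?thesis using True by (simp add: W_def Mr_def)
  next
    case False
    then have n: "n > 0" by simp
    define E where "E k = a * c ^ k / Mr ^ k" for k
    have E0: "E k \<ge> 0" for k using a0 c1 Mr by (simp add: E_def)
    define I where "I k = (\<integral>\<^sup>+y. e2 M k (Rf t y) (Xf t x y) \<partial>\<nu>)" for k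
    \<comment> \<open>The induction hypothesis inserted into \<open>exp_moment\<close> with the rate
      M; the quotient by \<open>Mr\<close> is the gain from one time integral.\<close>
    define B where "B k = E k * (K * W / Mr)" for k
    have B0: "B k \<ge> 0" for k using E0[of k] K W1 Mr by (simp add: B_def)
    have I: "ennreal (T - t) * I k \<le> ennreal (B k)" if k: "k < n" for k
    proof -
      have "I k \<le> (\<integral>\<^sup>+y. ennreal (E k) * ennreal (exp (Mr * (T - Rf t y)) * w (Xf t x y)) \<partial>\<nu>)"
        unfolding I_def
      proof (rule nn_integral_mono)
        fix y assume y: "y \<in> space \<nu>"
        have R: "Rf t y \<in> {0..T}" using Rf_range[OF t y] t by auto
        have X: "Xf t x y \<in> space S" using measurable_space[OF measurable_at(2)[OF x] y] .
        show "e2 M k (Rf t y) (Xf t x y) \<le> ennreal (E k) * ennreal (exp (Mr * (T - Rf t y)) * w (Xf t x y))"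
          using less.IH[OF k R X] E0[of k] w_ge_1[OF X] by (simp add: ennreal_mult[symmetric] E_def Mr_def)
      qed
      also have "\<dots> = ennreal (E k) * (\<integral>\<^sup>+y. ennreal (exp (Mr * (T - Rf t y)) * w (Xf t x y)) \<partial>\<nu>)"
        using measurable_at(1)[OF x, of t] measurable_compose[OF measurable_at(2)[OF x, of t] w_measurable]
        by (intro nn_integral_cmult) measurable
      finally have "ennreal (T - t) * I k \<le> ennreal (E k) * (ennreal (T - t) * (\<integral>\<^sup>+y. ennreal (exp (Mr * (T - Rf t y)) * w (Xf t x y)) \<partial>\<nu>))"
        by (metis mult.left_commute mult_left_mono zero_le)
      also have "\<dots> \<le> ennreal (E k) * ennreal (K * w x * exp (Mr * (T - t)) / Mr)"
        using Mr by (intro mult_left_mono exp_moment t x) auto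
      also have "\<dots> = ennreal (B k)"
        using E0[of k] K W1 Mr w_ge_1[OF x] by (simp add: ennreal_mult[symmetric] B_def W_def mult_ac)
      finally show ?thesis .
    qed
    \<comment> \<open>Bounds for the second moments of single summands. At level 0 the difference is
      the constant \<open>f 0\<close>, at the other levels \<open>Dt_second_moment\<close> applies,
      and first index n is the terminal value. Summing over the samples restores one of the two
      powers of M in each denominator.\<close>
    define q where "q j = (if fst j < n then
        (if fst j = 0 then T^2 * (f 0)^2 * W / (Mr ^ n)^2
         else T * (2 * L^2 * (B (fst j) + B (fst j - 1))) / (Mr ^ (n - fst j))^2)
        else G * W / (Mr ^ n)^2)" for j :: "nat \<times> nat"
    have q0: "q j \<ge> 0" for j using T G W1 B0 by (simp add: q_def)
    have Zm: "Zt M n t x j \<in> borel_measurable \<N>" if "j \<in> terms M n" for j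
      using that by (intro measurable_Zt[OF x]) (auto simp: terms_def block_def index_set_def)
    have Zq: "(\<integral>\<^sup>+z. ennreal ((Zt M n t x j z)^2) \<partial>\<N>) \<le> ennreal (q j)" if j: "j \<in> terms M n" for j
    proof -
      obtain k m where jk: "j = (k, m)" by (cases j)
      show ?thesis
      proof (cases "k < n")
        case True
        have Dm: "Dt M t x k m \<in> borel_measurable \<N>" if "t < T"
        proof -
          have "(\<lambda>z. Zt M n t x j z * (Mr ^ (n - k) / (T - t))) \<in> borel_measurable \<N>"
            using Zm[OF j] by measurable
          also have "(\<lambda>z. Zt M n t x j z * (Mr ^ (n - k) / (T - t))) = Dt M t x k m"
            using that True Mr by (auto simp: Zt_def jk Mr_def fun_eq_iff)
          finally show ?thesis .
        qed
        show ?thesis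
        proof (cases "t < T")
          case False
          then show ?thesis using True t q0 by (simp add: Zt_def jk)
        next
          case tT: True
          have "(\<integral>\<^sup>+z. ennreal ((Zt M n t x j z)^2) \<partial>\<N>) = (\<integral>\<^sup>+z. ennreal (((T - t) / Mr ^ (n - k))^2) * ennreal ((Dt M t x k m z)^2) \<partial>\<N>)"
            using True by (intro nn_integral_cong) (simp add: Zt_def jk Mr_def power_mult_distrib power_divide ennreal_mult[symmetric])
          also have "\<dots> = ennreal (((T - t) / Mr ^ (n - k))^2) * (\<integral>\<^sup>+z. ennreal ((Dt M t x k m z)^2) \<partial>\<N>)"
            using Dm[OF tT] by (intro nn_integral_cmult) measurable
          also have "\<dots> \<le> ennreal (q j)"
          proof (cases "k = 0")
            case k: True
            have "Dt M t x 0 m z = f 0" for z by (simp add: Dt_def FP_def Phi.simps)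
            then have "(\<integral>\<^sup>+z. ennreal ((Dt M t x k m z)^2) \<partial>\<N>) = ennreal ((f 0)^2)"
              by (simp add: k Pi.emeasure_space_1)
            moreover have "((T - t) / Mr ^ n)^2 * (f 0)^2 \<le> q j"
            proof -
              have "(T - t)^2 * (f 0)^2 \<le> T^2 * (f 0)^2" using tt by (intro mult_right_mono power_mono) auto
              also have "\<dots> = T^2 * (f 0)^2 * 1" by simp
              also have "\<dots> \<le> T^2 * (f 0)^2 * W" using W1 by (intro mult_left_mono) auto
              finally have "(T - t)^2 * (f 0)^2 / (Mr ^ n)^2 \<le> T^2 * (f 0)^2 * W / (Mr ^ n)^2"
                by (rule divide_right_mono) simp
              then show ?thesis using n by (simp add: q_def jk k power_divide)
            qed
            ultimately show ?thesis by (simp add: k ennreal_mult[symmetric] ennreal_leI)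
          next
            case k: False
            then have k0: "k > 0" by simp
            \<comment> \<open>One factor T - t stays beside the integrals, where \<open>I\<close>
              controls the product; the other is later estimated by T.\<close>
            have "((T - t) / Mr ^ (n - k))^2 = (T - t) * ((T - t) / (Mr ^ (n - k))^2)"
              by (simp add: power2_eq_square)
            then have "ennreal (((T - t) / Mr ^ (n - k))^2) = ennreal ((T - t) / (Mr ^ (n - k))^2) * ennreal (T - t)"
              using tt Mr by (simp add: ennreal_mult[symmetric] mult.commute)
            then have "ennreal (((T - t) / Mr ^ (n - k))^2) * (\<integral>\<^sup>+z. ennreal ((Dt M t x k m z)^2) \<partial>\<N>)
              = ennreal ((T - t) / (Mr ^ (n - k))^2) * (ennreal (T - t) * (\<integral>\<^sup>+z. ennreal ((Dt M t x k m z)^2) \<partial>\<N>))"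
              by (simp add: mult.assoc)
            also have "\<dots> \<le> ennreal ((T - t) / (Mr ^ (n - k))^2) * (ennreal (T - t) * (ennreal (2 * L^2) * (I k + I (k - 1))))"
              unfolding I_def by (intro mult_left_mono Dt_second_moment[OF x k0]) auto
            also have "\<dots> = ennreal ((T - t) / (Mr ^ (n - k))^2) * (ennreal (2 * L^2) * (ennreal (T - t) * I k + ennreal (T - t) * I (k - 1)))"
              by (simp add: distrib_left distrib_right mult_ac)
            also have "\<dots> \<le> ennreal ((T - t) / (Mr ^ (n - k))^2) * (ennreal (2 * L^2) * (ennreal (B k) + ennreal (B (k - 1))))"
              using \<open>k < n\<close> by (intro mult_left_mono add_mono I) auto
            also have "\<dots> = ennreal ((T - t) / (Mr ^ (n - k))^2 * (2 * L^2 * (B k + B (k - 1))))"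
              using tt Mr B0[of k] B0[of "k - 1"] by (simp only: ennreal_plus[symmetric] ennreal_mult[symmetric]) (simp add: ennreal_mult[symmetric] ennreal_plus[symmetric] del: ennreal_plus)
            also have "\<dots> \<le> ennreal (q j)"
            proof (rule ennreal_leI)
              have "(T - t) / (Mr ^ (n - k))^2 * (2 * L^2 * (B k + B (k - 1))) \<le> T / (Mr ^ (n - k))^2 * (2 * L^2 * (B k + B (k - 1)))"
                using tt Mr B0[of k] B0[of "k - 1"] by (intro mult_right_mono divide_right_mono) auto
              then show "(T - t) / (Mr ^ (n - k))^2 * (2 * L^2 * (B k + B (k - 1))) \<le> q j"
                using True k by (simp add: q_def jk)
            qed
            finally show ?thesis .
          qed
          finally show ?thesis .
        qed
      next
        case kn: False
        have "(\<lambda>z. z [int n, - int m]) \<in> measurable \<N> \<nu>" by (rule measurable_component_singleton) simp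
        note zm = this measurable_compose[OF this measurable_at(5)[OF x]]
        have "(\<integral>\<^sup>+z. ennreal ((Zt M n t x j z)^2) \<partial>\<N>) = (\<integral>\<^sup>+z. ennreal (1 / (Mr ^ n)^2) * ennreal ((g (XT t x (z [int n, - int m])))^2) \<partial>\<N>)"
          using kn by (intro nn_integral_cong) (simp add: Zt_def jk Mr_def power_divide ennreal_mult[symmetric])
        also have "\<dots> = ennreal (1 / (Mr ^ n)^2) * (\<integral>\<^sup>+z. ennreal ((g (XT t x (z [int n, - int m])))^2) \<partial>\<N>)"
          by (intro nn_integral_cmult measurable_compose[OF _ measurable_ennreal] borel_measurable_power zm(2))
        also have "(\<integral>\<^sup>+z. ennreal ((g (XT t x (z [int n, - int m])))^2) \<partial>\<N>) = (\<integral>\<^sup>+y. ennreal ((g (XT t x y))^2) \<partial>distr \<N> \<nu> (\<lambda>z. z [int n, - int m]))"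
          using measurable_at(5)[OF x, of t] zm(1) by (subst nn_integral_distr) auto
        also have "\<dots> \<le> ennreal (G * w x)"
          by (subst distr_coordinate) (auto intro: g_moment[OF t x])
        also have "ennreal (1 / (Mr ^ n)^2) * ennreal (G * w x) \<le> ennreal (q j)"
        proof -
          have "1 / (Mr ^ n)^2 * (G * w x) \<le> q j"
            using kn G Ww by (simp add: q_def jk divide_right_mono mult_left_mono)
          then show ?thesis using G w_ge_1[OF x] by (simp add: ennreal_mult[symmetric] ennreal_leI)
        qed
        finally show ?thesis by (simp add: mult_left_mono)
      qed
    qed
    have Z2: "integrable \<N> (\<lambda>z. (Zt M n t x j z)^2)" if "j \<in> terms M n" for j
    proof (rule integrableI_nonneg)
      show "(\<integral>\<^sup>+z. ennreal ((Zt M n t x j z)^2) \<partial>\<N>) < \<infinity>"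
        by (rule order.strict_trans1[OF Zq[OF that]]) (simp add: ennreal_less_top)
    qed (use Zm[OF that] in auto)
    have EZ2: "Pi.expectation (\<lambda>z. (Zt M n t x j z)^2) \<le> q j" if "j \<in> terms M n" for j
      using Zq[OF that] q0[of j] by (simp add: nn_integral_eq_integral[OF Z2[OF that]])
    define Fm where "Fm k = (\<integral>p. f (FP M k t x p) \<partial>(\<nu> \<Otimes>\<^sub>M \<N>))" for k
    have fin: "I k < \<infinity>" if "t < T" "k < n" for k
    proof -
      have "ennreal (T - t) * I k < \<infinity>" by (rule order.strict_trans1[OF I[OF that(2)]]) (simp add: ennreal_less_top)
      then show ?thesis using that by (auto simp: ennreal_mult_less_top)
    qed
    have EZ: "Pi.expectation (Zt M n t x (k, m)) = (T - t) / Mr ^ (n - k) * (Fm k - (if k = 0 then 0 else Fm (k - 1)))" if k: "k < n" for k m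
    proof (cases "t < T")
      case tT: True
      have i: "integrable (\<nu> \<Otimes>\<^sub>M \<N>) (\<lambda>p. f (FP M k' t x p))" if "k' < n" for k'
        using bias_bound(1)[OF x fin[OF tT that, unfolded I_def] u_second_moment_finite[OF U t tT x]] .
      have "Pi.expectation (Dt M t x k m) = Fm k - (if k = 0 then 0 else Fm (k - 1))"
      proof (cases "k = 0")
        case True
        then show ?thesis using expectation_FP(1)[OF x, of M k t "int k" "int m" "int k" "int m"] by (simp add: Dt_def[abs_def] Fm_def)
      next
        case False
        then show ?thesis
          using k by (simp add: Dt_def[abs_def] Fm_def Bochner_Integration.integral_diff[OF expectation_FP(2)[OF x i[OF k]] expectation_FP(2)[OF x i]]
            expectation_FP(1)[OF x])
      qed
      then show ?thesis using k by (simp add: Zt_def[abs_def] Mr_def)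
    next
      case False
      then have tT: "T - t = 0" using tt by simp
      have "Zt M n t x (k, m) z = 0" for z
        unfolding Zt_def fst_conv snd_conv tT using k by simp
      then have "Zt M n t x (k, m) = (\<lambda>z. 0)" by (rule ext)
      then show ?thesis unfolding tT by simp
    qed
    have EZn: "Pi.expectation (Zt M n t x (n, m)) = (\<integral>y. g (XT t x y) \<partial>\<nu>) / Mr ^ n" for m
    proof -
      have zm: "(\<lambda>z. z [int n, - int m]) \<in> measurable \<N> \<nu>" by (rule measurable_component_singleton) simp
      have "(\<integral>z. g (XT t x (z [int n, - int m])) \<partial>\<N>) = (\<integral>y. g (XT t x y) \<partial>distr \<N> \<nu> (\<lambda>z. z [int n, - int m]))"
        by (rule integral_distr[OF zm measurable_at(5)[OF x], symmetric])
      also have "\<dots> = (\<integral>y. g (XT t x y) \<partial>\<nu>)" by (subst distr_coordinate) auto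
      finally show ?thesis by (simp add: Zt_def[abs_def] Mr_def)
    qed
    \<comment> \<open>In expectation the level differences telescope, and only the highest level n -
      1 remains.\<close>
    have tel: "(\<Sum>k<n. Fm k - (if k = 0 then 0 else Fm (k - 1))) = Fm (n - 1)"
    proof -
      have "(\<Sum>k<Suc l. Fm k - (if k = 0 then 0 else Fm (k - 1))) = Fm l" for l by (induction l) auto
      from this[of "n - 1"] show ?thesis using n by simp
    qed
    have Mpow: "real (M ^ i) = Mr ^ i" "Mr ^ i \<noteq> 0" "Mr ^ i > 0" for i using Mr by (auto simp: Mr_def)
    have bias: "(\<Sum>j\<in>terms M n. Pi.expectation (Zt M n t x j)) - u t x = (T - t) * (Fm (n - 1) - (\<integral>y. f (u (Rf t y) (Xf t x y)) \<partial>\<nu>))"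
    proof -
      have "(\<Sum>j\<in>terms M n. Pi.expectation (Zt M n t x j)) =
        (\<Sum>k<n. \<Sum>m=1..M ^ (n - k). Pi.expectation (Zt M n t x (k, m))) + (\<Sum>m=1..M ^ n. Pi.expectation (Zt M n t x (n, m)))"
        by (rule sum_terms)
      also have "(\<Sum>m=1..M ^ n. Pi.expectation (Zt M n t x (n, m))) = (\<integral>y. g (XT t x y) \<partial>\<nu>)"
        using Mpow by (simp add: EZn)
      also have "(\<Sum>k<n. \<Sum>m=1..M ^ (n - k). Pi.expectation (Zt M n t x (k, m))) = (\<Sum>k<n. (T - t) * (Fm k - (if k = 0 then 0 else Fm (k - 1))))"
        using Mpow(1) Mr by (intro sum.cong refl) (auto simp: EZ)
      also have "\<dots> = (T - t) * Fm (n - 1)" using tel by (simp add: sum_distrib_left[symmetric])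
      finally show ?thesis using u_fixpoint[OF t x] by (simp add: algebra_simps)
    qed
    have bias2: "((\<Sum>j\<in>terms M n. Pi.expectation (Zt M n t x j)) - u t x)^2 \<le> T * L^2 * B (n - 1)"
    proof (cases "t < T")
      case tT: True
      let ?d = "Fm (n - 1) - (\<integral>y. f (u (Rf t y) (Xf t x y)) \<partial>\<nu>)"
      have n1: "n - 1 < n" using n by simp
      have "ennreal (?d^2) \<le> ennreal (L^2) * I (n - 1)"
        using bias_bound(2)[OF x fin[OF tT n1, unfolded I_def] u_second_moment_finite[OF U t tT x]] by (simp add: Fm_def I_def)
      then have "ennreal (T - t) * ennreal (?d^2) \<le> ennreal (T - t) * (ennreal (L^2) * I (n - 1))"
        by (rule mult_left_mono) simp
      also have "\<dots> = ennreal (L^2) * (ennreal (T - t) * I (n - 1))" by (simp add: mult_ac)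
      also have "\<dots> \<le> ennreal (L^2) * ennreal (B (n - 1))" using I[OF n1] by (rule mult_left_mono) simp
      finally have "(T - t) * ?d^2 \<le> L^2 * B (n - 1)"
        using tt B0[of "n - 1"] by (simp add: ennreal_mult[symmetric])
      then have "(T - t) * ((T - t) * ?d^2) \<le> (T - t) * (L^2 * B (n - 1))"
        using tt(1) by (rule mult_left_mono)
      also have "\<dots> \<le> T * (L^2 * B (n - 1))"
        using tt(2) B0[of "n - 1"] by (intro mult_right_mono) auto
      finally show ?thesis unfolding bias by (simp add: power_mult_distrib power2_eq_square mult_ac)
    next
      case False
      then have "T - t = 0" using tt by simp
      then show ?thesis unfolding bias using T B0[of "n - 1"] by simp
    qed
    have "e2 M n t x = (\<integral>\<^sup>+z. ennreal (((\<Sum>j\<in>terms M n. Zt M n t x j z) - u t x)^2) \<partial>\<N>)"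
      unfolding e2_def Phi_eq_sum[OF n] ..
    also have "\<dots> = ennreal (Pi.expectation (\<lambda>z. ((\<Sum>j\<in>terms M n. Zt M n t x j z) - u t x)^2))"
      by (rule nn_integral_eq_integral[OF Pi.second_moment_sum_indep(1)[OF finite_terms indep_terms[OF x] Z2]]) auto
    also have "\<dots> \<le> ennreal (a * c ^ n / Mr ^ n * W)"
    proof (rule ennreal_leI)
      have "Pi.expectation (\<lambda>z. ((\<Sum>j\<in>terms M n. Zt M n t x j z) - u t x)^2)
        \<le> ((\<Sum>j\<in>terms M n. Pi.expectation (Zt M n t x j)) - u t x)^2 + (\<Sum>j\<in>terms M n. Pi.expectation (\<lambda>z. (Zt M n t x j z)^2))"
        by (rule Pi.second_moment_sum_indep(2)[OF finite_terms indep_terms[OF x] Z2])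
      also have "\<dots> \<le> T * L^2 * B (n - 1) + (\<Sum>j\<in>terms M n. q j)"
        by (intro add_mono bias2 sum_mono EZ2)
      also have "(\<Sum>j\<in>terms M n. q j) = (\<Sum>k<n. Mr ^ (n - k) * q (k, 0)) + G * W / Mr ^ n"
      proof -
        have q_m: "q (k, m) = q (k, 0)" for k m by (simp add: q_def)
        have "(\<Sum>j\<in>terms M n. q j) = (\<Sum>k<n. \<Sum>m=1..M ^ (n - k). q (k, m)) + (\<Sum>m=1..M ^ n. q (n, m))"
          by (rule sum_terms)
        also have "(\<Sum>m=1..M ^ n. q (n, m)) = Mr ^ n * (G * W / (Mr ^ n)^2)" using Mpow by (simp add: q_def)
        also have "\<dots> = G * W / Mr ^ n" using Mr by (simp add: power2_eq_square)
        also have "(\<Sum>k<n. \<Sum>m=1..M ^ (n - k). q (k, m)) = (\<Sum>k<n. Mr ^ (n - k) * q (k, 0))"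
          using Mpow by (subst q_m) simp
        finally show ?thesis .
      qed
      also have "(\<Sum>k<n. Mr ^ (n - k) * q (k, 0)) \<le> (T^2 * (f 0)^2 * W) / Mr ^ n + (\<Sum>k<n. 4 * b * a * W / Mr ^ n * c ^ k)"
      proof -
        have summand: "Mr ^ (n - k) * q (k, 0) \<le> (if k = 0 then T^2 * (f 0)^2 * W / Mr ^ n else 0) + 4 * b * a * W / Mr ^ n * c ^ k" if k: "k < n" for k
        proof (cases "k = 0")
          case True
          have "Mr ^ n * (T^2 * (f 0)^2 * W / (Mr ^ n)^2) = T^2 * (f 0)^2 * W / Mr ^ n"
            using Mr by (simp add: power2_eq_square)
          moreover have "0 \<le> 4 * b * a * W / Mr ^ n" using a0 b W1 Mpow(3)[of n] by simp
          ultimately show ?thesis using True n by (simp add: q_def)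
        next
          case False
          then obtain l where l: "k = Suc l" by (cases k) auto
          \<comment> \<open>Level k - 1 carries the weaker power M^(-l), and \<open>E k\<close> is
            brought to the same denominator. The quotient by M in \<open>B\<close> and the average
            over M^(n - k) samples complete it to M^n.\<close>
          have Ek: "E k \<le> a * c ^ k / Mr ^ l"
            using a0 c1 Mr by (simp add: E_def l frac_le)
          have El: "E l \<le> a * c ^ k / Mr ^ l"
            using a0 c1 Mr by (auto simp: E_def l intro!: divide_right_mono mult_left_mono)
          have sumE: "E k + E l \<le> 2 * (a * c ^ k / Mr ^ l)" using Ek El by simp
          have "Mr ^ (n - k) * q (k, 0) = T * (2 * L^2 * (B k + B l)) / Mr ^ (n - k)"
            using False k Mr by (simp add: q_def l power2_eq_square)
          also have "\<dots> = 2 * b * W * (E k + E l) / (Mr * Mr ^ (n - k))"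
            using Mr by (simp add: B_def b_def field_simps)
          also have "\<dots> \<le> 2 * b * W * (2 * (a * c ^ k / Mr ^ l)) / (Mr * Mr ^ (n - k))"
            using sumE b W1 Mr by (intro divide_right_mono mult_left_mono) auto
          also have "\<dots> = 4 * b * a * W * c ^ k / (Mr ^ l * (Mr * Mr ^ (n - k)))"
            by (simp add: field_simps)
          also have "Mr ^ l * (Mr * Mr ^ (n - k)) = Mr ^ n"
            using k l by (simp add: power_add[symmetric] flip: power_Suc)
          finally show ?thesis using False by simp
        qed
        have "(\<Sum>k<n. Mr ^ (n - k) * q (k, 0)) \<le> (\<Sum>k<n. (if k = 0 then T^2 * (f 0)^2 * W / Mr ^ n else 0) + 4 * b * a * W / Mr ^ n * c ^ k)"
          by (intro sum_mono summand) auto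
        also have "\<dots> = T^2 * (f 0)^2 * W / Mr ^ n + (\<Sum>k<n. 4 * b * a * W / Mr ^ n * c ^ k)"
          using n by (simp add: sum.distrib)
        finally show ?thesis .
      qed
      also have "T * L^2 * B (n - 1) + (T^2 * (f 0)^2 * W / Mr ^ n + (\<Sum>k<n. 4 * b * a * W / Mr ^ n * c ^ k) + G * W / Mr ^ n)
        \<le> a * c ^ n / Mr ^ n * W"
      proof -
        have "T * L^2 * B (n - 1) = b * a * W / Mr ^ n * c ^ (n - 1)"
          using n Mr by (cases n) (auto simp: B_def E_def b_def field_simps)
        also have "\<dots> \<le> b * a * W / Mr ^ n * (\<Sum>k<n. c ^ k)"
          using n a0 b W1 c1 Mpow(3)[of n] by (intro mult_left_mono member_le_sum) auto
        finally have 1: "T * L^2 * B (n - 1) \<le> b * a * W / Mr ^ n * (\<Sum>k<n. c ^ k)" .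
        \<comment> \<open>The second assumption on \<open>a\<close> covers the terminal value and
          the constant contribution of level 0.\<close>
        have "(G + T^2 * (f 0)^2) * (W / Mr ^ n) \<le> a * (W / Mr ^ n)"
          using a(2) W1 Mpow(3)[of n] by (intro mult_right_mono) auto
        then have 2: "T^2 * (f 0)^2 * W / Mr ^ n + G * W / Mr ^ n \<le> a * W / Mr ^ n"
          by (simp add: algebra_simps)
        have "a * c ^ n / Mr ^ n * W = a * W / Mr ^ n * (1 + 5 * b * (\<Sum>k<n. c ^ k))"
          unfolding geometric_recursion[of c n, symmetric] c1(2) by (simp add: field_simps)
        also have "\<dots> = a * W / Mr ^ n + b * a * W / Mr ^ n * (\<Sum>k<n. c ^ k) + (\<Sum>k<n. 4 * b * a * W / Mr ^ n * c ^ k)"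
          unfolding sum_distrib_left[symmetric] by (simp add: algebra_simps)
        finally show ?thesis using 1 2 by linarith
      qed
      finally show "Pi.expectation (\<lambda>z. ((\<Sum>j\<in>terms M n. Zt M n t x j z) - u t x)^2) \<le> a * c ^ n / Mr ^ n * W"
        by (simp add: algebra_simps)
    qed
    finally show ?thesis by (simp add: W_def Mr_def)
  qed
qed

end

section \<open>Computational cost\<close>

text \<open>In units of d M^n each k contributes at most 2 + 2 * 6^k: d + 1 is at most 2 d, and
  \<open>C k\<close> and \<open>C (k - 1)\<close> yield at most d * 6^k each once the powers of M
  are collected. The base 6 is large enough for the inequality \<open>num\<close>.\<close>

lemma cost_bound:
  fixes C :: "nat \<Rightarrow> nat"
  assumes d: "d \<ge> 1" and M: "M \<ge> 1" and C0: "C 0 = 0"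
    and rec: "\<And>n. n \<ge> 1 \<Longrightarrow> C n \<le> d * M ^ n + (\<Sum>k=0..<n. M ^ (n - k) * (d + 1 + C k + (if k = 0 then 0 else C (k - 1))))"
  shows "C n \<le> d * (6 * M) ^ n"
proof (induction n rule: less_induct)
  case (less n)
  have num: "1 + 2 * n + 2 * (\<Sum>k<n. 6 ^ k) \<le> (6::nat) ^ n" if "n \<ge> 1" for n
    using that by (induction n rule: dec_induct) auto
  show ?case
  proof (cases "n = 0")
    case False
    have "M ^ (n - k) * (d + 1 + C k + (if k = 0 then 0 else C (k - 1))) \<le> M ^ n * (d * (2 + 2 * 6 ^ k))" if k: "k < n" for k
    proof -
      have a: "M ^ (n - k) * (d + 1) \<le> M ^ n * (d * 2)"
        using d M by (intro mult_mono power_increasing) auto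
      have "M ^ (n - k) * C k \<le> M ^ (n - k) * (d * (6 * M) ^ k)" using less.IH[OF k] by simp
      also have "\<dots> = M ^ n * (d * 6 ^ k)" using k by (simp add: power_mult_distrib mult_ac flip: power_add)
      finally have b: "M ^ (n - k) * C k \<le> M ^ n * (d * 6 ^ k)" .
      have c: "M ^ (n - k) * (if k = 0 then 0 else C (k - 1)) \<le> M ^ n * (d * 6 ^ k)"
      proof (cases "k = 0")
        case False
        then have "M ^ (n - k) * C (k - 1) \<le> M ^ (n - k) * (d * (6 * M) ^ (k - 1))" using less.IH[of "k - 1"] k by simp
        also have "\<dots> = M ^ (n - k + (k - 1)) * (d * 6 ^ (k - 1))" by (simp add: power_mult_distrib power_add mult_ac)
        also have "\<dots> \<le> M ^ n * (d * 6 ^ k)"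
          using M k False by (intro mult_mono power_increasing order_refl) auto
        finally show ?thesis using False by simp
      qed simp
      from a b c show ?thesis by (simp add: algebra_simps)
    qed
    then have "(\<Sum>k=0..<n. M ^ (n - k) * (d + 1 + C k + (if k = 0 then 0 else C (k - 1)))) \<le> (\<Sum>k=0..<n. M ^ n * (d * (2 + 2 * 6 ^ k)))"
      by (intro sum_mono) auto
    also have "\<dots> = M ^ n * (d * (2 * n + 2 * (\<Sum>k<n. 6 ^ k)))"
      by (simp add: sum_distrib_left[symmetric] sum.distrib atLeast0LessThan algebra_simps)
    finally have "C n \<le> d * M ^ n + M ^ n * (d * (2 * n + 2 * (\<Sum>k<n. 6 ^ k)))"
      using rec[of n] False by linarith
    also have "\<dots> = M ^ n * d * (1 + 2 * n + 2 * (\<Sum>k<n. 6 ^ k))" by (simp add: algebra_simps)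
    also have "\<dots> \<le> M ^ n * d * 6 ^ n" using num[of n] False by (intro mult_left_mono) auto
    finally show ?thesis by (simp add: power_mult_distrib mult_ac)
  qed (simp add: C0)
qed

section \<open>Choice of the number of levels\<close>

lemma self_power_dominates:
  fixes B :: real
  assumes B: "B \<ge> 0" and A: "A \<ge> 0" and e: "e > 0"
  shows "\<exists>n\<ge>1. A * B ^ n / real n ^ n \<le> e"
proof -
  obtain n0 where n0: "2 * B \<le> real n0" using real_arch_simple by blast
  have "(\<lambda>n. A * (1 / 2) ^ n) \<longlonglongrightarrow> A * 0" by (intro tendsto_intros LIMSEQ_power_zero) simp
  then have "\<forall>\<^sub>F n in sequentially. A * (1 / 2) ^ n < e" using e by (intro order_tendstoD(2)) auto
  then obtain n1 where n1: "\<And>n. n \<ge> n1 \<Longrightarrow> A * (1 / 2) ^ n < e" by (auto simp: eventually_sequentially)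
  define n where "n = max 1 (max n0 n1)"
  have n: "n \<ge> 1" "2 * B \<le> real n" "n \<ge> n1" using n0 by (auto simp: n_def)
  have "B / real n \<le> 1 / 2" using n by (simp add: field_simps)
  then have "(B / real n) ^ n \<le> (1 / 2) ^ n" using B by (intro power_mono) auto
  then have "A * (B ^ n / real n ^ n) \<le> A * (1 / 2) ^ n" using A by (intro mult_left_mono) (auto simp: power_divide)
  also have "\<dots> \<le> e" using n1[OF n(3)] by simp
  finally show ?thesis using n(1) by auto
qed

text \<open>For \<gamma> > 1 the power m^(- \<gamma> m) beats both the cost of the next level, of
  order m^(m + 1) up to geometric factors, and those factors. At \<gamma> = 1 the ratio would be
  unbounded, hence the loss of \<delta> in the exponent.\<close>

lemma self_power_ratio_bounded:
  fixes B \<gamma> :: real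
  assumes B: "B \<ge> 1" and \<gamma>: "\<gamma> > 1"
  shows "\<exists>S>0. \<forall>m\<ge>1. (6 * real (Suc m)) ^ Suc m * (B ^ m / real m ^ m) powr \<gamma> \<le> S"
proof -
  define s where "s m = (6 * real (Suc m)) ^ Suc m * (B ^ m / real m ^ m) powr \<gamma>" for m
  define b where "b m = 24 * B powr \<gamma> * real m powr (1 - \<gamma>)" for m
  have "((\<lambda>m::nat. real m powr (1 - \<gamma>)) \<longlongrightarrow> 0) sequentially"
    using \<gamma> by (intro tendsto_neg_powr filterlim_real_sequentially) auto
  then have "b \<longlonglongrightarrow> 24 * B powr \<gamma> * 0" unfolding b_def by (intro tendsto_intros)
  then have "\<forall>\<^sub>F m in sequentially. b m < 1" by (intro order_tendstoD(2)) auto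
  moreover have "\<forall>\<^sub>F m::nat in sequentially. m \<ge> 1" by (rule eventually_ge_at_top)
  ultimately have "\<forall>\<^sub>F m in sequentially. norm (s m) \<le> norm (12::real)"
  proof eventually_elim
    case (elim m)
    then have m: "real m \<ge> 1" by simp
    have b: "0 \<le> b m" by (simp add: b_def)
    \<comment> \<open>6 (m + 1) is at most 12 m, and the surplus factor m at most 2^m; this is the
      origin of the 24 in \<open>b\<close>.\<close>
    have 1: "(6 * real (Suc m)) ^ Suc m \<le> 12 * real m ^ m * 24 ^ m"
    proof -
      have "6 * real (Suc m) \<le> 12 * real m" using m by simp
      then have "(6 * real (Suc m)) ^ Suc m \<le> (12 * real m) ^ Suc m" by (intro power_mono) auto
      also have "\<dots> = 12 * real m ^ m * (12 ^ m * real m)" by (simp add: power_mult_distrib)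
      also have "\<dots> \<le> 12 * real m ^ m * (12 ^ m * 2 ^ m)"
      proof -
        have "real m \<le> 2 ^ m" using of_nat_mono[OF less_imp_le[OF less_exp[of m]], where 'a = real] by simp
        then show ?thesis by (intro mult_left_mono) auto
      qed
      finally show ?thesis by (simp add: power_mult_distrib[symmetric])
    qed
    have 2: "(B ^ m / real m ^ m) powr \<gamma> = (B powr \<gamma> / real m powr \<gamma>) ^ m"
    proof -
      have "(B ^ m / real m ^ m) powr \<gamma> = ((B / real m) powr real m) powr \<gamma>"
        using B m by (simp add: powr_realpow power_divide)
      also have "\<dots> = ((B / real m) powr \<gamma>) powr real m" by (simp add: powr_powr mult.commute)
      also have "\<dots> = ((B / real m) powr \<gamma>) ^ m" using B m by (simp add: powr_realpow)
      finally show ?thesis using B m by (simp add: powr_divide)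
    qed
    have "s m \<le> 12 * real m ^ m * 24 ^ m * (B powr \<gamma> / real m powr \<gamma>) ^ m"
      unfolding s_def 2 using 1 by (intro mult_right_mono) auto
    also have "\<dots> = 12 * (b m) ^ m"
    proof -
      have "real m powr (1 - \<gamma>) = real m / real m powr \<gamma>" using m by (simp add: powr_diff)
      then show ?thesis by (simp add: b_def power_mult_distrib power_divide)
    qed
    also have "\<dots> \<le> 12 * 1" using elim b by (intro mult_left_mono power_le_one) auto
    finally show ?case by (simp add: s_def)
  qed
  then have "Bseq s" by (rule Bseq_eventually_mono) simp
  then obtain S where "S > 0" "\<And>m. norm (s m) \<le> S" by (auto elim: BseqE)
  then show ?thesis unfolding s_def by (intro exI[of _ S]) (auto intro: order_trans[OF abs_ge_self])
qed

text \<open>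
  The number of levels is the least one that meets the tolerance, so that the previous level, which
  fails it, bounds the tolerance from below; the cost of one more level is compared with this bound.
\<close>

lemma level_choice:
  fixes A B Q :: real
  assumes A: "A \<ge> 1" and B: "B \<ge> 1" and Q: "Q \<ge> 0"
  obtains N :: "nat \<Rightarrow> real \<Rightarrow> nat" and C :: "real \<Rightarrow> real"
  where "\<And>d \<epsilon>. d \<ge> 1 \<Longrightarrow> \<epsilon> \<in> {0<..1} \<Longrightarrow> N d \<epsilon> \<ge> 1" "\<And>\<delta>. \<delta> > 0 \<Longrightarrow> C \<delta> > 0"
    "\<And>d \<epsilon>. d \<ge> 1 \<Longrightarrow> \<epsilon> \<in> {0<..1} \<Longrightarrow>
      A * real d powr (2 * Q) * B ^ N d \<epsilon> / real (N d \<epsilon>) ^ N d \<epsilon> \<le> \<epsilon>^2"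
    "\<And>d \<epsilon> \<delta>. d \<ge> 1 \<Longrightarrow> \<epsilon> \<in> {0<..1} \<Longrightarrow> \<delta> > 0 \<Longrightarrow>
      real d * (6 * real (N d \<epsilon>)) ^ N d \<epsilon> \<le> C \<delta> * real d powr (1 + Q * (2 + \<delta>)) * \<epsilon> powr (- (2 + \<delta>))"
proof -
  define R where "R d \<epsilon> n \<longleftrightarrow> n \<ge> 1 \<and> A * real d powr (2 * Q) * B ^ n / real n ^ n \<le> \<epsilon>^2" for d \<epsilon> and n :: nat
  define N where "N d \<epsilon> = (LEAST n. R d \<epsilon> n)" for d :: nat and \<epsilon>
  have ex: "\<exists>n. R d \<epsilon> n" if "\<epsilon> \<in> {0<..1}" for d :: nat and \<epsilon> :: real
    using self_power_dominates[of B "A * real d powr (2 * Q)" "\<epsilon>^2"] A B that by (auto simp: R_def)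
  have N: "R d \<epsilon> (N d \<epsilon>)" if "\<epsilon> \<in> {0<..1}" for d :: nat and \<epsilon> :: real
    unfolding N_def using ex[OF that] by (rule LeastI_ex)
  have "\<exists>S>0. \<forall>m\<ge>1. (6 * real (Suc m)) ^ Suc m * (B ^ m / real m ^ m) powr (1 + \<delta> / 2) \<le> S" if "\<delta> > 0" for \<delta>
    using B that by (intro self_power_ratio_bounded) auto
  then obtain S where S: "\<And>\<delta>. \<delta> > 0 \<Longrightarrow> S \<delta> > 0"
    "\<And>\<delta> m. \<delta> > 0 \<Longrightarrow> m \<ge> 1 \<Longrightarrow> (6 * real (Suc m)) ^ Suc m * (B ^ m / real m ^ m) powr (1 + \<delta> / 2) \<le> S \<delta>"
    by metis
  \<comment> \<open>The 6 covers the case of a single level, where no previous level bounds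
    \<epsilon> from below.\<close>
  define C where "C \<delta> = 6 + A powr (1 + \<delta> / 2) * S \<delta>" for \<delta>
  have Cpos: "C \<delta> > 0" "6 \<le> C \<delta>" "A powr (1 + \<delta> / 2) * S \<delta> \<le> C \<delta>" if "\<delta> > 0" for \<delta>
    using S(1)[OF that] A by (auto simp: C_def add_pos_nonneg)
  have cost: "real d * (6 * real (N d \<epsilon>)) ^ N d \<epsilon> \<le> C \<delta> * real d powr (1 + Q * (2 + \<delta>)) * \<epsilon> powr (- (2 + \<delta>))"
    if d: "d \<ge> 1" and \<epsilon>: "\<epsilon> \<in> {0<..1}" and \<delta>: "\<delta> > 0" for d :: nat and \<epsilon> \<delta>
  proof -
    \<comment> \<open>The error criterion bounds \<epsilon>^2, and the \<gamma>-th power of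
      \<epsilon>^2 is \<epsilon>^(2 + \<delta>).\<close>
    define \<gamma> where "\<gamma> = 1 + \<delta> / 2"
    have dp: "real d powr (1 + Q * (2 + \<delta>)) = real d * real d powr (Q * (2 + \<delta>))"
      using d by (simp add: powr_add)
    have \<epsilon>1: "\<epsilon> powr (- (2 + \<delta>)) \<ge> 1" using \<epsilon> \<delta> powr_mono2'[of "- (2 + \<delta>)" \<epsilon> 1] by simp
    have d1: "real d powr (Q * (2 + \<delta>)) \<ge> 1" using d Q \<delta> by (intro ge_one_powr_ge_zero) auto
    show ?thesis
    proof (cases "N d \<epsilon> = 1")
      case True
      have "real d * 6 * 1 * 1 \<le> real d * C \<delta> * real d powr (Q * (2 + \<delta>)) * \<epsilon> powr (- (2 + \<delta>))"
        using \<epsilon>1 d1 Cpos[OF \<delta>] by (intro mult_mono) auto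
      then show ?thesis using True by (simp add: dp mult_ac)
    next
      case False
      define m where "m = N d \<epsilon> - 1"
      have "N d \<epsilon> \<ge> 1" using N[OF \<epsilon>] by (simp add: R_def)
      with False have m: "m \<ge> 1" "N d \<epsilon> = Suc m" by (auto simp: m_def)
      then have "\<not> R d \<epsilon> m" using not_less_Least[of m "R d \<epsilon>"] by (simp add: N_def)
      then have lt: "\<epsilon>^2 < A * real d powr (2 * Q) * (B ^ m / real m ^ m)" using m by (simp add: R_def)
      have "\<epsilon> powr (2 + \<delta>) = (\<epsilon>^2) powr \<gamma>"
      proof -
        have "(\<epsilon>^2) powr \<gamma> = (\<epsilon> powr 2) powr \<gamma>" using \<epsilon> by (simp add: powr_numeral)
        then show ?thesis by (simp add: powr_powr \<gamma>_def)
      qed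
      also have "\<dots> \<le> (A * real d powr (2 * Q) * (B ^ m / real m ^ m)) powr \<gamma>"
        using lt \<delta> by (intro powr_mono2) (auto simp: \<gamma>_def)
      also have "\<dots> = A powr \<gamma> * real d powr (Q * (2 + \<delta>)) * (B ^ m / real m ^ m) powr \<gamma>"
      proof -
        have "0 \<le> B ^ m / real m ^ m" using B by simp
        then have "(A * real d powr (2 * Q) * (B ^ m / real m ^ m)) powr \<gamma> = A powr \<gamma> * (real d powr (2 * Q)) powr \<gamma> * (B ^ m / real m ^ m) powr \<gamma>"
          using A by (simp only: powr_mult mult_nonneg_nonneg powr_ge_zero)
        also have "(real d powr (2 * Q)) powr \<gamma> = real d powr (Q * (2 + \<delta>))"
          unfolding powr_powr \<gamma>_def by (simp add: algebra_simps)
        finally show ?thesis .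
      qed
      finally have \<epsilon>le: "\<epsilon> powr (2 + \<delta>) \<le> A powr \<gamma> * real d powr (Q * (2 + \<delta>)) * (B ^ m / real m ^ m) powr \<gamma>" .
      have "(6 * real (Suc m)) ^ Suc m * \<epsilon> powr (2 + \<delta>) \<le>
          (6 * real (Suc m)) ^ Suc m * (A powr \<gamma> * real d powr (Q * (2 + \<delta>)) * (B ^ m / real m ^ m) powr \<gamma>)"
        using \<epsilon>le by (intro mult_left_mono) auto
      also have "\<dots> = A powr \<gamma> * real d powr (Q * (2 + \<delta>)) * ((6 * real (Suc m)) ^ Suc m * (B ^ m / real m ^ m) powr \<gamma>)"
        by (simp only: mult_ac)
      also have "\<dots> \<le> A powr \<gamma> * real d powr (Q * (2 + \<delta>)) * S \<delta>"
        using S(2)[OF \<delta> m(1)] by (intro mult_left_mono) (auto simp: \<gamma>_def)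
      also have "\<dots> = (A powr \<gamma> * S \<delta>) * real d powr (Q * (2 + \<delta>))" by (simp only: mult_ac)
      also have "\<dots> \<le> C \<delta> * real d powr (Q * (2 + \<delta>))"
        using Cpos(3)[OF \<delta>] by (intro mult_right_mono) (auto simp: \<gamma>_def)
      finally have "(6 * real (Suc m)) ^ Suc m * \<epsilon> powr (2 + \<delta>) * \<epsilon> powr (- (2 + \<delta>)) \<le> C \<delta> * real d powr (Q * (2 + \<delta>)) * \<epsilon> powr (- (2 + \<delta>))"
        by (rule mult_right_mono) simp
      moreover have "\<epsilon> powr (2 + \<delta>) * \<epsilon> powr (- (2 + \<delta>)) = 1" using \<epsilon> by (simp add: powr_add[symmetric])
      ultimately have "(6 * real (Suc m)) ^ Suc m \<le> C \<delta> * real d powr (Q * (2 + \<delta>)) * \<epsilon> powr (- (2 + \<delta>))"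
        by (simp only: mult.assoc mult_1_right)
      then have "real d * (6 * real (Suc m)) ^ Suc m \<le> real d * (C \<delta> * real d powr (Q * (2 + \<delta>)) * \<epsilon> powr (- (2 + \<delta>)))"
        by (rule mult_left_mono) simp
      then show ?thesis unfolding m(2) dp by (simp only: mult_ac)
    qed
  qed
  show ?thesis
    by (rule that[of N C]) (use N cost Cpos in \<open>auto simp: R_def\<close>)
qed

section \<open>The approximations of the differential equation\<close>

lemma measurable_norm_Rd: "norm_Rd d \<in> borel_measurable (borel_Rd d)"
  unfolding norm_Rd_def[abs_def] L2_set_def by measurable

lemma measurable_rpow_norm: "(\<lambda>x. 1 + rpow (norm_Rd d x) r) \<in> borel_measurable (borel_Rd d)"
  using measurable_norm_Rd[of d] unfolding rpow_def by measurable

lemma rpow_power2: "0 \<le> a \<Longrightarrow> (rpow a r)^2 = rpow a (2 * r)"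
  by (simp add: rpow_def power2_eq_square powr_add[symmetric])

lemma one_plus_rpow_square: "0 \<le> a \<Longrightarrow> (1 + rpow a r)^2 \<le> 2 * (1 + rpow a (2 * r))"
  using square_add_le[of 1 "rpow a r"] by (simp add: rpow_power2)

text \<open>Clamping the time and restricting the point give a function that is defined and, for the
  solutions considered, continuous on the whole space. So the abstract scheme can ask for global
  measurability.\<close>

definition extend_Rd :: "real \<Rightarrow> nat \<Rightarrow> (real \<Rightarrow> (nat \<Rightarrow> real) \<Rightarrow> real) \<Rightarrow> real \<Rightarrow> (nat \<Rightarrow> real) \<Rightarrow> real" where
  "extend_Rd T d u s x = u (max 0 (min T s)) (restrict x {1..d})"

lemma restrict_Rd: "x \<in> Rd d \<Longrightarrow> restrict x {1..d} = x"
  by (auto simp: Rd_def PiE_iff extensional_restrict)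

lemma extend_Rd_eq: "s \<in> {0..T} \<Longrightarrow> x \<in> Rd d \<Longrightarrow> extend_Rd T d u s x = u s x"
  by (simp add: extend_Rd_def restrict_Rd)

lemma continuous_restrict: "continuous_on UNIV (\<lambda>x::nat \<Rightarrow> real. restrict x {1..d})"
proof (rule continuous_on_coordinatewise_then_product)
  fix i show "continuous_on UNIV (\<lambda>x::nat \<Rightarrow> real. restrict x {1..d} i)"
    by (cases "i \<in> {1..d}") (auto intro: continuous_intros)
qed

lemma measurable_extend_Rd:
  assumes T: "0 \<le> T" and c: "continuous_on ({0..T} \<times> Rd d) (\<lambda>(t, x). u t x)"
  shows "(\<lambda>p. extend_Rd T d u (fst p) (snd p)) \<in> borel_measurable (borel \<Otimes>\<^sub>M borel_Rd d)"
proof (rule borel_measurable_pair_borel_Rd_continuous)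
  have 1: "continuous_on UNIV (\<lambda>p::real \<times> (nat \<Rightarrow> real). max 0 (min T (fst p)))" by (intro continuous_intros)
  have 2: "continuous_on UNIV (\<lambda>p::real \<times> (nat \<Rightarrow> real). restrict (snd p) {1..d})"
    by (rule continuous_on_compose2[OF continuous_restrict]) (auto intro: continuous_intros)
  have "continuous_on UNIV (\<lambda>p. (\<lambda>(t, x). u t x) (max 0 (min T (fst p)), restrict (snd p) {1..d}))"
    by (rule continuous_on_compose2[OF c continuous_on_Pair[OF 1 2]]) (use T in \<open>auto simp: Rd_def\<close>)
  then show "continuous_on UNIV (\<lambda>p. extend_Rd T d u (fst p) (snd p))" by (simp add: extend_Rd_def)
qed

lemma measurable_continuous_Rd:
  fixes g :: "(nat \<Rightarrow> real) \<Rightarrow> real"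
  assumes "continuous_on (Rd d) g"
  shows "g \<in> borel_measurable (borel_Rd d)"
proof -
  have "continuous_on UNIV (\<lambda>x. g (restrict x {1..d}))"
    by (rule continuous_on_compose2[OF assms continuous_restrict]) (auto simp: Rd_def)
  then have "(\<lambda>x. g (restrict x {1..d})) \<in> borel_measurable (borel_Rd d)"
    by (rule borel_measurable_borel_Rd_continuous)
  then show ?thesis
    by (subst measurable_cong[where g = "\<lambda>x. g (restrict x {1..d})"]) (auto simp: space_borel_Rd restrict_Rd simp del: One_nat_def)
qed

context brownian_noise begin

text \<open>The Gaussian moment bound is uniform in the elapsed time and \<phi> depends on the time
  only, so \<open>K\<close> comes out of the time integral.\<close>

lemma weight_moment:
  assumes K: "K \<ge> 0" "\<And>\<tau> x. 0 \<le> \<tau> \<Longrightarrow> \<tau> \<le> T \<Longrightarrow>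
     (\<integral>\<^sup>+z. ennreal (1 + rpow (norm_Rd d (gbm \<alpha> \<beta> d x \<tau> z)) r) \<partial>std_gauss d) \<le> ennreal (K * (1 + rpow (norm_Rd d x) r))"
    and t: "t \<in> {0..T}" and x: "x \<in> Rd d" and \<phi>: "\<phi> \<in> borel_measurable borel"
  shows "ennreal (T - t) * (\<integral>\<^sup>+y. \<phi> (noise_time T t y) * ennreal (1 + rpow (norm_Rd d (noise_state \<alpha> \<beta> T d t x y)) r) \<partial>\<nu>)
    \<le> ennreal (K * (1 + rpow (norm_Rd d x) r)) * (\<integral>\<^sup>+s. indicator {t..T} s * \<phi> s \<partial>lborel)"
proof -
  have wm: "(\<lambda>y. ennreal (1 + rpow (norm_Rd d y) r)) \<in> borel_measurable (borel_Rd d)"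
    using measurable_rpow_norm[of d r] by measurable
  have h: "(\<lambda>p. \<phi> (fst p) * ennreal (1 + rpow (norm_Rd d (snd p)) r)) \<in> borel_measurable (borel \<Otimes>\<^sub>M borel_Rd d)"
    by (intro borel_measurable_times_ennreal measurable_compose[OF measurable_fst \<phi>] measurable_compose[OF measurable_snd wm])
  have "ennreal (T - t) * (\<integral>\<^sup>+y. \<phi> (noise_time T t y) * ennreal (1 + rpow (norm_Rd d (noise_state \<alpha> \<beta> T d t x y)) r) \<partial>\<nu>)
    = (\<integral>\<^sup>+s. indicator {t..T} s * (\<integral>\<^sup>+z. \<phi> s * ennreal (1 + rpow (norm_Rd d (gbm \<alpha> \<beta> d x (s - t) z)) r) \<partial>std_gauss d) \<partial>lborel)"
    using nn_integral_noise_state[OF _ _ x h, of t] t by simp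
  also have "\<dots> \<le> (\<integral>\<^sup>+s. ennreal (K * (1 + rpow (norm_Rd d x) r)) * (indicator {t..T} s * \<phi> s) \<partial>lborel)"
  proof (rule nn_integral_mono)
    fix s
    show "indicator {t..T} s * (\<integral>\<^sup>+z. \<phi> s * ennreal (1 + rpow (norm_Rd d (gbm \<alpha> \<beta> d x (s - t) z)) r) \<partial>std_gauss d)
      \<le> ennreal (K * (1 + rpow (norm_Rd d x) r)) * (indicator {t..T} s * \<phi> s)"
    proof (cases "s \<in> {t..T}")
      case True
      have gm: "gbm \<alpha> \<beta> d x (s - t) \<in> measurable (std_gauss d) (borel_Rd d)"
        by (intro measurable_gbm) auto
      have "(\<integral>\<^sup>+z. \<phi> s * ennreal (1 + rpow (norm_Rd d (gbm \<alpha> \<beta> d x (s - t) z)) r) \<partial>std_gauss d)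
        = \<phi> s * (\<integral>\<^sup>+z. ennreal (1 + rpow (norm_Rd d (gbm \<alpha> \<beta> d x (s - t) z)) r) \<partial>std_gauss d)"
        by (rule nn_integral_cmult[OF measurable_compose[OF gm wm]])
      also have "\<dots> \<le> \<phi> s * ennreal (K * (1 + rpow (norm_Rd d x) r))"
        using True t by (intro mult_left_mono K) auto
      finally show ?thesis using True by (simp add: mult.commute)
    qed simp
  qed
  also have "\<dots> = ennreal (K * (1 + rpow (norm_Rd d x) r)) * (\<integral>\<^sup>+s. indicator {t..T} s * \<phi> s \<partial>lborel)"
    using \<phi> by (intro nn_integral_cmult) measurable
  finally show ?thesis .
qed

end

text \<open>The exponent \<open>r\<close> describes the growth of the square of g. In the
  application \<open>K\<close> is chosen once for all dimensions, and \<open>cg\<close> carries the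
  dependence on d.\<close>

locale pde_noise = semilinear_pde T \<alpha> \<beta> L f d u + brownian_noise T \<alpha> \<beta> d \<mu>
  for T \<alpha> \<beta> L f d u \<mu> +
  fixes g :: "(nat \<Rightarrow> real) \<Rightarrow> real" and r K cg :: real
  assumes g_continuous: "continuous_on (Rd d) g" and terminal: "\<And>x. x \<in> Rd d \<Longrightarrow> u T x = g x"
    and cg: "cg \<ge> 0" "\<And>x. x \<in> Rd d \<Longrightarrow> (g x)^2 \<le> cg * (1 + rpow (norm_Rd d x) r)"
    and K: "K \<ge> 1" "\<And>\<tau> x. 0 \<le> \<tau> \<Longrightarrow> \<tau> \<le> T \<Longrightarrow>
     (\<integral>\<^sup>+z. ennreal (1 + rpow (norm_Rd d (gbm \<alpha> \<beta> d x \<tau> z)) r) \<partial>std_gauss d) \<le> ennreal (K * (1 + rpow (norm_Rd d x) r))"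
begin

abbreviation "\<u> \<equiv> extend_Rd T d u"

lemma u_measurable: "(\<lambda>p. \<u> (fst p) (snd p)) \<in> borel_measurable (borel \<Otimes>\<^sub>M borel_Rd d)"
  using semilinear_pde_axioms T by (intro measurable_extend_Rd) (auto simp: semilinear_pde_def C12_def)

lemma noise_state_Rd: "noise_state \<alpha> \<beta> T d t x y \<in> Rd d"
  by (simp add: noise_state_def brownian_gbm_def Rd_def)

text \<open>The exponent \<open>r'\<close> stems from the unspecified growth of u. Its constants may
  be large: they give integrability and start the iteration in \<open>u_square_le\<close>, where
  they disappear in the limit.\<close>

lemma growth_weight:
  obtains r' K' U where "r' \<ge> 0" "K' \<ge> 0" "U \<ge> 0"
    "\<And>s x. s \<in> {0..T} \<Longrightarrow> x \<in> Rd d \<Longrightarrow> (\<u> s x)^2 \<le> U * (1 + rpow (norm_Rd d x) r')"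
    "\<And>t x \<phi>. t \<in> {0..T} \<Longrightarrow> x \<in> Rd d \<Longrightarrow> \<phi> \<in> borel_measurable borel \<Longrightarrow>
      ennreal (T - t) * (\<integral>\<^sup>+y. \<phi> (noise_time T t y) * ennreal (1 + rpow (norm_Rd d (noise_state \<alpha> \<beta> T d t x y)) r') \<partial>\<nu>)
    \<le> ennreal (K' * (1 + rpow (norm_Rd d x) r')) * (\<integral>\<^sup>+s. indicator {t..T} s * \<phi> s \<partial>lborel)"
proof -
  obtain c q where cq: "c \<ge> 0" "q \<ge> 0" "\<And>t x. t\<in>{0..T} \<Longrightarrow> x\<in>Rd d \<Longrightarrow> \<bar>u t x\<bar> \<le> c * (1 + rpow (norm_Rd d x) q)"
    using growing unfolding polynomially_growing_def by blast
  have q2: "2 * q \<ge> 0" using cq by simp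
  obtain K' where K': "K' \<ge> 1" "\<And>d \<tau> x. 0 \<le> \<tau> \<Longrightarrow> \<tau> \<le> T \<Longrightarrow>
     (\<integral>\<^sup>+z. ennreal (1 + rpow (norm_Rd d (gbm \<alpha> \<beta> d x \<tau> z)) (2 * q)) \<partial>std_gauss d)
      \<le> ennreal (K' * (1 + rpow (norm_Rd d x) (2 * q)))"
    using gbm_weight_moment[OF T q2, of \<alpha> \<beta>] by blast
  show ?thesis
  proof (rule that[of "2 * q" K' "2 * c^2"])
    show "(\<u> s x)^2 \<le> 2 * c^2 * (1 + rpow (norm_Rd d x) (2 * q))" if "s \<in> {0..T}" "x \<in> Rd d" for s x
    proof -
      have "(\<u> s x)^2 = \<bar>u s x\<bar>^2" using that by (simp add: extend_Rd_eq)
      also have "\<dots> \<le> (c * (1 + rpow (norm_Rd d x) q))^2" using cq(3)[OF that] by (intro power_mono) auto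
      also have "\<dots> = c^2 * (1 + rpow (norm_Rd d x) q)^2" by (simp add: power_mult_distrib)
      also have "\<dots> \<le> c^2 * (2 * (1 + rpow (norm_Rd d x) (2 * q)))"
        by (intro mult_left_mono one_plus_rpow_square norm_Rd_nonneg) auto
      finally show ?thesis by (simp only: mult_ac)
    qed
  qed (use K' cq weight_moment[where K = K' and r = "2 * q"] in auto)
qed

text \<open>Supplies the integrability asked for in \<open>integral_noise_state\<close>. The growth
  bound on the square of u is turned into a bound on u by |v| <= 1 + v^2.\<close>

lemma f_u_integrable:
  assumes t: "t \<in> {0..T}" "t < T" and x: "x \<in> Rd d"
  shows "integrable \<nu> (\<lambda>y. f (\<u> (noise_time T t y) (noise_state \<alpha> \<beta> T d t x y)))"
proof -
  interpret nu: prob_space \<nu> by (rule prob_noise)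
  obtain r' K' U where *: "r' \<ge> 0" "K' \<ge> 0" "U \<ge> 0"
    "\<And>s x. s \<in> {0..T} \<Longrightarrow> x \<in> Rd d \<Longrightarrow> (\<u> s x)^2 \<le> U * (1 + rpow (norm_Rd d x) r')"
    "\<And>t x \<phi>. t \<in> {0..T} \<Longrightarrow> x \<in> Rd d \<Longrightarrow> \<phi> \<in> borel_measurable borel \<Longrightarrow>
      ennreal (T - t) * (\<integral>\<^sup>+y. \<phi> (noise_time T t y) * ennreal (1 + rpow (norm_Rd d (noise_state \<alpha> \<beta> T d t x y)) r') \<partial>\<nu>)
    \<le> ennreal (K' * (1 + rpow (norm_Rd d x) r')) * (\<integral>\<^sup>+s. indicator {t..T} s * \<phi> s \<partial>lborel)"
    using growth_weight by blast
  let ?X = "noise_state \<alpha> \<beta> T d t x" and ?R = "noise_time T t"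
  let ?w = "\<lambda>y. 1 + rpow (norm_Rd d (?X y)) r'"
  have R: "?R \<in> borel_measurable \<nu>" by (rule measurable_noise_time) auto
  have X: "?X \<in> measurable \<nu> (borel_Rd d)" using x by (intro measurable_noise_state) (auto simp: space_borel_Rd)
  have wm: "?w \<in> borel_measurable \<nu>" by (rule measurable_compose[OF X measurable_rpow_norm])
  have um: "(\<lambda>y. \<u> (?R y) (?X y)) \<in> borel_measurable \<nu>"
    using measurable_compose[OF measurable_Pair[OF R X] u_measurable] by simp
  have fm: "f \<in> borel_measurable borel" using continuous_f by (rule borel_measurable_continuous_onI)
  have w_int: "integrable \<nu> ?w"
  proof (rule integrableI_nonneg[OF wm])
    have "ennreal (T - t) * (\<integral>\<^sup>+y. ennreal (?w y) \<partial>\<nu>) \<le> ennreal (K' * (1 + rpow (norm_Rd d x) r')) * (\<integral>\<^sup>+s. indicator {t..T} s * 1 \<partial>lborel)"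
      using *(5)[OF t(1) x, of "\<lambda>_. 1"] by simp
    also have "\<dots> < \<infinity>" using t by (simp add: ennreal_mult_less_top)
    finally show "(\<integral>\<^sup>+y. ennreal (?w y) \<partial>\<nu>) < \<infinity>" using t(2) by (auto simp: ennreal_mult_less_top)
  qed (auto simp: rpow_nonneg)
  have L: "L \<ge> 0" using f_lipschitz by (rule lipschitz_on_nonneg)
  show ?thesis
  proof (rule Bochner_Integration.integrable_bound)
    show "integrable \<nu> (\<lambda>y. \<bar>f 0\<bar> + L * (1 + U * ?w y))"
      by (rule Bochner_Integration.integrable_add[OF nu.integrable_const integrable_mult_right[OF
          Bochner_Integration.integrable_add[OF nu.integrable_const integrable_mult_right[OF w_int]]]])
    show "(\<lambda>y. f (\<u> (?R y) (?X y))) \<in> borel_measurable \<nu>" by (rule measurable_compose[OF um fm])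
    show "AE y in \<nu>. norm (f (\<u> (?R y) (?X y))) \<le> norm (\<bar>f 0\<bar> + L * (1 + U * ?w y))"
    proof (rule AE_I2)
      fix y
      let ?v = "\<u> (?R y) (?X y)"
      have "?R y \<in> {0..T}" using noise_time_range[of t T y] t by auto
      then have "?v^2 \<le> U * ?w y" by (rule *(4)) (rule noise_state_Rd)
      moreover have "\<bar>?v\<bar> \<le> 1 + ?v^2" using sum_squares_bound[of "\<bar>?v\<bar>" 1] by simp
      ultimately have "L * \<bar>?v\<bar> \<le> L * (1 + U * ?w y)" using L by (intro mult_left_mono) auto
      moreover have "\<bar>f ?v - f 0\<bar> \<le> L * \<bar>?v\<bar>"
        using lipschitz_onD[OF f_lipschitz, of ?v 0] by (simp add: dist_real_def)
      ultimately show "norm (f ?v) \<le> norm (\<bar>f 0\<bar> + L * (1 + U * ?w y))"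
        unfolding real_norm_def by linarith
    qed
  qed
qed

text \<open>The substantial point is the fixed point equation, which is \<open>feynman_kac\<close>
  with the time integral rewritten as an expectation at a uniform random time. The second moment of
  g contributes the factor \<open>cg * K\<close>.\<close>

lemma mlp_instance:
  "mlp T L f \<nu> (borel_Rd d) (noise_time T) (noise_state \<alpha> \<beta> T d) (noise_final \<alpha> \<beta> T d) g \<u>
    (\<lambda>x. 1 + rpow (norm_Rd d x) r) K (cg * K)"
proof (rule mlp.intro)
  show "0 < T" by (rule T)
  show "L-lipschitz_on UNIV f" by (rule f_lipschitz)
  show "(\<lambda>p. noise_time T (fst p) (snd p)) \<in> borel_measurable (borel \<Otimes>\<^sub>M \<nu>)"
    by (intro measurable_noise_time) auto
  show "(\<lambda>p. noise_state \<alpha> \<beta> T d (fst p) (fst (snd p)) (snd (snd p))) \<in> measurable (borel \<Otimes>\<^sub>M (borel_Rd d \<Otimes>\<^sub>M \<nu>)) (borel_Rd d)"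
    by (intro measurable_noise_state) auto
  show "(\<lambda>p. noise_final \<alpha> \<beta> T d (fst p) (fst (snd p)) (snd (snd p))) \<in> measurable (borel \<Otimes>\<^sub>M (borel_Rd d \<Otimes>\<^sub>M \<nu>)) (borel_Rd d)"
    by (intro measurable_noise_final) auto
  show "noise_time T t y \<in> {t..T}" if "t \<in> {0..T}" for t and y :: "real \<times> (real \<Rightarrow> nat \<Rightarrow> real)"
    using that by (intro noise_time_range) auto
  show gm: "g \<in> borel_measurable (borel_Rd d)" using g_continuous by (rule measurable_continuous_Rd)
  show "(\<lambda>p. \<u> (fst p) (snd p)) \<in> borel_measurable (borel \<Otimes>\<^sub>M borel_Rd d)" by (rule u_measurable)
  show "(\<lambda>x. 1 + rpow (norm_Rd d x) r) \<in> borel_measurable (borel_Rd d)" by (rule measurable_rpow_norm)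
  show "1 \<le> 1 + rpow (norm_Rd d x) r" for x by (simp add: rpow_nonneg)
  show "0 \<le> K" "0 \<le> cg * K" using K cg by auto
  show "ennreal (T - t) * (\<integral>\<^sup>+y. \<phi> (noise_time T t y) * ennreal (1 + rpow (norm_Rd d (noise_state \<alpha> \<beta> T d t x y)) r) \<partial>\<nu>)
    \<le> ennreal (K * (1 + rpow (norm_Rd d x) r)) * (\<integral>\<^sup>+s. indicator {t..T} s * \<phi> s \<partial>lborel)"
    if "t \<in> {0..T}" "x \<in> space (borel_Rd d)" "\<phi> \<in> borel_measurable borel" for t x \<phi>
    using that K by (intro weight_moment) (auto simp: space_borel_Rd simp del: One_nat_def)
  show "(\<integral>\<^sup>+y. ennreal ((g (noise_final \<alpha> \<beta> T d t x y))^2) \<partial>\<nu>) \<le> ennreal (cg * K * (1 + rpow (norm_Rd d x) r))"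
    if t: "t \<in> {0..T}" and "x \<in> space (borel_Rd d)" for t x
  proof -
    have x: "x \<in> Rd d" using that by (simp add: space_borel_Rd)
    have gm2: "(\<lambda>y. ennreal ((g y)^2)) \<in> borel_measurable (borel_Rd d)" using gm by measurable
    have "(\<integral>\<^sup>+y. ennreal ((g (noise_final \<alpha> \<beta> T d t x y))^2) \<partial>\<nu>) = (\<integral>\<^sup>+z. ennreal ((g (gbm \<alpha> \<beta> d x (T - t) z))^2) \<partial>std_gauss d)"
      using nn_integral_noise_final[OF _ _ x gm2, of t] t by simp
    also have "\<dots> \<le> (\<integral>\<^sup>+z. ennreal cg * ennreal (1 + rpow (norm_Rd d (gbm \<alpha> \<beta> d x (T - t) z)) r) \<partial>std_gauss d)"
    proof (rule nn_integral_mono)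
      fix z
      show "ennreal ((g (gbm \<alpha> \<beta> d x (T - t) z))^2) \<le> ennreal cg * ennreal (1 + rpow (norm_Rd d (gbm \<alpha> \<beta> d x (T - t) z)) r)"
        using cg(1) by (subst ennreal_mult[symmetric]) (auto intro!: ennreal_leI cg(2) add_nonneg_nonneg simp: rpow_nonneg simp del: ennreal_plus)
    qed
    also have "\<dots> = ennreal cg * (\<integral>\<^sup>+z. ennreal (1 + rpow (norm_Rd d (gbm \<alpha> \<beta> d x (T - t) z)) r) \<partial>std_gauss d)"
    proof (rule nn_integral_cmult)
      have "gbm \<alpha> \<beta> d x (T - t) \<in> measurable (std_gauss d) (borel_Rd d)" by (intro measurable_gbm) auto
      from measurable_compose[OF measurable_compose[OF this measurable_rpow_norm] measurable_ennreal]
      show "(\<lambda>z. ennreal (1 + rpow (norm_Rd d (gbm \<alpha> \<beta> d x (T - t) z)) r)) \<in> borel_measurable (std_gauss d)" .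
    qed
    also have "\<dots> \<le> ennreal cg * ennreal (K * (1 + rpow (norm_Rd d x) r))"
      using t by (intro mult_left_mono K) auto
    also have "\<dots> = ennreal (cg * K * (1 + rpow (norm_Rd d x) r))"
      using cg K by (simp add: ennreal_mult[symmetric] rpow_nonneg mult.assoc)
    finally show ?thesis .
  qed
  show "\<u> t x = (\<integral>y. g (noise_final \<alpha> \<beta> T d t x y) \<partial>\<nu>) + (T - t) * (\<integral>y. f (\<u> (noise_time T t y) (noise_state \<alpha> \<beta> T d t x y)) \<partial>\<nu>)"
    if t: "t \<in> {0..T}" and "x \<in> space (borel_Rd d)" for t x
  proof -
    have x: "x \<in> Rd d" using that by (simp add: space_borel_Rd)
    have t': "0 \<le> t" "t \<le> T" using t by auto
    have fm: "f \<in> borel_measurable borel" using continuous_f by (rule borel_measurable_continuous_onI)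
    have h: "(\<lambda>p. f (\<u> (fst p) (snd p))) \<in> borel_measurable (borel \<Otimes>\<^sub>M borel_Rd d)"
      by (rule measurable_compose[OF u_measurable fm])
    have 1: "(T - t) * (\<integral>y. f (\<u> (noise_time T t y) (noise_state \<alpha> \<beta> T d t x y)) \<partial>\<nu>)
      = (\<integral>s. indicator {t..T} s * (\<integral>z. f (u s (gbm \<alpha> \<beta> d x (s - t) z)) \<partial>std_gauss d) \<partial>lborel)"
    proof -
      have "(T - t) * (\<integral>y. f (\<u> (noise_time T t y) (noise_state \<alpha> \<beta> T d t x y)) \<partial>\<nu>)
        = (\<integral>s. indicator {t..T} s * (\<integral>z. f (\<u> s (gbm \<alpha> \<beta> d x (s - t) z)) \<partial>std_gauss d) \<partial>lborel)"
        using integral_noise_state[OF t' x h] f_u_integrable[OF t _ x] by simp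
      also have "\<dots> = (\<integral>s. indicator {t..T} s * (\<integral>z. f (u s (gbm \<alpha> \<beta> d x (s - t) z)) \<partial>std_gauss d) \<partial>lborel)"
        using t' by (intro Bochner_Integration.integral_cong refl) (auto simp: extend_Rd_eq split: split_indicator)
      finally show ?thesis .
    qed
    have 2: "(\<integral>y. g (noise_final \<alpha> \<beta> T d t x y) \<partial>\<nu>) = (\<integral>z. u T (gbm \<alpha> \<beta> d x (T - t) z) \<partial>std_gauss d)"
      using integral_noise_final[OF t' x gm] by (simp add: terminal)
    show ?thesis using feynman_kac[OF t' x] 1 2 t x by (simp add: extend_Rd_eq)
  qed
qed (rule prob_noise)

text \<open>Affine in \<open>cg\<close>, with the other constants given by T, L, \<open>f 0\<close>
  and \<open>K\<close>: the growth of u is governed by that of g.\<close>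

lemma u_bound:
  assumes t: "t \<in> {0..T}" and x: "x \<in> Rd d"
  shows "(\<u> t x)^2 \<le> 2 * (2 * (cg * K) + 4 * T^2 * (f 0)^2) * exp ((8 * T * L^2 * K + 1) * T) * (1 + rpow (norm_Rd d x) r)"
proof -
  interpret mlp T L f \<nu> "borel_Rd d" "noise_time T" "noise_state \<alpha> \<beta> T d" "noise_final \<alpha> \<beta> T d" g \<u>
    "\<lambda>x. 1 + rpow (norm_Rd d x) r" K "cg * K" by (rule mlp_instance)
  obtain r' K' U where *: "r' \<ge> 0" "K' \<ge> 0" "U \<ge> 0"
    "\<And>s x. s \<in> {0..T} \<Longrightarrow> x \<in> Rd d \<Longrightarrow> (\<u> s x)^2 \<le> U * (1 + rpow (norm_Rd d x) r')"
    "\<And>t x \<phi>. t \<in> {0..T} \<Longrightarrow> x \<in> Rd d \<Longrightarrow> \<phi> \<in> borel_measurable borel \<Longrightarrow>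
      ennreal (T - t) * (\<integral>\<^sup>+y. \<phi> (noise_time T t y) * ennreal (1 + rpow (norm_Rd d (noise_state \<alpha> \<beta> T d t x y)) r') \<partial>\<nu>)
    \<le> ennreal (K' * (1 + rpow (norm_Rd d x) r')) * (\<integral>\<^sup>+s. indicator {t..T} s * \<phi> s \<partial>lborel)"
    using growth_weight by blast
  have "(\<u> t x)^2 \<le> 2 * (2 * (cg * K) + 4 * T^2 * (f 0)^2) * exp ((8 * T * L^2 * K + 1) * (T - t)) * (1 + rpow (norm_Rd d x) r)"
    by (rule u_square_le[of "\<lambda>x. 1 + rpow (norm_Rd d x) r'" K' U])
      (use * t x in \<open>auto simp: space_borel_Rd measurable_rpow_norm rpow_nonneg simp del: One_nat_def\<close>)
  also have "\<dots> \<le> 2 * (2 * (cg * K) + 4 * T^2 * (f 0)^2) * exp ((8 * T * L^2 * K + 1) * T) * (1 + rpow (norm_Rd d x) r)"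
  proof (intro mult_right_mono mult_left_mono)
    have "(8 * T * L^2 * K + 1) * (T - t) \<le> (8 * T * L^2 * K + 1) * T"
      using t K T by (intro mult_left_mono) auto
    then show "exp ((8 * T * L^2 * K + 1) * (T - t)) \<le> exp ((8 * T * L^2 * K + 1) * T)" by simp
  qed (use cg K in \<open>auto simp: rpow_nonneg\<close>)
  finally show ?thesis .
qed

end

section \<open>Dependence of the constants on d, and transfer to the given probability space\<close>

theorem theorem1p1:
  fixes T p \<PP> q \<alpha> \<beta> :: real
    and f :: "real \<Rightarrow> real"
    and \<xi> :: "nat \<Rightarrow> nat \<Rightarrow> real"
    and g :: "nat \<Rightarrow> (nat \<Rightarrow> real) \<Rightarrow> real"
    and u :: "nat \<Rightarrow> real \<Rightarrow> (nat \<Rightarrow> real) \<Rightarrow> real"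
    and P :: "'w measure"
    and \<R> :: "int list \<Rightarrow> 'w \<Rightarrow> real"
    and R :: "int list \<Rightarrow> real \<Rightarrow> 'w \<Rightarrow> real"
    and W :: "nat \<Rightarrow> int list \<Rightarrow> real \<Rightarrow> 'w \<Rightarrow> nat \<Rightarrow> real"
    and X :: "nat \<Rightarrow> int list \<Rightarrow> (nat \<Rightarrow> real) \<Rightarrow> real \<Rightarrow> real \<Rightarrow> 'w \<Rightarrow> nat \<Rightarrow> real"
    and V :: "nat \<Rightarrow> int list \<Rightarrow> int \<Rightarrow> int \<Rightarrow> real \<Rightarrow> (nat \<Rightarrow> real) \<Rightarrow> 'w \<Rightarrow> real"
    and \<C> :: "nat \<Rightarrow> int \<Rightarrow> int \<Rightarrow> nat"
  assumes T: "T > 0" and p: "p \<ge> 0" and PP: "\<PP> \<ge> 0" and q: "q \<ge> 0"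
    and f_lipschitz: "\<exists>L. L-lipschitz_on UNIV f"
    and xi: "\<And>d. d \<ge> 1 \<Longrightarrow> \<xi> d \<in> Rd d"
    and g_C2: "\<And>d. d \<ge> 1 \<Longrightarrow> C2_Rd d (g d)"
    and growth: "(SUP (d, x) \<in> (SIGMA d:{1..}. Rd d).
        ereal (\<bar>g d x\<bar> / (real d powr \<PP> * (1 + rpow (norm_Rd d x) p))
               + norm_Rd d (\<xi> d) / real d powr q)) < \<infinity>"
    and u_C12: "\<And>d. d \<ge> 1 \<Longrightarrow> C12 T d (u d)"
    and u_growth: "\<And>d. d \<ge> 1 \<Longrightarrow> polynomially_growing T d (u d)"
    and u_terminal: "\<And>d x. d \<ge> 1 \<Longrightarrow> x \<in> Rd d \<Longrightarrow> u d T x = g d x"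
    and u_pde: "\<And>d t x. d \<ge> 1 \<Longrightarrow> t \<in> {0<..<T} \<Longrightarrow> x \<in> Rd d \<Longrightarrow>
        deriv (\<lambda>s. u d s x) t
        + (\<Sum>i=1..d. \<bar>\<beta>\<bar>^2 * \<bar>x i\<bar>^2 / 2 * partial_deriv i (partial_deriv i (u d t)) x)
        + (\<Sum>i=1..d. \<alpha> * x i * partial_deriv i (u d t) x)
        + f (u d t x) = 0"
    and P: "prob_space P"
    and R_range: "\<And>\<theta> \<omega>. \<theta> \<in> index_set \<Longrightarrow> \<omega> \<in> space P \<Longrightarrow> \<R> \<theta> \<omega> \<in> {0..1}"
    and R_indep: "prob_space.indep_vars P (\<lambda>_. borel) \<R> index_set"
    and R_uniform: "\<And>\<theta>. \<theta> \<in> index_set \<Longrightarrow> distr P borel (\<R> \<theta>) = uniform_measure lborel {0..1}"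
    and R_t: "\<And>\<theta> t \<omega>. \<theta> \<in> index_set \<Longrightarrow> t \<in> {0..T} \<Longrightarrow> \<omega> \<in> space P \<Longrightarrow>
        R \<theta> t \<omega> = t + (T - t) * \<R> \<theta> \<omega>"
    and W_brownian: "\<And>d \<theta>. d \<ge> 1 \<Longrightarrow> \<theta> \<in> index_set \<Longrightarrow> std_brownian_motion P T d (W d \<theta>)"
    and W_indep: "prob_space.indep_vars P (\<lambda>(d, \<theta>). path_space T d)
        (\<lambda>(d, \<theta>). sample_path T (W d \<theta>)) ({1..} \<times> index_set)"
    and W_R_indep: "indep_random_variables P
        (PiM ({1..} \<times> index_set) (\<lambda>(d, \<theta>). path_space T d))
        (\<lambda>\<omega>. \<lambda>(d, \<theta>)\<in>{1..} \<times> index_set. sample_path T (W d \<theta>) \<omega>)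
        (PiM index_set (\<lambda>_. borel))
        (\<lambda>\<omega>. \<lambda>\<theta>\<in>index_set. \<R> \<theta> \<omega>)"
    and X_Rd: "\<And>d \<theta> x t s \<omega>. d \<ge> 1 \<Longrightarrow> \<theta> \<in> index_set \<Longrightarrow> x \<in> Rd d \<Longrightarrow>
        t \<in> {0..T} \<Longrightarrow> s \<in> {t..T} \<Longrightarrow> \<omega> \<in> space P \<Longrightarrow> X d \<theta> x t s \<omega> \<in> Rd d"
    and X_eq: "\<And>d \<theta> x t s \<omega> i. d \<ge> 1 \<Longrightarrow> \<theta> \<in> index_set \<Longrightarrow> x \<in> Rd d \<Longrightarrow>
        t \<in> {0..T} \<Longrightarrow> s \<in> {t..T} \<Longrightarrow> \<omega> \<in> space P \<Longrightarrow> i \<in> {1..d} \<Longrightarrow>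
        X d \<theta> x t s \<omega> i =
          x i * exp ((\<alpha> - \<beta>^2 / 2) * (s - t) + \<beta> * (W d \<theta> s \<omega> i - W d \<theta> t \<omega> i))"
    and V_init: "\<And>d M \<theta> t x \<omega>. d \<ge> 1 \<Longrightarrow> M \<ge> 1 \<Longrightarrow> \<theta> \<in> index_set \<Longrightarrow>
        t \<in> {0..T} \<Longrightarrow> x \<in> Rd d \<Longrightarrow> \<omega> \<in> space P \<Longrightarrow>
        V d \<theta> M (-1) t x \<omega> = 0 \<and> V d \<theta> M 0 t x \<omega> = 0"
    and V_rec: "\<And>d (M::nat) (n::nat) \<theta> t x \<omega>. d \<ge> 1 \<Longrightarrow> M \<ge> 1 \<Longrightarrow> n \<ge> 1 \<Longrightarrow> \<theta> \<in> index_set \<Longrightarrow>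
        t \<in> {0..T} \<Longrightarrow> x \<in> Rd d \<Longrightarrow> \<omega> \<in> space P \<Longrightarrow>
        V d \<theta> (int M) (int n) t x \<omega> =
          (\<Sum>k=0..<n. (T - t) / real M ^ (n - k) *
             (\<Sum>m=1..M ^ (n - k).
                f (V d (\<theta> @ [int k, int m]) (int M) (int k)
                     (R (\<theta> @ [int k, int m]) t \<omega>)
                     (X d (\<theta> @ [int k, int m]) x t (R (\<theta> @ [int k, int m]) t \<omega>) \<omega>) \<omega>)
                - indicator {1..} k *
                  f (V d (\<theta> @ [int k, - int m]) (int M) (int k - 1)
                     (R (\<theta> @ [int k, int m]) t \<omega>)
                     (X d (\<theta> @ [int k, int m]) x t (R (\<theta> @ [int k, int m]) t \<omega>) \<omega>) \<omega>)))
          + (\<Sum>m=1..M ^ n. g d (X d (\<theta> @ [int n, - int m]) x t T \<omega>) / real M ^ n)"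
    and C_init: "\<And>d M. d \<ge> 1 \<Longrightarrow> M \<ge> 1 \<Longrightarrow> \<C> d M 0 = 0"
    and C_rec: "\<And>d (M::nat) (n::nat). d \<ge> 1 \<Longrightarrow> M \<ge> 1 \<Longrightarrow> n \<ge> 1 \<Longrightarrow>
        \<C> d (int M) (int n) \<le> d * M ^ n
          + (\<Sum>k=0..<n. M ^ (n - k) *
               (d + 1 + \<C> d (int M) (int k) + indicator {1..} k * \<C> d (int M) (int k - 1)))"
  shows "\<exists>(N :: nat \<Rightarrow> real \<Rightarrow> nat) (C :: real \<Rightarrow> real).
      (\<forall>d\<ge>1. \<forall>\<epsilon>\<in>{0<..1}. N d \<epsilon> \<ge> 1) \<and> (\<forall>\<delta>>0. C \<delta> > 0) \<and>
      (\<forall>d\<ge>1. \<forall>\<epsilon>\<in>{0<..1}. \<forall>\<delta>>0.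
         real (\<C> d (int (N d \<epsilon>)) (int (N d \<epsilon>)))
           \<le> C \<delta> * real d powr (1 + (\<PP> + q * p) * (2 + \<delta>)) * \<epsilon> powr (- (2 + \<delta>)) \<and>
         integrable P (\<lambda>\<omega>. \<bar>u d 0 (\<xi> d) - V d [0] (int (N d \<epsilon>)) (int (N d \<epsilon>)) 0 (\<xi> d) \<omega>\<bar>^2) \<and>
         sqrt (\<integral>\<omega>. \<bar>u d 0 (\<xi> d) - V d [0] (int (N d \<epsilon>)) (int (N d \<epsilon>)) 0 (\<xi> d) \<omega>\<bar>^2 \<partial>P) \<le> \<epsilon>)"
proof -
  interpret P: prob_space P by (rule P)
  obtain L where L: "L-lipschitz_on UNIV f" using f_lipschitz by blast
  obtain c0 :: real where c0: "c0 \<ge> 0"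
    "\<And>d x. d \<ge> 1 \<Longrightarrow> x \<in> Rd d \<Longrightarrow> \<bar>g d x\<bar> / (real d powr \<PP> * (1 + rpow (norm_Rd d x) p)) + norm_Rd d (\<xi> d) / real d powr q \<le> c0"
  proof -
    \<comment> \<open>A supremum in \<open>ereal\<close> below infinity lies below some natural
      number, which serves as \<open>c0\<close>.\<close>
    obtain n :: nat where n: "(SUP (d, x) \<in> (SIGMA d:{1..}. Rd d).
        ereal (\<bar>g d x\<bar> / (real d powr \<PP> * (1 + rpow (norm_Rd d x) p)) + norm_Rd d (\<xi> d) / real d powr q)) < ereal (real n)"
      using less_imp_neq[OF growth, unfolded less_PInf_Ex_of_nat] by (rule exE)
    have "\<bar>g d x\<bar> / (real d powr \<PP> * (1 + rpow (norm_Rd d x) p)) + norm_Rd d (\<xi> d) / real d powr q \<le> real n"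
      if "d \<ge> 1" "x \<in> Rd d" for d x
    proof -
      have "ereal (\<bar>g d x\<bar> / (real d powr \<PP> * (1 + rpow (norm_Rd d x) p)) + norm_Rd d (\<xi> d) / real d powr q)
        \<le> (SUP (d, x) \<in> (SIGMA d:{1..}. Rd d).
        ereal (\<bar>g d x\<bar> / (real d powr \<PP> * (1 + rpow (norm_Rd d x) p)) + norm_Rd d (\<xi> d) / real d powr q))"
        using that by (intro SUP_upper2[of "(d, x)"]) auto
      then have "ereal (\<bar>g d x\<bar> / (real d powr \<PP> * (1 + rpow (norm_Rd d x) p)) + norm_Rd d (\<xi> d) / real d powr q) < ereal (real n)"
        using n by (rule order.strict_trans1)
      then show ?thesis by simp
    qed
    then show ?thesis by (intro that[of "real n"]) auto
  qed
  have g_bound: "\<bar>g d x\<bar> \<le> c0 * (real d powr \<PP> * (1 + rpow (norm_Rd d x) p))" if "d \<ge> 1" "x \<in> Rd d" for d x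
  proof -
    have pos: "real d powr \<PP> * (1 + rpow (norm_Rd d x) p) > 0"
      using that(1) by (intro mult_pos_pos add_pos_nonneg) (auto simp: rpow_nonneg)
    have "0 \<le> norm_Rd d (\<xi> d) / real d powr q" by (intro divide_nonneg_nonneg norm_Rd_nonneg) simp
    then have "\<bar>g d x\<bar> / (real d powr \<PP> * (1 + rpow (norm_Rd d x) p)) \<le> c0" using c0(2)[OF that] by linarith
    then show ?thesis using pos by (simp add: pos_divide_le_eq)
  qed
  have \<xi>_bound: "norm_Rd d (\<xi> d) \<le> c0 * real d powr q" if "d \<ge> 1" for d
  proof -
    have pos: "real d powr q > 0" using that by simp
    have "0 \<le> \<bar>g d (\<xi> d)\<bar> / (real d powr \<PP> * (1 + rpow (norm_Rd d (\<xi> d)) p))"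
      by (intro divide_nonneg_nonneg mult_nonneg_nonneg add_nonneg_nonneg) (auto simp: rpow_nonneg)
    then have "norm_Rd d (\<xi> d) / real d powr q \<le> c0" using c0(2)[OF that xi[OF that]] by linarith
    then show ?thesis using pos by (simp add: pos_divide_le_eq)
  qed
  \<comment> \<open>The weight has exponent 2 p because it has to dominate the square of g.\<close>
  have p2: "2 * p \<ge> 0" using p by simp
  obtain K where K: "K \<ge> 1" "\<And>d \<tau> x. 0 \<le> \<tau> \<Longrightarrow> \<tau> \<le> T \<Longrightarrow>
     (\<integral>\<^sup>+z. ennreal (1 + rpow (norm_Rd d (gbm \<alpha> \<beta> d x \<tau> z)) (2 * p)) \<partial>std_gauss d)
      \<le> ennreal (K * (1 + rpow (norm_Rd d x) (2 * p)))"
    using gbm_weight_moment[OF T p2, of \<alpha> \<beta>] by blast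
  define e0 where "e0 = exp ((8 * T * L^2 * K + 1) * T)"
  have e0: "e0 \<ge> 1" using T K by (simp add: e0_def)
  \<comment> \<open>The constant of \<open>u_bound\<close> for cg = 2 c0^2, the factor d^(2 \<PP>)
    being split off; adding 1 makes it at least 1.\<close>
  define a0 where "a0 = 2 * (2 * (2 * c0^2 * K) + 4 * T^2 * (f 0)^2) * e0 + 1"
  have a0: "a0 \<ge> 1" using e0 K by (simp add: a0_def)
  define c where "c = 1 + 5 * (L^2 * T * K)"
  have c: "c \<ge> 1" using T K by (simp add: c_def)
  \<comment> \<open>\<open>A\<close> contains the bound for the weight at \<xi>_d without its power
    of d. \<open>B\<close> joins the factor c per level to the exponential weight exp (n T) at time
    0, and 2 Q collects 2 \<PP> from g and 2 q p from \<xi>_d.\<close>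
  define A where "A = a0 * (1 + rpow c0 (2 * p))"
  define B where "B = c * exp T"
  define Q where "Q = \<PP> + q * p"
  have A: "A \<ge> 1" using mult_mono[OF a0, of 1 "1 + rpow c0 (2 * p)"] a0 by (simp add: A_def rpow_nonneg)
  have B: "B \<ge> 1" using mult_mono[OF c, of 1 "exp T"] c T by (simp add: B_def)
  have Q: "Q \<ge> 0" using PP q p by (simp add: Q_def)
  obtain N :: "nat \<Rightarrow> real \<Rightarrow> nat" and C :: "real \<Rightarrow> real" where
    NC: "\<And>d \<epsilon>. d \<ge> 1 \<Longrightarrow> \<epsilon> \<in> {0<..1} \<Longrightarrow> N d \<epsilon> \<ge> 1" "\<And>\<delta>. \<delta> > 0 \<Longrightarrow> C \<delta> > 0"
    "\<And>d \<epsilon>. d \<ge> 1 \<Longrightarrow> \<epsilon> \<in> {0<..1} \<Longrightarrow>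
      A * real d powr (2 * Q) * B ^ N d \<epsilon> / real (N d \<epsilon>) ^ N d \<epsilon> \<le> \<epsilon>^2"
    "\<And>d \<epsilon> \<delta>. d \<ge> 1 \<Longrightarrow> \<epsilon> \<in> {0<..1} \<Longrightarrow> \<delta> > 0 \<Longrightarrow>
      real d * (6 * real (N d \<epsilon>)) ^ N d \<epsilon> \<le> C \<delta> * real d powr (1 + Q * (2 + \<delta>)) * \<epsilon> powr (- (2 + \<delta>))"
  proof (rule level_choice[OF A B Q], goal_cases)
    case (1 N C)
    show ?case by (rule 1(1)[of N C]) (fact 1(2-5))+
  qed
  have cost: "real (\<C> d (int n) (int n)) \<le> real d * (6 * real n) ^ n" if "d \<ge> 1" "n \<ge> 1" for d n
  proof -
    have rec: "\<C> d (int n) (int k) \<le> d * n ^ k + (\<Sum>j=0..<k. n ^ (k - j) * (d + 1 + \<C> d (int n) (int j) +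
        (if j = 0 then 0 else \<C> d (int n) (int (j - 1)))))" if k: "k \<ge> 1" for k
    proof -
      have "(indicator {1..} j :: nat) * \<C> d (int n) (int j - 1) = (if j = 0 then 0 else \<C> d (int n) (int (j - 1)))" for j :: nat
        by (cases j) (auto simp: indicator_def)
      then show ?thesis using C_rec[OF \<open>d \<ge> 1\<close> \<open>n \<ge> 1\<close> k] by simp
    qed
    have "\<C> d (int n) (int n) \<le> d * (6 * n) ^ n"
      using that C_init[of d "int n"] by (intro cost_bound[of d n "\<lambda>k. \<C> d (int n) (int k)"] rec) auto
    then have "real (\<C> d (int n) (int n)) \<le> real (d * (6 * n) ^ n)" by (rule of_nat_mono)
    then show ?thesis by simp
  qed
  have error: "integrable P (\<lambda>\<omega>. \<bar>u d 0 (\<xi> d) - V d [0] (int n) (int n) 0 (\<xi> d) \<omega>\<bar>^2) \<and>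
      (\<integral>\<omega>. \<bar>u d 0 (\<xi> d) - V d [0] (int n) (int n) 0 (\<xi> d) \<omega>\<bar>^2 \<partial>P) \<le> A * real d powr (2 * Q) * B ^ n / real n ^ n"
    if d: "d \<ge> 1" and n: "n \<ge> 1" for d n
  proof -
    define \<mu> where "\<mu> = distr P (path_space T d) (sample_path T (W d [0]))"
    define \<nu> where "\<nu> = uniform01 \<Otimes>\<^sub>M \<mu>"
    define Y where "Y \<eta> \<omega> = (\<R> \<eta> \<omega>, sample_path T (W d \<eta>) \<omega>)" for \<eta> \<omega>
    define Sd where "Sd = real d powr (2 * \<PP>)"
    have Sd: "Sd \<ge> 1" unfolding Sd_def using d PP by (intro ge_one_powr_ge_zero) auto
    have i0: "[0] \<in> index_set" by (simp add: index_set_def)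
    have W0: "std_brownian_motion P T d (W d [0])" by (rule W_brownian[OF d i0])
    have noise: "brownian_noise T \<alpha> \<beta> d \<mu>"
    proof (rule brownian_noise.intro[OF T])
      show "prob_space \<mu>" unfolding \<mu>_def by (rule P.prob_space_distr[OF measurable_sample_path[OF W0]])
      show "sets \<mu> = sets (path_space T d)" by (simp add: \<mu>_def)
      show "(\<integral>\<^sup>+w. h (brownian_gbm \<alpha> \<beta> T d t s x w) \<partial>\<mu>) = (\<integral>\<^sup>+z. h (gbm \<alpha> \<beta> d x (s - t) z) \<partial>std_gauss d)"
        if "0 \<le> t" "t \<le> s" "s \<le> T" "x \<in> Rd d" "h \<in> borel_measurable (borel_Rd d)" for t s x h
        unfolding \<mu>_def by (rule nn_integral_brownian_gbm[OF P W0 T that measurable_sample_path[OF W0]])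
    qed
    have pde: "semilinear_pde T \<alpha> \<beta> L f d (u d)"
      by (rule semilinear_pde.intro[OF T L u_C12[OF d] u_growth[OF d] u_pde[OF d]])
    have "pde_noise T \<alpha> \<beta> L f d (u d) \<mu> (g d) (2 * p) K (2 * c0^2 * Sd)"
    proof (intro pde_noise.intro pde noise pde_noise_axioms.intro)
      show "continuous_on (Rd d) (g d)" using g_C2[OF d] by (simp add: C2_Rd_def)
      show "u d T x = g d x" if "x \<in> Rd d" for x by (rule u_terminal[OF d that])
      show "0 \<le> 2 * c0^2 * Sd" using Sd by simp
      show "(g d x)^2 \<le> 2 * c0^2 * Sd * (1 + rpow (norm_Rd d x) (2 * p))" if "x \<in> Rd d" for x
      proof -
        have "(g d x)^2 = \<bar>g d x\<bar>^2" by simp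
        also have "\<dots> \<le> (c0 * (real d powr \<PP> * (1 + rpow (norm_Rd d x) p)))^2"
          using g_bound[OF d that] by (intro power_mono) auto
        also have "\<dots> = c0^2 * Sd * (1 + rpow (norm_Rd d x) p)^2"
          using d by (simp add: power_mult_distrib Sd_def powr_add[symmetric] power2_eq_square)
        also have "\<dots> \<le> c0^2 * Sd * (2 * (1 + rpow (norm_Rd d x) (2 * p)))"
          using Sd by (intro mult_left_mono one_plus_rpow_square norm_Rd_nonneg) auto
        finally show ?thesis by (simp only: mult_ac)
      qed
    qed (use K in auto)
    then interpret D: pde_noise T \<alpha> \<beta> L f d "u d" \<mu> "g d" "2 * p" K "2 * c0^2 * Sd" .
    interpret m: mlp T L f \<nu> "borel_Rd d" "noise_time T" "noise_state \<alpha> \<beta> T d" "noise_final \<alpha> \<beta> T d" "g d"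
      "extend_Rd T d (u d)" "\<lambda>x. 1 + rpow (norm_Rd d x) (2 * p)" K "2 * c0^2 * Sd * K"
      unfolding \<nu>_def by (rule D.mlp_instance)
    have Ws: "W d \<eta> s \<omega> \<in> Rd d" if "\<eta> \<in> index_set" "s \<in> {0..T}" "\<omega> \<in> space P" for \<eta> s \<omega>
      using W_brownian[OF d that(1)] that measurable_space[of "W d \<eta> s" P "borel_Rd d" \<omega>]
      unfolding std_brownian_motion_def space_borel_Rd by blast
    have path: "path_at T d s (sample_path T (W d \<eta>) \<omega>) = W d \<eta> s \<omega>" if "\<eta> \<in> index_set" "s \<in> {0..T}" "\<omega> \<in> space P" for \<eta> s \<omega>
      unfolding sample_path_def using W_brownian[OF d that(1)] that
      by (intro path_at_continuous[OF T]) (auto simp: std_brownian_motion_def Ws)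
    have time_eq: "R \<eta> t \<omega> = noise_time T t (Y \<eta> \<omega>)" if "\<eta> \<in> index_set" "t \<in> {0..T}" "\<omega> \<in> space P" for \<eta> t \<omega>
      using R_t[OF that] R_range[OF that(1,3)] by (simp add: noise_time_def Y_def clamp01(2))
    have gbm_eq: "X d \<eta> x t s \<omega> = brownian_gbm \<alpha> \<beta> T d t s x (snd (Y \<eta> \<omega>))"
      if "\<eta> \<in> index_set" "t \<in> {0..T}" "s \<in> {t..T}" "x \<in> Rd d" "\<omega> \<in> space P" for \<eta> t s x \<omega>
    proof
      fix i
      show "X d \<eta> x t s \<omega> i = brownian_gbm \<alpha> \<beta> T d t s x (snd (Y \<eta> \<omega>)) i"
      proof (cases "i \<in> {1..d}")
        case True
        have "s \<in> {0..T}" using that by auto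
        then show ?thesis
          using X_eq[OF d that(1,4,2,3,5) True] that True by (simp add: brownian_gbm_def Y_def path)
      next
        case False
        then show ?thesis
          using X_Rd[OF d that(1,4,2,3,5)] by (auto simp: brownian_gbm_def Rd_def PiE_iff extensional_def)
      qed
    qed
    \<comment> \<open>An identity at every sample point: the two recursions agree once time and
      state are expressed through the noise. Index, time and point vary in the induction because the
      lower levels are evaluated elsewhere.\<close>
    have V_eq: "V d \<theta> (int n) (int k) t x \<omega> = m.Phi n k t x (\<lambda>\<zeta>\<in>index_set. Y (\<theta> @ \<zeta>) \<omega>)"
      if "\<theta> \<in> index_set" "t \<in> {0..T}" "x \<in> Rd d" and \<omega>: "\<omega> \<in> space P" for k \<theta> t x \<omega>
      using that(1-3)
    proof (induction k arbitrary: \<theta> t x rule: less_induct)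
      case (less k)
      note \<theta> = less.prems(1) and t = less.prems(2) and x = less.prems(3)
      show ?case
      proof (cases "k = 0")
        case True
        then show ?thesis using V_init[OF d _ \<theta> t x \<omega>, of "int n"] n by (simp add: m.Phi.simps)
      next
        case False
        then have k: "k \<ge> 1" by simp
        let ?Z = "\<lambda>\<zeta>\<in>index_set. Y (\<theta> @ \<zeta>) \<omega>"
        have sh: "m.shift [a, b] ?Z = (\<lambda>\<zeta>\<in>index_set. Y ((\<theta> @ [a, b]) @ \<zeta>) \<omega>)" for a b
          by (auto simp: m.shift_def index_set_def fun_eq_iff)
        have Zc: "?Z [a, b] = Y (\<theta> @ [a, b]) \<omega>" for a b by (simp add: index_set_def)
        have ix: "\<theta> @ [a, b] \<in> index_set" for a b by (simp add: index_set_def)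
        have summand: "f (V d (\<theta> @ [int j, int i]) (int n) (int j) (R (\<theta> @ [int j, int i]) t \<omega>)
              (X d (\<theta> @ [int j, int i]) x t (R (\<theta> @ [int j, int i]) t \<omega>) \<omega>) \<omega>)
            - indicator {1..} j * f (V d (\<theta> @ [int j, - int i]) (int n) (int j - 1) (R (\<theta> @ [int j, int i]) t \<omega>)
              (X d (\<theta> @ [int j, int i]) x t (R (\<theta> @ [int j, int i]) t \<omega>) \<omega>) \<omega>)
          = f (m.Phi n j (noise_time T t (?Z [int j, int i])) (noise_state \<alpha> \<beta> T d t x (?Z [int j, int i])) (m.shift [int j, int i] ?Z))
            - (if j = 0 then 0 else
              f (m.Phi n (j - 1) (noise_time T t (?Z [int j, int i])) (noise_state \<alpha> \<beta> T d t x (?Z [int j, int i])) (m.shift [int j, - int i] ?Z)))"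
          if j: "j < k" for i j
        proof -
          let ?\<eta> = "\<theta> @ [int j, int i]"
          let ?s = "noise_time T t (Y ?\<eta> \<omega>)" and ?x = "noise_state \<alpha> \<beta> T d t x (Y ?\<eta> \<omega>)"
          have s: "?s \<in> {t..T}" using t by (intro noise_time_range) auto
          then have s0: "?s \<in> {0..T}" using t by auto
          have X': "X d ?\<eta> x t ?s \<omega> = ?x" using gbm_eq[OF ix t s x \<omega>] by (simp add: noise_state_def)
          have xR: "?x \<in> Rd d" by (rule D.noise_state_Rd)
          have 1: "V d ?\<eta> (int n) (int j) ?s ?x \<omega> = m.Phi n j ?s ?x (m.shift [int j, int i] ?Z)"
            unfolding sh by (rule less.IH[OF j ix s0 xR])
          have 2: "V d (\<theta> @ [int j, - int i]) (int n) (int j - 1) ?s ?x \<omega> = m.Phi n (j - 1) ?s ?x (m.shift [int j, - int i] ?Z)" if "j \<noteq> 0"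
          proof -
            have i: "int j - 1 = int (j - 1)" and j': "j - 1 < k" using that j by simp_all
            show ?thesis unfolding sh i by (rule less.IH[OF j' ix s0 xR])
          qed
          show ?thesis
            unfolding time_eq[OF ix t \<omega>] X' Zc 1 using 2 by (cases "j = 0") (auto simp: indicator_def)
        qed
        have final: "X d (\<theta> @ [a, b]) x t T \<omega> = noise_final \<alpha> \<beta> T d t x (?Z [a, b])" for a b
          unfolding Zc noise_final_def using gbm_eq[OF ix t _ x \<omega>, of T] t by auto
        show ?thesis
          unfolding V_rec[OF d n k \<theta> t x \<omega>] m.Phi.simps[of n k] final atLeast0LessThan
          using False by (simp only: if_False) (intro arg_cong2[where f = "(+)"] sum.cong arg_cong2[where f = "times"] refl summand, simp)
      qed
    qed
    have Yiv: "P.indep_vars (\<lambda>_. noise_space T d) Y index_set"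
      unfolding Y_def[abs_def]
      by (rule P.iid_noise(1)[OF T d R_indep R_uniform W_brownian W_indep W_R_indep]) assumption+
    have Ylaw: "distr P (noise_space T d) (Y \<eta>) = \<nu>" if "\<eta> \<in> index_set" for \<eta>
      unfolding Y_def[abs_def] \<nu>_def \<mu>_def
      by (rule P.iid_noise(2)[OF T d R_indep R_uniform W_brownian W_indep W_R_indep]) (assumption | rule that)+
    have sets\<nu>: "sets \<nu> = sets (noise_space T d)" unfolding \<nu>_def by (rule D.sets_noise)
    \<comment> \<open>The index 0 of V is the list [0], so this approximation is driven by the noise
      of the extensions of [0], whose joint law is the canonical one.\<close>
    let ?Z = "\<lambda>\<omega>. \<lambda>\<zeta>\<in>index_set. Y ([0] @ \<zeta>) \<omega>"
    have Zlaw: "distr P m.\<N> ?Z = m.\<N>"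
      by (rule P.distr_shifted_iid[OF Yiv Ylaw sets\<nu> i0])
    have Zm: "?Z \<in> measurable P m.\<N>"
    proof (rule measurable_restrict)
      fix \<zeta> assume "\<zeta> \<in> index_set"
      then have "[0] @ \<zeta> \<in> index_set" by (simp add: index_set_def)
      then have "Y ([0] @ \<zeta>) \<in> measurable P (noise_space T d)" using Yiv by (auto simp: P.indep_vars_def)
      then show "Y ([0] @ \<zeta>) \<in> measurable P \<nu>" by (simp cong: measurable_cong_sets add: sets\<nu>)
    qed
    have \<xi>: "\<xi> d \<in> Rd d" by (rule xi[OF d])
    have \<xi>s: "\<xi> d \<in> space (borel_Rd d)" using \<xi> by (simp add: space_PiM Rd_def)
    have T0: "0 \<in> {0..T}" using T by simp
    have u0: "extend_Rd T d (u d) 0 (\<xi> d) = u d 0 (\<xi> d)" by (rule extend_Rd_eq[OF T0 \<xi>])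
    let ?F = "\<lambda>z. (m.Phi n n 0 (\<xi> d) z - u d 0 (\<xi> d))^2"
    have Fm: "?F \<in> borel_measurable m.\<N>"
      using \<xi>s by (intro borel_measurable_power borel_measurable_diff m.measurable_Phi) auto
    have FZ: "\<bar>u d 0 (\<xi> d) - V d [0] (int n) (int n) 0 (\<xi> d) \<omega>\<bar>^2 = ?F (?Z \<omega>)" if "\<omega> \<in> space P" for \<omega>
      unfolding V_eq[OF i0 T0 \<xi> that] by (simp add: power2_commute)
    \<comment> \<open>The a priori constant for cg = 2 c0^2 Sd. As Sd >= 1, it is at most a0 Sd, so
      its dependence on d is dominated by the single factor Sd.\<close>
    define U where "U = 2 * (2 * (2 * c0^2 * Sd * K) + 4 * T^2 * (f 0)^2) * e0"
    have U: "U \<ge> 0" using Sd K e0 by (simp add: U_def)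
    have Sd_mono: "y \<le> y * Sd" if "y \<ge> 0" for y using that Sd mult_left_mono[of 1 Sd y] by simp
    have aU: "U \<le> a0 * Sd"
    proof -
      have "U = 2 * (2 * (2 * c0^2 * K)) * e0 * Sd + 2 * (4 * T^2 * (f 0)^2) * e0" by (simp add: U_def algebra_simps)
      also have "\<dots> \<le> 2 * (2 * (2 * c0^2 * K)) * e0 * Sd + 2 * (4 * T^2 * (f 0)^2) * e0 * Sd"
        using e0 by (intro add_left_mono Sd_mono) simp
      also have "\<dots> \<le> a0 * Sd" using Sd by (simp add: a0_def algebra_simps)
      finally show ?thesis .
    qed
    have aG: "2 * c0^2 * Sd * K + T^2 * (f 0)^2 \<le> a0 * Sd"
    proof -
      have G0: "0 \<le> 2 * c0^2 * Sd * K + T^2 * (f 0)^2" using Sd K by simp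
      have "2 * c0^2 * Sd * K + T^2 * (f 0)^2 \<le> 2 * (2 * (2 * c0^2 * Sd * K) + 4 * T^2 * (f 0)^2) * 1"
        using Sd K by (simp add: algebra_simps)
      also have "\<dots> \<le> U" unfolding U_def using e0 Sd K by (intro mult_left_mono) auto
      finally show ?thesis using aU by simp
    qed
    have "m.e2 n n 0 (\<xi> d) \<le> ennreal (a0 * Sd * c ^ n / real n ^ n * (exp (real n * (T - 0)) * (1 + rpow (norm_Rd d (\<xi> d)) (2 * p))))"
    proof (rule m.mlp_error[OF n aU aG U _ c_def T0 \<xi>s])
      show "(extend_Rd T d (u d) t x)^2 \<le> U * (1 + rpow (norm_Rd d x) (2 * p))" if "t \<in> {0..T}" "x \<in> space (borel_Rd d)" for t x
        using D.u_bound[OF that(1), of x] that(2) unfolding U_def e0_def space_borel_Rd .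
    qed
    also have "\<dots> \<le> ennreal (A * real d powr (2 * Q) * B ^ n / real n ^ n)"
    proof (rule ennreal_leI)
      have dq: "real d powr (2 * q * p) \<ge> 1" using d q p by (intro ge_one_powr_ge_zero) auto
      have "rpow (norm_Rd d (\<xi> d)) (2 * p) \<le> rpow (c0 * real d powr q) (2 * p)"
        by (intro rpow_mono \<xi>_bound d norm_Rd_nonneg p2)
      also have "\<dots> = rpow c0 (2 * p) * real d powr (2 * q * p)"
        using c0 d by (subst rpow_mult) (auto simp: rpow_def powr_powr mult_ac)
      finally have "1 + rpow (norm_Rd d (\<xi> d)) (2 * p) \<le> (1 + rpow c0 (2 * p)) * real d powr (2 * q * p)"
        using dq by (simp add: algebra_simps)
      then have "a0 * Sd * c ^ n / real n ^ n * (exp (real n * (T - 0)) * (1 + rpow (norm_Rd d (\<xi> d)) (2 * p)))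
        \<le> a0 * Sd * c ^ n / real n ^ n * (exp (real n * (T - 0)) * ((1 + rpow c0 (2 * p)) * real d powr (2 * q * p)))"
        using a0 Sd c by (intro mult_left_mono) auto
      also have "\<dots> = A * (Sd * real d powr (2 * q * p)) * (c ^ n * exp (real n * T)) / real n ^ n"
        by (simp add: A_def)
      also have "Sd * real d powr (2 * q * p) = real d powr (2 * Q)"
        by (simp add: Sd_def powr_add[symmetric] Q_def algebra_simps)
      also have "c ^ n * exp (real n * T) = B ^ n" by (simp add: B_def power_mult_distrib exp_of_nat_mult)
      finally show "a0 * Sd * c ^ n / real n ^ n * (exp (real n * (T - 0)) * (1 + rpow (norm_Rd d (\<xi> d)) (2 * p)))
        \<le> A * real d powr (2 * Q) * B ^ n / real n ^ n" .
    qed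
    finally have e2: "m.e2 n n 0 (\<xi> d) \<le> ennreal (A * real d powr (2 * Q) * B ^ n / real n ^ n)" .
    have nn: "(\<integral>\<^sup>+\<omega>. ennreal (?F (?Z \<omega>)) \<partial>P) = m.e2 n n 0 (\<xi> d)"
    proof -
      have "(\<integral>\<^sup>+\<omega>. ennreal (?F (?Z \<omega>)) \<partial>P) = (\<integral>\<^sup>+z. ennreal (?F z) \<partial>distr P m.\<N> ?Z)"
        using Zm measurable_compose[OF Fm measurable_ennreal] by (simp add: nn_integral_distr)
      then show ?thesis unfolding Zlaw m.e2_def u0 .
    qed
    have FZi: "integrable P (\<lambda>\<omega>. ?F (?Z \<omega>))"
    proof (rule integrableI_nonneg[OF measurable_compose[OF Zm Fm]])
      show "(\<integral>\<^sup>+\<omega>. ennreal (?F (?Z \<omega>)) \<partial>P) < \<infinity>" unfolding nn by (rule order.strict_trans1[OF e2]) (simp add: ennreal_less_top)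
    qed simp
    have bound0: "0 \<le> A * real d powr (2 * Q) * B ^ n / real n ^ n" using A B by simp
    have "ennreal (\<integral>\<omega>. ?F (?Z \<omega>) \<partial>P) \<le> ennreal (A * real d powr (2 * Q) * B ^ n / real n ^ n)"
      using e2 unfolding nn[symmetric] by (subst (asm) nn_integral_eq_integral[OF FZi]) auto
    then have "(\<integral>\<omega>. ?F (?Z \<omega>) \<partial>P) \<le> A * real d powr (2 * Q) * B ^ n / real n ^ n"
      using bound0 by (simp add: ennreal_le_iff)
    then show ?thesis
      using FZi by (simp only: Bochner_Integration.integrable_cong[OF refl FZ] Bochner_Integration.integral_cong[OF refl FZ] simp_thms)
  qed
  show ?thesis
  proof (intro exI[of _ N] exI[of _ C] conjI allI ballI impI)
    fix d \<epsilon> \<delta> assume d: "(1::nat) \<le> d" and \<epsilon>: "\<epsilon> \<in> {0<..(1::real)}" and \<delta>: "(0::real) < \<delta>"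
    note n = NC(1)[OF d \<epsilon>]
    show "real (\<C> d (int (N d \<epsilon>)) (int (N d \<epsilon>))) \<le> C \<delta> * real d powr (1 + (\<PP> + q * p) * (2 + \<delta>)) * \<epsilon> powr (- (2 + \<delta>))"
      using order_trans[OF cost[OF d n] NC(4)[OF d \<epsilon> \<delta>]] by (simp add: Q_def)
    show "integrable P (\<lambda>\<omega>. \<bar>u d 0 (\<xi> d) - V d [0] (int (N d \<epsilon>)) (int (N d \<epsilon>)) 0 (\<xi> d) \<omega>\<bar>^2)"
      using error[OF d n] by blast
    have "(\<integral>\<omega>. \<bar>u d 0 (\<xi> d) - V d [0] (int (N d \<epsilon>)) (int (N d \<epsilon>)) 0 (\<xi> d) \<omega>\<bar>^2 \<partial>P) \<le> \<epsilon>^2"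
      using error[OF d n] NC(3)[OF d \<epsilon>] by linarith
    then have "sqrt (\<integral>\<omega>. \<bar>u d 0 (\<xi> d) - V d [0] (int (N d \<epsilon>)) (int (N d \<epsilon>)) 0 (\<xi> d) \<omega>\<bar>^2 \<partial>P) \<le> sqrt (\<epsilon>^2)"
      by (rule real_sqrt_le_mono)
    then show "sqrt (\<integral>\<omega>. \<bar>u d 0 (\<xi> d) - V d [0] (int (N d \<epsilon>)) (int (N d \<epsilon>)) 0 (\<xi> d) \<omega>\<bar>^2 \<partial>P) \<le> \<epsilon>"
      using \<epsilon> by simp
  qed (use NC in auto)
qed

end
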